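(* Let $\Omega$, $\zeta\in L^\infty(\Omega)$, $\kappa>0$, $q\in L^2(\Omega)$, $\tilde{\mathbf e},\tilde{\mathbf s}\in[L^2(\Omega)]^{d_\Omega}$, the spaces $X,Y$, the continuous problem P2, the discrete problem P2$_h$, and the methods (a), (b-2), (b-3) be as in the context. Let $(x,y)\in X\times Y$ be the solution of P2. Then, for each of the methods (a), (b-2) and (b-3), the discrete problem P2$_h$ is well-posed, and its solution $(x_h,y_h)\in X_h\times Y_h$ satisfies the following: there exists $c>0$ independent of $h$ such that $$|||(x,y)-(x_h,y_h)|||\ \le\ c\,\min_{(\bar x,\bar y)\in X_h\times Y_h}|||(x,y)-(\bar x,\bar y)|||,$$ where for $\bar x=(\bar u,\bar{\mathbf e},\bar{\mathbf s})$, $\bar y=(\bar\lambda,\bar{\boldsymbol\mu})$ the norm is, for methods (a) and (b-2), $$|||(\bar x,\bar y)|||^2=\|(\bar x,\bar y)\|_{X\times Y}^2=\|\nabla\bar u\|^2+\|\bar{\mathbf e}\|^2+\kappa\|\bar{\mathbf s}\|^2+\tfrac1\kappa\|\nabla\bar\lambda\|^2+\|\bar{\boldsymbol\mu}\|^2,$$ and, for method (b-3), $$|||(\bar x,\bar y)|||^2=\|(\bar x,\bar y)\|_{X\times Y}^2+\kappa h^2\|\nabla\cdot\bar{\mathbf s}\|^2+h^2\|\nabla\cdot\bar{\boldsymbol\mu}\|^2 .$$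
   Context: Setting. $\Omega\subset\mathbb{R}^{d_\Omega}$ is a regular domain (bounded, connected, with Lipschitz boundary), with boundary divided into a Dirichlet part $\partial\Omega_D$ (of positive surface measure) and a Neumann part $\partial\Omega_N$; boundary conditions are homogeneous. $\|\cdot\|$ and $(\cdot,\cdot)$ are the norm and scalar product of $L^2(\Omega)$ and of $[L^2(\Omega)]^{d_\Omega}$. $\zeta\in L^\infty(\Omega)$ is given (no sign condition), and $\kappa>0$ is a constant. Spaces: $U=L=\{v\in H^1(\Omega): v=0\text{ on }\partial\Omega_D\}$, $E=S=M=[L^2(\Omega)]^{d_\Omega}$, $X=U\times E\times S$, $Y=L\times M$. Continuous problem P2. Find the saddle point $(x,y)=(u,\mathbf e,\mathbf s,\lambda,\boldsymbol\mu)\in X\times Y$ (inf over $X$, sup over $Y$) of $$\mathcal L(\bar x,\bar y)=\tfrac12\|\bar{\mathbf e}-\tilde{\mathbf e}\|^2+\tfrac{\kappa}{2}\|\bar{\mathbf s}-\tilde{\mathbf s}\|^2-(\bar{\mathbf s},\nabla\bar\lambda)+(\zeta\bar u-q,\bar\lambda)+(\bar{\mathbf e}-\nabla\bar u,\bar{\boldsymbol\mu}),$$ where $\bar x=(\bar u,\bar{\mathbf e},\bar{\mathbf s})$, $\bar y=(\bar\lambda,\bar{\boldsymbol\mu})$. This problem has a unique solution, which satisfies weakly $\nabla\cdot\mathbf s+\zeta u=q$ and $\nabla\cdot\boldsymbol\mu+\zeta\lambda=0$ in $\Omega$, so that $\nabla\cdot\mathbf s,\nabla\cdot\boldsymbol\mu\in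 L^2(\Omega)$. Discrete problem P2$_h$. One considers a family of conformal, shape-regular meshes $\mathcal T_h$ of $\Omega$ indexed by the mesh size $h$ (so $0<h\le\operatorname{diam}\Omega$), and finite element (finite-dimensional, piecewise polynomial on $\mathcal T_h$) spaces $U_h\subset U$, $L_h\subset L$, $E_h,S_h,M_h\subset[L^2(\Omega)]^{d_\Omega}$, with $X_h=U_h\times E_h\times S_h$ and $Y_h=L_h\times M_h$. P2$_h$ is: find $(x_h,y_h)\in X_h\times Y_h$ with $$(x_h,y_h)=\arg\Big\{\inf_{\bar x\in X_h}\ \sup_{\bar y\in Y_h}\ \tilde{\mathcal L}(\bar x,\bar y)\Big\},$$ i.e. the saddle point on $X_h\times Y_h$ (equivalently, the solution in $X_h\times Y_h$ of the first-order optimality conditions) of $$\tilde{\mathcal L}(\bar x,\bar y)=\mathcal L(\bar x,\bar y)+\tfrac{\alpha}{2}\|\bar{\mathbf e}-\nabla\bar u\|^2-\tfrac{\gamma}{2}\|\bar{\mathbf e}+\bar{\boldsymbol\mu}-\tilde{\mathbf e}\|^2-\tfrac{\eta}{2\kappa}\|\kappa\bar{\mathbf s}-\nabla\bar\lambda-\kappa\tilde{\mathbf s}\|^2+\tfrac{\theta\kappa\ell_{\mathbf s}^2}{2}\|\nabla\cdot\bar{\mathbf s}+\zeta\bar u-q\|_h^2-\tfrac{\beta\ell_{\boldsymbol\mu}^2}{2}\|\nabla\cdot\bar{\boldsymbol\mu}+\zeta\bar\lambda\|_h^2,$$ where $\|f\|_h^2=\sum_{K\in\mathcal T_h}\|f\|_{L^2(K)}^2$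 (equal to the squared $L^2(\Omega)$ norm when the approximations of $\mathbf s,\boldsymbol\mu$ are continuous), $\alpha,\gamma,\eta,\theta,\beta\ge0$ are dimensionless coefficients and $\ell_{\mathbf s},\ell_{\boldsymbol\mu}$ are length scales. Methods. (a) Natural formulation: the spaces satisfy $\nabla U_h\subseteq M_h$, $\nabla L_h\subseteq S_h$, $E_h=M_h$, and $\alpha=\gamma=\eta=\theta=\beta=0$. (b) Equal-order formulations: the same $H^1$-conforming finite element space $V_h\subset H^1(\Omega)$ (typically continuous piecewise $P_k$) is used for all unknown fields, i.e. $U_h=L_h=\{v\in V_h: v=0\text{ on }\partial\Omega_D\}$ and $E_h=S_h=M_h=[V_h]^{d_\Omega}$. (b-2) Minimally-stabilized method: (b) with $\alpha=\tfrac18$, $\eta=\tfrac12$, $\gamma=\theta=\beta=0$. (b-3) Fully-stabilized method: (b) with $\alpha=\tfrac18$, $\gamma=\alpha$, $\eta=\tfrac12$, $\theta=\tfrac12$, $\beta=\tfrac12$, $\ell_{\mathbf s}=\ell_{\boldsymbol\mu}=h$. "Well-posed" for P2$_h$ means that for every $q\in L^2(\Omega)$, $\tilde{\mathbf e},\tilde{\mathbf s}\in[L^2(\Omega)]^{d_\Omega}$ there is a unique solution $(x_h,y_h)\in X_h\times Y_h$, depending continuously on the data. "Independent of $h$" means that $c$ is the same for all members of the family of meshes/spaces (it may depend on $\Omega$, $\partial\Omega_D$, $\zeta$, $\kappa$). *)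

theory Defs
  imports "HOL-Analysis.Analysis"
begin

text \<open>Scalar and vector fields are total functions; only their values on the domain matter, and
  elements of \<open>L\<^sup>2\<close> and \<open>H\<^sup>1\<close> are represented by functions, with equality understood almost
  everywhere on the domain.\<close>

definition L2 :: "'a::euclidean_space set \<Rightarrow> ('a \<Rightarrow> 'b::euclidean_space) set" where
  "L2 W = {f. f \<in> borel_measurable (lebesgue_on W) \<and>
              integrable (lebesgue_on W) (\<lambda>x. (norm (f x))\<^sup>2)}"

definition l2norm :: "'a::euclidean_space set \<Rightarrow> ('a \<Rightarrow> 'b::euclidean_space) \<Rightarrow> real" where
  "l2norm W f = sqrt (\<integral>x. (norm (f x))\<^sup>2 \<partial>lebesgue_on W)"

definition l2ip ::
  "'a::euclidean_space set \<Rightarrow> ('a \<Rightarrow> 'b::euclidean_space) \<Rightarrow> ('a \<Rightarrow> 'b) \<Rightarrow> real" where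
  "l2ip W f g = (\<integral>x. f x \<bullet> g x \<partial>lebesgue_on W)"

definition Linf :: "'a::euclidean_space set \<Rightarrow> ('a \<Rightarrow> real) set" where
  "Linf W = {f. f \<in> borel_measurable (lebesgue_on W) \<and>
                (\<exists>C. AE x in lebesgue_on W. \<bar>f x\<bar> \<le> C)}"

primrec Ck :: "nat \<Rightarrow> ('a::euclidean_space \<Rightarrow> real) \<Rightarrow> bool" where
  "Ck 0 f = continuous_on UNIV f"
| "Ck (Suc k) f = ((\<forall>x. f differentiable (at x)) \<and>
                   (\<forall>b\<in>Basis. Ck k (\<lambda>x. frechet_derivative f (at x) b)))"

definition smooth :: "('a::euclidean_space \<Rightarrow> real) \<Rightarrow> bool" where
  "smooth f \<longleftrightarrow> (\<forall>k. Ck k f)"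

definition test_function :: "'a::euclidean_space set \<Rightarrow> ('a \<Rightarrow> real) \<Rightarrow> bool" where
  "test_function W \<phi> \<longleftrightarrow>
     smooth \<phi> \<and> (\<exists>K. compact K \<and> K \<subseteq> W \<and> (\<forall>x. x \<notin> K \<longrightarrow> \<phi> x = 0))"

definition has_weak_grad ::
  "'a::euclidean_space set \<Rightarrow> ('a \<Rightarrow> real) \<Rightarrow> ('a \<Rightarrow> 'a) \<Rightarrow> bool" where
  "has_weak_grad W v g \<longleftrightarrow> g \<in> L2 W \<and>
     (\<forall>\<phi>. test_function W \<phi> \<longrightarrow> (\<forall>b\<in>Basis.
        (\<integral>x. v x * frechet_derivative \<phi> (at x) b \<partial>lebesgue_on W)
          = - (\<integral>x. (g x \<bullet> b) * \<phi> x \<partial>lebesgue_on W)))"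

definition has_weak_div ::
  "'a::euclidean_space set \<Rightarrow> ('a \<Rightarrow> 'a) \<Rightarrow> ('a \<Rightarrow> real) \<Rightarrow> bool" where
  "has_weak_div W s g \<longleftrightarrow> g \<in> L2 W \<and>
     (\<forall>\<phi>. test_function W \<phi> \<longrightarrow>
        (\<integral>x. frechet_derivative \<phi> (at x) (s x) \<partial>lebesgue_on W)
          = - (\<integral>x. g x * \<phi> x \<partial>lebesgue_on W))"

text \<open>The weak gradient and divergence are unique only up to null sets; a representative is chosen
  (arbitrary if there is none).\<close>

definition wgrad :: "'a::euclidean_space set \<Rightarrow> ('a \<Rightarrow> real) \<Rightarrow> 'a \<Rightarrow> 'a" where
  "wgrad W v = (SOME g. has_weak_grad W v g)"

definition wdiv :: "'a::euclidean_space set \<Rightarrow> ('a \<Rightarrow> 'a) \<Rightarrow> 'a \<Rightarrow> real" where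
  "wdiv W s = (SOME g. has_weak_div W s g)"

definition H1 :: "'a::euclidean_space set \<Rightarrow> ('a \<Rightarrow> real) set" where
  "H1 W = {v \<in> L2 W. \<exists>g. has_weak_grad W v g}"

definition h1norm :: "'a::euclidean_space set \<Rightarrow> ('a \<Rightarrow> real) \<Rightarrow> real" where
  "h1norm W v = sqrt ((l2norm W v)\<^sup>2 + (l2norm W (wgrad W v))\<^sup>2)"

text \<open>The surface measure is the \<open>(d - 1)\<close>-dimensional Hausdorff measure on Borel sets, normalised
  so as to agree with the usual area. Covering sets are required to be bounded because the library's
  diameter of an unbounded set is meaningless, and the empty set is given cost 0 separately because
  \<open>0 ^ 0 = 1\<close> when \<open>d = 1\<close>.\<close>

definition hausdorff_cost :: "nat \<Rightarrow> 'a::euclidean_space set \<Rightarrow> ennreal" where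
  "hausdorff_cost k C =
     (if C = {} then 0 else ennreal (unit_ball_vol (real k) / 2 ^ k * diameter C ^ k))"

definition hausdorff_content :: "nat \<Rightarrow> real \<Rightarrow> 'a::euclidean_space set \<Rightarrow> ennreal" where
  "hausdorff_content k \<delta> A =
     (INF C \<in> {C :: nat \<Rightarrow> 'a set. A \<subseteq> (\<Union>i. C i) \<and> (\<forall>i. bounded (C i) \<and> diameter (C i) \<le> \<delta>)}.
        (\<Sum>i. hausdorff_cost k (C i)))"

definition hausdorff_outer :: "nat \<Rightarrow> 'a::euclidean_space set \<Rightarrow> ennreal" where
  "hausdorff_outer k A = (SUP \<delta> \<in> {0<..}. hausdorff_content k \<delta> A)"

definition surface_measure :: "'a::euclidean_space measure" where
  "surface_measure = measure_of UNIV (sets borel) (hausdorff_outer (DIM('a) - 1))"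

text \<open>The trace is the \<open>L\<^sup>2(\<partial>\<Omega>)\<close>-limit of the boundary values of smooth functions that converge to
  \<open>v\<close> in \<open>H\<^sup>1(\<Omega>)\<close>.\<close>

definition has_trace :: "'a::euclidean_space set \<Rightarrow> ('a \<Rightarrow> real) \<Rightarrow> ('a \<Rightarrow> real) \<Rightarrow> bool" where
  "has_trace \<Omega> v g \<longleftrightarrow> v \<in> H1 \<Omega> \<and> g \<in> borel_measurable borel \<and>
     (\<exists>\<phi> :: nat \<Rightarrow> 'a \<Rightarrow> real. (\<forall>n. smooth (\<phi> n)) \<and>
        (\<lambda>n. h1norm \<Omega> (\<phi> n - v)) \<longlonglongrightarrow> 0 \<and>
        (\<lambda>n. \<integral>\<^sup>+x\<in>frontier \<Omega>. ennreal ((\<phi> n x - g x)\<^sup>2) \<partial>surface_measure) \<longlonglongrightarrow> 0)"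

definition vanishes_on :: "'a::euclidean_space set \<Rightarrow> 'a set \<Rightarrow> ('a \<Rightarrow> real) \<Rightarrow> bool" where
  "vanishes_on \<Omega> \<Gamma> v \<longleftrightarrow>
     (\<exists>g. has_trace \<Omega> v g \<and> (AE x in surface_measure. x \<in> \<Gamma> \<longrightarrow> g x = 0))"

definition H1D :: "'a::euclidean_space set \<Rightarrow> 'a set \<Rightarrow> ('a \<Rightarrow> real) set" where
  "H1D \<Omega> \<Gamma> = {v \<in> H1 \<Omega>. vanishes_on \<Omega> \<Gamma> v}"

text \<open>Near each boundary point, the domain is the strict epigraph, in some direction \<open>n\<close>, of a
  Lipschitz function \<open>g\<close> on the hyperplane orthogonal to \<open>n\<close>.\<close>

definition lipschitz_boundary :: "'a::euclidean_space set \<Rightarrow> bool" where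
  "lipschitz_boundary \<Omega> \<longleftrightarrow> (\<forall>x \<in> frontier \<Omega>. \<exists>r > 0. \<exists>n L. \<exists>g :: 'a \<Rightarrow> real.
     norm n = 1 \<and> L-lipschitz_on {z. z \<bullet> n = 0} g \<and>
     \<Omega> \<inter> ball x r = {y \<in> ball x r. g (y - (y \<bullet> n) *\<^sub>R n) < y \<bullet> n})"

definition regular_domain :: "'a::euclidean_space set \<Rightarrow> bool" where
  "regular_domain \<Omega> \<longleftrightarrow>
     open \<Omega> \<and> \<Omega> \<noteq> {} \<and> bounded \<Omega> \<and> connected \<Omega> \<and> lipschitz_boundary \<Omega>"

text \<open>The Neumann part is the complement \<open>frontier \<Omega> - \<Gamma>\<close>. As boundary conditions are homogeneous
  and Neumann conditions are natural, it appears nowhere else.\<close>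

definition dirichlet_part :: "'a::euclidean_space set \<Rightarrow> 'a set \<Rightarrow> bool" where
  "dirichlet_part \<Omega> \<Gamma> \<longleftrightarrow>
     \<Gamma> \<in> sets borel \<and> \<Gamma> \<subseteq> frontier \<Omega> \<and> emeasure surface_measure \<Gamma> > 0"

type_synonym 'a primal = "('a \<Rightarrow> real) \<times> ('a \<Rightarrow> 'a) \<times> ('a \<Rightarrow> 'a)"
type_synonym 'a dual = "('a \<Rightarrow> real) \<times> ('a \<Rightarrow> 'a)"

text \<open>The data are \<open>(q, \<tilde>e, \<tilde>s)\<close>.\<close>

type_synonym 'a data = "('a \<Rightarrow> real) \<times> ('a \<Rightarrow> 'a) \<times> ('a \<Rightarrow> 'a)"

definition data_space :: "'a::euclidean_space set \<Rightarrow> 'a data set" where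
  "data_space \<Omega> = L2 \<Omega> \<times> L2 \<Omega> \<times> L2 \<Omega>"

fun data_norm :: "'a::euclidean_space set \<Rightarrow> 'a data \<Rightarrow> real" where
  "data_norm \<Omega> (q, et, st) = sqrt ((l2norm \<Omega> q)\<^sup>2 + (l2norm \<Omega> et)\<^sup>2 + (l2norm \<Omega> st)\<^sup>2)"

definition X_space :: "'a::euclidean_space set \<Rightarrow> 'a set \<Rightarrow> 'a primal set" where
  "X_space \<Omega> \<Gamma> = H1D \<Omega> \<Gamma> \<times> L2 \<Omega> \<times> L2 \<Omega>"

definition Y_space :: "'a::euclidean_space set \<Rightarrow> 'a set \<Rightarrow> 'a dual set" where
  "Y_space \<Omega> \<Gamma> = H1D \<Omega> \<Gamma> \<times> L2 \<Omega>"

fun lagrangian ::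
  "'a::euclidean_space set \<Rightarrow> ('a \<Rightarrow> real) \<Rightarrow> real \<Rightarrow> 'a data \<Rightarrow> 'a primal \<Rightarrow> 'a dual \<Rightarrow> real" where
  "lagrangian \<Omega> \<zeta> \<kappa> (q, et, st) (u, e, s) (l, m) =
     1/2 * (l2norm \<Omega> (\<lambda>x. e x - et x))\<^sup>2
     + \<kappa>/2 * (l2norm \<Omega> (\<lambda>x. s x - st x))\<^sup>2
     - l2ip \<Omega> s (wgrad \<Omega> l)
     + l2ip \<Omega> (\<lambda>x. \<zeta> x * u x - q x) l
     + l2ip \<Omega> (\<lambda>x. e x - wgrad \<Omega> u x) m"

definition saddle_point ::
  "'x set \<Rightarrow> 'y set \<Rightarrow> ('x \<Rightarrow> 'y \<Rightarrow> real) \<Rightarrow> 'x \<times> 'y \<Rightarrow> bool" where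
  "saddle_point A B F p \<longleftrightarrow> (case p of (x, y) \<Rightarrow>
     x \<in> A \<and> y \<in> B \<and> (\<forall>y'\<in>B. F x y' \<le> F x y) \<and> (\<forall>x'\<in>A. F x y \<le> F x' y))"

definition P2_solution ::
  "'a::euclidean_space set \<Rightarrow> 'a set \<Rightarrow> ('a \<Rightarrow> real) \<Rightarrow> real \<Rightarrow> 'a data
     \<Rightarrow> 'a primal \<times> 'a dual \<Rightarrow> bool" where
  "P2_solution \<Omega> \<Gamma> \<zeta> \<kappa> d p \<longleftrightarrow>
     saddle_point (X_space \<Omega> \<Gamma>) (Y_space \<Omega> \<Gamma>) (lagrangian \<Omega> \<zeta> \<kappa> d) p"

text \<open>Elements are closed convex polytopes, which covers simplices and parallelepipeds of any
  dimension; any two of them meet in a common (possibly empty) face.\<close>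

definition conformal_mesh :: "'a::euclidean_space set \<Rightarrow> 'a set set \<Rightarrow> bool" where
  "conformal_mesh \<Omega> T \<longleftrightarrow>
     finite T \<and> T \<noteq> {} \<and> (\<forall>K\<in>T. polytope K \<and> interior K \<noteq> {}) \<and> \<Union>T = closure \<Omega> \<and>
     (\<forall>K\<in>T. \<forall>K'\<in>T. (K \<inter> K') face_of K \<and> (K \<inter> K') face_of K')"

definition mesh_size :: "'a::euclidean_space set set \<Rightarrow> real" where
  "mesh_size T = Max (diameter ` T)"

text \<open>\<open>T h\<close> is the mesh of size \<open>h\<close>, for \<open>h\<close> in a set \<open>H\<close> of mesh sizes; \<open>\<sigma>\<close> bounds the ratio of
  the diameter to the inradius uniformly over the family.\<close>

definition mesh_family ::
  "'a::euclidean_space set \<Rightarrow> real set \<Rightarrow> (real \<Rightarrow> 'a set set) \<Rightarrow> bool" where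
  "mesh_family \<Omega> H T \<longleftrightarrow>
     (\<forall>h\<in>H. conformal_mesh \<Omega> (T h) \<and> mesh_size (T h) = h) \<and>
     (\<exists>\<sigma>>0. \<forall>h\<in>H. \<forall>K\<in>T h. \<exists>x r. r > 0 \<and> ball x r \<subseteq> K \<and> diameter K \<le> \<sigma> * r)"

definition finite_dim_space :: "('a \<Rightarrow> 'b::real_vector) set \<Rightarrow> bool" where
  "finite_dim_space W \<longleftrightarrow>
     (\<exists>B. finite B \<and> W = {f. \<exists>c :: ('a \<Rightarrow> 'b) \<Rightarrow> real. f = (\<lambda>x. \<Sum>b\<in>B. c b *\<^sub>R b x)})"

definition fe_space ::
  "'a::euclidean_space set set \<Rightarrow> ('a \<Rightarrow> 'b::euclidean_space) set \<Rightarrow> bool" where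
  "fe_space T W \<longleftrightarrow> finite_dim_space W \<and>
     (\<forall>w\<in>W. \<forall>K\<in>T. \<exists>p. polynomial_function p \<and> (\<forall>x\<in>interior K. w x = p x))"

text \<open>The inclusions \<open>\<nabla>U\<^sub>h \<subseteq> M\<^sub>h\<close> and \<open>\<nabla>L\<^sub>h \<subseteq> S\<^sub>h\<close> hold up to null sets: some representative of
  the gradient belongs to the discrete space.\<close>

definition natural_spaces ::
  "'a::euclidean_space set \<Rightarrow> 'a set \<Rightarrow> 'a set set \<Rightarrow> ('a \<Rightarrow> real) set \<Rightarrow> ('a \<Rightarrow> real) set
     \<Rightarrow> ('a \<Rightarrow> 'a) set \<Rightarrow> ('a \<Rightarrow> 'a) set \<Rightarrow> ('a \<Rightarrow> 'a) set \<Rightarrow> bool" where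
  "natural_spaces \<Omega> \<Gamma> T Uh Lh Eh Sh Mh \<longleftrightarrow>
     fe_space T Uh \<and> fe_space T Lh \<and> fe_space T Eh \<and> fe_space T Sh \<and> fe_space T Mh \<and>
     Uh \<subseteq> H1D \<Omega> \<Gamma> \<and> Lh \<subseteq> H1D \<Omega> \<Gamma> \<and> Eh \<subseteq> L2 \<Omega> \<and> Sh \<subseteq> L2 \<Omega> \<and> Mh \<subseteq> L2 \<Omega> \<and>
     (\<forall>u\<in>Uh. \<exists>m\<in>Mh. has_weak_grad \<Omega> u m) \<and>
     (\<forall>l\<in>Lh. \<exists>s\<in>Sh. has_weak_grad \<Omega> l s) \<and>
     Eh = Mh"

definition h1_conforming ::
  "'a::euclidean_space set \<Rightarrow> 'a set set \<Rightarrow> ('a \<Rightarrow> real) set \<Rightarrow> bool" where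
  "h1_conforming \<Omega> T V \<longleftrightarrow> fe_space T V \<and> V \<subseteq> H1 \<Omega>"

definition dirichlet_subspace ::
  "'a::euclidean_space set \<Rightarrow> 'a set \<Rightarrow> ('a \<Rightarrow> real) set \<Rightarrow> ('a \<Rightarrow> real) set" where
  "dirichlet_subspace \<Omega> \<Gamma> V = {v \<in> V. vanishes_on \<Omega> \<Gamma> v}"

definition vector_fields :: "('a::euclidean_space \<Rightarrow> real) set \<Rightarrow> ('a \<Rightarrow> 'a) set" where
  "vector_fields V = {w. \<forall>b\<in>Basis. (\<lambda>x. w x \<bullet> b) \<in> V}"

definition equal_order_X ::
  "'a::euclidean_space set \<Rightarrow> 'a set \<Rightarrow> ('a \<Rightarrow> real) set \<Rightarrow> 'a primal set" where
  "equal_order_X \<Omega> \<Gamma> V = dirichlet_subspace \<Omega> \<Gamma> V \<times> vector_fields V \<times> vector_fields V"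

definition equal_order_Y ::
  "'a::euclidean_space set \<Rightarrow> 'a set \<Rightarrow> ('a \<Rightarrow> real) set \<Rightarrow> 'a dual set" where
  "equal_order_Y \<Omega> \<Gamma> V = dirichlet_subspace \<Omega> \<Gamma> V \<times> vector_fields V"

record stabilization =
  stab_alpha :: real
  stab_gamma :: real
  stab_eta :: real
  stab_theta :: real
  stab_beta :: real
  len_s :: real
  len_mu :: real

text \<open>The length scales multiply zero coefficients in \<open>stab_natural\<close> and \<open>stab_minimal\<close>,
  where they are irrelevant.\<close>

definition stab_natural :: stabilization where
  "stab_natural = \<lparr>stab_alpha = 0, stab_gamma = 0, stab_eta = 0, stab_theta = 0, stab_beta = 0,
                   len_s = 0, len_mu = 0\<rparr>"

definition stab_minimal :: stabilization where
  "stab_minimal = \<lparr>stab_alpha = 1/8, stab_gamma = 0, stab_eta = 1/2, stab_theta = 0, stab_beta = 0,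
                   len_s = 0, len_mu = 0\<rparr>"

definition stab_full :: "real \<Rightarrow> stabilization" where
  "stab_full h = \<lparr>stab_alpha = 1/8, stab_gamma = 1/8, stab_eta = 1/2, stab_theta = 1/2,
                  stab_beta = 1/2, len_s = h, len_mu = h\<rparr>"

text \<open>The last two terms are elementwise: the divergence is taken separately in the interior of
  each element, so that they make sense for discontinuous fields.\<close>

fun stab_lagrangian ::
  "'a::euclidean_space set \<Rightarrow> ('a \<Rightarrow> real) \<Rightarrow> real \<Rightarrow> 'a set set \<Rightarrow> stabilization
     \<Rightarrow> 'a data \<Rightarrow> 'a primal \<Rightarrow> 'a dual \<Rightarrow> real" where
  "stab_lagrangian \<Omega> \<zeta> \<kappa> T P (q, et, st) (u, e, s) (l, m) =
     lagrangian \<Omega> \<zeta> \<kappa> (q, et, st) (u, e, s) (l, m)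
     + stab_alpha P / 2 * (l2norm \<Omega> (\<lambda>x. e x - wgrad \<Omega> u x))\<^sup>2
     - stab_gamma P / 2 * (l2norm \<Omega> (\<lambda>x. e x + m x - et x))\<^sup>2
     - stab_eta P / (2 * \<kappa>) *
         (l2norm \<Omega> (\<lambda>x. \<kappa> *\<^sub>R s x - wgrad \<Omega> l x - \<kappa> *\<^sub>R st x))\<^sup>2
     + stab_theta P * \<kappa> * (len_s P)\<^sup>2 / 2 *
         (\<Sum>K\<in>T. (l2norm (interior K) (\<lambda>x. wdiv (interior K) s x + \<zeta> x * u x - q x))\<^sup>2)
     - stab_beta P * (len_mu P)\<^sup>2 / 2 *
         (\<Sum>K\<in>T. (l2norm (interior K) (\<lambda>x. wdiv (interior K) m x + \<zeta> x * l x))\<^sup>2)"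

definition P2h_solution ::
  "'a::euclidean_space set \<Rightarrow> ('a \<Rightarrow> real) \<Rightarrow> real \<Rightarrow> 'a set set \<Rightarrow> stabilization
     \<Rightarrow> 'a primal set \<Rightarrow> 'a dual set \<Rightarrow> 'a data \<Rightarrow> 'a primal \<times> 'a dual \<Rightarrow> bool" where
  "P2h_solution \<Omega> \<zeta> \<kappa> T P Xh Yh d p \<longleftrightarrow> saddle_point Xh Yh (stab_lagrangian \<Omega> \<zeta> \<kappa> T P d) p"

fun norm_XY :: "'a::euclidean_space set \<Rightarrow> real \<Rightarrow> 'a primal \<times> 'a dual \<Rightarrow> real" where
  "norm_XY \<Omega> \<kappa> ((u, e, s), (l, m)) =
     sqrt ((l2norm \<Omega> (wgrad \<Omega> u))\<^sup>2 + (l2norm \<Omega> e)\<^sup>2 + \<kappa> * (l2norm \<Omega> s)\<^sup>2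
           + 1 / \<kappa> * (l2norm \<Omega> (wgrad \<Omega> l))\<^sup>2 + (l2norm \<Omega> m)\<^sup>2)"

fun norm_full :: "'a::euclidean_space set \<Rightarrow> real \<Rightarrow> real \<Rightarrow> 'a primal \<times> 'a dual \<Rightarrow> real" where
  "norm_full \<Omega> \<kappa> h ((u, e, s), (l, m)) =
     sqrt ((norm_XY \<Omega> \<kappa> ((u, e, s), (l, m)))\<^sup>2
           + \<kappa> * h\<^sup>2 * (l2norm \<Omega> (wdiv \<Omega> s))\<^sup>2 + h\<^sup>2 * (l2norm \<Omega> (wdiv \<Omega> m))\<^sup>2)"

fun ae_eq :: "'a::euclidean_space set \<Rightarrow> 'a primal \<times> 'a dual \<Rightarrow> 'a primal \<times> 'a dual \<Rightarrow> bool" where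
  "ae_eq \<Omega> ((u, e, s), (l, m)) ((u', e', s'), (l', m')) \<longleftrightarrow>
     (AE x in lebesgue_on \<Omega>. u x = u' x \<and> e x = e' x \<and> s x = s' x \<and> l x = l' x \<and> m x = m' x)"

definition well_posed ::
  "'a::euclidean_space set \<Rightarrow> ('a \<Rightarrow> real) \<Rightarrow> real \<Rightarrow> 'a set set \<Rightarrow> stabilization
     \<Rightarrow> 'a primal set \<Rightarrow> 'a dual set \<Rightarrow> bool" where
  "well_posed \<Omega> \<zeta> \<kappa> T P Xh Yh \<longleftrightarrow>
     (\<forall>d\<in>data_space \<Omega>.
        (\<exists>p. P2h_solution \<Omega> \<zeta> \<kappa> T P Xh Yh d p) \<and>
        (\<forall>p p'. P2h_solution \<Omega> \<zeta> \<kappa> T P Xh Yh d p \<longrightarrow> P2h_solution \<Omega> \<zeta> \<kappa> T P Xh Yh d p'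
           \<longrightarrow> ae_eq \<Omega> p p') \<and>
        (\<forall>p. P2h_solution \<Omega> \<zeta> \<kappa> T P Xh Yh d p \<longrightarrow>
           (\<forall>\<epsilon>>0. \<exists>\<delta>>0. \<forall>d'\<in>data_space \<Omega>. \<forall>p'. P2h_solution \<Omega> \<zeta> \<kappa> T P Xh Yh d' p' \<longrightarrow>
              data_norm \<Omega> (d' - d) < \<delta> \<longrightarrow> norm_XY \<Omega> \<kappa> (p' - p) < \<epsilon>)))"

text \<open>The constant is chosen before the mesh size \<open>h\<close> and before the data and the solutions.
  Differences of tuples of fields are componentwise and pointwise.\<close>

definition quasi_optimal ::
  "'a::euclidean_space set \<Rightarrow> 'a set \<Rightarrow> ('a \<Rightarrow> real) \<Rightarrow> real \<Rightarrow> real set \<Rightarrow> (real \<Rightarrow> 'a set set)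
     \<Rightarrow> (real \<Rightarrow> stabilization) \<Rightarrow> (real \<Rightarrow> 'a primal set) \<Rightarrow> (real \<Rightarrow> 'a dual set)
     \<Rightarrow> (real \<Rightarrow> 'a primal \<times> 'a dual \<Rightarrow> real) \<Rightarrow> bool" where
  "quasi_optimal \<Omega> \<Gamma> \<zeta> \<kappa> H T P Xh Yh N \<longleftrightarrow>
     (\<exists>c>0. \<forall>h\<in>H. \<forall>d\<in>data_space \<Omega>. \<forall>p ph.
        P2_solution \<Omega> \<Gamma> \<zeta> \<kappa> d p \<longrightarrow>
        P2h_solution \<Omega> \<zeta> \<kappa> (T h) (P h) (Xh h) (Yh h) d ph \<longrightarrow>
        (\<exists>b. is_arg_min (\<lambda>z. N h (p - z)) (\<lambda>z. z \<in> Xh h \<times> Yh h) b \<and>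
             N h (p - ph) \<le> c * N h (p - b)))"

end

theory Submission
  imports Defs "HOL-Library.Function_Algebras"
begin

text \<open>The error estimate is a consequence of a uniform inf-sup condition. Regarded as a function of data, primal and
  dual unknowns, each stabilized Lagrangian is half of a symmetric bilinear form on the diagonal, nonnegative
  on primal and nonpositive on dual unknowns. Its saddle points are therefore the stationary points
  (\<open>saddle_point_iff_stationary\<close>), which solve a symmetric linear system.

  Stability comes from testing with the unknown itself after flipping the sign of its dual part. All mixed terms
  cancel (\<open>test_expand\<close>), among them the term with \<open>\<zeta>\<close>, whatever its sign, and
  what remains is a sum of squares. For the natural spaces and for the minimal stabilization, the squares that
  are missing are supplied by a small discrete correction of the test function (\<open>stability_natural\<close>,
  \<open>stability_minimal\<close>); in the fully stabilized case all of them are already there, up to lower order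
  terms (\<open>stability_full\<close>). The constants depend on \<open>\<Omega>\<close>, \<open>\<zeta>\<close>, \<open>\<kappa>\<close> and the Dirichlet part only.

  The exact solution makes the residuals in all stabilization terms vanish, so it solves the stabilized equations
  as well (\<open>P2_solution_consistent\<close>). The discrete problems are finite-dimensional, hence uniqueness gives
  existence, and the argument of Cea bounds the error by the best approximation error; the minimum is attained
  at an orthogonal projection (\<open>galerkin_conclusion\<close>).

  The analytic input is continuity of the forms in a norm that contains only the gradients of \<open>u\<close> and \<open>\<lambda>\<close>. It
  rests on the Friedrichs inequality on functions that vanish on the Dirichlet part (\<open>poincare_H1D\<close>), which is
  proved in an elementary way. Translations propagate square integrals from a ball over the connected
  Lipschitz domain at the cost of gradients (\<open>poincare_from_ball\<close>), so a function with small gradient is nearly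
  constant. If the inequality failed, the constants would stay away from zero while the boundary values
  on the Dirichlet part tend to zero; integrating along segments that start there shows that these segments
  sweep out a null set. A set on a Lipschitz graph with this property has Hausdorff measure zero
  (\<open>hausdorff_outer_zero_of_sweep\<close>), whereas the Dirichlet part has positive measure. Weak derivatives are handled
  through the fundamental lemma of the calculus of variations (\<open>AE_zero_if_test_integrals_zero\<close>).\<close>

section \<open>Smooth functions and their gradients\<close>

text \<open>The derivative may be supplied by hand, so that the closure properties below reduce to the usual
  differentiation rules.\<close>

lemma Ck_SucI:
  assumes "\<And>x. (f has_derivative f' x) (at x)" "\<And>b. b \<in> Basis \<Longrightarrow> Ck k (\<lambda>x. f' x b)"
  shows "Ck (Suc k) f"
  using assms frechet_derivative_at[OF assms(1)] by (auto simp: differentiable_def)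

lemma Ck_SucD:
  assumes "Ck (Suc k) f"
  shows "(f has_derivative frechet_derivative f (at x)) (at x)"
    and "b \<in> Basis \<Longrightarrow> Ck k (\<lambda>x. frechet_derivative f (at x) b)"
  using assms by (auto simp: frechet_derivative_works)

lemma Ck_Suc_imp: "Ck (Suc k) f \<Longrightarrow> Ck k f"
proof (induction k arbitrary: f)
  case 0 then show ?case
    by (simp add: continuous_at_imp_continuous_on differentiable_imp_continuous_within)
next
  case (Suc k) then show ?case by simp
qed

lemma Ck_const: "Ck k (\<lambda>x. c)"
  by (induction k arbitrary: c) auto

lemma Ck_add: "Ck k f \<Longrightarrow> Ck k g \<Longrightarrow> Ck k (\<lambda>x. f x + g x)"
proof (induction k arbitrary: f g)
  case 0 then show ?case by (simp add: continuous_on_add)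
next
  case (Suc k)
  note d = Ck_SucD[OF Suc.prems(1)] Ck_SucD[OF Suc.prems(2)]
  show ?case
    by (rule Ck_SucI[OF has_derivative_add[OF d(1) d(3)]]) (use Suc.IH d in auto)
qed

lemma Ck_mult: "Ck k f \<Longrightarrow> Ck k g \<Longrightarrow> Ck k (\<lambda>x. f x * g x)"
proof (induction k arbitrary: f g)
  case 0 then show ?case by (simp add: continuous_on_mult)
next
  case (Suc k)
  note d = Ck_SucD[OF Suc.prems(1)] Ck_SucD[OF Suc.prems(2)]
  note c = Ck_Suc_imp[OF Suc.prems(1)] Ck_Suc_imp[OF Suc.prems(2)]
  show ?case
    by (rule Ck_SucI[OF has_derivative_mult[OF d(1) d(3)]])
       (use Suc.IH d c in \<open>auto intro!: Ck_add\<close>)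
qed

lemma Ck_prod: "(\<And>i. i \<in> I \<Longrightarrow> Ck k (f i)) \<Longrightarrow> Ck k (\<lambda>x. \<Prod>i\<in>I. f i x)"
  by (induction I rule: infinite_finite_induct) (auto intro: Ck_const Ck_mult)

lemma smooth_const: "smooth (\<lambda>x. c)" by (simp add: smooth_def Ck_const)
lemma smooth_add: "smooth f \<Longrightarrow> smooth g \<Longrightarrow> smooth (\<lambda>x. f x + g x)"
  by (simp add: smooth_def Ck_add)
lemma smooth_mult: "smooth f \<Longrightarrow> smooth g \<Longrightarrow> smooth (\<lambda>x. f x * g x)"
  by (simp add: smooth_def Ck_mult)
lemma smooth_prod: "(\<And>i. i \<in> I \<Longrightarrow> smooth (f i)) \<Longrightarrow> smooth (\<lambda>x. \<Prod>i\<in>I. f i x)"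
  by (simp add: smooth_def Ck_prod)

definition grad :: "('a::euclidean_space \<Rightarrow> real) \<Rightarrow> 'a \<Rightarrow> 'a" where
  "grad f x = (\<Sum>b\<in>Basis. frechet_derivative f (at x) b *\<^sub>R b)"

lemma smooth_differentiable: "smooth f \<Longrightarrow> f differentiable (at x)"
  unfolding smooth_def by (metis Ck.simps(2))

lemma smooth_continuous: "smooth f \<Longrightarrow> continuous_on S f"
  by (metis Ck.simps(1) continuous_on_subset smooth_def subset_UNIV)

lemma frechet_derivative_grad:
  assumes "f differentiable (at x)" shows "frechet_derivative f (at x) v = grad f x \<bullet> v"
proof -
  interpret linear "frechet_derivative f (at x)" by (rule linear_frechet_derivative[OF assms])
  have "frechet_derivative f (at x) v = frechet_derivative f (at x) (\<Sum>b\<in>Basis. (v \<bullet> b) *\<^sub>R b)"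
    by (simp add: euclidean_representation)
  also have "\<dots> = grad f x \<bullet> v"
    unfolding sum scale grad_def inner_sum_left inner_scaleR_left
    by (intro sum.cong) (simp_all add: inner_commute)
  finally show ?thesis .
qed

lemma grad_inner_Basis: "b \<in> Basis \<Longrightarrow> grad f x \<bullet> b = frechet_derivative f (at x) b"
  by (simp add: grad_def)

lemma has_derivative_grad:
  "f differentiable (at x) \<Longrightarrow> (f has_derivative (\<lambda>v. grad f x \<bullet> v)) (at x)"
  using frechet_derivative_grad[of f x] frechet_derivative_works[of f "at x"]
  by (metis (no_types, lifting) ext)

lemma grad_eqI:
  assumes "(f has_derivative (\<lambda>v. g \<bullet> v)) (at x)" shows "grad f x = g"
proof -
  have "frechet_derivative f (at x) = (\<lambda>v. g \<bullet> v)"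
    using frechet_derivative_at[OF assms] by simp
  then show ?thesis unfolding grad_def by (simp add: euclidean_representation)
qed

lemma smooth_grad_continuous:
  assumes "smooth f" shows "continuous_on S (grad f)"
proof -
  have "continuous_on UNIV (\<lambda>x. frechet_derivative f (at x) b)" if "b \<in> Basis" for b
    using assms that unfolding smooth_def by (metis Ck.simps)
  then have "continuous_on UNIV (grad f)"
    unfolding grad_def by (intro continuous_intros) auto
  then show ?thesis by (rule continuous_on_subset) simp
qed

lemma grad_mult:
  assumes "smooth f" "smooth g"
  shows "grad (\<lambda>x. f x * g x) x = f x *\<^sub>R grad g x + g x *\<^sub>R grad f x"
  by (rule grad_eqI, rule has_derivative_eq_rhs,
      rule has_derivative_mult[OF has_derivative_grad has_derivative_grad])
     (use assms smooth_differentiable in \<open>auto simp: inner_add_left\<close>)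

lemma grad_add:
  assumes "smooth f" "smooth g"
  shows "grad (\<lambda>x. f x + g x) x = grad f x + grad g x"
  by (rule grad_eqI, rule has_derivative_eq_rhs,
      rule has_derivative_add[OF has_derivative_grad has_derivative_grad])
     (use assms smooth_differentiable in \<open>auto simp: inner_add_left\<close>)

lemma grad_cmult:
  assumes "smooth f" shows "grad (\<lambda>x. c * f x) x = c *\<^sub>R grad f x"
  using grad_mult[OF smooth_const[of c] assms, of x] grad_eqI[of "\<lambda>x. c" 0 x] by simp

section \<open>Smooth bump functions of boxes\<close>

text \<open>All derivatives of the flat function \<open>t \<mapsto> exp (- 1 / t)\<close> are linear combinations of these
  functions, and each of them extends by zero.\<close>

definition expinv :: "nat \<Rightarrow> real \<Rightarrow> real" where
  "expinv m t = (if t > 0 then exp (- (1 / t)) * (1 / t) ^ m else 0)"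

text \<open>The exponential series contains the term \<open>y ^ (m + 2) / fact (m + 2)\<close>, which at \<open>y = 1 / t\<close> beats the
  singular factor \<open>(1 / t) ^ m\<close> by \<open>t\<^sup>2\<close>. Two spare powers are what differentiability at \<open>0\<close>
  takes.\<close>

lemma expinv_bound: "\<bar>expinv m t\<bar> \<le> fact (m + 2) * t\<^sup>2"
proof (cases "t > 0")
  case True
  define y where "y = 1 / t"
  have y: "y > 0" using True by (simp add: y_def)
  have "y ^ (m+2) /\<^sub>R fact (m+2) \<le> exp y"
    using sum_le_suminf[OF sums_summable[OF exp_converges[of y]], of "{m+2}"] y
      sums_unique[OF exp_converges[of y]] by auto
  then have "y ^ (m+2) / fact (m+2) \<le> exp y" by (simp only: divide_real_def real_scaleR_def mult.commute)
  then have "y ^ (m+2) \<le> fact (m+2) * exp y" by (simp only: pos_divide_le_eq[OF fact_gt_zero] mult.commute)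
  then have "exp (- y) * y ^ (m+2) \<le> exp (-y) * (fact (m+2) * exp y)"
    by (intro mult_left_mono) auto
  also have "\<dots> = fact (m+2)" by (simp add: exp_minus)
  finally have "exp (- y) * y ^ m * y\<^sup>2 \<le> fact (m+2)" by (simp add: power_add mult_ac power2_eq_square)
  then have "exp (- y) * y ^ m \<le> fact (m+2) / y\<^sup>2" using y by (simp add: pos_le_divide_eq)
  then show ?thesis using True y by (simp add: expinv_def y_def power_divide)
qed (simp add: expinv_def)

text \<open>The family is closed under differentiation; this makes every member smooth.\<close>

lemma expinv_DERIV: "DERIV (expinv m) t :> expinv (m + 2) t - real m * expinv (m + 1) t"
proof -
  consider "t > 0" | "t < 0" | "t = 0" by linarith
  then show ?thesis
  proof cases
    case 1
    have "DERIV (\<lambda>t. exp (- (1 / t)) * (1 / t) ^ m) t :> expinv (m + 2) t - real m * expinv (m + 1) t"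
      using 1 by (auto intro!: derivative_eq_intros simp: expinv_def power_add power2_eq_square)
         (cases m; simp add: field_simps)
    moreover have "\<forall>\<^sub>F s in nhds t. expinv m s = exp (- (1 / s)) * (1 / s) ^ m"
      using eventually_nhds_in_open[of "{0<..}" t] 1 by (auto elim!: eventually_mono simp: expinv_def)
    ultimately show ?thesis by (subst DERIV_cong_ev) auto
  next
    case 2
    have "DERIV (\<lambda>t. 0) t :> expinv (m + 2) t - real m * expinv (m + 1) t"
      using 2 by (simp add: expinv_def)
    moreover have "\<forall>\<^sub>F s in nhds t. expinv m s = 0"
      using eventually_nhds_in_open[of "{..<0}" t] 2 by (auto elim!: eventually_mono simp: expinv_def)
    ultimately show ?thesis by (subst DERIV_cong_ev) auto
  next
    case 3
    have b: "\<bar>expinv m h / h\<bar> \<le> fact (m + 2) * \<bar>h\<bar>" for h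
    proof (cases "h = 0")
      case False
      have "\<bar>expinv m h\<bar> \<le> (fact (m + 2) * \<bar>h\<bar>) * \<bar>h\<bar>"
        using expinv_bound[of m h] by (simp only: power2_eq_square mult.assoc abs_mult_self)
      then show ?thesis using False by (simp only: abs_divide pos_divide_le_eq zero_less_abs_iff not_False_eq_True)
    qed simp
    have "(\<lambda>h. fact (m + 2) * \<bar>h\<bar>) \<midarrow>0\<rightarrow> fact (m + 2) * \<bar>0::real\<bar>"
      by (intro tendsto_intros)
    then have lim: "(\<lambda>h. fact (m + 2) * \<bar>h\<bar>) \<midarrow>0\<rightarrow> (0::real)"
      by (simp only: abs_zero mult_zero_right)
    have "(\<lambda>h. expinv m h / h) \<midarrow>0\<rightarrow> 0"
      by (rule Lim_null_comparison[OF _ lim], intro always_eventually allI, simp only: real_norm_def b)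
    then show ?thesis using 3 by (simp add: DERIV_def expinv_def)
  qed
qed

lemma Ck_expinv_affine: "Ck k (\<lambda>x. expinv m (w \<bullet> x + c))"
proof (induction k arbitrary: m)
  case 0
  have "continuous_on UNIV (expinv m)"
    by (meson DERIV_isCont continuous_at_imp_continuous_on expinv_DERIV)
  then show ?case
    by (auto intro!: continuous_on_compose2[of UNIV "expinv m"] continuous_intros)
next
  case (Suc k)
  have d: "((\<lambda>x. expinv m (w \<bullet> x + c)) has_derivative
      (\<lambda>v. (w \<bullet> v) * (expinv (m + 2) (w \<bullet> x + c) - real m * expinv (m + 1) (w \<bullet> x + c)))) (at x)" for x
    by (rule DERIV_compose_FDERIV[OF expinv_DERIV]) (auto intro!: derivative_eq_intros)
  show ?case
    using Ck_mult[OF Ck_const Ck_add[OF Suc[of "m+2"] Ck_mult[OF Ck_const[of k "- real m"] Suc[of "m+1"]]]]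
    by (intro Ck_SucI[OF d]) simp
qed

text \<open>Each factor switches from 0 to positive across one face of the box. The slopes of the arguments
  grow with \<open>n\<close>, so the bumps increase to the indicator of the box.\<close>

definition box_bump :: "'a::euclidean_space \<Rightarrow> 'a \<Rightarrow> nat \<Rightarrow> 'a \<Rightarrow> real" where
  "box_bump a c n x = (\<Prod>b\<in>Basis. expinv 0 ((real (Suc n) *\<^sub>R b) \<bullet> x + (- real (Suc n) * (a \<bullet> b)))
                                * expinv 0 (((- real (Suc n)) *\<^sub>R b) \<bullet> x + real (Suc n) * (c \<bullet> b)))"

lemma expinv0_nonneg: "0 \<le> expinv 0 t" and expinv0_le1: "expinv 0 t \<le> 1"
  by (auto simp: expinv_def)

lemma smooth_box_bump: "smooth (box_bump a c n)"
  unfolding box_bump_def[abs_def]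
  by (intro smooth_prod smooth_mult; unfold smooth_def; intro allI Ck_expinv_affine)

lemma box_bump_bounds: "0 \<le> box_bump a c n x" "box_bump a c n x \<le> 1"
  unfolding box_bump_def
  by (auto intro!: prod_nonneg prod_le_1 mult_nonneg_nonneg mult_le_one expinv0_nonneg expinv0_le1)

lemma box_bump_outside:
  assumes "x \<notin> box a c" shows "box_bump a c n x = 0"
proof -
  obtain b where b: "b \<in> Basis" "\<not> (a \<bullet> b < x \<bullet> b \<and> x \<bullet> b < c \<bullet> b)"
    using assms by (auto simp: box_def)
  have arg: "(real (Suc n) *\<^sub>R b) \<bullet> x + (- real (Suc n) * (a \<bullet> b)) = real (Suc n) * (x \<bullet> b - a \<bullet> b)"
       "((- real (Suc n)) *\<^sub>R b) \<bullet> x + real (Suc n) * (c \<bullet> b) = real (Suc n) * (c \<bullet> b - x \<bullet> b)"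
    by (simp_all add: inner_commute right_diff_distrib del: of_nat_Suc)
  have "expinv 0 ((real (Suc n) *\<^sub>R b) \<bullet> x + (- real (Suc n) * (a \<bullet> b)))
      * expinv 0 (((- real (Suc n)) *\<^sub>R b) \<bullet> x + real (Suc n) * (c \<bullet> b)) = 0"
    unfolding arg using b by (auto simp: expinv_def zero_less_mult_iff)
  then show ?thesis unfolding box_bump_def using b(1) by (intro prod_zero) auto
qed

lemma expinv0_tendsto:
  assumes "t > 0" shows "(\<lambda>n. expinv 0 (real (Suc n) * t)) \<longlonglongrightarrow> 1"
proof -
  have "(\<lambda>n. exp (- ((1 / t) * inverse (real (Suc n))))) \<longlonglongrightarrow> exp (- ((1 / t) * 0))"
    by (intro tendsto_intros LIMSEQ_inverse_real_of_nat)
  moreover have "expinv 0 (real (Suc n) * t) = exp (- ((1 / t) * inverse (real (Suc n))))" for n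
    using assms by (simp add: expinv_def zero_less_mult_iff divide_inverse)
  ultimately show ?thesis by simp
qed

lemma box_bump_tendsto: "(\<lambda>n. box_bump a c n x) \<longlonglongrightarrow> indicator (box a c) x"
proof (cases "x \<in> box a c")
  case True
  have *: "(\<lambda>n. expinv 0 (real (Suc n) * (x \<bullet> b - a \<bullet> b)) * expinv 0 (real (Suc n) * (c \<bullet> b - x \<bullet> b)))
        \<longlonglongrightarrow> 1 * 1" if "b \<in> Basis" for b
    using True that by (intro tendsto_mult expinv0_tendsto) (auto simp: box_def)
  have eq: "box_bump a c n x =
      (\<Prod>b\<in>Basis. expinv 0 (real (Suc n) * (x \<bullet> b - a \<bullet> b)) * expinv 0 (real (Suc n) * (c \<bullet> b - x \<bullet> b)))" for n
    unfolding box_bump_def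
    by (intro prod.cong refl arg_cong2[where f="(*)"] arg_cong[where f="expinv 0"])
       (simp_all add: inner_commute right_diff_distrib del: of_nat_Suc)
  have "(\<lambda>n. box_bump a c n x) \<longlonglongrightarrow> (\<Prod>b\<in>(Basis::'a set). 1 * 1)"
    unfolding eq by (intro tendsto_prod *)
  then show ?thesis using True by simp
qed (simp add: box_bump_outside)

lemma test_function_box_bump:
  assumes "cbox a c \<subseteq> W" shows "test_function W (box_bump a c n)"
  unfolding test_function_def
proof (intro conjI exI[of _ "cbox a c"] allI impI)
  fix x assume "x \<notin> cbox a c"
  then show "box_bump a c n x = 0" using box_bump_outside box_subset_cbox by blast
qed (use assms smooth_box_bump in auto)

section \<open>Square integrable fields\<close>

lemma L2_D: assumes "f \<in> L2 W" shows "f \<in> borel_measurable (lebesgue_on W)"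
    "integrable (lebesgue_on W) (\<lambda>x. (norm (f x))\<^sup>2)"
  using assms by (auto simp: L2_def)

lemma L2_bounded_by:
  fixes f :: "'a::euclidean_space \<Rightarrow> 'b::euclidean_space"
  assumes "f \<in> borel_measurable (lebesgue_on W)" "integrable (lebesgue_on W) w"
    "AE x in lebesgue_on W. (norm (f x))\<^sup>2 \<le> w x"
  shows "f \<in> L2 W"
  unfolding L2_def
proof (intro CollectI conjI assms(1) Bochner_Integration.integrable_bound[OF assms(2)])
  show "(\<lambda>x. (norm (f x))\<^sup>2) \<in> borel_measurable (lebesgue_on W)" using assms(1) by measurable
  show "AE x in lebesgue_on W. norm ((norm (f x))\<^sup>2) \<le> norm (w x)"
    using assms(3) by eventually_elim auto
qed

lemma L2_inner_integrable:
  assumes "f \<in> L2 W" "g \<in> L2 W" shows "integrable (lebesgue_on W) (\<lambda>x. f x \<bullet> g x)"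
proof (rule Bochner_Integration.integrable_bound[OF Bochner_Integration.integrable_add[OF L2_D(2)[OF assms(1)] L2_D(2)[OF assms(2)]]])
  show "(\<lambda>x. f x \<bullet> g x) \<in> borel_measurable (lebesgue_on W)"
    using L2_D(1)[OF assms(1)] L2_D(1)[OF assms(2)] by measurable
  have "norm (f x \<bullet> g x) \<le> norm ((norm (f x))\<^sup>2 + (norm (g x))\<^sup>2)" for x
  proof -
    have "\<bar>f x \<bullet> g x\<bar> \<le> norm (f x) * norm (g x)" by (rule Cauchy_Schwarz_ineq2)
    also have "\<dots> \<le> (norm (f x))\<^sup>2 + (norm (g x))\<^sup>2"
    proof -
      have "0 \<le> norm (f x) * norm (g x)" by simp
      then show ?thesis using sum_squares_bound[of "norm (f x)" "norm (g x)"] by linarith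
    qed
    finally show ?thesis by simp
  qed
  then show "AE x in lebesgue_on W. norm (f x \<bullet> g x) \<le> norm ((norm (f x))\<^sup>2 + (norm (g x))\<^sup>2)" by simp
qed

lemma L2_mult_integrable:
  fixes f g :: "'a::euclidean_space \<Rightarrow> real"
  assumes "f \<in> L2 W" "g \<in> L2 W" shows "integrable (lebesgue_on W) (\<lambda>x. f x * g x)"
  using L2_inner_integrable[OF assms] by simp

lemma L2_add: assumes "f \<in> L2 W" "g \<in> L2 W" shows "(\<lambda>x. f x + g x) \<in> L2 W"
proof (rule L2_bounded_by)
  show "(\<lambda>x. f x + g x) \<in> borel_measurable (lebesgue_on W)"
    using L2_D(1)[OF assms(1)] L2_D(1)[OF assms(2)] by measurable
  show "integrable (lebesgue_on W) (\<lambda>x. (norm (f x))\<^sup>2 + (norm (g x))\<^sup>2 + 2 * (f x \<bullet> g x))"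
    using L2_D(2)[OF assms(1)] L2_D(2)[OF assms(2)] L2_inner_integrable[OF assms] by auto
  show "AE x in lebesgue_on W. (norm (f x + g x))\<^sup>2 \<le> (norm (f x))\<^sup>2 + (norm (g x))\<^sup>2 + 2 * (f x \<bullet> g x)"
    by (simp add: power2_norm_eq_inner inner_add inner_commute)
qed

lemma L2_scaleR: assumes "f \<in> L2 W" shows "(\<lambda>x. c *\<^sub>R f x) \<in> L2 W"
  using assms by (auto simp: L2_def power_mult_distrib)

lemma L2_zero: "(\<lambda>x. 0) \<in> L2 W"
  by (auto simp: L2_def)

lemma L2_Basis:
  assumes "f \<in> L2 W" "norm b \<le> 1" shows "(\<lambda>x. f x \<bullet> b) \<in> L2 W"
proof (rule L2_bounded_by[OF _ L2_D(2)[OF assms(1)]])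
  show "(\<lambda>x. f x \<bullet> b) \<in> borel_measurable (lebesgue_on W)" using L2_D(1)[OF assms(1)] by measurable
  have "(norm (f x \<bullet> b))\<^sup>2 \<le> (norm (f x))\<^sup>2" for x
    using order_trans[OF Cauchy_Schwarz_ineq2[of "f x" b] mult_left_le[OF assms(2) norm_ge_zero]]
    by (intro power_mono) auto
  then show "AE x in lebesgue_on W. (norm (f x \<bullet> b))\<^sup>2 \<le> (norm (f x))\<^sup>2" by simp
qed

lemma L2_Linf_mult:
  assumes "f \<in> L2 W" "\<zeta> \<in> Linf W" shows "(\<lambda>x. \<zeta> x * f x) \<in> L2 W"
proof -
  obtain C where C: "AE x in lebesgue_on W. \<bar>\<zeta> x\<bar> \<le> C" and
    m: "\<zeta> \<in> borel_measurable (lebesgue_on W)" using assms(2) by (auto simp: Linf_def)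
  show ?thesis
  proof (rule L2_bounded_by)
    show "(\<lambda>x. \<zeta> x * f x) \<in> borel_measurable (lebesgue_on W)"
      using L2_D(1)[OF assms(1)] m by measurable
    show "integrable (lebesgue_on W) (\<lambda>x. C\<^sup>2 * (norm (f x))\<^sup>2)"
      using L2_D(2)[OF assms(1)] by auto
    show "AE x in lebesgue_on W. (norm (\<zeta> x * f x))\<^sup>2 \<le> C\<^sup>2 * (norm (f x))\<^sup>2"
      using C by eventually_elim (auto simp: power_mult_distrib intro!: mult_right_mono abs_le_square_iff[THEN iffD1])
  qed
qed

section \<open>Integration of compactly supported functions\<close>

lemma integral_lebesgue_on_supp:
  fixes f :: "'a::euclidean_space \<Rightarrow> 'b::euclidean_space"
  assumes "W \<in> sets lebesgue" "\<And>x. x \<notin> W \<Longrightarrow> f x = 0"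
  shows "(\<integral>x. f x \<partial>lebesgue_on W) = (\<integral>x. f x \<partial>lebesgue)"
proof -
  have "(\<lambda>x. indicator W x *\<^sub>R f x) = f" using assms(2) by (auto simp: indicator_def)
  then show ?thesis using integral_restrict_space[of W lebesgue f] assms(1) by simp
qed

lemma continuous_compact_support_integrable:
  fixes f :: "'a::euclidean_space \<Rightarrow> 'b::euclidean_space"
  assumes "continuous_on UNIV f" "compact K" "\<And>x. x \<notin> K \<Longrightarrow> f x = 0"
  shows "integrable lborel f" "integrable lebesgue f"
proof -
  have "(\<lambda>x. indicator K x *\<^sub>R f x) = f" using assms(3) by (auto simp: indicator_def)
  then show *: "integrable lborel f"
    using borel_integrable_compact[OF assms(2) continuous_on_subset[OF assms(1)]] by simp
  then show "integrable lebesgue f"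
    by (simp add: integrable_completion)
qed

lemma grad_outside_support:
  assumes "compact K" "\<And>x. x \<notin> K \<Longrightarrow> f x = 0" "x \<notin> K"
  shows "grad f x = 0"
proof (rule grad_eqI)
  have "((\<lambda>x. 0) has_derivative (\<lambda>v. 0 \<bullet> v)) (at x)" by simp
  then show "(f has_derivative (\<lambda>v. 0 \<bullet> v)) (at x)"
    by (rule has_derivative_transform_within_open[of _ _ _ _ "- K"])
       (use assms compact_imp_closed in auto)
qed

lemma test_functionE:
  assumes "test_function W f"
  obtains K where "smooth f" "compact K" "K \<subseteq> W" "\<And>x. x \<notin> K \<Longrightarrow> f x = 0" "\<And>x. x \<notin> K \<Longrightarrow> grad f x = 0"
  using assms unfolding test_function_def by (metis grad_outside_support)

lemma continuous_compact_support_L2: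
  fixes f :: "'a::euclidean_space \<Rightarrow> 'b::euclidean_space"
  assumes "continuous_on UNIV f" "compact K" "\<And>x. x \<notin> K \<Longrightarrow> f x = 0" "W \<in> sets lebesgue"
  shows "f \<in> L2 W"
proof -
  have "integrable lebesgue (\<lambda>x. (norm (f x))\<^sup>2)"
    by (rule continuous_compact_support_integrable(2)[OF _ assms(2)])
       (use assms in \<open>auto intro!: continuous_intros\<close>)
  then have "integrable (lebesgue_on W) (\<lambda>x. (norm (f x))\<^sup>2)"
    using assms(4) integrable_mult_indicator[of W lebesgue "\<lambda>x. (norm (f x))\<^sup>2"]
    by (simp add: integrable_restrict_space)
  moreover have "f \<in> borel_measurable lebesgue"
    using assms(1) by (intro measurable_completion) (auto intro: borel_measurable_continuous_onI)
  ultimately show ?thesis unfolding L2_def using measurable_restrict_space1 by blast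
qed

lemma test_function_L2:
  assumes "test_function W f" "A \<in> sets lebesgue" shows "f \<in> L2 A" "grad f \<in> L2 A"
proof -
  obtain K where K: "smooth f" "compact K" "K \<subseteq> W" "\<And>x. x \<notin> K \<Longrightarrow> f x = 0" "\<And>x. x \<notin> K \<Longrightarrow> grad f x = 0"
    using test_functionE[OF assms(1)] by blast
  show "f \<in> L2 A" by (rule continuous_compact_support_L2[OF smooth_continuous[OF K(1)] K(2,4) assms(2)])
  show "grad f \<in> L2 A" by (rule continuous_compact_support_L2[OF smooth_grad_continuous[OF K(1)] K(2,5) assms(2)])
qed

lemma integral_lborel_translate:
  fixes f :: "'a::euclidean_space \<Rightarrow> 'b::euclidean_space"
  assumes "f \<in> borel_measurable borel"
  shows "(\<integral>x. f (x + c) \<partial>lborel) = (\<integral>x. f x \<partial>lborel)"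
proof -
  have "(\<integral>x. f x \<partial>distr lborel borel ((+) c)) = (\<integral>x. f (c + x) \<partial>lborel)"
    using assms by (intro integral_distr) auto
  then show ?thesis by (simp add: lborel_distr_plus add.commute)
qed

text \<open>Lebesgue measure is translation invariant, so the difference quotient \<open>(f (x + t v) - f x) / t\<close> has
  integral zero for every \<open>t\<close>. As \<open>f\<close> is Lipschitz with compact support, the quotients are dominated
  and the derivative inherits the property.\<close>

lemma integral_grad_compact_support:
  assumes "smooth f" "compact K" "\<And>x. x \<notin> K \<Longrightarrow> f x = 0"
  shows "(\<integral>x. grad f x \<bullet> v \<partial>lborel) = 0"
proof -
  have gK: "\<And>x. x \<notin> K \<Longrightarrow> grad f x = 0" by (rule grad_outside_support[of K f]) (use assms in auto)
  have "bounded (grad f ` K)"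
    by (intro compact_imp_bounded compact_continuous_image smooth_grad_continuous assms)
  then obtain M where M: "M > 0" "\<And>x. x \<in> K \<Longrightarrow> norm (grad f x) \<le> M"
    unfolding bounded_pos by auto
  have M': "norm (grad f x) \<le> M" for x using M gK[of x] by (cases "x \<in> K") auto
  obtain R where R: "\<And>x. x \<in> K \<Longrightarrow> norm x \<le> R" using compact_imp_bounded[OF assms(2)] bounded_pos by metis
  \<comment> \<open>contains the supports of all difference quotients with step at most 1\<close>
  define K' where "K' = cball (0::'a) (R + norm v)"
  define q where "q n x = real (Suc n) * (f (x + inverse (real (Suc n)) *\<^sub>R v) - f x)" for n x
  have fb: "f \<in> borel_measurable borel" using smooth_continuous[OF assms(1)] by (rule borel_measurable_continuous_onI)
  have fi: "integrable lborel f"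
    by (rule continuous_compact_support_integrable(1)[OF smooth_continuous[OF assms(1)] assms(2,3)])
  have ft: "integrable lborel (\<lambda>x. f (x + c))" for c
  proof -
    have "integrable (distr lborel borel ((+) c)) f" using fi by (simp add: lborel_distr_plus)
    then show ?thesis using fb by (subst (asm) integrable_distr_eq) (auto simp: add.commute)
  qed
  have q0: "(\<integral>x. q n x \<partial>lborel) = 0" for n
    unfolding q_def using ft fi integral_lborel_translate[OF fb] by (simp del: of_nat_Suc)
  have lip: "\<bar>f (x + w) - f x\<bar> \<le> M * norm w" for x w
  proof -
    have "norm (f (x + w) - f x) \<le> M * norm (x + w - x)"
      by (rule differentiable_bound[OF convex_UNIV has_derivative_at_withinI[OF has_derivative_grad[OF smooth_differentiable[OF assms(1)]]]])
         (auto intro!: onorm_le_matrix_component_sum onorm_le order_trans[OF Cauchy_Schwarz_ineq2] mult_right_mono M')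
    then show ?thesis by simp
  qed
  have "(\<lambda>n. \<integral>x. q n x \<partial>lborel) \<longlonglongrightarrow> (\<integral>x. grad f x \<bullet> v \<partial>lborel)"
  proof (rule integral_dominated_convergence[where w="\<lambda>x. indicator K' x *\<^sub>R (M * norm v)"])
    show "(\<lambda>x. grad f x \<bullet> v) \<in> borel_measurable lborel"
      using borel_measurable_continuous_onI[OF smooth_grad_continuous[OF assms(1)]] by measurable
    show "q n \<in> borel_measurable lborel" for n unfolding q_def using fb by measurable
    show "integrable lborel (\<lambda>x. indicator K' x *\<^sub>R (M * norm v))"
      by (rule borel_integrable_compact) (auto simp: K'_def)
    show "AE x in lborel. (\<lambda>n. q n x) \<longlonglongrightarrow> grad f x \<bullet> v"
    proof (rule AE_I2)
      fix x
      have d: "((\<lambda>t. f (x + t *\<^sub>R v)) has_real_derivative grad f x \<bullet> v) (at 0)"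
      proof -
        have "((\<lambda>t. f (x + t *\<^sub>R v)) has_derivative (\<lambda>t. grad f (x + 0 *\<^sub>R v) \<bullet> (t *\<^sub>R v))) (at 0)"
          by (rule has_derivative_compose[of "\<lambda>t. x + t *\<^sub>R v" "\<lambda>t. t *\<^sub>R v" 0 UNIV f])
             (auto intro!: derivative_eq_intros has_derivative_grad smooth_differentiable assms)
        then have "((\<lambda>t. f (x + t *\<^sub>R v)) has_derivative (\<lambda>t. t * (grad f x \<bullet> v))) (at 0)" by simp
        moreover have "(\<lambda>t. t * (grad f x \<bullet> v)) = (*) (grad f x \<bullet> v)" by (simp add: fun_eq_iff)
        ultimately show ?thesis by (simp add: has_field_derivative_def)
      qed
      then have "(\<lambda>h. (f (x + h *\<^sub>R v) - f x) / h) \<midarrow>0\<rightarrow> grad f x \<bullet> v"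
        unfolding DERIV_def by simp
      moreover have "filterlim (\<lambda>n. inverse (real (Suc n))) (at 0) sequentially"
        using LIMSEQ_inverse_real_of_nat by (auto simp: filterlim_at simp del: of_nat_Suc)
      ultimately have "(\<lambda>n. (f (x + inverse (real (Suc n)) *\<^sub>R v) - f x) / inverse (real (Suc n))) \<longlonglongrightarrow> grad f x \<bullet> v"
        by (rule filterlim_compose)
      then show "(\<lambda>n. q n x) \<longlonglongrightarrow> grad f x \<bullet> v"
        unfolding q_def by (simp add: divide_inverse mult.commute del: of_nat_Suc)
    qed
    show "AE x in lborel. norm (q n x) \<le> indicator K' x *\<^sub>R (M * norm v)" for n
    proof (rule AE_I2)
      fix x
      let ?r = "inverse (real (Suc n))"
      have r: "0 < ?r" "?r \<le> 1" by (auto simp: inverse_le_1_iff)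
      have "norm (q n x) \<le> M * norm v"
      proof -
        have "norm (q n x) = real (Suc n) * \<bar>f (x + ?r *\<^sub>R v) - f x\<bar>" by (simp add: q_def abs_mult del: of_nat_Suc)
        also have "\<dots> \<le> real (Suc n) * (M * norm (?r *\<^sub>R v))" by (intro mult_left_mono lip) auto
        also have "\<dots> = M * norm v" by (simp del: of_nat_Suc)
        finally show ?thesis .
      qed
      moreover have "q n x = 0" if "x \<notin> K'"
      proof -
        have nx: "norm x > R + norm v" using that by (simp add: K'_def)
        have "norm x \<le> norm (x + ?r *\<^sub>R v) + norm (?r *\<^sub>R v)"
          by (metis add_diff_cancel_right' norm_triangle_ineq4)
        moreover have "norm (?r *\<^sub>R v) \<le> norm v" using r by (simp add: mult_left_le_one_le del: of_nat_Suc)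
        ultimately have "norm (x + ?r *\<^sub>R v) > R" using nx by linarith
        moreover have "norm x > R" using nx norm_ge_zero[of v] by linarith
        ultimately have "x + ?r *\<^sub>R v \<notin> K" "x \<notin> K" using R by force+
        then show ?thesis using assms(3) by (simp add: q_def)
      qed
      ultimately show "norm (q n x) \<le> indicator K' x *\<^sub>R (M * norm v)" by (cases "x \<in> K'") auto
    qed
  qed
  then show ?thesis unfolding q0 by (simp add: LIMSEQ_const_iff)
qed

section \<open>The fundamental lemma of the calculus of variations\<close>

lemma sets_lebesgue_open: "open W \<Longrightarrow> W \<in> sets lebesgue"
  by (simp add: borel_open)

lemma L2_set_integrable_cbox:
  fixes g :: "'a::euclidean_space \<Rightarrow> real"
  assumes g: "g \<in> L2 W" and W: "W \<in> sets lebesgue"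
  shows "set_integrable lebesgue (cbox a b) (\<lambda>x. indicator W x * g x)"
proof -
  have m: "(\<lambda>x. indicator W x * g x) \<in> borel_measurable lebesgue"
    using L2_D(1)[OF g] W by (simp add: borel_measurable_restrict_space_iff)
  have i: "integrable lebesgue (\<lambda>x. indicator W x * (g x)\<^sup>2)"
    using L2_D(2)[OF g] W by (simp add: integrable_restrict_space)
  have c: "integrable lebesgue (\<lambda>x. indicator (cbox a b) x *\<^sub>R (1::real))"
    using borel_integrable_compact[OF compact_cbox[of a b] continuous_on_const[of _ "1::real"]]
    by (simp add: integrable_completion)
  show ?thesis unfolding set_integrable_def
  proof (rule Bochner_Integration.integrable_bound[OF Bochner_Integration.integrable_add[OF c i]])
    show "(\<lambda>x. indicat_real (cbox a b) x *\<^sub>R (indicator W x * g x)) \<in> borel_measurable lebesgue"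
      using m by (intro borel_measurable_scaleR borel_measurable_indicator) auto
    have "\<bar>t\<bar> \<le> 1 + t\<^sup>2" for t :: real
      using sum_squares_bound[of "\<bar>t\<bar>" 1] by simp
    then show "AE x in lebesgue. norm (indicat_real (cbox a b) x *\<^sub>R (indicator W x * g x))
        \<le> norm (indicat_real (cbox a b) x *\<^sub>R 1 + indicator W x * (g x)\<^sup>2)"
      by (auto simp: indicator_def)
  qed
qed

text \<open>Lebesgue differentiation: almost every value of \<open>f\<close> is the limit of averages over small cubes with
  one corner at the point, and these averages vanish as soon as the cube lies in \<open>W\<close>.\<close>

lemma AE_zero_if_box_integrals_zero:
  fixes f :: "'a::euclidean_space \<Rightarrow> real"
  assumes "open W" "\<And>a b. f integrable_on cbox a b"
    and z: "\<And>a b. cbox a b \<subseteq> W \<Longrightarrow> integral (cbox a b) f = 0"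
  shows "AE x in lebesgue_on W. f x = 0"
proof -
  obtain N where N: "negligible N"
    "\<And>x e. \<lbrakk>x \<notin> N; 0 < e\<rbrakk> \<Longrightarrow> \<exists>d>0. \<forall>h. 0 < h \<and> h < d \<longrightarrow>
         norm(integral (cbox x (x + h *\<^sub>R One)) f /\<^sub>R h ^ DIM('a) - f x) < e"
    using integrable_ccontinuous_explicit[OF assms(2)] by metis
  have "f x = 0" if x: "x \<in> W" "x \<notin> N" for x
  proof (rule ccontr)
    assume "f x \<noteq> 0"
    then obtain d where d: "d > 0" "\<And>h. 0 < h \<Longrightarrow> h < d \<Longrightarrow>
         norm(integral (cbox x (x + h *\<^sub>R One)) f /\<^sub>R h ^ DIM('a) - f x) < \<bar>f x\<bar>"
      using N(2)[OF x(2), of "\<bar>f x\<bar>"] by auto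
    obtain r where r: "r > 0" "ball x r \<subseteq> W" using assms(1) x(1) open_contains_ball by blast
    define D where "D = real DIM('a)"
    have D: "D > 0" by (simp add: D_def)
    \<comment> \<open>small enough for both the approximation at \<open>x\<close> and the inclusion of the cube in the ball\<close>
    define h where "h = min (d / 2) (r / (2 * D))"
    have h: "0 < h" "h < d" "h * D < r" using d(1) r(1) D by (auto simp: h_def min_def field_simps)
    have "cbox x (x + h *\<^sub>R One) \<subseteq> ball x r"
    proof
      fix y assume y: "y \<in> cbox x (x + h *\<^sub>R One)"
      have "norm (y - x) \<le> (\<Sum>b\<in>Basis. \<bar>(y - x) \<bullet> b\<bar>)" by (rule norm_le_l1)
      also have "\<dots> \<le> (\<Sum>b\<in>(Basis::'a set). h)"
        using y by (intro sum_mono) (force simp: mem_box inner_diff_left inner_add_left)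
      also have "\<dots> < r" using h(3) by (simp add: D_def mult.commute)
      finally show "y \<in> ball x r" by (simp add: dist_norm norm_minus_commute)
    qed
    then have "integral (cbox x (x + h *\<^sub>R One)) f = 0" using z r(2) by blast
    then show False using d(2)[OF h(1,2)] by simp
  qed
  moreover have "AE x in lebesgue. x \<notin> N"
    using N(1) by (intro AE_not_in) (simp add: negligible_iff_null_sets)
  ultimately show ?thesis
    using assms(1) by (auto simp: AE_restrict_space_iff sets_lebesgue_open elim!: eventually_mono)
qed

text \<open>The bumps of a box converge to its indicator, so testing against them shows that \<open>g\<close> has
  integral zero over every box inside \<open>W\<close>.\<close>

lemma AE_zero_if_test_integrals_zero:
  fixes g :: "'a::euclidean_space \<Rightarrow> real"
  assumes W: "open W" and g: "g \<in> L2 W"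
    and z: "\<And>\<phi>. test_function W \<phi> \<Longrightarrow> (\<integral>x. g x * \<phi> x \<partial>lebesgue_on W) = 0"
  shows "AE x in lebesgue_on W. g x = 0"
proof -
  define f where "f = (\<lambda>x. indicator W x * g x)"
  have Wl: "W \<in> sets lebesgue" by (rule sets_lebesgue_open[OF W])
  have si: "set_integrable lebesgue (cbox a b) f" for a b
    unfolding f_def by (rule L2_set_integrable_cbox[OF g Wl])
  have fm: "f \<in> borel_measurable lebesgue"
    using L2_D(1)[OF g] Wl by (simp add: borel_measurable_restrict_space_iff f_def)
  have "integral (cbox a b) f = 0" if ab: "cbox a b \<subseteq> W" for a b
  proof -
    have "(\<lambda>n. \<integral>x. f x * box_bump a b n x \<partial>lebesgue) \<longlonglongrightarrow> (\<integral>x. f x * indicator (box a b) x \<partial>lebesgue)"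
    proof (rule integral_dominated_convergence[where w="\<lambda>x. norm (indicator (cbox a b) x *\<^sub>R f x)"])
      show "integrable lebesgue (\<lambda>x. norm (indicat_real (cbox a b) x *\<^sub>R f x))"
        using si[of a b] unfolding set_integrable_def by (rule integrable_norm)
      have "box_bump a b n \<in> borel_measurable lebesgue" for n
        by (intro measurable_completion) (simp add: borel_measurable_continuous_onI smooth_continuous smooth_box_bump)
      then show "(\<lambda>x. f x * box_bump a b n x) \<in> borel_measurable lebesgue" for n
        by (intro borel_measurable_times fm)
      show "(\<lambda>x. f x * indicator (box a b) x) \<in> borel_measurable lebesgue"
        by (intro borel_measurable_times fm borel_measurable_indicator) auto
      show "AE x in lebesgue. (\<lambda>n. f x * box_bump a b n x) \<longlonglongrightarrow> f x * indicator (box a b) x"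
        by (intro AE_I2 tendsto_intros box_bump_tendsto)
      show "AE x in lebesgue. norm (f x * box_bump a b n x) \<le> norm (indicat_real (cbox a b) x *\<^sub>R f x)" for n
      proof (rule AE_I2)
        fix x show "norm (f x * box_bump a b n x) \<le> norm (indicat_real (cbox a b) x *\<^sub>R f x)"
          using box_bump_bounds[of a b n x] box_bump_outside[of x a b n] box_subset_cbox[of a b]
          by (cases "x \<in> box a b") (auto simp: abs_mult mult_left_le)
      qed
    qed
    moreover have "(\<integral>x. f x * box_bump a b n x \<partial>lebesgue) = 0" for n
    proof -
      have "(\<integral>x. f x * box_bump a b n x \<partial>lebesgue) = (\<integral>x. f x * box_bump a b n x \<partial>lebesgue_on W)"
        by (rule integral_lebesgue_on_supp[symmetric]) (use Wl in \<open>auto simp: f_def\<close>)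
      also have "\<dots> = (\<integral>x. g x * box_bump a b n x \<partial>lebesgue_on W)"
        by (rule Bochner_Integration.integral_cong) (auto simp: f_def)
      also have "\<dots> = 0" by (rule z[OF test_function_box_bump[OF ab]])
      finally show ?thesis .
    qed
    ultimately have "(\<integral>x. f x * indicator (box a b) x \<partial>lebesgue) = 0"
      by (simp add: LIMSEQ_const_iff)
    then have *: "(LINT x:box a b|lebesgue. f x) = 0"
      unfolding set_lebesgue_integral_def by (simp add: mult.commute)
    have "set_integrable lebesgue (box a b) f"
      by (rule set_integrable_subset[OF si[of a b]]) (auto simp: box_subset_cbox)
    from set_lebesgue_integral_eq_integral(2)[OF this] * show ?thesis
      by (simp add: integral_open_interval)
  qed
  moreover have "f integrable_on cbox a b" for a b
    by (rule set_lebesgue_integral_eq_integral(1)[OF si])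
  ultimately have "AE x in lebesgue_on W. f x = 0"
    by (intro AE_zero_if_box_integrals_zero W)
  then show ?thesis
    by (auto simp: AE_restrict_space_iff Wl f_def elim!: eventually_mono)
qed

section \<open>Weak gradients and weak divergences\<close>

text \<open>Both weak derivatives are rewritten with the gradient vector of the test function, which makes
  the integrands products of square integrable fields.\<close>

lemma has_weak_grad_alt:
  "has_weak_grad W v g \<longleftrightarrow> g \<in> L2 W \<and>
     (\<forall>\<phi>. test_function W \<phi> \<longrightarrow> (\<forall>b\<in>Basis.
        (\<integral>x. v x * (grad \<phi> x \<bullet> b) \<partial>lebesgue_on W) = - (\<integral>x. (g x \<bullet> b) * \<phi> x \<partial>lebesgue_on W)))"
  unfolding has_weak_grad_def by (simp add: grad_inner_Basis cong: ball_cong)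

lemma has_weak_div_alt:
  "has_weak_div W s g \<longleftrightarrow> g \<in> L2 W \<and>
     (\<forall>\<phi>. test_function W \<phi> \<longrightarrow>
        (\<integral>x. s x \<bullet> grad \<phi> x \<partial>lebesgue_on W) = - (\<integral>x. g x * \<phi> x \<partial>lebesgue_on W))"
  unfolding has_weak_div_def
  by (intro arg_cong2[where f="(\<and>)"] refl all_cong1 imp_cong)
     (auto simp: test_function_def frechet_derivative_grad smooth_differentiable inner_commute)

lemma weak_grad_unique:
  assumes W: "open W" and g: "has_weak_grad W v g" "has_weak_grad W v g'"
  shows "AE x in lebesgue_on W. g x = g' x"
proof -
  have Wl: "W \<in> sets lebesgue" by (rule sets_lebesgue_open[OF W])
  have L: "g \<in> L2 W" "g' \<in> L2 W" using g by (auto simp: has_weak_grad_def)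
  have "AE x in lebesgue_on W. \<forall>b\<in>Basis. g x \<bullet> b - g' x \<bullet> b = 0"
  proof (intro AE_finite_allI finite_Basis AE_zero_if_test_integrals_zero W)
    fix b :: 'a assume b: "b \<in> Basis"
    have Lb: "(\<lambda>x. g x \<bullet> b) \<in> L2 W" "(\<lambda>x. g' x \<bullet> b) \<in> L2 W"
      using L b by (auto intro: L2_Basis)
    show "(\<lambda>x. g x \<bullet> b - g' x \<bullet> b) \<in> L2 W"
      using L2_add[OF Lb(1) L2_scaleR[OF Lb(2), of "-1"]] by simp
    fix \<phi> :: "'a \<Rightarrow> real" assume t: "test_function W \<phi>"
    have "integrable (lebesgue_on W) (\<lambda>x. (g x \<bullet> b) * \<phi> x)" "integrable (lebesgue_on W) (\<lambda>x. (g' x \<bullet> b) * \<phi> x)"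
      by (intro L2_mult_integrable Lb test_function_L2[OF t Wl])+
    then show "(\<integral>x. (g x \<bullet> b - g' x \<bullet> b) * \<phi> x \<partial>lebesgue_on W) = 0"
      using g t b by (simp add: has_weak_grad_alt left_diff_distrib)
  qed
  then show ?thesis by eventually_elim (auto intro: euclidean_eqI)
qed

lemma weak_div_unique:
  assumes W: "open W" and g: "has_weak_div W v g" "has_weak_div W v g'"
  shows "AE x in lebesgue_on W. g x = g' x"
proof -
  have Wl: "W \<in> sets lebesgue" by (rule sets_lebesgue_open[OF W])
  have L: "g \<in> L2 W" "g' \<in> L2 W" using g by (auto simp: has_weak_div_def)
  have "AE x in lebesgue_on W. g x - g' x = 0"
  proof (intro AE_zero_if_test_integrals_zero W)
    show "(\<lambda>x. g x - g' x) \<in> L2 W"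
      using L2_add[OF L(1) L2_scaleR[OF L(2), of "-1"]] by simp
    fix \<phi> :: "'a \<Rightarrow> real" assume t: "test_function W \<phi>"
    have "integrable (lebesgue_on W) (\<lambda>x. g x * \<phi> x)" "integrable (lebesgue_on W) (\<lambda>x. g' x * \<phi> x)"
      by (intro L2_mult_integrable L test_function_L2[OF t Wl])+
    then show "(\<integral>x. (g x - g' x) * \<phi> x \<partial>lebesgue_on W) = 0"
      using g t by (simp add: has_weak_div_alt left_diff_distrib)
  qed
  then show ?thesis by eventually_elim auto
qed

lemma has_weak_grad_wgrad: "v \<in> H1 W \<Longrightarrow> has_weak_grad W v (wgrad W v)"
  unfolding H1_def wgrad_def by (auto intro: someI[of "has_weak_grad W v"])

text \<open>Uniqueness is what makes the chosen representative usable: it agrees almost everywhere with any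
  gradient found by other means.\<close>

lemma wgrad_AE:
  assumes "open W" "has_weak_grad W v g" shows "AE x in lebesgue_on W. wgrad W v x = g x"
  using weak_grad_unique[OF assms(1) _ assms(2)] assms(2) unfolding wgrad_def by (metis someI_ex)

lemma wdiv_AE:
  assumes "open W" "has_weak_div W s g" shows "AE x in lebesgue_on W. wdiv W s x = g x"
  using weak_div_unique[OF assms(1) _ assms(2)] assms(2) unfolding wdiv_def by (metis someI_ex)

lemma wgrad_L2: "v \<in> H1 W \<Longrightarrow> wgrad W v \<in> L2 W"
  using has_weak_grad_wgrad has_weak_grad_def by blast

lemma has_weak_grad_add:
  assumes W: "open W" and v: "v \<in> L2 W" "v' \<in> L2 W" "has_weak_grad W v g" "has_weak_grad W v' g'"
  shows "has_weak_grad W (\<lambda>x. v x + v' x) (\<lambda>x. g x + g' x)"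
  unfolding has_weak_grad_alt
proof (intro conjI allI impI ballI)
  have Wl: "W \<in> sets lebesgue" by (rule sets_lebesgue_open[OF W])
  have L: "g \<in> L2 W" "g' \<in> L2 W" using v by (auto simp: has_weak_grad_def)
  show "(\<lambda>x. g x + g' x) \<in> L2 W" by (rule L2_add[OF L])
  fix b :: "'a" and \<phi> assume t: "test_function W \<phi>" and b: "b \<in> Basis"
  have "integrable (lebesgue_on W) (\<lambda>x. v x * (grad \<phi> x \<bullet> b))" "integrable (lebesgue_on W) (\<lambda>x. v' x * (grad \<phi> x \<bullet> b))"
    "integrable (lebesgue_on W) (\<lambda>x. (g x \<bullet> b) * \<phi> x)" "integrable (lebesgue_on W) (\<lambda>x. (g' x \<bullet> b) * \<phi> x)"
    using b by (auto intro!: L2_mult_integrable v L2_Basis L test_function_L2[OF t Wl])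
  then show "(\<integral>x. (v x + v' x) * (grad \<phi> x \<bullet> b) \<partial>lebesgue_on W)
       = - (\<integral>x. ((g x + g' x) \<bullet> b) * \<phi> x \<partial>lebesgue_on W)"
    using v(3,4) t b by (simp add: has_weak_grad_alt distrib_right inner_add_left)
qed

lemma has_weak_grad_scaleR:
  assumes "has_weak_grad W v g"
  shows "has_weak_grad W (\<lambda>x. c * v x) (\<lambda>x. c *\<^sub>R g x)"
  using assms unfolding has_weak_grad_alt by (auto simp: L2_scaleR mult.assoc)

lemma has_weak_div_add:
  assumes W: "open W" and v: "v \<in> L2 W" "v' \<in> L2 W" "has_weak_div W v g" "has_weak_div W v' g'"
  shows "has_weak_div W (\<lambda>x. v x + v' x) (\<lambda>x. g x + g' x)"
  unfolding has_weak_div_alt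
proof (intro conjI allI impI ballI)
  have Wl: "W \<in> sets lebesgue" by (rule sets_lebesgue_open[OF W])
  have L: "g \<in> L2 W" "g' \<in> L2 W" using v by (auto simp: has_weak_div_def)
  show "(\<lambda>x. g x + g' x) \<in> L2 W" by (rule L2_add[OF L])
  fix \<phi> assume t: "test_function W \<phi>"
  have "integrable (lebesgue_on W) (\<lambda>x. v x \<bullet> grad \<phi> x)" "integrable (lebesgue_on W) (\<lambda>x. v' x \<bullet> grad \<phi> x)"
    "integrable (lebesgue_on W) (\<lambda>x. g x * \<phi> x)" "integrable (lebesgue_on W) (\<lambda>x. g' x * \<phi> x)"
    by (auto intro!: L2_mult_integrable L2_inner_integrable v L test_function_L2[OF t Wl])
  then show "(\<integral>x. (v x + v' x) \<bullet> grad \<phi> x \<partial>lebesgue_on W)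
       = - (\<integral>x. (g x + g' x) * \<phi> x \<partial>lebesgue_on W)"
    using v(3,4) t by (simp add: has_weak_div_alt distrib_right inner_add_left)
qed

lemma has_weak_div_scaleR:
  assumes "has_weak_div W v g"
  shows "has_weak_div W (\<lambda>x. c *\<^sub>R v x) (\<lambda>x. c * g x)"
  using assms L2_scaleR[of g W c] unfolding has_weak_div_alt by (auto simp: mult.assoc)

lemma bounded_L2:
  fixes f :: "'a::euclidean_space \<Rightarrow> 'b::euclidean_space"
  assumes "continuous_on UNIV f" "bounded W" "W \<in> sets lebesgue"
  shows "f \<in> L2 W"
proof -
  have "compact (closure W)" using assms(2) by simp
  from compact_imp_bounded[OF compact_continuous_image[OF continuous_on_subset[OF assms(1)] this]]
  obtain M where M: "\<And>x. x \<in> closure W \<Longrightarrow> norm (f x) \<le> M" by (auto simp: bounded_iff)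
  have fm: "finite_measure (lebesgue_on W)"
    by (rule finite_measure_lebesgue_on[OF bounded_set_imp_lmeasurable[OF assms(2,3)]])
  show ?thesis
  proof (rule L2_bounded_by)
    have "f \<in> borel_measurable lebesgue"
      using assms(1) by (intro measurable_completion) (auto intro: borel_measurable_continuous_onI)
    then show "f \<in> borel_measurable (lebesgue_on W)" by (rule measurable_restrict_space1)
    show "integrable (lebesgue_on W) (\<lambda>x. M\<^sup>2)" using fm by (rule finite_measure.integrable_const)
    show "AE x in lebesgue_on W. (norm (f x))\<^sup>2 \<le> M\<^sup>2"
      by (rule AE_I2) (use M closure_subset in \<open>auto intro!: power_mono\<close>)
  qed
qed

text \<open>The product with a test function is smooth with compact support, so the integral of its gradient
  vanishes, which is the product rule in integrated form.\<close>

lemma has_weak_grad_smooth: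
  assumes W: "open W" "bounded W" and f: "smooth f"
  shows "has_weak_grad W f (grad f)"
  unfolding has_weak_grad_alt
proof (intro conjI allI impI ballI)
  have Wl: "W \<in> sets lebesgue" by (rule sets_lebesgue_open[OF W(1)])
  show "grad f \<in> L2 W" by (rule bounded_L2[OF smooth_grad_continuous[OF f] W(2) Wl])
  fix b :: 'a and \<phi> assume b: "b \<in> Basis" and t: "test_function W \<phi>"
  obtain K where K: "smooth \<phi>" "compact K" "K \<subseteq> W" "\<And>x. x \<notin> K \<Longrightarrow> \<phi> x = 0" "\<And>x. x \<notin> K \<Longrightarrow> grad \<phi> x = 0"
    using test_functionE[OF t] by blast
  have i1: "integrable lborel (\<lambda>x. f x * (grad \<phi> x \<bullet> b))"
    by (rule continuous_compact_support_integrable[OF _ K(2)])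
       (use K in \<open>auto intro!: continuous_intros smooth_continuous[OF f] smooth_grad_continuous[OF f]
              smooth_continuous[OF K(1)] smooth_grad_continuous[OF K(1)]\<close>)
  have i2: "integrable lborel (\<lambda>x. (grad f x \<bullet> b) * \<phi> x)"
    by (rule continuous_compact_support_integrable[OF _ K(2)])
       (use K in \<open>auto intro!: continuous_intros smooth_continuous[OF f] smooth_grad_continuous[OF f]
              smooth_continuous[OF K(1)] smooth_grad_continuous[OF K(1)]\<close>)
  have "0 = (\<integral>x. grad (\<lambda>x. f x * \<phi> x) x \<bullet> b \<partial>lborel)"
    by (rule integral_grad_compact_support[symmetric, OF smooth_mult[OF f K(1)] K(2)]) (simp add: K)
  also have "\<dots> = (\<integral>x. f x * (grad \<phi> x \<bullet> b) + (grad f x \<bullet> b) * \<phi> x \<partial>lborel)"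
    by (simp only: grad_mult[OF f K(1)], simp add: inner_add_left mult.commute)
  also have "\<dots> = (\<integral>x. f x * (grad \<phi> x \<bullet> b) \<partial>lborel) + (\<integral>x. (grad f x \<bullet> b) * \<phi> x \<partial>lborel)"
    using i1 i2 by simp
  also have "\<dots> = (\<integral>x. f x * (grad \<phi> x \<bullet> b) \<partial>lebesgue) + (\<integral>x. (grad f x \<bullet> b) * \<phi> x \<partial>lebesgue)"
    using i1 i2 by (simp add: integral_completion borel_measurable_integrable)
  also have "\<dots> = (\<integral>x. f x * (grad \<phi> x \<bullet> b) \<partial>lebesgue_on W) + (\<integral>x. (grad f x \<bullet> b) * \<phi> x \<partial>lebesgue_on W)"
  proof -
    have "\<phi> x = 0" "grad \<phi> x = 0" if "x \<notin> W" for x using K(3-5) that by auto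
    then show ?thesis by (subst (1 2) integral_lebesgue_on_supp[OF Wl]) auto
  qed
  finally show "(\<integral>x. f x * (grad \<phi> x \<bullet> b) \<partial>lebesgue_on W) = - (\<integral>x. (grad f x \<bullet> b) * \<phi> x \<partial>lebesgue_on W)"
    by simp
qed

lemma smooth_H1:
  assumes "open W" "bounded W" "smooth f" shows "f \<in> H1 W"
  unfolding H1_def
  using has_weak_grad_smooth[OF assms] bounded_L2[OF smooth_continuous[OF assms(3)] assms(2) sets_lebesgue_open[OF assms(1)]]
  by blast

lemma wgrad_smooth_AE:
  assumes "open W" "bounded W" "smooth f" shows "AE x in lebesgue_on W. wgrad W f x = grad f x"
  by (rule wgrad_AE[OF assms(1) has_weak_grad_smooth[OF assms]])

section \<open>Propagation of square integrals by translation\<close>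

lemma nn_integral_lborel_translate:
  fixes f :: "'a::euclidean_space \<Rightarrow> ennreal"
  assumes "f \<in> borel_measurable borel"
  shows "(\<integral>\<^sup>+x. f (x + c) \<partial>lborel) = (\<integral>\<^sup>+x. f x \<partial>lborel)"
proof -
  have "(\<integral>\<^sup>+x. f x \<partial>distr lborel borel ((+) c)) = (\<integral>\<^sup>+x. f (c + x) \<partial>lborel)"
    using assms by (intro nn_integral_distr) auto
  then show ?thesis by (simp add: lborel_distr_plus add.commute)
qed

text \<open>The squared norm as an extended real, so that no integrability has to be carried through the
  Fubini and translation arguments.\<close>

definition sq_int :: "('a::euclidean_space \<Rightarrow> 'b::real_normed_vector) \<Rightarrow> 'a set \<Rightarrow> ennreal" where
  "sq_int f A = (\<integral>\<^sup>+x\<in>A. ennreal ((norm (f x))\<^sup>2) \<partial>lborel)"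

lemma sq_int_mono: "A \<subseteq> B \<Longrightarrow> sq_int f A \<le> sq_int f B"
  unfolding sq_int_def by (intro nn_integral_mono) (auto simp: indicator_def)

text \<open>Variance is nonnegative: integrate the square of \<open>h\<close> minus its mean.\<close>

lemma square_integral_le:
  fixes h :: "real \<Rightarrow> real"
  assumes "continuous_on {0..t} h" "0 \<le> t"
  shows "(integral {0..t} h)\<^sup>2 \<le> t * integral {0..t} (\<lambda>s. (h s)\<^sup>2)"
proof (cases "t = 0")
  case False
  then have t: "t > 0" using assms(2) by simp
  define c where "c = integral {0..t} h / t"
  have i: "h integrable_on {0..t}" "(\<lambda>s. (h s)\<^sup>2) integrable_on {0..t}"
    by (intro integrable_continuous_real continuous_intros assms)+
  have "0 \<le> integral {0..t} (\<lambda>s. (h s - c)\<^sup>2)"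
    by (intro integral_nonneg integrable_continuous_real continuous_intros assms) auto
  also have "(\<lambda>s. (h s - c)\<^sup>2) = (\<lambda>s. (h s)\<^sup>2 - (2 * c) * h s + c\<^sup>2)"
    by (auto simp: power2_eq_square algebra_simps)
  also have "integral {0..t} \<dots> = integral {0..t} (\<lambda>s. (h s)\<^sup>2) - 2 * c * integral {0..t} h + t * c\<^sup>2"
    using i t by (subst integral_add integral_diff integral_mult_right, auto intro!: integrable_on_mult_right integrable_diff)+
  finally show ?thesis using t by (simp add: c_def power2_eq_square field_simps)
qed simp

lemma line_ftc:
  assumes "smooth f" "a \<le> b"
  shows "((\<lambda>s. grad f (x + s *\<^sub>R v) \<bullet> v) has_integral (f (x + b *\<^sub>R v) - f (x + a *\<^sub>R v))) {a..b}"
proof (rule fundamental_theorem_of_calculus[OF assms(2)])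
  fix t
  have "((\<lambda>t. f (x + t *\<^sub>R v)) has_derivative (\<lambda>s. grad f (x + t *\<^sub>R v) \<bullet> (s *\<^sub>R v))) (at t within {a..b})"
    by (rule has_derivative_compose[of "\<lambda>t. x + t *\<^sub>R v" "\<lambda>t. t *\<^sub>R v" t _ f])
       (auto intro!: derivative_eq_intros has_derivative_grad smooth_differentiable assms)
  then show "((\<lambda>t. f (x + t *\<^sub>R v)) has_vector_derivative grad f (x + t *\<^sub>R v) \<bullet> v) (at t within {a..b})"
    by (simp add: has_vector_derivative_def)
qed

lemma continuous_on_grad_line:
  assumes "smooth f" shows "continuous_on S (\<lambda>s. grad f (x + s *\<^sub>R v) \<bullet> v)"
  by (intro continuous_intros continuous_on_compose2[OF smooth_grad_continuous[OF assms, of UNIV]]) auto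

lemma line_diff_square_le:
  fixes f :: "'a::euclidean_space \<Rightarrow> real"
  assumes f: "smooth f" and t: "0 \<le> t"
  shows "ennreal ((f (x + t *\<^sub>R v) - f x)\<^sup>2)
      \<le> (\<integral>\<^sup>+s\<in>{0<..<t}. ennreal (t * (norm v)\<^sup>2 * (norm (grad f (x + s *\<^sub>R v)))\<^sup>2) \<partial>lborel)"
proof -
  let ?h = "\<lambda>s. grad f (x + s *\<^sub>R v) \<bullet> v"
  have "f (x + t *\<^sub>R v) - f x = integral {0..t} ?h"
    using integral_unique[OF line_ftc[OF f t, of x v]] by simp
  then have "(f (x + t *\<^sub>R v) - f x)\<^sup>2 \<le> t * integral {0..t} (\<lambda>s. (?h s)\<^sup>2)"
    using square_integral_le[OF continuous_on_grad_line[OF f, of _ x v] t] by simp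
  also have "ennreal \<dots> = (\<integral>\<^sup>+s\<in>{0<..<t}. ennreal (t * (?h s)\<^sup>2) \<partial>lborel)"
  proof -
    have "((\<lambda>s. t * (?h s)\<^sup>2) has_integral t * integral {0..t} (\<lambda>s. (?h s)\<^sup>2)) {0..t}"
      by (intro has_integral_mult_right integrable_integral integrable_continuous_real continuous_intros continuous_on_grad_line f)
    then have "((\<lambda>s. t * (?h s)\<^sup>2) has_integral t * integral {0..t} (\<lambda>s. (?h s)\<^sup>2)) {0<..<t}"
      by (simp only: has_integral_Icc_iff_Ioo)
    from nn_integral_has_integral_lebesgue'[OF _ this] t show ?thesis by simp
  qed
  also have "\<dots> \<le> (\<integral>\<^sup>+s\<in>{0<..<t}. ennreal (t * (norm v)\<^sup>2 * (norm (grad f (x + s *\<^sub>R v)))\<^sup>2) \<partial>lborel)"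
  proof (intro nn_integral_mono mult_right_mono ennreal_leI)
    fix s
    have "(?h s)\<^sup>2 \<le> (norm (grad f (x + s *\<^sub>R v)) * norm v)\<^sup>2"
      using Cauchy_Schwarz_ineq2 by (rule abs_le_square_iff[THEN iffD1, OF order_trans]) simp
    then have "(?h s)\<^sup>2 \<le> (norm v)\<^sup>2 * (norm (grad f (x + s *\<^sub>R v)))\<^sup>2"
      by (simp only: power_mult_distrib mult.commute)
    from mult_left_mono[OF this t]
    show "t * (?h s)\<^sup>2 \<le> t * (norm v)\<^sup>2 * (norm (grad f (x + s *\<^sub>R v)))\<^sup>2"
      by (simp only: mult.assoc)
  qed simp
  finally show ?thesis by (simp add: ennreal_leI)
qed

text \<open>Along the segment from \<open>x\<close> to \<open>x + v\<close> the increment is the integral of a directional derivative.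
  Squaring, integrating over \<open>x\<close> and exchanging the integrals leaves, for each position on the segment,
  an integral over a translate of \<open>A\<close>, which lies in \<open>W\<close>.\<close>

lemma sq_int_shift_diff:
  fixes f :: "'a::euclidean_space \<Rightarrow> real"
  assumes f: "smooth f" and [measurable]: "A \<in> sets borel" "W \<in> sets borel"
    and sweep: "\<And>x s. x \<in> A \<Longrightarrow> 0 \<le> s \<Longrightarrow> s \<le> 1 \<Longrightarrow> x + s *\<^sub>R v \<in> W"
  shows "sq_int (\<lambda>x. f (x + v) - f x) A \<le> ennreal ((norm v)\<^sup>2) * sq_int (grad f) W"
proof -
  have [measurable]: "f \<in> borel_measurable borel" "grad f \<in> borel_measurable borel"
    by (auto intro!: borel_measurable_continuous_onI smooth_continuous smooth_grad_continuous f)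
  have [measurable]: "{0<..<1::real} \<in> sets borel" by simp
  define F where "F y = ennreal ((norm v)\<^sup>2 * (norm (grad f y))\<^sup>2)" for y
  have [measurable]: "F \<in> borel_measurable borel" unfolding F_def by measurable
  have pt: "ennreal ((norm (f (x + v) - f x))\<^sup>2) \<le> (\<integral>\<^sup>+s\<in>{0<..<1}. F (x + s *\<^sub>R v) \<partial>lborel)" for x
    using line_diff_square_le[OF f, of 1 x v] by (simp add: F_def)
  have "sq_int (\<lambda>x. f (x + v) - f x) A \<le> (\<integral>\<^sup>+x\<in>A. (\<integral>\<^sup>+s\<in>{0<..<1}. F (x + s *\<^sub>R v) \<partial>lborel) \<partial>lborel)"
    unfolding sq_int_def by (intro nn_integral_mono mult_right_mono pt) simp
  also have "\<dots> = (\<integral>\<^sup>+x. (\<integral>\<^sup>+s. F (x + s *\<^sub>R v) * indicator {0<..<1} s * indicator A x \<partial>lborel) \<partial>lborel)"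
    by (intro nn_integral_cong nn_integral_multc[symmetric]) measurable
  also have "\<dots> = (\<integral>\<^sup>+s. (\<integral>\<^sup>+x. F (x + s *\<^sub>R v) * indicator {0<..<1::real} s * indicator A x \<partial>lborel) \<partial>lborel)"
    by (rule lborel_pair.Fubini') measurable
  also have "\<dots> \<le> (\<integral>\<^sup>+s. (\<integral>\<^sup>+y. F y * indicator W y \<partial>lborel) * indicator {0<..<1::real} s \<partial>lborel)"
  proof (intro nn_integral_mono)
    fix s :: real
    have "(\<integral>\<^sup>+x. F (x + s *\<^sub>R v) * indicator {0<..<1} s * indicator A x \<partial>lborel)
        \<le> (\<integral>\<^sup>+x. F (x + s *\<^sub>R v) * indicator W (x + s *\<^sub>R v) * indicator {0<..<1} s \<partial>lborel)"
      using sweep by (intro nn_integral_mono) (auto simp: indicator_def)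
    also have "\<dots> = (\<integral>\<^sup>+y. F y * indicator W y * indicator {0<..<1} s \<partial>lborel)"
      by (rule nn_integral_lborel_translate) measurable
    also have "\<dots> = (\<integral>\<^sup>+y. F y * indicator W y \<partial>lborel) * indicator {0<..<1::real} s"
      by (rule nn_integral_multc) measurable
    finally show "(\<integral>\<^sup>+x. F (x + s *\<^sub>R v) * indicator {0<..<1} s * indicator A x \<partial>lborel)
        \<le> (\<integral>\<^sup>+y. F y * indicator W y \<partial>lborel) * indicator {0<..<1::real} s" .
  qed
  also have "\<dots> = (\<integral>\<^sup>+y. F y * indicator W y \<partial>lborel)"
    by (subst nn_integral_cmult) auto
  also have "\<dots> = ennreal ((norm v)\<^sup>2) * sq_int (grad f) W"
    unfolding F_def sq_int_def by (subst nn_integral_cmult[symmetric]) (auto simp: ennreal_mult mult.assoc)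
  finally show ?thesis .
qed

lemma ennreal_square_add_le:
  fixes a b :: real shows "ennreal (a\<^sup>2) \<le> 2 * ennreal (b\<^sup>2) + 2 * ennreal ((b - a)\<^sup>2)"
proof -
  have "a\<^sup>2 \<le> 2 * b\<^sup>2 + 2 * (b - a)\<^sup>2" using sum_squares_bound[of "2 * b" a] zero_le_power2[of "2 * b - a"]
    by (simp add: power2_eq_square algebra_simps)
  then have "ennreal (a\<^sup>2) \<le> ennreal (2 * b\<^sup>2 + 2 * (b - a)\<^sup>2)" by (rule ennreal_leI)
  then show ?thesis by (simp add: ennreal_plus ennreal_mult')
qed

lemma sq_int_shift_le:
  fixes f :: "'a::euclidean_space \<Rightarrow> real"
  assumes f: "smooth f" and [measurable]: "A \<in> sets borel" "W \<in> sets borel"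
    and sweep: "\<And>x s. x \<in> A \<Longrightarrow> 0 \<le> s \<Longrightarrow> s \<le> 1 \<Longrightarrow> x + s *\<^sub>R v \<in> W"
    and B: "B \<in> sets borel" "\<And>x. x \<in> A \<Longrightarrow> x + v \<in> B"
  shows "sq_int f A \<le> 2 * sq_int f B + 2 * (ennreal ((norm v)\<^sup>2) * sq_int (grad f) W)"
proof -
  note [measurable] = B(1)
  have [measurable]: "f \<in> borel_measurable borel"
    by (auto intro!: borel_measurable_continuous_onI smooth_continuous f)
  have "sq_int f A \<le> (\<integral>\<^sup>+x. 2 * (ennreal ((f (x + v))\<^sup>2) * indicator B (x + v))
                       + 2 * (ennreal ((f (x + v) - f x)\<^sup>2) * indicator A x) \<partial>lborel)"
    unfolding sq_int_def
    using B(2) by (intro nn_integral_mono) (auto simp: indicator_def intro: ennreal_square_add_le)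
  also have "\<dots> = 2 * (\<integral>\<^sup>+x. ennreal ((f (x + v))\<^sup>2) * indicator B (x + v) \<partial>lborel)
      + 2 * sq_int (\<lambda>x. f (x + v) - f x) A"
    unfolding sq_int_def by (subst nn_integral_add, measurable) (simp add: nn_integral_cmult)
  also have "(\<integral>\<^sup>+x. ennreal ((f (x + v))\<^sup>2) * indicator B (x + v) \<partial>lborel) = sq_int f B"
    unfolding sq_int_def by (subst nn_integral_lborel_translate) auto
  finally show ?thesis
    using sq_int_shift_diff[OF f assms(2,3) sweep]
    by (meson add_left_mono mult_left_mono order_trans zero_le)
qed

text \<open>\<open>A\<close> is controlled when a function with small gradient in \<open>W\<close> that is small on the reference set \<open>B\<close> must
  also be small on \<open>A\<close>. The constant depends on the three sets only. Controlled sets are closed under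
  finite unions and under pulling back by translations within \<open>W\<close>, so that control spreads from a ball
  over the whole domain by a compactness argument.\<close>

definition controlled :: "'a::euclidean_space set \<Rightarrow> 'a set \<Rightarrow> 'a set \<Rightarrow> bool" where
  "controlled W B A \<longleftrightarrow> A \<in> sets borel \<and>
     (\<exists>C::real. \<forall>f. smooth f \<longrightarrow> sq_int f A \<le> ennreal C * (sq_int f B + sq_int (grad f) W))"

lemma controlledE:
  assumes "controlled W B A"
  obtains C where "A \<in> sets borel" "C \<ge> 0" "\<And>f. smooth f \<Longrightarrow> sq_int f A \<le> ennreal C * (sq_int f B + sq_int (grad f) W)"
proof -
  obtain C where C: "A \<in> sets borel" "\<And>f. smooth f \<Longrightarrow> sq_int f A \<le> ennreal C * (sq_int f B + sq_int (grad f) W)"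
    using assms by (auto simp: controlled_def)
  have "ennreal C = ennreal (max C 0)" by (auto simp: max_def ennreal_neg)
  then show ?thesis using C that[of "max C 0"] by auto
qed

lemma controlled_subset: "controlled W B A \<Longrightarrow> A' \<subseteq> A \<Longrightarrow> A' \<in> sets borel \<Longrightarrow> controlled W B A'"
  unfolding controlled_def using sq_int_mono by (meson order_trans)

lemma controlled_refl: "B \<in> sets borel \<Longrightarrow> controlled W B B"
  unfolding controlled_def by (auto intro!: exI[of _ 1])

lemma controlled_empty: "controlled W B {}"
  unfolding controlled_def sq_int_def by auto

lemma controlled_Un:
  assumes "controlled W B A" "controlled W B A'" shows "controlled W B (A \<union> A')"
proof -
  obtain C where C: "A \<in> sets borel" "C \<ge> 0" "\<And>f. smooth f \<Longrightarrow> sq_int f A \<le> ennreal C * (sq_int f B + sq_int (grad f) W)"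
    by (rule controlledE[OF assms(1)]) blast
  obtain C' where C': "A' \<in> sets borel" "C' \<ge> 0" "\<And>f. smooth f \<Longrightarrow> sq_int f A' \<le> ennreal C' * (sq_int f B + sq_int (grad f) W)"
    by (rule controlledE[OF assms(2)]) blast
  note [measurable] = C(1) C'(1)
  have "sq_int f (A \<union> A') \<le> ennreal (C + C') * (sq_int f B + sq_int (grad f) W)" if f: "smooth f" for f :: "'a \<Rightarrow> real"
  proof -
    have [measurable]: "f \<in> borel_measurable borel"
      by (auto intro!: borel_measurable_continuous_onI smooth_continuous f)
    have "sq_int f (A \<union> A') \<le> (\<integral>\<^sup>+x. ennreal ((f x)\<^sup>2) * indicator A x + ennreal ((f x)\<^sup>2) * indicator A' x \<partial>lborel)"
      unfolding sq_int_def by (intro nn_integral_mono) (auto simp: indicator_def)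
    also have "\<dots> = sq_int f A + sq_int f A'" unfolding sq_int_def by (subst nn_integral_add) auto
    also have "\<dots> \<le> ennreal C * (sq_int f B + sq_int (grad f) W) + ennreal C' * (sq_int f B + sq_int (grad f) W)"
      by (intro add_mono C C' f)
    finally show ?thesis using C C' by (simp add: ennreal_plus distrib_right)
  qed
  then show ?thesis unfolding controlled_def using C(1) C'(1) by blast
qed

lemma controlled_UN: "finite I \<Longrightarrow> (\<And>i. i \<in> I \<Longrightarrow> controlled W B (A i)) \<Longrightarrow> controlled W B (\<Union>i\<in>I. A i)"
  by (induction I rule: finite_induct) (auto intro: controlled_empty controlled_Un)

text \<open>If the segments from \<open>A\<close> to its translate stay inside \<open>W\<close>, the difference between the values at
  both ends is bounded by the gradient in \<open>W\<close>.\<close>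

lemma controlled_shift:
  assumes "controlled W B A'" "A \<in> sets borel" "W \<in> sets borel"
    and sweep: "\<And>x s. x \<in> A \<Longrightarrow> 0 \<le> s \<Longrightarrow> s \<le> 1 \<Longrightarrow> x + s *\<^sub>R v \<in> W"
    and shift: "\<And>x. x \<in> A \<Longrightarrow> x + v \<in> A'"
  shows "controlled W B A"
proof -
  obtain C where C: "A' \<in> sets borel" "C \<ge> 0" "\<And>f. smooth f \<Longrightarrow> sq_int f A' \<le> ennreal C * (sq_int f B + sq_int (grad f) W)"
    by (rule controlledE[OF assms(1)]) blast
  have "sq_int f A \<le> ennreal (2 * C + 2 * (norm v)\<^sup>2) * (sq_int f B + sq_int (grad f) W)" if f: "smooth f" for f :: "'a \<Rightarrow> real"
  proof -
    let ?E = "sq_int f B + sq_int (grad f) W"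
    have "sq_int f A \<le> 2 * sq_int f A' + 2 * (ennreal ((norm v)\<^sup>2) * sq_int (grad f) W)"
      by (rule sq_int_shift_le[OF f assms(2,3) sweep C(1) shift])
    also have "\<dots> \<le> 2 * (ennreal C * ?E) + 2 * (ennreal ((norm v)\<^sup>2) * ?E)"
      by (intro add_mono mult_left_mono C f) (auto intro: add_increasing)
    also have "\<dots> = ennreal (2 * C + 2 * (norm v)\<^sup>2) * ?E"
      using C(2) by (simp add: ennreal_plus ennreal_mult' distrib_right mult.assoc)
    finally show ?thesis .
  qed
  then show ?thesis unfolding controlled_def using assms(2) by blast
qed

text \<open>The points that have a controlled neighbourhood form a set that is open and relatively closed in \<open>W\<close>:
  near a limit point, a small ball is carried by a translation onto a ball around a good point.
  Connectedness does the rest.\<close>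

lemma controlled_interior_point:
  assumes W: "open W" "connected W" and x0: "x0 \<in> W" "\<rho>0 > 0" "controlled W B (ball x0 \<rho>0)"
    and x: "x \<in> W"
  shows "\<exists>\<rho>>0. controlled W B (ball x \<rho>)"
proof -
  define S where "S = {x \<in> W. \<exists>\<rho>>0. controlled W B (ball x \<rho>)}"
  have Wb: "W \<in> sets borel" using W by simp
  have "openin (top_of_set W) S"
  proof -
    have "open S" unfolding open_contains_ball
    proof
      fix x assume "x \<in> S"
      then obtain \<rho> where r: "\<rho> > 0" "controlled W B (ball x \<rho>)" and xW: "x \<in> W" by (auto simp: S_def)
      obtain r where r': "r > 0" "ball x r \<subseteq> W" using W(1) xW open_contains_ball by blast
      have "ball x (min r \<rho>) \<subseteq> S"
      proof
        fix y assume y: "y \<in> ball x (min r \<rho>)"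
        then have "ball y (\<rho> - dist x y) \<subseteq> ball x \<rho>" by (simp add: ball_subset_ball_iff dist_commute)
        then have "controlled W B (ball y (\<rho> - dist x y))"
          using controlled_subset[OF r(2)] by simp
        moreover have "\<rho> - dist x y > 0" "y \<in> W" using y r'(2) by auto
        ultimately show "y \<in> S" unfolding S_def by blast
      qed
      then show "\<exists>e>0. ball x e \<subseteq> S" using r r' by (intro exI[of _ "min r \<rho>"]) auto
    qed
    then show ?thesis by (auto simp: S_def openin_open intro!: exI[of _ S])
  qed
  moreover have "closedin (top_of_set W) S"
    unfolding closedin_limpt
  proof (intro conjI allI impI)
    show "S \<subseteq> W" by (auto simp: S_def)
    fix x assume "x islimpt S \<and> x \<in> W"
    then have lim: "x islimpt S" and xW: "x \<in> W" by auto
    obtain r where r: "r > 0" "ball x r \<subseteq> W" using W(1) xW open_contains_ball by blast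
    obtain y where y: "y \<in> S" "dist y x < r / 2" using lim r(1) unfolding islimpt_approachable
      by (meson half_gt_zero)
    obtain \<rho> where \<rho>: "\<rho> > 0" "controlled W B (ball y \<rho>)" using y by (auto simp: S_def)
    define \<delta> where "\<delta> = min \<rho> (r / 2)"
    have "controlled W B (ball x \<delta>)"
    proof (rule controlled_shift[OF \<rho>(2) _ Wb, where v="y - x"])
      fix z :: "'a" assume z: "z \<in> ball x \<delta>"
      show "z + (y - x) \<in> ball y \<rho>" using z by (simp add: \<delta>_def dist_norm algebra_simps)
      fix s :: real assume s: "0 \<le> s" "s \<le> 1"
      have "norm (z + s *\<^sub>R (y - x) - x) \<le> norm (z - x) + norm (s *\<^sub>R (y - x))"
        by (metis add_diff_eq diff_add_eq norm_triangle_ineq)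
      also have "norm (s *\<^sub>R (y - x)) \<le> norm (y - x)" using s by (simp add: mult_left_le_one_le)
      finally have "norm (z + s *\<^sub>R (y - x) - x) < r"
        using z y(2) by (simp add: \<delta>_def dist_norm norm_minus_commute)
      then show "z + s *\<^sub>R (y - x) \<in> W" using r(2) by (auto simp: dist_norm norm_minus_commute)
    qed simp
    moreover have "\<delta> > 0" using \<rho>(1) r(1) by (simp add: \<delta>_def)
    ultimately show "x \<in> S" using xW by (auto simp: S_def)
  qed
  moreover have "x0 \<in> S" using x0 by (auto simp: S_def)
  ultimately have "S = W" using W(2) unfolding connected_clopen by blast
  then show ?thesis using x by (auto simp: S_def)
qed

text \<open>In a boundary chart the domain lies above a graph. Translation along the axis of the chart pushes
  the part near the boundary into a compact subset of the domain, without leaving the domain.\<close>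

lemma controlled_boundary_point:
  assumes W: "open W" "lipschitz_boundary W" and K: "\<And>K. compact K \<Longrightarrow> K \<subseteq> W \<Longrightarrow> controlled W B K"
    and x: "x \<in> frontier W"
  shows "\<exists>\<rho>>0. controlled W B (W \<inter> ball x \<rho>)"
proof -
  obtain r n L and g :: "'a \<Rightarrow> real" where r: "r > 0" "norm n = 1" "L-lipschitz_on {z. z \<bullet> n = 0} g"
    "W \<inter> ball x r = {y \<in> ball x r. g (y - (y \<bullet> n) *\<^sub>R n) < y \<bullet> n}"
    using W(2) x unfolding lipschitz_boundary_def by blast
  have nn: "n \<bullet> n = 1" using r(2) by (simp add: norm_eq_1)
  define t where "t = r / 4"
  have t: "t > 0" using r by (simp add: t_def)
  \<comment> \<open>the points at height at least \<open>t\<close> above the graph; a translation by \<open>t\<close> lands here, and the radii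
    \<open>t = r / 4\<close> and \<open>2 t\<close> keep everything inside the chart\<close>
  define K where "K = cball x (r / 2) \<inter> {y. g (y - (y \<bullet> n) *\<^sub>R n) + t \<le> y \<bullet> n}"
  have cont: "continuous_on UNIV (\<lambda>y. g (y - (y \<bullet> n) *\<^sub>R n))"
    by (rule continuous_on_compose2[OF lipschitz_on_continuous_on[OF r(3)]])
       (auto intro!: continuous_intros simp: inner_diff_left nn)
  have "closed {y. g (y - (y \<bullet> n) *\<^sub>R n) + t \<le> y \<bullet> n}"
    by (intro closed_Collect_le continuous_intros cont)
  then have "compact K" unfolding K_def by (intro compact_Int_closed) auto
  moreover have "K \<subseteq> W"
  proof
    fix y assume "y \<in> K"
    then have "y \<in> {y \<in> ball x r. g (y - (y \<bullet> n) *\<^sub>R n) < y \<bullet> n}" using r(1) t by (auto simp: K_def)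
    then show "y \<in> W" using r(4) by blast
  qed
  ultimately have cK: "controlled W B K" by (rule K)
  have "controlled W B (W \<inter> ball x t)"
  proof (rule controlled_shift[OF cK, where v="t *\<^sub>R n"])
    show "W \<inter> ball x t \<in> sets borel" "W \<in> sets borel" using W(1) by auto
    fix y assume y: "y \<in> W \<inter> ball x t"
    moreover have "t \<le> r" using r(1) by (simp add: t_def)
    ultimately have "y \<in> W \<inter> ball x r" by auto
    then have gy: "g (y - (y \<bullet> n) *\<^sub>R n) < y \<bullet> n" using r(4) by blast
    have proj: "(y + c *\<^sub>R n) - ((y + c *\<^sub>R n) \<bullet> n) *\<^sub>R n = y - (y \<bullet> n) *\<^sub>R n" for c
      by (simp add: inner_add_left nn algebra_simps)
    have dist: "dist x (y + c *\<^sub>R n) < 2 * t" if "0 \<le> c" "c \<le> t" for c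
    proof -
      have "dist x (y + c *\<^sub>R n) \<le> dist x y + norm (c *\<^sub>R n)"
        by (metis dist_triangle dist_add_cancel add.right_neutral dist_0_norm)
      then show ?thesis using y that r(2) by auto
    qed
    show "y + t *\<^sub>R n \<in> K"
      unfolding K_def Int_iff mem_Collect_eq proj
      using gy dist[of t] t by (auto simp: inner_add_left nn t_def)
    fix s :: real assume s: "0 \<le> s" "s \<le> 1"
    have st: "0 \<le> s * t" "s * t \<le> t" using s t by (auto simp: mult_left_le_one_le)
    have "y + (s * t) *\<^sub>R n \<in> {y \<in> ball x r. g (y - (y \<bullet> n) *\<^sub>R n) < y \<bullet> n}"
      unfolding mem_Collect_eq proj using gy dist[OF st] st t by (auto simp: inner_add_left nn t_def)
    then show "y + s *\<^sub>R t *\<^sub>R n \<in> W" using r(4) by auto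
  qed
  then show ?thesis using t by blast
qed

text \<open>Finitely many small balls cover the closure of the domain, and each of them meets the domain in a
  controlled set.\<close>

theorem poincare_from_ball:
  assumes W: "regular_domain W" and B: "ball x0 \<rho>0 \<subseteq> W" "\<rho>0 > 0"
  obtains C where "C \<ge> 0" "\<And>f. smooth f \<Longrightarrow> sq_int f W \<le> ennreal C * (sq_int f (ball x0 \<rho>0) + sq_int (grad f) W)"
proof -
  have W': "open W" "bounded W" "connected W" "lipschitz_boundary W" using W by (auto simp: regular_domain_def)
  let ?B = "ball x0 \<rho>0"
  have x0: "x0 \<in> W" using B by auto
  have int: "\<exists>\<rho>>0. controlled W ?B (ball x \<rho>)" if "x \<in> W" for x
    by (rule controlled_interior_point[OF W'(1,3) x0 B(2) controlled_refl that]) simp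
  have cpt: "controlled W ?B K" if K: "compact K" "K \<subseteq> W" for K
  proof -
    obtain \<rho> where \<rho>: "\<And>x. x \<in> K \<Longrightarrow> \<rho> x > 0 \<and> controlled W ?B (ball x (\<rho> x))"
      using int K(2) by (metis subsetD)
    obtain D where D: "D \<subseteq> K" "finite D" "K \<subseteq> (\<Union>x\<in>D. ball x (\<rho> x))"
    proof (rule compactE_image[OF K(1), of K "\<lambda>x. ball x (\<rho> x)"])
      show "K \<subseteq> (\<Union>x\<in>K. ball x (\<rho> x))" using \<rho> by force
    qed auto
    have "controlled W ?B (\<Union>x\<in>D. ball x (\<rho> x))" using D \<rho> by (intro controlled_UN) auto
    then show ?thesis using controlled_subset[OF _ D(3)] K(1) by (simp add: compact_imp_closed)
  qed
  have "\<exists>\<rho>>0. controlled W ?B (W \<inter> ball x \<rho>)" if "x \<in> closure W" for x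
  proof (cases "x \<in> W")
    case True
    then obtain \<rho> where "\<rho> > 0" "controlled W ?B (ball x \<rho>)" using int by blast
    then show ?thesis using controlled_subset[of W ?B "ball x \<rho>" "W \<inter> ball x \<rho>"] W'(1) by auto
  next
    case False
    then have "x \<in> frontier W" using that W'(1) by (simp add: frontier_def interior_open)
    then show ?thesis using controlled_boundary_point[OF W'(1,4) cpt] by blast
  qed
  then obtain \<rho> where \<rho>: "\<And>x. x \<in> closure W \<Longrightarrow> \<rho> x > 0 \<and> controlled W ?B (W \<inter> ball x (\<rho> x))" by metis
  have "compact (closure W)" using W'(2) by simp
  then obtain D where D: "D \<subseteq> closure W" "finite D" "closure W \<subseteq> (\<Union>x\<in>D. ball x (\<rho> x))"
  proof (rule compactE_image[of "closure W" "closure W" "\<lambda>x. ball x (\<rho> x)"])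
    show "closure W \<subseteq> (\<Union>x\<in>closure W. ball x (\<rho> x))" using \<rho> by force
  qed auto
  have "controlled W ?B (\<Union>x\<in>D. W \<inter> ball x (\<rho> x))" using D \<rho> by (intro controlled_UN) auto
  moreover have "W = (\<Union>x\<in>D. W \<inter> ball x (\<rho> x))" using D(3) closure_subset by auto
  ultimately have "controlled W ?B W" by simp
  then show thesis using that by (elim controlledE) auto
qed

section \<open>Null sets swept out by a piece of a Lipschitz graph\<close>

lemma cube_diameter_power_le:
  fixes c d :: "'a::euclidean_space"
  assumes "\<And>i. i \<in> Basis \<Longrightarrow> d \<bullet> i - c \<bullet> i = l" "l \<ge> 0"
  shows "ennreal (diameter (cbox c d) ^ DIM('a)) \<le> ennreal (real DIM('a) ^ DIM('a)) * emeasure lborel (cbox c d)"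
proof -
  have ne: "\<And>i. i \<in> Basis \<Longrightarrow> c \<bullet> i \<le> d \<bullet> i" using assms by (metis diff_ge_0_iff_ge)
  have "diameter (cbox c d) \<le> real DIM('a) * l"
  proof (rule diameter_le)
    show "cbox c d \<noteq> {} \<or> 0 \<le> real DIM('a) * l" using assms by simp
    fix x y assume xy: "x \<in> cbox c d" "y \<in> cbox c d"
    have "norm (x - y) \<le> (\<Sum>b\<in>Basis. \<bar>(x - y) \<bullet> b\<bar>)" by (rule norm_le_l1)
    also have "\<dots> \<le> (\<Sum>b\<in>(Basis::'a set). l)"
    proof (rule sum_mono)
      fix b :: 'a assume b: "b \<in> Basis"
      show "\<bar>(x - y) \<bullet> b\<bar> \<le> l"
        using xy b assms(1)[OF b] by (auto simp: mem_box inner_diff_left abs_le_iff dest!: bspec[OF _ b])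
    qed
    finally show "norm (x - y) \<le> real DIM('a) * l" by simp
  qed
  then have "diameter (cbox c d) ^ DIM('a) \<le> (real DIM('a) * l) ^ DIM('a)"
    by (intro power_mono diameter_ge_0 bounded_cbox)
  also have "\<dots> = real DIM('a) ^ DIM('a) * l ^ DIM('a)" by (simp add: power_mult_distrib)
  finally have "ennreal (diameter (cbox c d) ^ DIM('a)) \<le> ennreal (real DIM('a) ^ DIM('a)) * ennreal (l ^ DIM('a))"
    by (simp add: ennreal_mult'[symmetric] ennreal_leI)
  moreover have "emeasure lborel (cbox c d) = ennreal (l ^ DIM('a))"
    using ne assms by (simp add: emeasure_lborel_cbox inner_diff_left)
  ultimately show ?thesis by simp
qed

text \<open>Outer regularity provides dyadic cubes with disjoint interiors and small total volume, and the
  diameter of a cube to the power of the dimension is comparable to its volume.\<close>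

lemma negligible_cube_cover:
  fixes D :: "'a::euclidean_space set"
  assumes D: "negligible D" "bounded D" and e: "e > 0"
  obtains Q :: "nat \<Rightarrow> 'a set" where "D \<subseteq> (\<Union>i. Q i)" "\<And>i. bounded (Q i)"
    "(\<Sum>i. ennreal (diameter (Q i) ^ DIM('a))) \<le> ennreal e"
proof -
  define M where "M = real DIM('a) ^ DIM('a)"
  have M: "M > 0" by (simp add: M_def)
  obtain R where R: "R > 0" "D \<subseteq> cbox (- (R *\<^sub>R One)) (R *\<^sub>R One)"
  proof -
    obtain r where r: "\<And>x. x \<in> D \<Longrightarrow> norm x \<le> r" using D(2) bounded_iff by metis
    show thesis
    proof (rule that[of "max r 1"])
      show "D \<subseteq> cbox (- (max r 1 *\<^sub>R One)) (max r 1 *\<^sub>R One)"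
      proof
        fix x assume "x \<in> D"
        then have "norm x \<le> max r 1" using r by fastforce
        then have "\<bar>x \<bullet> i\<bar> \<le> max r 1" if "i \<in> Basis" for i
          using Basis_le_norm[OF that] order_trans by blast
        then show "x \<in> cbox (- (max r 1 *\<^sub>R One)) (max r 1 *\<^sub>R One)"
          by (simp add: mem_box abs_le_iff) (metis minus_le_iff)
      qed
    qed auto
  qed
  let ?a = "- (R *\<^sub>R One) :: 'a" and ?b = "R *\<^sub>R One :: 'a"
  have bne: "box ?a ?b \<noteq> {}" using R(1) by (simp add: box_ne_empty)
  have Dm: "D \<in> lmeasurable" "measure lebesgue D = 0"
    using D(1) by (auto simp: negligible_iff_measure)
  obtain \<D> where \<D>: "countable \<D>" "\<And>K. K \<in> \<D> \<Longrightarrow> K \<noteq> {} \<and> (\<exists>c d. K = cbox c d)"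
    "pairwise (\<lambda>A B. interior A \<inter> interior B = {}) \<D>"
    "\<And>u v. cbox u v \<in> \<D> \<Longrightarrow> \<exists>n. \<forall>i \<in> Basis. v \<bullet> i - u \<bullet> i = (?b \<bullet> i - ?a \<bullet> i)/2^n"
    "D \<subseteq> \<Union>\<D>" "\<Union>\<D> \<in> lmeasurable" "measure lebesgue (\<Union>\<D>) \<le> measure lebesgue D + e / M"
    using measurable_outer_intervals_bounded[OF Dm(1) R(2), of "e / M"] e M by (metis divide_pos_pos)
  \<comment> \<open>the countable family as a sequence, padded with empty sets\<close>
  define Q where "Q i = (if i \<in> to_nat_on \<D> ` \<D> then from_nat_into \<D> i else {})" for i
  have QD: "Q (to_nat_on \<D> K) = K" if "K \<in> \<D>" for K using that \<D>(1) by (simp add: Q_def)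
  have Qin: "Q i \<in> \<D> \<and> to_nat_on \<D> (Q i) = i" if "Q i \<noteq> {}" for i
  proof -
    from that obtain K where "K \<in> \<D>" "i = to_nat_on \<D> K" by (auto simp: Q_def split: if_splits)
    then show ?thesis using QD by simp
  qed
  have Qc: "Q i = {} \<or> (\<exists>c d l. Q i = cbox c d \<and> l \<ge> 0 \<and> (\<forall>i\<in>Basis. d \<bullet> i - c \<bullet> i = l))" for i
  proof (cases "Q i = {}")
    case False
    then obtain c d where cd: "Q i = cbox c d" "cbox c d \<in> \<D>" using Qin \<D>(2) by metis
    obtain n where "\<forall>i \<in> Basis. d \<bullet> i - c \<bullet> i = (?b \<bullet> i - ?a \<bullet> i)/2^n" using \<D>(4)[OF cd(2)] by blast
    then have "\<forall>i\<in>Basis. d \<bullet> i - c \<bullet> i = 2 * R / 2 ^ n" by simp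
    then show ?thesis using cd(1) R(1) by (intro disjI2 exI[of _ c] exI[of _ d] exI[of _ "2 * R / 2 ^ n"]) simp
  qed simp
  have dis: "disjoint_family (\<lambda>i. interior (Q i))"
    unfolding disjoint_family_on_def
  proof (intro ballI impI)
    fix i j :: nat assume "i \<noteq> j"
    show "interior (Q i) \<inter> interior (Q j) = {}"
    proof (cases "Q i = {} \<or> Q j = {}")
      case False
      then have "Q i \<in> \<D>" "Q j \<in> \<D>" "Q i \<noteq> Q j" using Qin[of i] Qin[of j] \<open>i \<noteq> j\<close> by auto
      then show ?thesis using pairwiseD[OF \<D>(3)] by blast
    qed auto
  qed
  have "(\<Sum>i. ennreal (diameter (Q i) ^ DIM('a))) \<le> (\<Sum>i. ennreal M * emeasure lebesgue (interior (Q i)))"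
  proof (rule suminf_le)
    fix i
    show "ennreal (diameter (Q i) ^ DIM('a)) \<le> ennreal M * emeasure lebesgue (interior (Q i))"
      using Qc[of i]
    proof (elim disjE exE conjE)
      fix c d l assume *: "Q i = cbox c d" "l \<ge> 0" "\<forall>i\<in>Basis. d \<bullet> i - c \<bullet> i = l"
      have "emeasure lebesgue (interior (Q i)) = emeasure lborel (cbox c d)"
        unfolding * by (simp add: emeasure_lborel_box_eq emeasure_lborel_cbox_eq)
      then show ?thesis using cube_diameter_power_le[of d c l] * by (simp add: M_def)
    qed (simp add: zero_power)
  qed auto
  also have "\<dots> = ennreal M * (\<Sum>i. emeasure lebesgue (interior (Q i)))" by simp
  finally have sum_le: "(\<Sum>i. ennreal (diameter (Q i) ^ DIM('a)))
      \<le> ennreal M * (\<Sum>i. emeasure lebesgue (interior (Q i)))" .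
  have "(\<Sum>i. emeasure lebesgue (interior (Q i))) = emeasure lebesgue (\<Union>i. interior (Q i))"
    by (rule suminf_emeasure[OF _ dis]) auto
  also have "\<dots> \<le> emeasure lebesgue (\<Union>\<D>)"
  proof (rule emeasure_mono)
    show "(\<Union>i. interior (Q i)) \<subseteq> \<Union>\<D>" using Qin interior_subset by fastforce
    show "\<Union>\<D> \<in> sets lebesgue" using \<D>(6) by auto
  qed
  also have "emeasure lebesgue (\<Union>\<D>) = ennreal (measure lebesgue (\<Union>\<D>))"
    using \<D>(6) by (simp add: emeasure_eq_measure2)
  also have "\<dots> \<le> ennreal (e / M)" using \<D>(7) Dm by (intro ennreal_leI) simp
  finally have "(\<Sum>i. ennreal (diameter (Q i) ^ DIM('a))) \<le> ennreal M * ennreal (e / M)"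
    using order_trans[OF sum_le mult_left_mono] by simp
  also have "ennreal M * ennreal (e / M) = ennreal e" using M e by (simp add: ennreal_mult[symmetric])
  finally have "(\<Sum>i. ennreal (diameter (Q i) ^ DIM('a))) \<le> ennreal e" .
  moreover have "D \<subseteq> (\<Union>i. Q i)"
  proof
    fix x assume "x \<in> D"
    then obtain K where "K \<in> \<D>" "x \<in> K" using \<D>(5) by blast
    then show "x \<in> (\<Union>i. Q i)" using QD[of K] by (metis UN_I UNIV_I)
  qed
  moreover have "bounded (Q i)" for i using Qc[of i] by auto
  ultimately show thesis using that by blast
qed

lemma diameter_translation: "diameter ((+) a ` S) = diameter (S :: 'a::real_normed_vector set)"
proof -
  have "(\<lambda>(x, y). dist x y) ` (((+) a ` S) \<times> ((+) a ` S)) = (\<lambda>(x, y). dist x y) ` (S \<times> S)"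
    by (force simp: image_iff)
  then show ?thesis by (simp add: diameter_def)
qed

text \<open>Cover the swept set by cubes with \<open>\<Sum> diam^d\<close> small. The height \<open>\<phi>\<close> above the graph is Lipschitz, so a
  cube of diameter \<open>a\<close> meets the slice at height \<open>t\<close> only for \<open>t\<close> in an interval of length
  proportional to \<open>a\<close>. Averaging over \<open>t\<close> therefore finds one slice that is covered by the
  cubes meeting it with \<open>\<Sum> diam^(d - 1)\<close> small, and this slice is a translate of \<open>E\<close>.\<close>

lemma hausdorff_content_zero_of_sweep:
  fixes E :: "'a::euclidean_space set" and g :: "'a \<Rightarrow> real"
  assumes n: "norm n = 1" and g: "L-lipschitz_on {z. z \<bullet> n = 0} g"
    and E: "\<And>z. z \<in> E \<Longrightarrow> z \<bullet> n = g (z - (z \<bullet> n) *\<^sub>R n)" "bounded E"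
    and \<tau>: "\<tau> > 0" and neg: "negligible {z + t *\<^sub>R n |z t. z \<in> E \<and> 0 < t \<and> t < \<tau>}"
    and \<delta>: "\<delta> > 0"
  shows "hausdorff_content (DIM('a) - 1) \<delta> E = 0"
proof -
  let ?k = "DIM('a) - 1"
  have DIM: "DIM('a) = Suc ?k" by simp
  define D where "D = {z + t *\<^sub>R n |z t. z \<in> E \<and> 0 < t \<and> t < \<tau>}"
  have nn: "n \<bullet> n = 1" using n by (simp add: norm_eq_1)
  \<comment> \<open>height above the graph; its level sets are the translates of the graph\<close>
  define \<phi> where "\<phi> y = y \<bullet> n - g (y - (y \<bullet> n) *\<^sub>R n)" for y
  define \<Lambda> where "\<Lambda> = 1 + 2 * L"
  have L: "L \<ge> 0" using g lipschitz_on_nonneg by blast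
  have \<phi>_lip: "\<bar>\<phi> x - \<phi> y\<bar> \<le> \<Lambda> * dist x y" for x y
  proof -
    let ?P = "\<lambda>y. y - (y \<bullet> n) *\<^sub>R n"
    have 1: "\<bar>x \<bullet> n - y \<bullet> n\<bar> \<le> dist x y"
      using Cauchy_Schwarz_ineq2[of "x - y" n] n by (simp add: inner_diff_left dist_norm)
    have "dist (g (?P x)) (g (?P y)) \<le> L * dist (?P x) (?P y)"
      by (rule lipschitz_onD[OF g]) (auto simp: inner_diff_left nn)
    also have "dist (?P x) (?P y) = norm ((x - y) - ((x \<bullet> n) - (y \<bullet> n)) *\<^sub>R n)"
      by (simp add: dist_norm algebra_simps)
    also have "\<dots> \<le> norm (x - y) + norm (((x \<bullet> n) - (y \<bullet> n)) *\<^sub>R n)" by (rule norm_triangle_ineq4)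
    also have "\<dots> \<le> 2 * dist x y" using 1 n by (simp add: dist_norm)
    finally have "\<bar>g (?P x) - g (?P y)\<bar> \<le> L * (2 * dist x y)"
      using L by (simp add: dist_real_def mult_left_mono)
    then show ?thesis using 1 by (simp add: \<phi>_def \<Lambda>_def algebra_simps abs_le_iff)
  qed
  have \<phi>_sweep: "\<phi> (z + t *\<^sub>R n) = t" if "z \<in> E" for z t
  proof -
    have "(z + t *\<^sub>R n) - ((z + t *\<^sub>R n) \<bullet> n) *\<^sub>R n = z - (z \<bullet> n) *\<^sub>R n"
      by (simp add: inner_add_left nn algebra_simps)
    then show ?thesis using E(1)[OF that] unfolding \<phi>_def by (simp only:) (simp add: inner_add_left nn)
  qed
  have bD: "bounded D"
  proof -
    obtain R where R: "\<And>z. z \<in> E \<Longrightarrow> norm z \<le> R" using E(2) bounded_iff by metis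
    have "norm y \<le> R + \<tau>" if "y \<in> D" for y
    proof -
      obtain z t where "y = z + t *\<^sub>R n" "z \<in> E" "0 < t" "t < \<tau>" using \<open>y \<in> D\<close> by (auto simp: D_def)
      then show ?thesis using R[of z] n norm_triangle_ineq[of z "t *\<^sub>R n"] by simp
    qed
    then show ?thesis using bounded_iff by blast
  qed
  define c where "c = unit_ball_vol (real ?k) / 2 ^ ?k"
  have c: "c \<ge> 0" by (simp add: c_def)
  have \<Lambda>: "\<Lambda> \<ge> 1" using L by (simp add: \<Lambda>_def)
  have main: "hausdorff_content ?k \<delta> E \<le> ennreal (c * (3 * \<Lambda> * e / \<tau>))"
    if e: "e > 0" "e \<le> \<delta> ^ DIM('a)" for e
  proof -
    obtain Q where Q: "D \<subseteq> (\<Union>i. Q i)" "\<And>i. bounded (Q i)"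
      "(\<Sum>i. ennreal (diameter (Q i) ^ DIM('a))) \<le> ennreal e"
      using negligible_cube_cover[OF neg[folded D_def] bD e(1)] by metis
    have dpos: "0 \<le> diameter (Q i)" for i using Q(2) by (rule diameter_ge_0)
    have diam: "diameter (Q i) \<le> \<delta>" for i
    proof -
      have "ennreal (diameter (Q i) ^ DIM('a)) \<le> (\<Sum>i. ennreal (diameter (Q i) ^ DIM('a)))"
        using sum_le_suminf[of "\<lambda>i. ennreal (diameter (Q i) ^ DIM('a))" "{i}"] by simp
      then have "ennreal (diameter (Q i) ^ DIM('a)) \<le> ennreal (\<delta> ^ DIM('a))"
        using Q(3) e(2) by (meson ennreal_leI order_trans)
      then have "diameter (Q i) ^ DIM('a) \<le> \<delta> ^ DIM('a)" using \<delta> by simp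
      then show ?thesis using power_le_imp_le_base[of "diameter (Q i)" ?k \<delta>] \<delta> by simp
    qed
    define p where "p i = (SOME y. y \<in> Q i)" for i
    \<comment> \<open>an interval that contains all heights in \<open>Q i\<close>\<close>
    define J where "J i = {\<phi> (p i) - \<Lambda> * diameter (Q i) .. \<phi> (p i) + \<Lambda> * diameter (Q i)}" for i
    have J: "\<phi> y \<in> J i" if "y \<in> Q i" for y i
    proof -
      have "p i \<in> Q i" using that unfolding p_def by (rule someI)
      then have "dist y (p i) \<le> diameter (Q i)" using that by (intro diameter_bounded_bound Q)
      then have "\<bar>\<phi> y - \<phi> (p i)\<bar> \<le> \<Lambda> * diameter (Q i)"
        using \<phi>_lip[of y "p i"] \<Lambda> mult_left_mono[of "dist y (p i)" "diameter (Q i)" \<Lambda>] by linarith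
      then show ?thesis by (auto simp: J_def abs_le_iff)
    qed
    \<comment> \<open>an upper bound for the cost of covering the slice at height \<open>t\<close>\<close>
    define G where "G t = (\<Sum>i. ennreal (diameter (Q i) ^ ?k) * indicator (J i) t)" for t
    have [measurable]: "J i \<in> sets borel" for i by (simp add: J_def)
    have G_int: "(\<integral>\<^sup>+t\<in>{0<..<\<tau>}. G t \<partial>lborel) \<le> ennreal (2 * \<Lambda> * e)"
    proof -
      have "(\<integral>\<^sup>+t\<in>{0<..<\<tau>}. G t \<partial>lborel) \<le> (\<integral>\<^sup>+t. G t \<partial>lborel)"
        by (intro nn_integral_mono) (auto simp: indicator_def)
      also have "\<dots> = (\<Sum>i. \<integral>\<^sup>+t. ennreal (diameter (Q i) ^ ?k) * indicator (J i) t \<partial>lborel)"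
        unfolding G_def by (rule nn_integral_suminf) measurable
      also have "\<dots> = (\<Sum>i. ennreal (2 * \<Lambda>) * ennreal (diameter (Q i) ^ DIM('a)))"
      proof (intro suminf_cong)
        fix i
        have "0 \<le> \<Lambda> * diameter (Q i)" using \<Lambda> dpos[of i] by simp
        then have "emeasure lborel (J i) = ennreal (2 * \<Lambda> * diameter (Q i))"
          unfolding J_def by (subst emeasure_lborel_Icc) (auto simp: algebra_simps)
        then have "(\<integral>\<^sup>+t. ennreal (diameter (Q i) ^ ?k) * indicator (J i) t \<partial>lborel)
            = ennreal (diameter (Q i) ^ ?k) * ennreal (2 * \<Lambda> * diameter (Q i))"
          by (simp add: nn_integral_cmult)
        also have "\<dots> = ennreal (2 * \<Lambda> * diameter (Q i) ^ Suc ?k)"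
        proof -
          have "diameter (Q i) ^ ?k * (2 * \<Lambda> * diameter (Q i)) = 2 * \<Lambda> * diameter (Q i) ^ Suc ?k"
            by (simp only: power_Suc mult_ac)
          then show ?thesis using \<Lambda> dpos[of i] by (subst ennreal_mult[symmetric]) simp_all
        qed
        also have "\<dots> = ennreal (2 * \<Lambda>) * ennreal (diameter (Q i) ^ DIM('a))"
        proof -
          have pw: "diameter (Q i) ^ Suc ?k = diameter (Q i) ^ DIM('a)" by (simp only: DIM[symmetric])
          have "ennreal (2 * \<Lambda> * diameter (Q i) ^ DIM('a)) = ennreal (2 * \<Lambda>) * ennreal (diameter (Q i) ^ DIM('a))"
            using \<Lambda> dpos[of i] by (simp add: ennreal_mult)
          then show ?thesis by (simp only: pw)
        qed
        finally show "(\<integral>\<^sup>+t. ennreal (diameter (Q i) ^ ?k) * indicator (J i) t \<partial>lborel)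
            = ennreal (2 * \<Lambda>) * ennreal (diameter (Q i) ^ DIM('a))" .
      qed
      also have "\<dots> = ennreal (2 * \<Lambda>) * (\<Sum>i. ennreal (diameter (Q i) ^ DIM('a)))" by simp
      also have "\<dots> \<le> ennreal (2 * \<Lambda>) * ennreal e" by (intro mult_left_mono Q) simp
      also have "\<dots> = ennreal (2 * \<Lambda> * e)" using \<Lambda> e by (simp add: ennreal_mult[symmetric])
      finally show ?thesis .
    qed
    have "\<exists>t\<in>{0<..<\<tau>}. G t \<le> ennreal (3 * \<Lambda> * e / \<tau>)"
    proof (rule ccontr)
      assume "\<not> ?thesis"
      then have "ennreal (3 * \<Lambda> * e / \<tau>) * indicator {0<..<\<tau>} t \<le> G t * indicator {0<..<\<tau>} t" for t
        by (cases "t \<in> {0<..<\<tau>}") (auto simp: not_le less_imp_le)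
      then have "(\<integral>\<^sup>+t. ennreal (3 * \<Lambda> * e / \<tau>) * indicator {0<..<\<tau>} t \<partial>lborel) \<le> (\<integral>\<^sup>+t\<in>{0<..<\<tau>}. G t \<partial>lborel)"
        by (intro nn_integral_mono)
      also have "(\<integral>\<^sup>+t. ennreal (3 * \<Lambda> * e / \<tau>) * indicator {0<..<\<tau>} t \<partial>lborel) = ennreal (3 * \<Lambda> * e)"
        using \<tau> \<Lambda> e by (simp add: nn_integral_cmult ennreal_mult[symmetric])
      finally have "ennreal (3 * \<Lambda> * e) \<le> ennreal (2 * \<Lambda> * e)" using G_int by (rule order_trans)
      then show False using \<Lambda> e by simp
    qed
    then obtain t where t: "0 < t" "t < \<tau>" "G t \<le> ennreal (3 * \<Lambda> * e / \<tau>)" by auto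
    \<comment> \<open>only the cubes that meet the slice are kept, translated back to \<open>E\<close>\<close>
    define C where "C i = (if \<exists>z\<in>E. z + t *\<^sub>R n \<in> Q i then (+) (- t *\<^sub>R n) ` Q i else {})" for i
    have "hausdorff_content ?k \<delta> E \<le> (\<Sum>i. hausdorff_cost ?k (C i))"
      unfolding hausdorff_content_def
    proof (rule INF_lower, intro CollectI conjI allI subsetI)
      fix z assume z: "z \<in> E"
      then have "z + t *\<^sub>R n \<in> D" using t by (auto simp: D_def)
      then obtain i where i: "z + t *\<^sub>R n \<in> Q i" using Q(1) by auto
      then have "z \<in> C i" using z unfolding C_def by (auto intro!: image_eqI[of _ _ "z + t *\<^sub>R n"])
      then show "z \<in> (\<Union>i. C i)" by blast
    next
      fix i show "bounded (C i)"
        by (cases "\<exists>z\<in>E. z + t *\<^sub>R n \<in> Q i")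
           (simp_all only: C_def if_True if_False bounded_translation[OF Q(2)] bounded_empty)
      show "diameter (C i) \<le> \<delta>" using diam[of i] \<delta>
        by (cases "\<exists>z\<in>E. z + t *\<^sub>R n \<in> Q i")
           (simp_all only: C_def if_True if_False diameter_translation diameter_empty less_imp_le)
    qed
    also have "\<dots> \<le> (\<Sum>i. ennreal c * (ennreal (diameter (Q i) ^ ?k) * indicator (J i) t))"
    proof (rule suminf_le)
      fix i
      show "hausdorff_cost ?k (C i) \<le> ennreal c * (ennreal (diameter (Q i) ^ ?k) * indicator (J i) t)"
      proof (cases "\<exists>z\<in>E. z + t *\<^sub>R n \<in> Q i")
        case True
        then obtain z where z: "z \<in> E" "z + t *\<^sub>R n \<in> Q i" by blast
        have "t \<in> J i" using J[OF z(2)] \<phi>_sweep[OF z(1)] by simp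
        moreover have "C i = (+) (- t *\<^sub>R n) ` Q i" using True by (simp only: C_def if_True)
        moreover have "Q i \<noteq> {}" using z(2) by blast
        ultimately show ?thesis using c dpos[of i]
          by (simp only: hausdorff_cost_def diameter_translation) (simp add: c_def ennreal_mult[symmetric])
      qed (simp add: C_def hausdorff_cost_def)
    qed auto
    also have "\<dots> = ennreal c * G t" unfolding G_def by simp
    also have "\<dots> \<le> ennreal c * ennreal (3 * \<Lambda> * e / \<tau>)" by (intro mult_left_mono t) simp
    also have "\<dots> = ennreal (c * (3 * \<Lambda> * e / \<tau>))" using c \<Lambda> e \<tau> by (simp add: ennreal_mult[symmetric])
    finally show ?thesis .
  qed
  have "hausdorff_content ?k \<delta> E \<le> ennreal \<eta>" if \<eta>: "\<eta> > 0" for \<eta>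
  proof -
    define e where "e = min (\<delta> ^ DIM('a)) (\<eta> * \<tau> / ((c + 1) * (3 * \<Lambda>)))"
    have "e > 0" using \<delta> \<eta> \<tau> \<Lambda> c by (auto simp: e_def)
    moreover have "e \<le> \<delta> ^ DIM('a)" by (simp add: e_def)
    moreover have "c * (3 * \<Lambda> * e / \<tau>) \<le> \<eta>"
    proof -
      have "e \<le> \<eta> * \<tau> / ((c + 1) * (3 * \<Lambda>))" by (simp add: e_def)
      then have "e * ((c + 1) * (3 * \<Lambda>)) \<le> \<eta> * \<tau>" using c \<Lambda> by (simp add: pos_le_divide_eq)
      moreover have "e * (c * (3 * \<Lambda>)) \<le> e * ((c + 1) * (3 * \<Lambda>))"
        using \<open>e > 0\<close> \<Lambda> by (intro mult_left_mono mult_right_mono) auto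
      ultimately have "c * (3 * \<Lambda> * e) \<le> \<eta> * \<tau>" by (simp add: mult_ac)
      then show ?thesis using \<tau> by (simp add: pos_divide_le_eq)
    qed
    ultimately show ?thesis using main[of e] by (meson ennreal_leI order_trans)
  qed
  then show ?thesis
    by (metis ennreal_0 ennreal_le_epsilon le_zero_eq add_0 ennreal_zero_less_top)
qed

lemma hausdorff_outer_zero_of_sweep:
  fixes E :: "'a::euclidean_space set" and g :: "'a \<Rightarrow> real"
  assumes "norm n = 1" "L-lipschitz_on {z. z \<bullet> n = 0} g"
    "\<And>z. z \<in> E \<Longrightarrow> z \<bullet> n = g (z - (z \<bullet> n) *\<^sub>R n)" "bounded E"
    "\<tau> > 0" "negligible {z + t *\<^sub>R n |z t. z \<in> E \<and> 0 < t \<and> t < \<tau>}"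
  shows "hausdorff_outer (DIM('a) - 1) E = 0"
  unfolding hausdorff_outer_def
  using hausdorff_content_zero_of_sweep[OF assms] by (simp add: SUP_constant)

section \<open>Deviation from constants on a ball\<close>

text \<open>The double integral of \<open>(f x - f y)\<^sup>2\<close> over the ball is, after the substitution \<open>x = u + y\<close>, a
  superposition of the shift differences bounded above. Hence some \<open>y\<close> makes the integral over \<open>x\<close>
  no larger than average, and \<open>- f y\<close> is the constant sought. With the slack \<open>\<eta>\<close>, the contrary
  assumption contradicts the bound on the average at once.\<close>

lemma wirtinger_ball:
  fixes x0 :: "'a::euclidean_space"
  assumes \<rho>: "\<rho> > 0" and W: "ball x0 \<rho> \<subseteq> W" "W \<in> sets borel"
  obtains K where "K \<ge> 0" "\<And>f \<eta>. smooth f \<Longrightarrow> \<eta> > 0 \<Longrightarrow> sq_int (grad f) W < \<infinity> \<Longrightarrow>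
     \<exists>c. sq_int (\<lambda>x. f x + c) (ball x0 \<rho>) \<le> ennreal K * sq_int (grad f) W + ennreal \<eta>"
proof -
  define B where "B = ball x0 \<rho>"
  define b where "b = measure lborel B"
  have Bm[measurable]: "B \<in> sets borel" by (simp add: B_def)
  have eB: "emeasure lborel B = ennreal b"
    using emeasure_lborel_ball_finite[of x0 \<rho>]
    unfolding b_def B_def by (intro emeasure_eq_ennreal_measure) auto
  have b: "b > 0"
    using content_ball_pos[OF \<rho>, of x0] by (simp add: b_def B_def)
  define V where "V = ball (0::'a) (2 * \<rho>)"
  define v where "v = measure lborel V"
  have [measurable]: "V \<in> sets borel" by (simp add: V_def)
  have eV: "emeasure lborel V = ennreal v"
    using emeasure_lborel_ball_finite[of "0::'a" "2 * \<rho>"]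
    unfolding v_def V_def by (intro emeasure_eq_ennreal_measure) auto
  have v: "v \<ge> 0" by (simp add: v_def)
  \<comment> \<open>differences \<open>u\<close> of points of the ball lie in \<open>V\<close> and have norm below \<open>2 \<rho>\<close>\<close>
  define K where "K = (2 * \<rho>)\<^sup>2 * v / b"
  have K: "K \<ge> 0" using v b by (simp add: K_def)
  show thesis
  proof (rule that[OF K])
    fix f :: "'a \<Rightarrow> real" and \<eta> :: real
    assume f: "smooth f" and \<eta>: "\<eta> > 0" and fin: "sq_int (grad f) W < \<infinity>"
    have [measurable]: "f \<in> borel_measurable borel"
      by (auto intro!: borel_measurable_continuous_onI smooth_continuous f)
    define G where "G = enn2real (sq_int (grad f) W)"
    have G: "sq_int (grad f) W = ennreal G" "G \<ge> 0" using fin by (auto simp: G_def)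
    define h where "h y = (\<integral>\<^sup>+x. ennreal ((f x - f y)\<^sup>2) * indicator B x \<partial>lborel)" for y
    have [measurable]: "h \<in> borel_measurable borel" unfolding h_def by measurable
    have "(\<integral>\<^sup>+y. h y * indicator B y \<partial>lborel)
        = (\<integral>\<^sup>+y. (\<integral>\<^sup>+u. ennreal ((f (u + y) - f y)\<^sup>2) * indicator B (u + y) \<partial>lborel) * indicator B y \<partial>lborel)"
      unfolding h_def by (intro nn_integral_cong arg_cong2[where f="(*)"] refl nn_integral_lborel_translate[symmetric]) measurable
    also have "\<dots> = (\<integral>\<^sup>+y. (\<integral>\<^sup>+u. ennreal ((f (u + y) - f y)\<^sup>2) * indicator B (u + y) * indicator B y \<partial>lborel) \<partial>lborel)"
      by (intro nn_integral_cong nn_integral_multc[symmetric]) measurable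
    also have "\<dots> = (\<integral>\<^sup>+u. (\<integral>\<^sup>+y. ennreal ((f (u + y) - f y)\<^sup>2) * indicator B (u + y) * indicator B y \<partial>lborel) \<partial>lborel)"
      by (rule lborel_pair.Fubini') measurable
    also have "\<dots> \<le> (\<integral>\<^sup>+u. ennreal ((2 * \<rho>)\<^sup>2 * G) * indicator V u \<partial>lborel)"
    proof (rule nn_integral_mono)
      fix u :: 'a
      define A where "A = {y \<in> B. u + y \<in> B}"
      have [measurable]: "A \<in> sets borel" unfolding A_def by measurable
      have eq: "(\<integral>\<^sup>+y. ennreal ((f (u + y) - f y)\<^sup>2) * indicator B (u + y) * indicator B y \<partial>lborel)
          = sq_int (\<lambda>y. f (y + u) - f y) A"
        unfolding sq_int_def by (intro nn_integral_cong) (auto simp: A_def indicator_def add.commute)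
      show "(\<integral>\<^sup>+y. ennreal ((f (u + y) - f y)\<^sup>2) * indicator B (u + y) * indicator B y \<partial>lborel)
          \<le> ennreal ((2 * \<rho>)\<^sup>2 * G) * indicator V u"
      proof (cases "A = {}")
        case True
        then show ?thesis unfolding eq by (simp add: sq_int_def)
      next
        case False
        then obtain y where y: "y \<in> B" "u + y \<in> B" by (auto simp: A_def)
        then have "norm u < 2 * \<rho>"
          using dist_triangle2[of y "u + y" x0] by (simp add: B_def dist_commute dist_norm)
        then have uV: "u \<in> V" "(norm u)\<^sup>2 \<le> (2 * \<rho>)\<^sup>2" using power_mono[of "norm u" "2 * \<rho>" 2] by (auto simp: V_def)
        have "sq_int (\<lambda>y. f (y + u) - f y) A \<le> ennreal ((norm u)\<^sup>2) * sq_int (grad f) W"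
        proof (rule sq_int_shift_diff[OF f _ W(2)])
          fix x s :: "'a" assume "x \<in> A"
          fix s :: real assume s: "0 \<le> s" "s \<le> 1"
          have "(1 - s) *\<^sub>R x + s *\<^sub>R (u + x) \<in> B"
            using \<open>x \<in> A\<close> s convex_ball[of x0 \<rho>] unfolding A_def B_def by (intro convexD) auto
          then show "x + s *\<^sub>R u \<in> W" using W(1) by (auto simp: B_def algebra_simps)
        qed simp
        also have "\<dots> \<le> ennreal ((2 * \<rho>)\<^sup>2) * ennreal G"
          unfolding G(1) using uV by (intro mult_right_mono ennreal_leI) auto
        finally show ?thesis unfolding eq using uV G(2) by (simp add: ennreal_mult)
      qed
    qed
    also have "\<dots> = ennreal ((2 * \<rho>)\<^sup>2 * G) * ennreal v" by (simp add: nn_integral_cmult eV)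
    also have "\<dots> = ennreal (K * G * b)" using G(2) v b by (simp add: K_def ennreal_mult[symmetric] mult_ac)
    finally have int_le: "(\<integral>\<^sup>+y. h y * indicator B y \<partial>lborel) \<le> ennreal (K * G * b)" .
    have "\<exists>y\<in>B. h y \<le> ennreal (K * G + \<eta>)"
    proof (rule ccontr)
      assume "\<not> ?thesis"
      then have "ennreal (K * G + \<eta>) * indicator B y \<le> h y * indicator B y" for y
        by (cases "y \<in> B") (auto simp: not_le less_imp_le)
      then have "(\<integral>\<^sup>+y. ennreal (K * G + \<eta>) * indicator B y \<partial>lborel) \<le> (\<integral>\<^sup>+y. h y * indicator B y \<partial>lborel)"
        by (intro nn_integral_mono)
      also have "(\<integral>\<^sup>+y. ennreal (K * G + \<eta>) * indicator B y \<partial>lborel) = ennreal ((K * G + \<eta>) * b)"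
        using K G(2) \<eta> b by (simp add: nn_integral_cmult eB ennreal_mult[symmetric] ennreal_plus[symmetric] del: ennreal_plus)
      finally have "ennreal ((K * G + \<eta>) * b) \<le> ennreal (K * G * b)" using int_le by (rule order_trans)
      then have "(K * G + \<eta>) * b \<le> K * G * b" using K G(2) b by simp
      then show False using mult_pos_pos[OF \<eta> b] by (simp add: distrib_right)
    qed
    then obtain y where "h y \<le> ennreal (K * G + \<eta>)" by blast
    then have "sq_int (\<lambda>x. f x + (- f y)) B \<le> ennreal K * sq_int (grad f) W + ennreal \<eta>"
      using K G(2) \<eta> unfolding G(1) by (simp add: sq_int_def h_def ennreal_mult ennreal_plus)
    then show "\<exists>c. sq_int (\<lambda>x. f x + c) (ball x0 \<rho>) \<le> ennreal K * sq_int (grad f) W + ennreal \<eta>"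
      unfolding B_def by blast
  qed
qed

lemma sq_int_finite:
  fixes f :: "'a::euclidean_space \<Rightarrow> 'b::euclidean_space"
  assumes "continuous_on UNIV f" "bounded W" shows "sq_int f W < \<infinity>"
proof -
  obtain M where M: "\<And>x. x \<in> closure W \<Longrightarrow> norm (f x) \<le> M"
    using compact_imp_bounded[OF compact_continuous_image[OF continuous_on_subset[OF assms(1)], of "closure W"]] assms(2)
    by (auto simp: bounded_iff)
  obtain R where R: "W \<subseteq> ball 0 R" using assms(2) bounded_subset_ballD by blast
  have "sq_int f W \<le> (\<integral>\<^sup>+x. ennreal (M\<^sup>2) * indicator (ball (0::'a) R) x \<partial>lborel)"
    unfolding sq_int_def
  proof (rule nn_integral_mono)
    fix x
    show "ennreal ((norm (f x))\<^sup>2) * indicator W x \<le> ennreal (M\<^sup>2) * indicator (ball 0 R) x"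
      using R M[of x] closure_subset[of W] by (auto simp: indicator_def intro!: ennreal_leI power_mono)
  qed
  also have "\<dots> < \<infinity>" using emeasure_lborel_ball_finite[of "0::'a" R]
    by (subst nn_integral_cmult_indicator) (auto simp: ennreal_mult_less_top)
  finally show ?thesis .
qed

lemma sq_int_cmult:
  fixes f :: "'a::euclidean_space \<Rightarrow> 'b::real_normed_vector"
  assumes [measurable]: "(\<lambda>x. norm (f x)) \<in> borel_measurable borel" "A \<in> sets borel"
  shows "sq_int (\<lambda>x. c *\<^sub>R f x) A = ennreal (c\<^sup>2) * sq_int f A"
  unfolding sq_int_def by (subst nn_integral_cmult[symmetric]) (auto simp: power_mult_distrib ennreal_mult mult.assoc)

text \<open>Geometric decay of the integrals makes the series of the functions finite almost everywhere, so
  that the terms converge without passing to a subsequence.\<close>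

lemma AE_tendsto_zero_of_summable:
  fixes f :: "nat \<Rightarrow> 'a \<Rightarrow> ennreal"
  assumes [measurable]: "\<And>n. f n \<in> borel_measurable M"
    and le: "\<And>n. (\<integral>\<^sup>+x. f n x \<partial>M) \<le> ennreal (C * (1/4) ^ n)" and C: "C \<ge> 0"
  shows "AE x in M. (\<lambda>n. f n x) \<longlonglongrightarrow> 0"
proof -
  have "(\<integral>\<^sup>+x. (\<Sum>n. f n x) \<partial>M) = (\<Sum>n. \<integral>\<^sup>+x. f n x \<partial>M)"
    by (rule nn_integral_suminf) measurable
  also have "\<dots> \<le> (\<Sum>n. ennreal (C * (1/4) ^ n))" by (intro suminf_le le) auto
  also have "\<dots> < \<infinity>"
    using C by (subst suminf_ennreal2) (auto intro!: summable_mult summable_geometric)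
  finally have "AE x in M. (\<Sum>n. f n x) \<noteq> \<infinity>"
    by (intro nn_integral_noteq_infinite) auto
  then show ?thesis
  proof eventually_elim
    case (elim x)
    have r: "f n x = ennreal (enn2real (f n x))" for n
    proof -
      have "f n x \<le> (\<Sum>n. f n x)" using sum_le_suminf[of "\<lambda>n. f n x" "{n}"] by simp
      then have "f n x < top" using elim by (metis infinity_ennreal_def le_less_trans top.not_eq_extremum)
      then show ?thesis by simp
    qed
    have "summable (\<lambda>n. enn2real (f n x))"
      using elim by (intro summable_suminf_not_top) (auto simp: r[symmetric])
    then have "(\<lambda>n. enn2real (f n x)) \<longlonglongrightarrow> 0" by (rule summable_LIMSEQ_zero)
    then have "(\<lambda>n. ennreal (enn2real (f n x))) \<longlonglongrightarrow> ennreal 0" by (intro tendsto_ennrealI)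
    then show ?case by (simp add: r[symmetric])
  qed
qed

lemma tendsto_zero_of_ennreal_square:
  fixes a :: "nat \<Rightarrow> real"
  assumes "(\<lambda>n. ennreal ((a n)\<^sup>2)) \<longlonglongrightarrow> 0" shows "a \<longlonglongrightarrow> 0"
proof -
  have "(\<lambda>n. enn2real (ennreal ((a n)\<^sup>2))) \<longlonglongrightarrow> enn2real 0"
    by (rule tendsto_enn2real) (use assms in auto)
  then have "(\<lambda>n. (a n)\<^sup>2) \<longlonglongrightarrow> 0" by simp
  then have "(\<lambda>n. sqrt ((a n)\<^sup>2)) \<longlonglongrightarrow> sqrt 0" by (rule tendsto_real_sqrt)
  then show ?thesis by (simp add: tendsto_rabs_zero_iff)
qed

section \<open>The Friedrichs inequality for smooth functions\<close>

text \<open>The boundary points near \<open>x\<close> lie on the graph itself: below the graph is the exterior, because the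
  set below it is open and misses the domain.\<close>

lemma boundary_chart:
  assumes W: "open W" "lipschitz_boundary W" and x: "x \<in> frontier W"
  obtains r n L g where "r > 0" "norm n = 1" "L-lipschitz_on {z. z \<bullet> n = 0} g"
    "\<And>z. z \<in> frontier W \<Longrightarrow> z \<in> ball x r \<Longrightarrow> z \<bullet> n = g (z - (z \<bullet> n) *\<^sub>R n)"
    "\<And>z t. z \<in> frontier W \<Longrightarrow> z \<in> ball x r \<Longrightarrow> 0 < t \<Longrightarrow> t < r \<Longrightarrow> z + t *\<^sub>R n \<in> W"
    "\<And>z t. z \<in> frontier W \<Longrightarrow> z \<in> ball x r \<Longrightarrow> 0 < t \<Longrightarrow> t < r \<Longrightarrow> z - t *\<^sub>R n \<notin> closure W"
proof -
  obtain R n L and g :: "'a \<Rightarrow> real" where R: "R > 0" "norm n = 1" "L-lipschitz_on {z. z \<bullet> n = 0} g"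
    "W \<inter> ball x R = {y \<in> ball x R. g (y - (y \<bullet> n) *\<^sub>R n) < y \<bullet> n}"
    using W(2) x unfolding lipschitz_boundary_def by blast
  have nn: "n \<bullet> n = 1" using R(2) by (simp add: norm_eq_1)
  let ?g = "\<lambda>y. g (y - (y \<bullet> n) *\<^sub>R n)"
  have cont: "continuous_on UNIV ?g"
    by (rule continuous_on_compose2[OF lipschitz_on_continuous_on[OF R(3)]])
       (auto intro!: continuous_intros simp: inner_diff_left nn)
  have Wiff: "y \<in> W \<longleftrightarrow> ?g y < y \<bullet> n" if "y \<in> ball x R" for y using R(4) that by blast
  have below: "y \<notin> closure W" if "y \<in> ball x R" "y \<bullet> n < ?g y" for y
  proof -
    have "open {y \<in> ball x R. y \<bullet> n < ?g y}"
    proof -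
      have "open {y. y \<bullet> n < ?g y}" by (intro open_Collect_less continuous_intros cont)
      moreover have "{y \<in> ball x R. y \<bullet> n < ?g y} = ball x R \<inter> {y. y \<bullet> n < ?g y}" by auto
      ultimately show ?thesis by auto
    qed
    moreover have "{y \<in> ball x R. y \<bullet> n < ?g y} \<inter> W = {}" using Wiff by fastforce
    ultimately have "{y \<in> ball x R. y \<bullet> n < ?g y} \<inter> closure W = {}"
      by (simp add: open_Int_closure_eq_empty)
    then show ?thesis using that by blast
  qed
  have graph: "z \<bullet> n = ?g z" if z: "z \<in> frontier W" "z \<in> ball x R" for z
  proof -
    have "z \<notin> W" "z \<in> closure W" using z(1) W(1) by (auto simp: frontier_def interior_open)
    then show ?thesis using Wiff[OF z(2)] below[OF z(2)] by (meson linorder_cases)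
  qed
  have shift: "?g (z + c *\<^sub>R n) = ?g z" "(z + c *\<^sub>R n) \<bullet> n = z \<bullet> n + c" for z c
  proof -
    have "(z + c *\<^sub>R n) - ((z + c *\<^sub>R n) \<bullet> n) *\<^sub>R n = z - (z \<bullet> n) *\<^sub>R n"
      by (simp add: inner_add_left nn algebra_simps)
    then show "?g (z + c *\<^sub>R n) = ?g z" by (simp only:)
    show "(z + c *\<^sub>R n) \<bullet> n = z \<bullet> n + c" by (simp add: inner_add_left nn)
  qed
  have near: "z + c *\<^sub>R n \<in> ball x R" if "z \<in> ball x (R / 2)" "\<bar>c\<bar> < R / 2" for z c
  proof -
    have "dist x (z + c *\<^sub>R n) \<le> dist x z + norm (c *\<^sub>R n)"
      by (metis dist_triangle dist_add_cancel add.right_neutral dist_0_norm)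
    then show ?thesis using that R(2) by auto
  qed
  show thesis
  proof (rule that[of "R / 2" n L g])
    fix z assume z: "z \<in> frontier W" "z \<in> ball x (R / 2)"
    then have zR: "z \<in> ball x R" using R(1) by auto
    show "z \<bullet> n = ?g z" using graph[OF z(1) zR] .
    fix t :: real assume t: "0 < t" "t < R / 2"
    have "?g (z + t *\<^sub>R n) < (z + t *\<^sub>R n) \<bullet> n"
      using graph[OF z(1) zR] t(1) by (subst shift(1), subst shift(2)) simp
    then show "z + t *\<^sub>R n \<in> W" using Wiff[OF near[OF z(2), of t]] t by simp
    show "z - t *\<^sub>R n \<notin> closure W"
      using below[OF near[OF z(2), of "- t"]] graph[OF z(1) zR] t shift[of z "- t"] by simp
  qed (use R in auto)
qed

text \<open>By convention, the measure generated by a set function is zero unless the set function is a measure. Positivity on a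
  single set therefore suffices to identify the surface measure with the Hausdorff outer measure
  on all Borel sets.\<close>

lemma surface_measure_nonzero_D:
  assumes "emeasure (surface_measure :: 'a::euclidean_space measure) \<Gamma> > 0" "A \<in> sets borel"
  shows "emeasure surface_measure A = hausdorff_outer (DIM('a) - 1) (A :: 'a set)"
proof -
  have "sigma_algebra UNIV (sets (borel :: 'a measure))"
    using sets.sigma_algebra_axioms[of "borel :: 'a measure"] by simp
  then have sig: "sigma_sets UNIV (sets (borel :: 'a measure)) = sets borel"
    by (rule sigma_algebra.sigma_sets_eq)
  have "measure_space UNIV (sets (borel :: 'a measure)) (hausdorff_outer (DIM('a) - 1))"
  proof (rule ccontr)
    assume "\<not> ?thesis"
    then have "emeasure (surface_measure :: 'a measure) \<Gamma> = 0"
      unfolding surface_measure_def by (simp add: emeasure_measure_of_conv sig)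
    then show False using assms(1) by simp
  qed
  then show ?thesis unfolding surface_measure_def using assms(2)
    by (simp add: emeasure_measure_of_conv sig)
qed

lemma sets_surface_measure: "sets (surface_measure :: 'a::euclidean_space measure) = sets borel"
  and space_surface_measure: "space (surface_measure :: 'a::euclidean_space measure) = UNIV"
proof -
  have "sigma_algebra UNIV (sets (borel :: 'a measure))"
    using sets.sigma_algebra_axioms[of "borel :: 'a measure"] by simp
  then have sig: "sigma_sets UNIV (sets (borel :: 'a measure)) = sets borel"
    by (rule sigma_algebra.sigma_sets_eq)
  show "sets (surface_measure :: 'a measure) = sets borel"
    unfolding surface_measure_def by (subst sets_measure_of) (auto simp: sig)
  show "space (surface_measure :: 'a measure) = UNIV"
    unfolding surface_measure_def by (rule space_measure_of) auto
qed

text \<open>Suppose not. Then there are smooth functions of norm one whose gradients and whose values on the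
  Dirichlet part decay geometrically. By \<open>wirtinger_ball\<close> and \<open>poincare_from_ball\<close> they differ little from constants
  \<open>- c n\<close>, so that \<open>c n\<close> cannot tend to zero, while almost everywhere on the Dirichlet part the values
  do tend to zero. Integrating the gradient along the chart axis, the value at a boundary point and the
  value at almost every point of the segment above it approach each other, which would force \<open>c n\<close> to
  zero. Hence the segments above the Dirichlet part sweep out a null set, and the Dirichlet part has
  surface measure zero.\<close>

theorem poincare_smooth:
  fixes W \<Gamma> :: "'a::euclidean_space set"
  assumes W: "regular_domain W" and \<Gamma>: "dirichlet_part W \<Gamma>"
  obtains C where "C \<ge> 0" "\<And>f. smooth f \<Longrightarrow>
     sq_int f W \<le> ennreal C * (sq_int (grad f) W + (\<integral>\<^sup>+x\<in>\<Gamma>. ennreal ((f x)\<^sup>2) \<partial>surface_measure))"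
proof -
  let ?S = "\<lambda>f::'a \<Rightarrow> real. \<integral>\<^sup>+x\<in>\<Gamma>. ennreal ((f x)\<^sup>2) \<partial>surface_measure"
  have W': "open W" "W \<noteq> {}" "bounded W" "connected W" "lipschitz_boundary W"
    using W by (auto simp: regular_domain_def)
  have Wb[measurable]: "W \<in> sets borel" using W'(1) by simp
  have \<Gamma>': "\<Gamma> \<in> sets borel" "\<Gamma> \<subseteq> frontier W" "emeasure surface_measure \<Gamma> > 0"
    using \<Gamma> by (auto simp: dirichlet_part_def)
  note [measurable] = \<Gamma>'(1)
  note [measurable_cong] = sets_surface_measure
  have "\<exists>C::real. C \<ge> 0 \<and> (\<forall>f. smooth f \<longrightarrow> sq_int f W \<le> ennreal C * (sq_int (grad f) W + ?S f))"
  proof (rule ccontr)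
    assume neg: "\<not> ?thesis"
    have "\<exists>f. smooth f \<and> sq_int f W = 1 \<and> sq_int (grad f) W + ?S f \<le> ennreal ((1/4) ^ n)" for n
    proof -
      obtain f where f: "smooth f" "\<not> sq_int f W \<le> ennreal (4 ^ n) * (sq_int (grad f) W + ?S f)"
        using neg by (metis zero_le_numeral zero_le_power)
      have [measurable]: "f \<in> borel_measurable borel" "grad f \<in> borel_measurable borel"
        by (auto intro!: borel_measurable_continuous_onI smooth_continuous smooth_grad_continuous f)
      define s where "s = enn2real (sq_int f W)"
      have s: "sq_int f W = ennreal s"
        using sq_int_finite[OF smooth_continuous[OF f(1)] W'(3)] by (simp add: s_def)
      have "sq_int f W > 0" using f(2) by (metis not_gr_zero zero_le)
      then have s0: "s > 0" unfolding s by simp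
      define c where "c = 1 / sqrt s"
      have c2: "c\<^sup>2 = 1 / s" using s0 by (simp add: c_def power_divide)
      define \<phi> where "\<phi> = (\<lambda>x. c * f x)"
      have "smooth \<phi>" unfolding \<phi>_def by (intro smooth_mult smooth_const f)
      moreover have "sq_int \<phi> W = 1"
        using sq_int_cmult[of f W c] s s0 by (simp add: \<phi>_def c2 ennreal_mult[symmetric] ennreal_1[symmetric] del: ennreal_1)
      moreover have "sq_int (grad \<phi>) W + ?S \<phi> \<le> ennreal ((1/4) ^ n)"
      proof -
        have "grad \<phi> = (\<lambda>x. c *\<^sub>R grad f x)" using grad_cmult[OF f(1)] by (auto simp: \<phi>_def)
        then have "sq_int (grad \<phi>) W = ennreal (1 / s) * sq_int (grad f) W"
          using sq_int_cmult[of "grad f" W c] by (simp add: c2)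
        moreover have "?S \<phi> = ennreal (1 / s) * ?S f"
        proof -
          have "ennreal ((\<phi> x)\<^sup>2) = ennreal (1 / s) * ennreal ((f x)\<^sup>2)" for x
            using s0 by (simp add: \<phi>_def power_mult_distrib c2 ennreal_mult[symmetric])
          then show ?thesis by (subst nn_integral_cmult[symmetric]) (simp_all add: mult.assoc)
        qed
        ultimately have eq: "sq_int (grad \<phi>) W + ?S \<phi> = ennreal (1 / s) * (sq_int (grad f) W + ?S f)"
          by (simp add: distrib_left)
        have "ennreal (4 ^ n) * (sq_int (grad f) W + ?S f) \<le> ennreal s"
          using f(2) unfolding s by simp
        then have "ennreal ((1/4) ^ n * (1 / s)) * (ennreal (4 ^ n) * (sq_int (grad f) W + ?S f))
            \<le> ennreal ((1/4) ^ n * (1 / s)) * ennreal s" by (rule mult_left_mono) simp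
        moreover have "ennreal ((1/4) ^ n * (1 / s)) * ennreal s = ennreal ((1/4) ^ n)"
          using s0 by (simp add: ennreal_mult[symmetric])
        moreover have "ennreal ((1/4) ^ n * (1 / s)) * ennreal (4 ^ n) = ennreal (1 / s)"
          using s0 by (simp add: ennreal_mult[symmetric] power_divide)
        ultimately show ?thesis unfolding eq by (simp add: mult.assoc[symmetric])
      qed
      ultimately show ?thesis by blast
    qed
    then obtain \<phi> where \<phi>: "\<And>n. smooth (\<phi> n)" "\<And>n. sq_int (\<phi> n) W = 1"
      "\<And>n. sq_int (grad (\<phi> n)) W + ?S (\<phi> n) \<le> ennreal ((1/4) ^ n)" by metis
    have grad_le: "sq_int (grad (\<phi> n)) W \<le> ennreal ((1/4) ^ n)" for n
      by (rule order_trans[OF _ \<phi>(3)]) (simp add: add_increasing2)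
    have S_le: "?S (\<phi> n) \<le> ennreal ((1/4) ^ n)" for n
      by (rule order_trans[OF _ \<phi>(3)[of n]]) (simp add: add_increasing)
    have [measurable]: "\<phi> n \<in> borel_measurable borel" "grad (\<phi> n) \<in> borel_measurable borel" for n
      by (auto intro!: borel_measurable_continuous_onI smooth_continuous smooth_grad_continuous \<phi>)
    obtain x0 \<rho> where B: "\<rho> > 0" "ball x0 \<rho> \<subseteq> W"
      using W'(1,2) open_contains_ball by (metis ex_in_conv)
    obtain K where K: "K \<ge> 0" "\<And>f \<eta>. smooth f \<Longrightarrow> \<eta> > 0 \<Longrightarrow> sq_int (grad f) W < \<infinity> \<Longrightarrow>
       \<exists>c. sq_int (\<lambda>x. f x + c) (ball x0 \<rho>) \<le> ennreal K * sq_int (grad f) W + ennreal \<eta>"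
      using wirtinger_ball[OF B Wb] by blast
    obtain C1 where C1: "C1 \<ge> 0" "\<And>f. smooth f \<Longrightarrow> sq_int f W \<le> ennreal C1 * (sq_int f (ball x0 \<rho>) + sq_int (grad f) W)"
      using poincare_from_ball[OF W B(2,1)] by blast
    have "\<exists>c. sq_int (\<lambda>x. \<phi> n x + c) (ball x0 \<rho>) \<le> ennreal ((K + 1) * (1/4) ^ n)" for n
    proof -
      have "sq_int (grad (\<phi> n)) W < \<infinity>" using grad_le[of n] by (auto intro: le_less_trans)
      then obtain c where "sq_int (\<lambda>x. \<phi> n x + c) (ball x0 \<rho>) \<le> ennreal K * sq_int (grad (\<phi> n)) W + ennreal ((1/4) ^ n)"
        using K(2)[OF \<phi>(1), of "(1/4) ^ n" n] by auto
      also have "\<dots> \<le> ennreal K * ennreal ((1/4) ^ n) + ennreal ((1/4) ^ n)"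
        by (intro add_mono mult_left_mono grad_le) auto
      also have "\<dots> = ennreal ((K + 1) * (1/4) ^ n)" using K(1) by (simp add: ennreal_mult[symmetric] ennreal_plus[symmetric] distrib_right del: ennreal_plus)
      finally show ?thesis by blast
    qed
    then obtain c where c: "\<And>n. sq_int (\<lambda>x. \<phi> n x + c n) (ball x0 \<rho>) \<le> ennreal ((K + 1) * (1/4) ^ n)" by metis
    define C2 where "C2 = C1 * (K + 2)"
    have C2: "C2 \<ge> 0" using C1 K by (simp add: C2_def)
    have dev: "sq_int (\<lambda>x. \<phi> n x + c n) W \<le> ennreal (C2 * (1/4) ^ n)" for n
    proof -
      have sm: "smooth (\<lambda>x. \<phi> n x + c n)" by (intro smooth_add smooth_const \<phi>)
      have gr: "grad (\<lambda>x. \<phi> n x + c n) = grad (\<phi> n)"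
        using grad_add[OF \<phi>(1)[of n] smooth_const[of "c n"]] grad_eqI[of "\<lambda>x::'a. c n" 0] by (simp add: fun_eq_iff)
      have "sq_int (\<lambda>x. \<phi> n x + c n) W \<le> ennreal C1 * (ennreal ((K + 1) * (1/4) ^ n) + ennreal ((1/4) ^ n))"
        using C1(2)[OF sm] unfolding gr
        by (rule order_trans) (intro mult_left_mono add_mono c grad_le, simp)
      also have "\<dots> = ennreal (C2 * (1/4) ^ n)"
        using C1(1) K(1) by (simp add: C2_def ennreal_mult[symmetric] ennreal_plus[symmetric] algebra_simps del: ennreal_plus)
      finally show ?thesis .
    qed
    have ae1: "AE x in lborel. (\<lambda>n. ennreal ((norm (\<phi> n x + c n))\<^sup>2) * indicator W x) \<longlonglongrightarrow> 0"
      by (rule AE_tendsto_zero_of_summable[OF _ _ C2]) (measurable, use dev in \<open>simp add: sq_int_def\<close>)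
    have ae2: "AE x in surface_measure. (\<lambda>n. ennreal ((\<phi> n x)\<^sup>2) * indicator \<Gamma> x) \<longlonglongrightarrow> 0"
      by (rule AE_tendsto_zero_of_summable[where C=1]) (measurable, use S_le in simp_all)
    have c_not: "\<not> c \<longlonglongrightarrow> 0"
    proof
      assume c0: "c \<longlonglongrightarrow> 0"
      have "1 \<le> 2 * sq_int (\<lambda>x. \<phi> n x + c n) W + 2 * (ennreal ((c n)\<^sup>2) * emeasure lborel W)" for n
      proof -
        have "sq_int (\<phi> n) W \<le> (\<integral>\<^sup>+x. 2 * (ennreal ((\<phi> n x + c n)\<^sup>2) * indicator W x) + 2 * (ennreal ((c n)\<^sup>2) * indicator W x) \<partial>lborel)"
          unfolding sq_int_def
        proof (rule nn_integral_mono)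
          fix x show "ennreal ((norm (\<phi> n x))\<^sup>2) * indicator W x
            \<le> 2 * (ennreal ((\<phi> n x + c n)\<^sup>2) * indicator W x) + 2 * (ennreal ((c n)\<^sup>2) * indicator W x)"
            using ennreal_square_add_le[of "\<phi> n x" "\<phi> n x + c n"] by (auto simp: indicator_def)
        qed
        also have "\<dots> = 2 * sq_int (\<lambda>x. \<phi> n x + c n) W + 2 * (ennreal ((c n)\<^sup>2) * emeasure lborel W)"
          unfolding sq_int_def by (subst nn_integral_add, measurable) (simp add: nn_integral_cmult)
        finally show ?thesis using \<phi>(2)[of n] by simp
      qed
      note le = this
      obtain w where w: "emeasure lborel W = ennreal w" "w \<ge> 0"
        using emeasure_bounded_finite[OF W'(3)] by (metis enn2real_nonneg ennreal_enn2real infinity_ennreal_def)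
      have "1 \<le> 2 * (C2 * (1/4) ^ n) + 2 * ((c n)\<^sup>2 * w)" for n
      proof -
        have "1 \<le> 2 * ennreal (C2 * (1/4) ^ n) + 2 * (ennreal ((c n)\<^sup>2) * ennreal w)"
          using le[of n] unfolding w by (rule order_trans) (intro add_mono mult_left_mono dev order_refl, auto)
        also have "\<dots> = ennreal (2 * (C2 * (1/4) ^ n) + 2 * ((c n)\<^sup>2 * w))"
          using C2 w(2) by (simp add: ennreal_mult' ennreal_plus)
        finally show ?thesis by (simp add: ennreal_1[symmetric] ennreal_le_iff2 del: ennreal_1)
      qed
      moreover have "(\<lambda>n. 2 * (C2 * (1/4) ^ n) + 2 * ((c n)\<^sup>2 * w)) \<longlonglongrightarrow> 2 * (C2 * 0) + 2 * (0\<^sup>2 * w)"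
        by (intro tendsto_intros c0 LIMSEQ_power_zero) simp
      ultimately have "1 \<le> 2 * (C2 * 0) + 2 * (0\<^sup>2 * w)" by (intro LIMSEQ_le_const) auto
      then show False by simp
    qed
    \<comment> \<open>all of \<open>\<Gamma>\<close> up to a surface null set, by \<open>ae2\<close>\<close>
    define \<Gamma>0 where "\<Gamma>0 = {z \<in> \<Gamma>. (\<lambda>n. \<phi> n z) \<longlonglongrightarrow> 0}"
    have \<Gamma>0m[measurable]: "\<Gamma>0 \<in> sets borel" unfolding \<Gamma>0_def by measurable
    have "\<exists>r>0. emeasure surface_measure (\<Gamma>0 \<inter> ball x r) = 0" if x: "x \<in> frontier W" for x
    proof -
      obtain r n L g where ch: "r > 0" "norm n = 1" "L-lipschitz_on {z. z \<bullet> n = 0} g"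
        "\<And>z. z \<in> frontier W \<Longrightarrow> z \<in> ball x r \<Longrightarrow> z \<bullet> n = g (z - (z \<bullet> n) *\<^sub>R n)"
        "\<And>z t. z \<in> frontier W \<Longrightarrow> z \<in> ball x r \<Longrightarrow> 0 < t \<Longrightarrow> t < r \<Longrightarrow> z + t *\<^sub>R n \<in> W"
        by (rule boundary_chart[OF W'(1,5) x], rule that; assumption)
      define E where "E = \<Gamma>0 \<inter> ball x r"
      define D where "D = {z + t *\<^sub>R n |z t. z \<in> E \<and> 0 < t \<and> t < r}"
      \<comment> \<open>bounds the squared increments on the segment of length \<open>r\<close> that runs downwards from \<open>y\<close>\<close>
      define F where "F k y = (\<integral>\<^sup>+s. ennreal (r * (norm (grad (\<phi> k) (y + s *\<^sub>R (- n))))\<^sup>2) * indicator W (y + s *\<^sub>R (- n)) * indicator {0<..<r} s \<partial>lborel)" for k y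
      have [measurable]: "{0<..<r} \<in> sets borel" by simp
      have [measurable]: "F k \<in> borel_measurable borel" for k unfolding F_def by measurable
      have F_int: "(\<integral>\<^sup>+y. F k y \<partial>lborel) \<le> ennreal (r\<^sup>2 * (1/4) ^ k)" for k
      proof -
        have "(\<integral>\<^sup>+y. F k y \<partial>lborel) = (\<integral>\<^sup>+s. (\<integral>\<^sup>+y. ennreal (r * (norm (grad (\<phi> k) (y + s *\<^sub>R (- n))))\<^sup>2) * indicator W (y + s *\<^sub>R (- n)) * indicator {0<..<r} s \<partial>lborel) \<partial>lborel)"
          unfolding F_def by (rule lborel_pair.Fubini') measurable
        also have "\<dots> = (\<integral>\<^sup>+s. (ennreal r * sq_int (grad (\<phi> k)) W) * indicator {0<..<r} s \<partial>lborel)"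
        proof (rule nn_integral_cong)
          fix s :: real
          have "(\<integral>\<^sup>+y. ennreal (r * (norm (grad (\<phi> k) (y + s *\<^sub>R (- n))))\<^sup>2) * indicator W (y + s *\<^sub>R (- n)) * indicator {0<..<r} s \<partial>lborel)
              = (\<integral>\<^sup>+y. ennreal (r * (norm (grad (\<phi> k) y))\<^sup>2) * indicator W y * indicator {0<..<r} s \<partial>lborel)"
            by (rule nn_integral_lborel_translate) measurable
          also have "\<dots> = (\<integral>\<^sup>+y. ennreal r * (ennreal ((norm (grad (\<phi> k) y))\<^sup>2) * indicator W y) * indicator {0<..<r} s \<partial>lborel)"
            using ch(1) by (simp add: ennreal_mult mult.assoc)
          also have "\<dots> = (ennreal r * sq_int (grad (\<phi> k)) W) * indicator {0<..<r} s"
            unfolding sq_int_def by (subst nn_integral_multc, measurable) (simp add: nn_integral_cmult)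
          finally show "(\<integral>\<^sup>+y. ennreal (r * (norm (grad (\<phi> k) (y + s *\<^sub>R (- n))))\<^sup>2) * indicator W (y + s *\<^sub>R (- n)) * indicator {0<..<r} s \<partial>lborel)
              = (ennreal r * sq_int (grad (\<phi> k)) W) * indicator {0<..<r} s" .
        qed
        also have "\<dots> = (ennreal r * sq_int (grad (\<phi> k)) W) * ennreal r"
          using ch(1) by (simp add: nn_integral_cmult)
        also have "\<dots> \<le> (ennreal r * ennreal ((1/4) ^ k)) * ennreal r"
          by (intro mult_right_mono mult_left_mono grad_le) auto
        also have "\<dots> = ennreal (r\<^sup>2 * (1/4) ^ k)"
          using ch(1) by (simp add: ennreal_mult[symmetric] power2_eq_square mult_ac)
        finally show ?thesis .
      qed
      have ae3: "AE y in lborel. (\<lambda>k. F k y) \<longlonglongrightarrow> 0"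
        by (rule AE_tendsto_zero_of_summable[OF _ F_int]) auto
      have "AE y in lborel. y \<notin> D"
        using ae1 ae3
      proof eventually_elim
        case (elim y)
        show "y \<notin> D"
        proof
          assume "y \<in> D"
          then obtain z t where z: "z \<in> \<Gamma>0" "z \<in> ball x r" "0 < t" "t < r" "y = z + t *\<^sub>R n"
            by (auto simp: D_def E_def)
          have zf: "z \<in> frontier W" using z(1) \<Gamma>'(2) by (auto simp: \<Gamma>0_def)
          have yW: "y \<in> W" using ch(5)[OF zf z(2-4)] z(5) by simp
          have le: "ennreal ((\<phi> k z - \<phi> k y)\<^sup>2) \<le> F k y" for k
          proof -
            have "ennreal ((\<phi> k (y + t *\<^sub>R (- n)) - \<phi> k y)\<^sup>2)
                \<le> (\<integral>\<^sup>+s\<in>{0<..<t}. ennreal (t * (norm (- n))\<^sup>2 * (norm (grad (\<phi> k) (y + s *\<^sub>R (- n))))\<^sup>2) \<partial>lborel)"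
              using z(3) by (intro line_diff_square_le \<phi>) auto
            also have "\<dots> \<le> F k y"
              unfolding F_def
            proof (rule nn_integral_mono)
              fix s
              have "y + s *\<^sub>R (- n) \<in> W" if "0 < s" "s < t"
                using ch(5)[OF zf z(2), of "t - s"] that z(4,5) by (simp add: algebra_simps)
              then show "ennreal (t * (norm (- n))\<^sup>2 * (norm (grad (\<phi> k) (y + s *\<^sub>R (- n))))\<^sup>2) * indicator {0<..<t} s
                \<le> ennreal (r * (norm (grad (\<phi> k) (y + s *\<^sub>R (- n))))\<^sup>2) * indicator W (y + s *\<^sub>R (- n)) * indicator {0<..<r} s"
                using z(3,4) ch(2) by (auto simp: indicator_def intro!: ennreal_leI mult_right_mono)
            qed
            finally show ?thesis using z(5) by simp
          qed
          have "(\<lambda>k. ennreal ((\<phi> k z - \<phi> k y)\<^sup>2)) \<longlonglongrightarrow> 0"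
            by (rule tendsto_sandwich[OF _ _ tendsto_const elim(2)]) (use le in auto)
          then have "(\<lambda>k. \<phi> k z - \<phi> k y) \<longlonglongrightarrow> 0" by (rule tendsto_zero_of_ennreal_square)
          moreover have "(\<lambda>k. \<phi> k z) \<longlonglongrightarrow> 0" using z(1) by (simp add: \<Gamma>0_def)
          moreover have "(\<lambda>k. \<phi> k y + c k) \<longlonglongrightarrow> 0"
            by (rule tendsto_zero_of_ennreal_square) (use elim(1) yW in simp)
          ultimately have "(\<lambda>k. (\<phi> k y + c k) + (\<phi> k z - \<phi> k y) - \<phi> k z) \<longlonglongrightarrow> 0 + 0 - 0"
            by (intro tendsto_diff tendsto_add)
          then have "c \<longlonglongrightarrow> 0" by simp
          then show False using c_not by simp
        qed
      qed
      then obtain N where "N \<in> null_sets lborel" "D \<subseteq> N"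
        by (auto simp: eventually_ae_filter)
      then have "negligible D"
        by (meson negligible_iff_null_sets negligible_subset null_sets_completionI)
      then have "hausdorff_outer (DIM('a) - 1) E = 0"
        unfolding D_def
        by (intro hausdorff_outer_zero_of_sweep[OF ch(2,3) _ _ ch(1)] ch(4))
           (use \<Gamma>'(2) in \<open>auto simp: E_def \<Gamma>0_def intro: bounded_subset[OF bounded_ball]\<close>)
      moreover have "E \<in> sets borel" unfolding E_def by simp
      ultimately have "emeasure surface_measure E = 0" using surface_measure_nonzero_D[OF \<Gamma>'(3)] by simp
      then show ?thesis using ch(1) unfolding E_def by blast
    qed
    then obtain r where r: "\<And>x. x \<in> frontier W \<Longrightarrow> r x > 0 \<and> emeasure surface_measure (\<Gamma>0 \<inter> ball x (r x)) = 0"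
      by metis
    have "compact (frontier W)" using W'(3) by (rule compact_frontier_bounded)
    then obtain N where N: "N \<subseteq> frontier W" "finite N" "frontier W \<subseteq> (\<Union>x\<in>N. ball x (r x))"
    proof (rule compactE_image[of "frontier W" "frontier W" "\<lambda>x. ball x (r x)"])
      show "frontier W \<subseteq> (\<Union>x\<in>frontier W. ball x (r x))" using r by force
    qed auto
    have "(\<Union>x\<in>N. \<Gamma>0 \<inter> ball x (r x)) \<in> null_sets surface_measure"
    proof (rule null_sets_UN')
      show "countable N" using N(2) by (rule countable_finite)
      show "\<Gamma>0 \<inter> ball x (r x) \<in> null_sets surface_measure" if "x \<in> N" for x
        using r[of x] N(1) that by (auto simp: null_sets_def sets_surface_measure)
    qed
    then have "AE x in surface_measure. x \<notin> (\<Union>x\<in>N. \<Gamma>0 \<inter> ball x (r x))" by (rule AE_not_in)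
    with ae2 have "AE x in surface_measure. x \<notin> \<Gamma>"
    proof eventually_elim
      case (elim x)
      show "x \<notin> \<Gamma>"
      proof
        assume x: "x \<in> \<Gamma>"
        have "(\<lambda>n. \<phi> n x) \<longlonglongrightarrow> 0" by (rule tendsto_zero_of_ennreal_square) (use elim(1) x in simp)
        then have "x \<in> \<Gamma>0" using x by (simp add: \<Gamma>0_def)
        moreover have "x \<in> frontier W" using x \<Gamma>'(2) by blast
        ultimately show False using elim(2) N(3) by blast
      qed
    qed
    then have "emeasure surface_measure \<Gamma> = 0"
      using \<Gamma>'(1) by (subst (asm) AE_iff_measurable[of \<Gamma>]) (auto simp: space_surface_measure sets_surface_measure)
    then show False using \<Gamma>'(3) by simp
  qed
  then show thesis using that by blast
qed

section \<open>Symmetric bilinear forms, saddle points and finite-dimensional systems\<close>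

text \<open>The carrier is a subspace instead of a type, since the forms of interest are linear only between
  fields that have weak derivatives.\<close>

definition sym_bilinear :: "'z::real_vector set \<Rightarrow> ('z \<Rightarrow> 'z \<Rightarrow> real) \<Rightarrow> bool" where
  "sym_bilinear Z B \<longleftrightarrow> subspace Z \<and>
     (\<forall>x\<in>Z. \<forall>y\<in>Z. B x y = B y x) \<and>
     (\<forall>x\<in>Z. \<forall>y\<in>Z. \<forall>z\<in>Z. B (x + y) z = B x z + B y z) \<and>
     (\<forall>c. \<forall>x\<in>Z. \<forall>z\<in>Z. B (c *\<^sub>R x) z = c * B x z)"

lemma sym_bilinear_subspace: "sym_bilinear Z B \<Longrightarrow> subspace Z"
  by (simp add: sym_bilinear_def)

lemma sym_bilinearD:
  assumes "sym_bilinear Z B" "x \<in> Z" "y \<in> Z"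
  shows "B x y = B y x" "z \<in> Z \<Longrightarrow> B (x + y) z = B x z + B y z" "z \<in> Z \<Longrightarrow> B z (x + y) = B z x + B z y"
    "B (c *\<^sub>R x) y = c * B x y" "B x (c *\<^sub>R y) = c * B x y"
proof -
  have sub: "x + y \<in> Z" "c *\<^sub>R y \<in> Z"
    using assms sym_bilinear_subspace subspace_add subspace_scale by blast+
  show "B x y = B y x" "z \<in> Z \<Longrightarrow> B (x + y) z = B x z + B y z" "B (c *\<^sub>R x) y = c * B x y"
    using assms unfolding sym_bilinear_def by blast+
  show "B x (c *\<^sub>R y) = c * B x y" "z \<in> Z \<Longrightarrow> B z (x + y) = B z x + B z y"
    using assms sub unfolding sym_bilinear_def by metis+
qed

lemma sym_bilinear_diff:
  assumes "sym_bilinear Z B" "x \<in> Z" "y \<in> Z" "z \<in> Z"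
  shows "B (x - y) z = B x z - B y z" "B z (x - y) = B z x - B z y"
proof -
  have my: "- 1 *\<^sub>R y \<in> Z"
    using assms sym_bilinear_subspace subspace_scale by blast
  have eq: "x - y = x + (- 1) *\<^sub>R y" by simp
  show "B (x - y) z = B x z - B y z" "B z (x - y) = B z x - B z y"
    unfolding eq using sym_bilinearD(2,3)[OF assms(1,2) my assms(4)] sym_bilinearD(4)[OF assms(1,3,4), of "-1"]
      sym_bilinearD(5)[OF assms(1,4,3), of "-1"] by simp_all
qed

lemma sym_bilinear_zero:
  assumes "sym_bilinear Z B" "z \<in> Z" shows "B 0 z = 0" "B z 0 = 0"
  using sym_bilinear_diff[OF assms(1,2,2,2)] by auto

lemma sym_bilinear_subset: "sym_bilinear Z B \<Longrightarrow> Z' \<subseteq> Z \<Longrightarrow> subspace Z' \<Longrightarrow> sym_bilinear Z' B"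
  unfolding sym_bilinear_def by blast

lemma sym_bilinear_quadratic:
  assumes "sym_bilinear Z B" "x \<in> Z" "y \<in> Z"
  shows "B (x + t *\<^sub>R y) (x + t *\<^sub>R y) = B x x + 2 * t * B x y + t\<^sup>2 * B y y"
proof -
  have ty: "t *\<^sub>R y \<in> Z" "x + t *\<^sub>R y \<in> Z"
    using assms sym_bilinear_subspace subspace_scale subspace_add by metis+
  show ?thesis
    using sym_bilinearD(2)[OF assms(1,2) ty(1) ty(2)] sym_bilinearD(3)[OF assms(1,2) ty(1) assms(2)]
      sym_bilinearD(3)[OF assms(1,2) ty(1) ty(1)] sym_bilinearD(4)[OF assms(1,3,2), of t]
      sym_bilinearD(5)[OF assms(1,2,3), of t] sym_bilinearD(4)[OF assms(1,3) ty(1), of t]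
      sym_bilinearD(5)[OF assms(1,3,3), of t] sym_bilinearD(1)[OF assms(1,2,3)]
    by (simp add: power2_eq_square algebra_simps)
qed

lemma linear_coeff_zero:
  fixes a b :: real
  assumes "\<And>t. 0 \<le> t * b + t\<^sup>2 * a" shows "b = 0"
proof (rule ccontr)
  assume b: "b \<noteq> 0"
  \<comment> \<open>for small \<open>t\<close> of the sign opposite to \<open>b\<close> the linear term wins\<close>
  define t where "t = - b / (\<bar>a\<bar> + 1)"
  have "t * b + t\<^sup>2 * a \<le> t * b + t\<^sup>2 * \<bar>a\<bar>" by (intro add_left_mono mult_left_mono) auto
  also have "\<dots> < t * b + t\<^sup>2 * (\<bar>a\<bar> + 1)"
  proof -
    have "t\<^sup>2 > 0" using b by (simp add: t_def)
    then show ?thesis by (simp add: distrib_left)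
  qed
  also have "t\<^sup>2 * (\<bar>a\<bar> + 1) = - (t * b)" by (simp add: t_def power2_eq_square)
  finally show False using assms[of t] by simp
qed

text \<open>Semi-definiteness is enough, which matters because representatives that differ on a null set are
  distinct vectors at distance zero.\<close>

lemma Cauchy_Schwarz_form:
  assumes M: "sym_bilinear Z M" "\<And>z. z \<in> Z \<Longrightarrow> 0 \<le> M z z" and x: "x \<in> Z" "y \<in> Z"
  shows "\<bar>M x y\<bar> \<le> sqrt (M x x) * sqrt (M y y)"
proof -
  have q: "0 \<le> M x x + 2 * t * M x y + t\<^sup>2 * M y y" for t
  proof -
    have "x + t *\<^sub>R y \<in> Z"
      using M(1) x sym_bilinear_subspace subspace_scale subspace_add by metis
    then show ?thesis using sym_bilinear_quadratic[OF M(1) x, of t] M(2) by metis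
  qed
  have "(M x y)\<^sup>2 \<le> M x x * M y y"
  proof (cases "M y y = 0")
    case True
    have "M x y = 0"
    proof (rule ccontr)
      assume "M x y \<noteq> 0"
      then show False using q[of "- (M x x + 1) / (2 * M x y)"] True by (simp add: field_simps)
    qed
    then show ?thesis using M(2)[OF x(1)] True by simp
  next
    case False
    then have p: "M y y > 0" using M(2)[OF x(2)] by simp
    then show ?thesis using q[of "- M x y / M y y"] by (simp add: field_simps power2_eq_square)
  qed
  then have "sqrt ((M x y)\<^sup>2) \<le> sqrt (M x x * M y y)" by (rule real_sqrt_le_mono)
  then show ?thesis by (simp add: real_sqrt_mult)
qed

lemma seminorm_triangle:
  assumes M: "sym_bilinear Z M" "\<And>z. z \<in> Z \<Longrightarrow> 0 \<le> M z z" and x: "x \<in> Z" "y \<in> Z"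
  shows "sqrt (M (x + y) (x + y)) \<le> sqrt (M x x) + sqrt (M y y)"
proof -
  have "M (x + y) (x + y) = M x x + 2 * M x y + M y y"
    using sym_bilinear_quadratic[OF M(1) x, of 1] by simp
  also have "\<dots> \<le> M x x + 2 * (sqrt (M x x) * sqrt (M y y)) + M y y"
    using Cauchy_Schwarz_form[OF M x] by (simp add: abs_le_iff)
  also have "\<dots> = (sqrt (M x x) + sqrt (M y y))\<^sup>2"
    using M(2)[OF x(1)] M(2)[OF x(2)] by (simp add: power2_sum)
  finally show ?thesis
    using M(2)[OF x(1)] M(2)[OF x(2)] by (intro real_le_lsqrt) auto
qed

text \<open>Along a line, the functional is a quadratic polynomial whose linear coefficient is the value of the
  form. An extremum forces that coefficient to vanish; conversely, the sign of the quadratic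
  coefficient turns stationarity into an extremum. The data \<open>d\<close> are treated as a third component of the
  argument, so that the affine terms of the functional become bilinear.\<close>

lemma saddle_point_iff_stationary:
  fixes F :: "'x::real_vector \<Rightarrow> 'y::real_vector \<Rightarrow> real" and B :: "('d::real_vector \<times> 'x \<times> 'y) \<Rightarrow> ('d \<times> 'x \<times> 'y) \<Rightarrow> real"
  assumes B: "sym_bilinear (D \<times> X \<times> Y) B" and X: "subspace X" and Y: "subspace Y" and D: "subspace D" and d: "d \<in> D"
    and F: "\<And>x y. x \<in> X \<Longrightarrow> y \<in> Y \<Longrightarrow> F x y = 1/2 * B (d, x, y) (d, x, y)"
    and pos: "\<And>x. x \<in> X \<Longrightarrow> 0 \<le> B (0, x, 0) (0, x, 0)"
    and neg: "\<And>y. y \<in> Y \<Longrightarrow> B (0, 0, y) (0, 0, y) \<le> 0"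
  shows "saddle_point X Y F (x, y) \<longleftrightarrow>
     x \<in> X \<and> y \<in> Y \<and> (\<forall>x'\<in>X. \<forall>y'\<in>Y. B (d, x, y) (0, x', y') = 0)"
proof (cases "x \<in> X \<and> y \<in> Y")
  case xy: True
  then have x: "x \<in> X" and y: "y \<in> Y" by auto
  have z: "0 \<in> X" "0 \<in> Y" "0 \<in> D" using X Y D subspace_0 by auto
  let ?w = "(d, x, y)"
  have w: "?w \<in> D \<times> X \<times> Y" using x y d by simp
  have Fx: "F (x + t *\<^sub>R x') y = F x y + (t * B ?w (0, x', 0) + t\<^sup>2 * (B (0, x', 0) (0, x', 0) / 2))" if x': "x' \<in> X" for x' t
  proof -
    have "x + t *\<^sub>R x' \<in> X" using X x x' subspace_add subspace_scale by blast
    moreover have "?w + t *\<^sub>R (0, x', 0) = (d, x + t *\<^sub>R x', y)" by simp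
    ultimately show ?thesis
      using sym_bilinear_quadratic[OF B w, of "(0, x', 0)" t] z x' F[OF x y] F[of "x + t *\<^sub>R x'" y] y
      by (simp add: field_simps)
  qed
  have Fy: "F x (y + t *\<^sub>R y') = F x y + (t * B ?w (0, 0, y') + t\<^sup>2 * (B (0, 0, y') (0, 0, y') / 2))" if y': "y' \<in> Y" for y' t
  proof -
    have "y + t *\<^sub>R y' \<in> Y" using Y y y' subspace_add subspace_scale by blast
    moreover have "?w + t *\<^sub>R (0, 0, y') = (d, x, y + t *\<^sub>R y')" by simp
    ultimately show ?thesis
      using sym_bilinear_quadratic[OF B w, of "(0, 0, y')" t] z y' F[OF x y] F[of x "y + t *\<^sub>R y'"] x
      by (simp add: field_simps)
  qed
  have "saddle_point X Y F (x, y) \<longleftrightarrow> (\<forall>x'\<in>X. B ?w (0, x', 0) = 0) \<and> (\<forall>y'\<in>Y. B ?w (0, 0, y') = 0)"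
  proof (intro iffI conjI ballI)
    assume s: "saddle_point X Y F (x, y)"
    {
      fix x' assume x': "x' \<in> X"
      show "B ?w (0, x', 0) = 0"
      proof (rule linear_coeff_zero)
        fix t
        have "x + t *\<^sub>R x' \<in> X" using X x x' subspace_add subspace_scale by blast
        then have "F x y \<le> F (x + t *\<^sub>R x') y" using s by (simp add: saddle_point_def)
        then show "0 \<le> t * B ?w (0, x', 0) + t\<^sup>2 * (B (0, x', 0) (0, x', 0) / 2)" using Fx[OF x', of t] by simp
      qed
    next
      fix y' assume y': "y' \<in> Y"
      have "- B ?w (0, 0, y') = 0"
      proof (rule linear_coeff_zero)
        fix t
        have "y + t *\<^sub>R y' \<in> Y" using Y y y' subspace_add subspace_scale by blast
        then have "F x (y + t *\<^sub>R y') \<le> F x y" using s by (simp add: saddle_point_def)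
        then show "0 \<le> t * - B ?w (0, 0, y') + t\<^sup>2 * - (B (0, 0, y') (0, 0, y') / 2)" using Fy[OF y', of t] by simp
      qed
      then show "B ?w (0, 0, y') = 0" by simp
    }
  next
    assume st: "(\<forall>x'\<in>X. B ?w (0, x', 0) = 0) \<and> (\<forall>y'\<in>Y. B ?w (0, 0, y') = 0)"
    show "saddle_point X Y F (x, y)"
      unfolding saddle_point_def
    proof (simp add: x y, intro conjI ballI)
      fix y' assume y': "y' \<in> Y"
      then have d: "y' - y \<in> Y" using Y y subspace_diff by blast
      show "F x y' \<le> F x y" using Fy[OF d, of 1] neg[OF d] st d by simp
    next
      fix x' assume x': "x' \<in> X"
      then have d: "x' - x \<in> X" using X x subspace_diff by blast
      show "F x y \<le> F x' y" using Fx[OF d, of 1] pos[OF d] st d by simp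
    qed
  qed
  also have "\<dots> \<longleftrightarrow> (\<forall>x'\<in>X. \<forall>y'\<in>Y. B ?w (0, x', y') = 0)"
  proof -
    have "B ?w (0, x', y') = B ?w (0, x', 0) + B ?w (0, 0, y')" if "x' \<in> X" "y' \<in> Y" for x' y'
      using sym_bilinearD(3)[OF B, of "(0, x', 0)" "(0, 0, y')" ?w] that z w by simp
    note split = this
    show ?thesis
    proof (intro iffI ballI conjI)
      fix x' y' assume "(\<forall>x'\<in>X. B ?w (0, x', 0) = 0) \<and> (\<forall>y'\<in>Y. B ?w (0, 0, y') = 0)" "x' \<in> X" "y' \<in> Y"
      then show "B ?w (0, x', y') = 0" using split[of x' y'] by simp
    next
      fix x' assume "\<forall>x'\<in>X. \<forall>y'\<in>Y. B ?w (0, x', y') = 0" "x' \<in> X"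
      then show "B ?w (0, x', 0) = 0" using z(2) by blast
    next
      fix y' assume "\<forall>x'\<in>X. \<forall>y'\<in>Y. B ?w (0, x', y') = 0" "y' \<in> Y"
      then show "B ?w (0, 0, y') = 0" using z(1) by blast
    qed
  qed
  finally show ?thesis using x y by simp
qed (auto simp: saddle_point_def)

text \<open>Induction on the number of functionals, restricting to the kernel of one of them. This and the next
  lemma are the row-rank form of the solvability of linear systems, stated for functionals on a
  subspace so that no coordinates have to be chosen.\<close>

lemma functional_in_span_of_finite:
  fixes f :: "'b \<Rightarrow> 'v::real_vector \<Rightarrow> real"
  assumes "finite S" "subspace V"
    and "\<And>b. b \<in> S \<Longrightarrow> (\<forall>x\<in>V. \<forall>y\<in>V. f b (x + y) = f b x + f b y) \<and> (\<forall>c. \<forall>x\<in>V. f b (c *\<^sub>R x) = c * f b x)"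
    and "(\<forall>x\<in>V. \<forall>y\<in>V. g (x + y) = g x + g y) \<and> (\<forall>c. \<forall>x\<in>V. g (c *\<^sub>R x) = c * g x)"
    and "\<And>v. v \<in> V \<Longrightarrow> (\<forall>b\<in>S. f b v = 0) \<Longrightarrow> g v = 0"
  shows "\<exists>c. \<forall>v\<in>V. g v = (\<Sum>b\<in>S. c b * f b v)"
  using assms
proof (induction S arbitrary: V g rule: finite_induct)
  case empty
  then show ?case by auto
next
  case (insert a S)
  have fa: "\<And>x y. x \<in> V \<Longrightarrow> y \<in> V \<Longrightarrow> f a (x + y) = f a x + f a y" "\<And>c x. x \<in> V \<Longrightarrow> f a (c *\<^sub>R x) = c * f a x"
    using insert.prems(2)[of a] by auto
  have fa0: "f a 0 = 0" using fa(2)[of 0 0] subspace_0[OF insert.prems(1)] by simp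
  define V' where "V' = {v \<in> V. f a v = 0}"
  have V': "subspace V'"
    using insert.prems(1) fa fa0 by (auto simp: V'_def subspace_def)
  have "\<exists>c. \<forall>v\<in>V'. g v = (\<Sum>b\<in>S. c b * f b v)"
    using insert.prems(2-4) by (intro insert.IH[OF V']) (auto simp: V'_def)
  then obtain c where c: "\<And>v. v \<in> V' \<Longrightarrow> g v = (\<Sum>b\<in>S. c b * f b v)" by blast
  define h where "h v = g v - (\<Sum>b\<in>S. c b * f b v)" for v
  have h: "h (x + t *\<^sub>R y) = h x + t * h y" if "x \<in> V" "y \<in> V" for x y t
  proof -
    have "t *\<^sub>R y \<in> V" using that insert.prems(1) subspace_scale by blast
    moreover have "f b (x + t *\<^sub>R y) = f b x + t * f b y" if "b \<in> S" for b
      using insert.prems(2)[of b] that \<open>x \<in> V\<close> \<open>y \<in> V\<close> calculation by simp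
    ultimately show ?thesis using insert.prems(3) that
      by (simp add: h_def algebra_simps sum.distrib sum_distrib_left)
  qed
  have h0: "h v = 0" if "v \<in> V" "f a v = 0" for v using c[of v] that by (simp add: h_def V'_def)
  have "\<exists>k. \<forall>v\<in>V. h v = k * f a v"
  proof (cases "\<exists>w\<in>V. f a w \<noteq> 0")
    case True
    then obtain w where w: "w \<in> V" "f a w \<noteq> 0" by blast
    have "h v = (h w / f a w) * f a v" if v: "v \<in> V" for v
    proof -
      let ?t = "- (f a v / f a w)"
      have tw: "?t *\<^sub>R w \<in> V" using w insert.prems(1) subspace_scale by blast
      have "v + ?t *\<^sub>R w \<in> V" using v tw insert.prems(1) subspace_add by blast
      moreover have "f a (v + ?t *\<^sub>R w) = 0" using fa(1)[OF v tw] fa(2)[OF w(1), of ?t] w(2) by simp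
      ultimately have "h (v + ?t *\<^sub>R w) = 0" by (rule h0)
      then show ?thesis using h[OF v w(1), of ?t] by simp
    qed
    then show ?thesis by blast
  next
    case False
    then show ?thesis using h0 by (intro exI[of _ 0]) auto
  qed
  then obtain k where k: "\<And>v. v \<in> V \<Longrightarrow> h v = k * f a v" by blast
  show ?case
  proof (intro exI[of _ "c(a := k)"] ballI)
    fix v assume "v \<in> V"
    have "(\<Sum>b\<in>S. (c(a := k)) b * f b v) = (\<Sum>b\<in>S. c b * f b v)"
      using insert.hyps by (intro sum.cong) auto
    then show "g v = (\<Sum>b\<in>insert a S. (c(a := k)) b * f b v)"
      using insert.hyps k[OF \<open>v \<in> V\<close>] by (simp add: h_def)
  qed
qed

lemma finite_system_solvable:
  fixes f :: "'b \<Rightarrow> 'v::real_vector \<Rightarrow> real"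
  assumes "finite S" "subspace V"
    and "\<And>b. b \<in> S \<Longrightarrow> (\<forall>x\<in>V. \<forall>y\<in>V. f b (x + y) = f b x + f b y) \<and> (\<forall>c. \<forall>x\<in>V. f b (c *\<^sub>R x) = c * f b x)"
    and "\<And>c. (\<forall>v\<in>V. (\<Sum>b\<in>S. c b * f b v) = 0) \<Longrightarrow> (\<Sum>b\<in>S. c b * r b) = 0"
  shows "\<exists>v\<in>V. \<forall>b\<in>S. f b v = (r b::real)"
  using assms
proof (induction S rule: finite_induct)
  case empty
  then show ?case using subspace_0 by auto
next
  case (insert a S)
  have fb: "\<And>b x y. b \<in> insert a S \<Longrightarrow> x \<in> V \<Longrightarrow> y \<in> V \<Longrightarrow> f b (x + y) = f b x + f b y"
    "\<And>b c x. b \<in> insert a S \<Longrightarrow> x \<in> V \<Longrightarrow> f b (c *\<^sub>R x) = c * f b x"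
    using insert.prems(2) by blast+
  have sum_upd: "(\<Sum>b\<in>insert a S. (c(a := k)) b * g b) = k * g a + (\<Sum>b\<in>S. c b * g b)" for c k and g :: "'b \<Rightarrow> real"
  proof -
    have "(\<Sum>b\<in>S. (c(a := k)) b * g b) = (\<Sum>b\<in>S. c b * g b)"
      using insert.hyps by (intro sum.cong) auto
    then show ?thesis using insert.hyps by simp
  qed
  have "\<exists>v\<in>V. \<forall>b\<in>S. f b v = r b"
  proof (rule insert.IH[OF insert.prems(1)])
    show "(\<forall>x\<in>V. \<forall>y\<in>V. f b (x + y) = f b x + f b y) \<and> (\<forall>c. \<forall>x\<in>V. f b (c *\<^sub>R x) = c * f b x)" if "b \<in> S" for b
      using insert.prems(2) that by blast
    fix c assume "\<forall>v\<in>V. (\<Sum>b\<in>S. c b * f b v) = 0"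
    then have "\<forall>v\<in>V. (\<Sum>b\<in>insert a S. (c(a := 0)) b * f b v) = 0" unfolding sum_upd by simp
    from insert.prems(3)[OF this] show "(\<Sum>b\<in>S. c b * r b) = 0" unfolding sum_upd by simp
  qed
  then obtain v0 where v0: "v0 \<in> V" "\<And>b. b \<in> S \<Longrightarrow> f b v0 = r b" by blast
  show ?case
  proof (cases "\<exists>w\<in>V. (\<forall>b\<in>S. f b w = 0) \<and> f a w \<noteq> 0")
    case True
    then obtain w where w: "w \<in> V" "\<And>b. b \<in> S \<Longrightarrow> f b w = 0" "f a w \<noteq> 0" by blast
    define t where "t = (r a - f a v0) / f a w"
    have tw: "t *\<^sub>R w \<in> V" using w insert.prems(1) subspace_scale by blast
    have "v0 + t *\<^sub>R w \<in> V" using v0(1) tw insert.prems(1) subspace_add by blast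
    moreover have "f b (v0 + t *\<^sub>R w) = r b" if "b \<in> insert a S" for b
      using fb(1)[OF that v0(1) tw] fb(2)[OF that w(1), of t] that v0(2) w(2,3) by (auto simp: t_def)
    ultimately show ?thesis by blast
  next
    \<comment> \<open>the new equation depends on the old ones, and the compatibility condition makes it hold
      automatically\<close>
    case False
    then have "\<exists>c. \<forall>v\<in>V. f a v = (\<Sum>b\<in>S. c b * f b v)"
      by (intro functional_in_span_of_finite insert.hyps insert.prems) blast+
    then obtain c where c: "\<And>v. v \<in> V \<Longrightarrow> f a v = (\<Sum>b\<in>S. c b * f b v)" by blast
    have "\<forall>v\<in>V. (\<Sum>b\<in>insert a S. (c(a := - 1)) b * f b v) = 0" unfolding sum_upd using c by simp
    from insert.prems(3)[OF this] have "r a = (\<Sum>b\<in>S. c b * r b)" unfolding sum_upd by simp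
    also have "\<dots> = f a v0" using c[OF v0(1)] v0(2) by simp
    finally show ?thesis using v0 by auto
  qed
qed

text \<open>The Fredholm alternative in finite dimension: for a symmetric form, a functional that annihilates the
  kernel is represented by a vector. The form may be degenerate, and it is on discrete spaces whose
  members are only determined up to null sets.\<close>

lemma symmetric_form_solvable:
  assumes A: "sym_bilinear V A" and V: "finite S" "V \<subseteq> span S"
    and F: "\<And>x y. x \<in> V \<Longrightarrow> y \<in> V \<Longrightarrow> F (x + y) = F x + F y" "\<And>c x. x \<in> V \<Longrightarrow> F (c *\<^sub>R x) = c * F x"
    and ker: "\<And>z. z \<in> V \<Longrightarrow> (\<forall>v\<in>V. A v z = 0) \<Longrightarrow> F z = 0"
  shows "\<exists>p\<in>V. \<forall>z\<in>V. A p z = (F z :: real)"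
proof -
  have sV: "subspace V" by (rule sym_bilinear_subspace[OF A])
  obtain T where T: "T \<subseteq> V" "independent T" "V \<subseteq> span T" using basis_exists[of V] by metis
  have fT: "finite T" using independent_span_bound[OF V(1) T(2)] T(1) V(2) by blast
  have Tspan: "\<exists>c. z = (\<Sum>b\<in>T. c b *\<^sub>R b)" if "z \<in> V" for z
    using T(3) that span_finite[OF fT] by auto
  have sumV: "(\<Sum>b\<in>T'. c b *\<^sub>R b) \<in> V" if "T' \<subseteq> T" for T' and c :: "_ \<Rightarrow> real"
    using T(1) that by (intro subspace_sum[OF sV] subspace_scale[OF sV]) auto
  have F0: "F 0 = 0" using F(2)[of 0 0] subspace_0[OF sV] by simp
  have Fsum: "F (\<Sum>b\<in>T'. c b *\<^sub>R b) = (\<Sum>b\<in>T'. c b * F b)" if "T' \<subseteq> T" for T' and c :: "_ \<Rightarrow> real"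
    using finite_subset[OF that fT] that
  proof (induction T' rule: finite_induct)
    case (insert a T')
    have "c a *\<^sub>R a \<in> V" "a \<in> V" using insert.prems T(1) subspace_scale[OF sV] by auto
    then show ?case using insert F(1)[of "c a *\<^sub>R a" "\<Sum>b\<in>T'. c b *\<^sub>R b"] F(2)[of a "c a"] sumV by auto
  qed (simp add: F0)
  have Asum: "A v (\<Sum>b\<in>T'. c b *\<^sub>R b) = (\<Sum>b\<in>T'. c b * A v b)" if "T' \<subseteq> T" "v \<in> V" for T' v and c :: "_ \<Rightarrow> real"
    using finite_subset[OF that(1) fT] that
  proof (induction T' rule: finite_induct)
    case (insert a T')
    have "c a *\<^sub>R a \<in> V" "a \<in> V" using insert.prems T(1) subspace_scale[OF sV] by auto
    then show ?case
      using insert sym_bilinearD(3)[OF A, of "c a *\<^sub>R a" "\<Sum>b\<in>T'. c b *\<^sub>R b" v] sym_bilinearD(5)[OF A, of v a "c a"] sumV by auto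
  qed (simp add: sym_bilinear_zero[OF A])
  have "\<exists>p\<in>V. \<forall>b\<in>T. A p b = F b"
  proof (rule finite_system_solvable[OF fT sV, of "\<lambda>b v. A v b"])
    fix b assume "b \<in> T"
    then have "b \<in> V" using T(1) by blast
    then show "(\<forall>x\<in>V. \<forall>y\<in>V. A (x + y) b = A x b + A y b) \<and> (\<forall>c. \<forall>x\<in>V. A (c *\<^sub>R x) b = c * A x b)"
      using sym_bilinearD(2,4)[OF A] by blast
  next
    fix c assume "\<forall>v\<in>V. (\<Sum>b\<in>T. c b * A v b) = 0"
    then have "\<forall>v\<in>V. A v (\<Sum>b\<in>T. c b *\<^sub>R b) = 0" using Asum by simp
    then have "F (\<Sum>b\<in>T. c b *\<^sub>R b) = 0" by (intro ker sumV) auto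
    then show "(\<Sum>b\<in>T. c b * F b) = 0" using Fsum by simp
  qed
  then obtain p where p: "p \<in> V" "\<And>b. b \<in> T \<Longrightarrow> A p b = F b" by blast
  have "A p z = F z" if z: "z \<in> V" for z
  proof -
    obtain c where c: "z = (\<Sum>b\<in>T. c b *\<^sub>R b)" using Tspan[OF z] by blast
    show ?thesis unfolding c using Asum[OF order_refl p(1)] Fsum p(2) by simp
  qed
  then show ?thesis using p(1) by blast
qed

text \<open>The orthogonal projection exists because the functional \<open>M p\<close> vanishes on the kernel of the
  seminorm by Cauchy and Schwarz.\<close>

lemma best_approximation_exists:
  assumes M: "sym_bilinear Z M" "\<And>z. z \<in> Z \<Longrightarrow> 0 \<le> M z z"
    and V: "subspace V" "V \<subseteq> Z" "finite S" "V \<subseteq> span S" and p: "p \<in> Z"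
  shows "\<exists>b\<in>V. \<forall>v\<in>V. sqrt (M (p - b) (p - b)) \<le> sqrt (M (p - v) (p - v))"
proof -
  have sZ: "subspace Z" by (rule sym_bilinear_subspace[OF M(1)])
  have MV: "sym_bilinear V M" by (rule sym_bilinear_subset[OF M(1) V(2,1)])
  have "\<exists>b\<in>V. \<forall>z\<in>V. M b z = M p z"
  proof (rule symmetric_form_solvable[OF MV V(3,4)])
    fix x y c assume x: "x \<in> V"
    show "M p (c *\<^sub>R x) = c * M p x" using sym_bilinearD(5)[OF M(1) p] x V(2) by blast
    assume y: "y \<in> V"
    show "M p (x + y) = M p x + M p y" using sym_bilinearD(3)[OF M(1) _ _ p] x y V(2) by blast
  next
    fix z assume z: "z \<in> V" "\<forall>v\<in>V. M v z = 0"
    then show "M p z = 0" using Cauchy_Schwarz_form[OF M p, of z] V(2) by fastforce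
  qed
  then obtain b where b: "b \<in> V" "\<And>z. z \<in> V \<Longrightarrow> M b z = M p z" by blast
  have "M (p - b) (p - b) \<le> M (p - v) (p - v)" if v: "v \<in> V" for v
  proof -
    have bv: "b - v \<in> V" using V(1) b(1) v subspace_diff by blast
    have in_Z: "b \<in> Z" "p - b \<in> Z" "b - v \<in> Z" using sZ p b bv V(2) subspace_diff by blast+
    have "M (p - b) (b - v) = 0"
      using sym_bilinear_diff(1)[OF M(1) p in_Z(1,3)] b(2)[OF bv] by simp
    moreover have "(p - b) + 1 *\<^sub>R (b - v) = p - v" by simp
    ultimately show ?thesis
      using sym_bilinear_quadratic[OF M(1) in_Z(2,3), of 1] M(2)[OF in_Z(3)] by simp
  qed
  then show ?thesis using b(1) by (intro bexI[of _ b]) auto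
qed

section \<open>Sobolev spaces as subspaces of the space of functions\<close>

instantiation "fun" :: (type, real_vector) real_vector
begin
definition scaleR_fun :: "real \<Rightarrow> ('a \<Rightarrow> 'b) \<Rightarrow> 'a \<Rightarrow> 'b" where "scaleR_fun r f = (\<lambda>x. r *\<^sub>R f x)"
instance
  by standard (auto simp: scaleR_fun_def fun_eq_iff scaleR_add_right scaleR_add_left)
end

text \<open>Fields then form a vector space, so that subspaces, spans and bases are available for the discrete
  spaces.\<close>

lemma fun_ops: "f + g = (\<lambda>x. f x + g x)" "r *\<^sub>R f = (\<lambda>x. r *\<^sub>R f x)" "0 = (\<lambda>x. 0)" "f - g = (\<lambda>x. f x - g x)"
  for f g :: "'a \<Rightarrow> 'b::real_vector"
  by (auto simp: plus_fun_def scaleR_fun_def zero_fun_def fun_diff_def)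

lemma subspace_L2: "subspace (L2 W :: ('a::euclidean_space \<Rightarrow> 'b::euclidean_space) set)"
  unfolding subspace_def fun_ops by (auto intro: L2_zero L2_add L2_scaleR)

lemma sym_bilinear_l2ip: "sym_bilinear (L2 W) (l2ip W :: ('a::euclidean_space \<Rightarrow> 'b::euclidean_space) \<Rightarrow> _)"
  unfolding sym_bilinear_def fun_ops l2ip_def
proof (intro conjI subspace_L2 ballI allI)
  fix f g k :: "'a \<Rightarrow> 'b" and c :: real assume f: "f \<in> L2 W" and g: "g \<in> L2 W"
  show "(\<integral>x. f x \<bullet> g x \<partial>lebesgue_on W) = (\<integral>x. g x \<bullet> f x \<partial>lebesgue_on W)" by (simp add: inner_commute)
  show "(\<integral>x. (c *\<^sub>R f x) \<bullet> g x \<partial>lebesgue_on W) = c * (\<integral>x. f x \<bullet> g x \<partial>lebesgue_on W)" by simp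
  assume k: "k \<in> L2 W"
  show "(\<integral>x. (f x + g x) \<bullet> k x \<partial>lebesgue_on W) = (\<integral>x. f x \<bullet> k x \<partial>lebesgue_on W) + (\<integral>x. g x \<bullet> k x \<partial>lebesgue_on W)"
    using L2_inner_integrable[OF f k] L2_inner_integrable[OF g k] by (simp add: inner_add_left)
qed

lemma l2ip_self: "l2ip W f f = (l2norm W f)\<^sup>2"
  unfolding l2ip_def l2norm_def by (simp add: dot_square_norm integral_nonneg_AE)

lemma l2norm_eq: "l2norm W f = sqrt (l2ip W f f)"
  unfolding l2ip_def l2norm_def by (simp add: dot_square_norm)

lemma l2norm_nonneg: "0 \<le> l2norm W f"
  unfolding l2norm_def by (simp add: integral_nonneg_AE)

lemma l2ip_bound: "f \<in> L2 W \<Longrightarrow> g \<in> L2 W \<Longrightarrow> \<bar>l2ip W f g\<bar> \<le> l2norm W f * l2norm W g"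
  using Cauchy_Schwarz_form[OF sym_bilinear_l2ip, of W f g] by (simp add: l2norm_eq[symmetric] l2ip_self l2norm_nonneg)

lemma l2norm_add_le: "f \<in> L2 W \<Longrightarrow> g \<in> L2 W \<Longrightarrow> l2norm W (\<lambda>x. f x + g x) \<le> l2norm W f + l2norm W g"
  using seminorm_triangle[OF sym_bilinear_l2ip, of W f g] by (simp add: l2norm_eq[symmetric] l2ip_self fun_ops l2norm_nonneg)

lemma l2norm_scaleR: "l2norm W (\<lambda>x. c *\<^sub>R f x) = \<bar>c\<bar> * l2norm W f"
  unfolding l2norm_def by (simp add: power_mult_distrib real_sqrt_mult)

lemma l2ip_cong_AE:
  assumes "f \<in> L2 W" "f' \<in> L2 W" "g \<in> L2 W" "g' \<in> L2 W"
    "AE x in lebesgue_on W. f x = f' x" "AE x in lebesgue_on W. g x = g' x"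
  shows "l2ip W f g = l2ip W f' g'"
  unfolding l2ip_def
  using assms L2_inner_integrable[OF assms(1,3)] L2_inner_integrable[OF assms(2,4)]
  by (intro integral_cong_AE) auto

lemma l2norm_cong_AE:
  assumes "f \<in> L2 W" "f' \<in> L2 W" "AE x in lebesgue_on W. f x = f' x"
  shows "l2norm W f = l2norm W f'"
  unfolding l2norm_eq using l2ip_cong_AE[OF assms(1,2) assms(1,2) assms(3,3)] by simp

lemma l2norm_zero_AE:
  assumes "f \<in> L2 W" "l2norm W f = 0" shows "AE x in lebesgue_on W. f x = 0"
proof -
  have "(\<integral>x. (norm (f x))\<^sup>2 \<partial>lebesgue_on W) = 0"
    using assms(2) by (simp add: l2norm_def integral_nonneg_AE)
  then show ?thesis
    using integral_nonneg_eq_0_iff_AE[OF L2_D(2)[OF assms(1)]] by simp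
qed

lemma l2norm_Linf_mult_le:
  assumes "\<zeta> \<in> Linf W"
  obtains C where "C \<ge> 0" "\<And>f. f \<in> L2 W \<Longrightarrow> l2norm W (\<lambda>x. \<zeta> x * f x) \<le> C * l2norm W f"
proof -
  obtain C where C: "AE x in lebesgue_on W. \<bar>\<zeta> x\<bar> \<le> C" using assms by (auto simp: Linf_def)
  have "l2norm W (\<lambda>x. \<zeta> x * f x) \<le> \<bar>C\<bar> * l2norm W f" if f: "f \<in> L2 W" for f
  proof -
    have "(\<integral>x. (norm (\<zeta> x * f x))\<^sup>2 \<partial>lebesgue_on W) \<le> (\<integral>x. C\<^sup>2 * (norm (f x))\<^sup>2 \<partial>lebesgue_on W)"
    proof (rule integral_mono_AE)
      show "integrable (lebesgue_on W) (\<lambda>x. (norm (\<zeta> x * f x))\<^sup>2)" by (rule L2_D(2)[OF L2_Linf_mult[OF f assms]])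
      show "integrable (lebesgue_on W) (\<lambda>x. C\<^sup>2 * (norm (f x))\<^sup>2)" using L2_D(2)[OF f] by simp
      show "AE x in lebesgue_on W. (norm (\<zeta> x * f x))\<^sup>2 \<le> C\<^sup>2 * (norm (f x))\<^sup>2"
        using C by eventually_elim (auto simp: power_mult_distrib intro!: mult_right_mono abs_le_square_iff[THEN iffD1])
    qed
    then have "sqrt (\<integral>x. (norm (\<zeta> x * f x))\<^sup>2 \<partial>lebesgue_on W) \<le> sqrt (C\<^sup>2 * (\<integral>x. (norm (f x))\<^sup>2 \<partial>lebesgue_on W))"
      by (intro real_sqrt_le_mono) simp
    then show ?thesis unfolding l2norm_def by (simp add: real_sqrt_mult)
  qed
  then show thesis by (intro that[of "\<bar>C\<bar>"]) auto
qed

lemma zero_H1: "(\<lambda>x. 0) \<in> H1 W"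
  unfolding H1_def has_weak_grad_def by (auto intro!: L2_zero exI[of _ "\<lambda>x. 0"])

lemma subspace_H1: assumes "open W" shows "subspace (H1 W)"
  unfolding subspace_def fun_ops
proof (intro conjI ballI allI zero_H1)
  fix u v :: "'a \<Rightarrow> real" and c :: real
  assume u: "u \<in> H1 W"
  show "(\<lambda>x. c *\<^sub>R u x) \<in> H1 W"
    using has_weak_grad_scaleR[OF has_weak_grad_wgrad[OF u], of c] L2_scaleR[of u W c] u by (auto simp: H1_def)
  assume v: "v \<in> H1 W"
  show "(\<lambda>x. u x + v x) \<in> H1 W"
    using has_weak_grad_add[OF assms _ _ has_weak_grad_wgrad[OF u] has_weak_grad_wgrad[OF v]] L2_add[of u W v] u v
    by (auto simp: H1_def)
qed

lemma wgrad_add_AE: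
  assumes "open W" "u \<in> H1 W" "v \<in> H1 W"
  shows "AE x in lebesgue_on W. wgrad W (u + v) x = wgrad W u x + wgrad W v x"
  unfolding fun_ops
  using assms by (intro wgrad_AE has_weak_grad_add has_weak_grad_wgrad) (auto simp: H1_def)

lemma wgrad_scaleR_AE:
  assumes "open W" "u \<in> H1 W"
  shows "AE x in lebesgue_on W. wgrad W (c *\<^sub>R u) x = c *\<^sub>R wgrad W u x"
  unfolding fun_ops real_scaleR_def
  using assms by (intro wgrad_AE has_weak_grad_scaleR has_weak_grad_wgrad)

definition Hdiv :: "'a::euclidean_space set \<Rightarrow> ('a \<Rightarrow> 'a) set" where
  "Hdiv W = {s \<in> L2 W. \<exists>g. has_weak_div W s g}"

lemma has_weak_div_wdiv: "s \<in> Hdiv W \<Longrightarrow> has_weak_div W s (wdiv W s)"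
  unfolding Hdiv_def wdiv_def by (auto intro: someI[of "has_weak_div W s"])

lemma wdiv_L2: "s \<in> Hdiv W \<Longrightarrow> wdiv W s \<in> L2 W"
  using has_weak_div_wdiv has_weak_div_def by blast

lemma subspace_Hdiv: assumes "open W" shows "subspace (Hdiv W)"
proof -
  have "has_weak_div W (\<lambda>x. 0) (\<lambda>x. 0)" unfolding has_weak_div_alt by (auto simp: L2_zero)
  then have z: "(\<lambda>x. 0) \<in> Hdiv W" by (auto simp: Hdiv_def L2_zero)
  show ?thesis
    unfolding subspace_def fun_ops
  proof (intro conjI ballI allI z)
    fix u v :: "'a \<Rightarrow> 'a" and c :: real
    assume u: "u \<in> Hdiv W"
    show "(\<lambda>x. c *\<^sub>R u x) \<in> Hdiv W"
      using has_weak_div_scaleR[OF has_weak_div_wdiv[OF u], of c] L2_scaleR[of u W c] u by (auto simp: Hdiv_def)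
    assume v: "v \<in> Hdiv W"
    show "(\<lambda>x. u x + v x) \<in> Hdiv W"
      using has_weak_div_add[OF assms _ _ has_weak_div_wdiv[OF u] has_weak_div_wdiv[OF v]] L2_add[of u W v] u v
      by (auto simp: Hdiv_def)
  qed
qed

lemma wdiv_add_AE:
  assumes "open W" "u \<in> Hdiv W" "v \<in> Hdiv W"
  shows "AE x in lebesgue_on W. wdiv W (u + v) x = wdiv W u x + wdiv W v x"
  unfolding fun_ops
  using assms by (intro wdiv_AE has_weak_div_add has_weak_div_wdiv) (auto simp: Hdiv_def)

lemma wdiv_scaleR_AE:
  assumes "open W" "u \<in> Hdiv W"
  shows "AE x in lebesgue_on W. wdiv W (c *\<^sub>R u) x = c *\<^sub>R wdiv W u x"
  unfolding fun_ops real_scaleR_def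
  using assms by (intro wdiv_AE has_weak_div_scaleR has_weak_div_wdiv)

section \<open>Traces and the Friedrichs inequality\<close>

text \<open>Linearity of the gradient holds only almost everywhere; the inner product does not notice.\<close>

lemma sym_bilinear_h1:
  assumes "open W"
  shows "sym_bilinear (H1 W) (\<lambda>u v. l2ip W u v + l2ip W (wgrad W u) (wgrad W v))"
  unfolding sym_bilinear_def
proof (intro conjI subspace_H1[OF assms] ballI allI)
  note L = sym_bilinearD[OF sym_bilinear_l2ip[of W]]
  have H: "u \<in> L2 W" if "u \<in> H1 W" for u :: "'a \<Rightarrow> real" using that by (simp add: H1_def)
  fix u v w :: "'a \<Rightarrow> real" and c :: real assume u: "u \<in> H1 W" and v: "v \<in> H1 W"
  have cu: "c *\<^sub>R u \<in> H1 W" using subspace_H1[OF assms] u subspace_scale by blast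
  show "l2ip W u v + l2ip W (wgrad W u) (wgrad W v) = l2ip W v u + l2ip W (wgrad W v) (wgrad W u)"
    using L(1)[OF H[OF u] H[OF v]] L(1)[OF wgrad_L2[OF u] wgrad_L2[OF v]] by simp
  have "l2ip W (wgrad W (c *\<^sub>R u)) (wgrad W v) = l2ip W (c *\<^sub>R wgrad W u) (wgrad W v)"
    using wgrad_scaleR_AE[OF assms u, of c] wgrad_L2[OF u] wgrad_L2[OF v] wgrad_L2[OF cu] subspace_scale[OF subspace_L2]
    by (intro l2ip_cong_AE) (auto simp: fun_ops(2))
  then show "l2ip W (c *\<^sub>R u) v + l2ip W (wgrad W (c *\<^sub>R u)) (wgrad W v) = c * (l2ip W u v + l2ip W (wgrad W u) (wgrad W v))"
    using L(4)[OF H[OF u] H[OF v]] L(4)[OF wgrad_L2[OF u] wgrad_L2[OF v]] by (simp add: distrib_left)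
  assume w: "w \<in> H1 W"
  have uv: "u + v \<in> H1 W" using subspace_H1[OF assms] u v subspace_add by blast
  have "l2ip W (wgrad W (u + v)) (wgrad W w) = l2ip W (wgrad W u + wgrad W v) (wgrad W w)"
    using wgrad_add_AE[OF assms u v] wgrad_L2[OF u] wgrad_L2[OF v] wgrad_L2[OF w] wgrad_L2[OF uv] subspace_add[OF subspace_L2]
    by (intro l2ip_cong_AE) (auto simp: fun_ops(1))
  then show "l2ip W (u + v) w + l2ip W (wgrad W (u + v)) (wgrad W w) =
      l2ip W u w + l2ip W (wgrad W u) (wgrad W w) + (l2ip W v w + l2ip W (wgrad W v) (wgrad W w))"
    using L(2)[OF H[OF u] H[OF v] H[OF w]] L(2)[OF wgrad_L2[OF u] wgrad_L2[OF v] wgrad_L2[OF w]] by simp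
qed

lemma h1norm_eq: "h1norm W u = sqrt (l2ip W u u + l2ip W (wgrad W u) (wgrad W u))"
  by (simp add: h1norm_def l2ip_self)

lemma h1norm_triangle:
  assumes "open W" "u \<in> H1 W" "v \<in> H1 W" shows "h1norm W (u + v) \<le> h1norm W u + h1norm W v"
  unfolding h1norm_eq
  by (rule seminorm_triangle[OF sym_bilinear_h1[OF assms(1)] _ assms(2,3)]) (simp add: l2ip_self)

lemma h1norm_scaleR:
  assumes "open W" "u \<in> H1 W" shows "h1norm W (c *\<^sub>R u) = \<bar>c\<bar> * h1norm W u"
proof -
  have "c *\<^sub>R u \<in> H1 W" using subspace_H1[OF assms(1)] assms(2) subspace_scale by blast
  then have "l2ip W (c *\<^sub>R u) (c *\<^sub>R u) + l2ip W (wgrad W (c *\<^sub>R u)) (wgrad W (c *\<^sub>R u))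
      = c * (c * (l2ip W u u + l2ip W (wgrad W u) (wgrad W u)))"
    using sym_bilinearD(4)[OF sym_bilinear_h1[OF assms(1)] assms(2), of "c *\<^sub>R u" c]
      sym_bilinearD(5)[OF sym_bilinear_h1[OF assms(1)] assms(2) assms(2), of c] by simp
  then show ?thesis unfolding h1norm_eq
    by (simp add: real_sqrt_mult mult.assoc[symmetric] flip: power2_eq_square)
qed

lemma h1norm_nonneg: "0 \<le> h1norm W u" by (simp add: h1norm_def)

lemma has_trace_add:
  assumes W: "open W" "bounded W" and v: "has_trace W v g" "has_trace W v' g'"
  shows "has_trace W (v + v') (\<lambda>x. g x + g' x)"
proof -
  note [measurable_cong] = sets_surface_measure
  have H: "v \<in> H1 W" "v' \<in> H1 W" and [measurable]: "g \<in> borel_measurable borel" "g' \<in> borel_measurable borel"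
    using v by (auto simp: has_trace_def)
  obtain \<phi> where \<phi>: "\<And>n. smooth (\<phi> n)" "(\<lambda>n. h1norm W (\<phi> n - v)) \<longlonglongrightarrow> 0"
    "(\<lambda>n. \<integral>\<^sup>+x\<in>frontier W. ennreal ((\<phi> n x - g x)\<^sup>2) \<partial>surface_measure) \<longlonglongrightarrow> 0"
    using v(1) by (auto simp: has_trace_def)
  obtain \<psi> where \<psi>: "\<And>n. smooth (\<psi> n)" "(\<lambda>n. h1norm W (\<psi> n - v')) \<longlonglongrightarrow> 0"
    "(\<lambda>n. \<integral>\<^sup>+x\<in>frontier W. ennreal ((\<psi> n x - g' x)\<^sup>2) \<partial>surface_measure) \<longlonglongrightarrow> 0"
    using v(2) by (auto simp: has_trace_def)
  have [measurable]: "\<phi> n \<in> borel_measurable borel" "\<psi> n \<in> borel_measurable borel" for n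
    by (auto intro!: borel_measurable_continuous_onI smooth_continuous \<phi> \<psi>)
  have fr[measurable]: "frontier W \<in> sets borel" by simp
  have sm: "smooth (\<phi> n + \<psi> n)" for n unfolding fun_ops by (rule smooth_add[OF \<phi>(1) \<psi>(1)])
  have "(\<lambda>n. h1norm W ((\<phi> n + \<psi> n) - (v + v'))) \<longlonglongrightarrow> 0"
  proof (rule tendsto_sandwich[OF _ _ tendsto_const])
    show "(\<lambda>n. h1norm W (\<phi> n - v) + h1norm W (\<psi> n - v')) \<longlonglongrightarrow> 0" using tendsto_add[OF \<phi>(2) \<psi>(2)] by simp
    have "h1norm W ((\<phi> n + \<psi> n) - (v + v')) \<le> h1norm W (\<phi> n - v) + h1norm W (\<psi> n - v')" for n
    proof -
      have "\<phi> n - v \<in> H1 W" "\<psi> n - v' \<in> H1 W"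
        using subspace_diff[OF subspace_H1[OF W(1)]] smooth_H1[OF W] \<phi> \<psi> H by blast+
      from h1norm_triangle[OF W(1) this] show ?thesis by (simp add: algebra_simps)
    qed
    then show "\<forall>\<^sub>F n in sequentially. h1norm W ((\<phi> n + \<psi> n) - (v + v')) \<le> h1norm W (\<phi> n - v) + h1norm W (\<psi> n - v')" by simp
  qed (simp add: h1norm_nonneg)
  moreover have "(\<lambda>n. \<integral>\<^sup>+x\<in>frontier W. ennreal (((\<phi> n + \<psi> n) x - (g x + g' x))\<^sup>2) \<partial>surface_measure) \<longlonglongrightarrow> 0"
  proof (rule tendsto_sandwich[OF _ _ tendsto_const])
    show "(\<lambda>n. 2 * (\<integral>\<^sup>+x\<in>frontier W. ennreal ((\<phi> n x - g x)\<^sup>2) \<partial>surface_measure)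
          + 2 * (\<integral>\<^sup>+x\<in>frontier W. ennreal ((\<psi> n x - g' x)\<^sup>2) \<partial>surface_measure)) \<longlonglongrightarrow> 0"
      using tendsto_add[OF ennreal_tendsto_cmult[OF _ \<phi>(3), of 2] ennreal_tendsto_cmult[OF _ \<psi>(3), of 2]] by simp
    have "(\<integral>\<^sup>+x\<in>frontier W. ennreal (((\<phi> n + \<psi> n) x - (g x + g' x))\<^sup>2) \<partial>surface_measure)
       \<le> 2 * (\<integral>\<^sup>+x\<in>frontier W. ennreal ((\<phi> n x - g x)\<^sup>2) \<partial>surface_measure)
          + 2 * (\<integral>\<^sup>+x\<in>frontier W. ennreal ((\<psi> n x - g' x)\<^sup>2) \<partial>surface_measure)" for n
    proof -
      have "(\<integral>\<^sup>+x\<in>frontier W. ennreal (((\<phi> n + \<psi> n) x - (g x + g' x))\<^sup>2) \<partial>surface_measure)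
        \<le> (\<integral>\<^sup>+x. 2 * (ennreal ((\<phi> n x - g x)\<^sup>2) * indicator (frontier W) x)
              + 2 * (ennreal ((\<psi> n x - g' x)\<^sup>2) * indicator (frontier W) x) \<partial>surface_measure)"
      proof (rule nn_integral_mono)
        fix x
        have "((\<phi> n + \<psi> n) x - (g x + g' x))\<^sup>2 \<le> 2 * (\<phi> n x - g x)\<^sup>2 + 2 * (\<psi> n x - g' x)\<^sup>2"
          using zero_le_power2[of "(\<phi> n x - g x) - (\<psi> n x - g' x)"] by (simp add: power2_eq_square algebra_simps)
        then have "ennreal (((\<phi> n + \<psi> n) x - (g x + g' x))\<^sup>2) \<le> 2 * ennreal ((\<phi> n x - g x)\<^sup>2) + 2 * ennreal ((\<psi> n x - g' x)\<^sup>2)"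
          by (simp add: ennreal_mult'[symmetric] ennreal_plus[symmetric] ennreal_leI flip: ennreal_numeral del: ennreal_plus)
        then show "ennreal (((\<phi> n + \<psi> n) x - (g x + g' x))\<^sup>2) * indicator (frontier W) x
          \<le> 2 * (ennreal ((\<phi> n x - g x)\<^sup>2) * indicator (frontier W) x)
              + 2 * (ennreal ((\<psi> n x - g' x)\<^sup>2) * indicator (frontier W) x)"
          by (auto simp: indicator_def)
      qed
      also have "\<dots> = 2 * (\<integral>\<^sup>+x\<in>frontier W. ennreal ((\<phi> n x - g x)\<^sup>2) \<partial>surface_measure)
          + 2 * (\<integral>\<^sup>+x\<in>frontier W. ennreal ((\<psi> n x - g' x)\<^sup>2) \<partial>surface_measure)"
        by (subst nn_integral_add, measurable) (simp add: nn_integral_cmult)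
      finally show ?thesis .
    qed
    then show "\<forall>\<^sub>F n in sequentially. (\<integral>\<^sup>+x\<in>frontier W. ennreal (((\<phi> n + \<psi> n) x - (g x + g' x))\<^sup>2) \<partial>surface_measure)
       \<le> 2 * (\<integral>\<^sup>+x\<in>frontier W. ennreal ((\<phi> n x - g x)\<^sup>2) \<partial>surface_measure)
          + 2 * (\<integral>\<^sup>+x\<in>frontier W. ennreal ((\<psi> n x - g' x)\<^sup>2) \<partial>surface_measure)" by simp
  qed simp
  ultimately show ?thesis
    unfolding has_trace_def using subspace_add[OF subspace_H1[OF W(1)] H] sm
    by (intro conjI exI[of _ "\<lambda>n. \<phi> n + \<psi> n"] allI) auto
qed

lemma has_trace_scaleR:
  assumes W: "open W" "bounded W" and v: "has_trace W v g"
  shows "has_trace W (c *\<^sub>R v) (\<lambda>x. c * g x)"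
proof -
  note [measurable_cong] = sets_surface_measure
  have H: "v \<in> H1 W" and [measurable]: "g \<in> borel_measurable borel"
    using v by (auto simp: has_trace_def)
  obtain \<phi> where \<phi>: "\<And>n. smooth (\<phi> n)" "(\<lambda>n. h1norm W (\<phi> n - v)) \<longlonglongrightarrow> 0"
    "(\<lambda>n. \<integral>\<^sup>+x\<in>frontier W. ennreal ((\<phi> n x - g x)\<^sup>2) \<partial>surface_measure) \<longlonglongrightarrow> 0"
    using v(1) by (auto simp: has_trace_def)
  have [measurable]: "\<phi> n \<in> borel_measurable borel" for n
    by (auto intro!: borel_measurable_continuous_onI smooth_continuous \<phi>)
  have [measurable]: "frontier W \<in> sets borel" by simp
  have "smooth (c *\<^sub>R \<phi> n)" for n unfolding fun_ops real_scaleR_def by (rule smooth_mult[OF smooth_const \<phi>(1)])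
  moreover have "(\<lambda>n. h1norm W (c *\<^sub>R \<phi> n - c *\<^sub>R v)) \<longlonglongrightarrow> 0"
  proof -
    have "h1norm W (c *\<^sub>R \<phi> n - c *\<^sub>R v) = \<bar>c\<bar> * h1norm W (\<phi> n - v)" for n
    proof -
      have "\<phi> n - v \<in> H1 W" using subspace_diff[OF subspace_H1[OF W(1)]] smooth_H1[OF W] \<phi> H by blast
      from h1norm_scaleR[OF W(1) this, of c] show ?thesis by (simp add: scaleR_diff_right)
    qed
    then show ?thesis using tendsto_mult_left[OF \<phi>(2), of "\<bar>c\<bar>"] by simp
  qed
  moreover have "(\<lambda>n. \<integral>\<^sup>+x\<in>frontier W. ennreal (((c *\<^sub>R \<phi> n) x - c * g x)\<^sup>2) \<partial>surface_measure) \<longlonglongrightarrow> 0"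
  proof -
    have "(\<integral>\<^sup>+x\<in>frontier W. ennreal (((c *\<^sub>R \<phi> n) x - c * g x)\<^sup>2) \<partial>surface_measure)
       = ennreal (c\<^sup>2) * (\<integral>\<^sup>+x\<in>frontier W. ennreal ((\<phi> n x - g x)\<^sup>2) \<partial>surface_measure)" for n
    proof -
      have "ennreal (((c *\<^sub>R \<phi> n) x - c * g x)\<^sup>2) = ennreal (c\<^sup>2) * ennreal ((\<phi> n x - g x)\<^sup>2)" for x
        by (simp add: fun_ops right_diff_distrib[symmetric] power_mult_distrib ennreal_mult)
      then show ?thesis by (subst nn_integral_cmult[symmetric]) (measurable, simp add: mult.assoc)
    qed
    then show ?thesis using ennreal_tendsto_cmult[OF _ \<phi>(3), of "ennreal (c\<^sup>2)"] by simp
  qed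
  ultimately show ?thesis
    unfolding has_trace_def using subspace_scale[OF subspace_H1[OF W(1)] H, of c]
    by (intro conjI exI[of _ "\<lambda>n. c *\<^sub>R \<phi> n"] allI) auto
qed

lemma h1norm_zero: assumes "open W" shows "h1norm W 0 = 0"
  using h1norm_scaleR[OF assms zero_H1, of 0] by (simp add: fun_ops)

lemma has_trace_smooth:
  assumes "open W" "bounded W" "smooth \<phi>" shows "has_trace W \<phi> \<phi>"
  unfolding has_trace_def
  using smooth_H1[OF assms] borel_measurable_continuous_onI[OF smooth_continuous[OF assms(3)]]
  by (intro conjI exI[of _ "\<lambda>n. \<phi>"]) (auto simp: assms h1norm_zero)

lemma subspace_H1D:
  assumes W: "open W" "bounded W" shows "subspace (H1D W \<Gamma>)"
  unfolding subspace_def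
proof (intro conjI ballI allI)
  have "has_trace W 0 (\<lambda>x. 0)" using has_trace_smooth[OF W smooth_const[of 0]] by (simp add: fun_ops)
  then show "0 \<in> H1D W \<Gamma>" unfolding H1D_def vanishes_on_def using subspace_0[OF subspace_H1[OF W(1)]] by auto
  fix v v' c assume "v \<in> H1D W \<Gamma>"
  then obtain g where g: "v \<in> H1 W" "has_trace W v g" "AE x in surface_measure. x \<in> \<Gamma> \<longrightarrow> g x = 0"
    by (auto simp: H1D_def vanishes_on_def)
  have "AE x in surface_measure. x \<in> \<Gamma> \<longrightarrow> c * g x = 0" using g(3) by eventually_elim auto
  then show "c *\<^sub>R v \<in> H1D W \<Gamma>"
    using has_trace_scaleR[OF W g(2), of c] subspace_scale[OF subspace_H1[OF W(1)] g(1), of c]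
    by (auto simp: H1D_def vanishes_on_def)
  assume "v' \<in> H1D W \<Gamma>"
  then obtain g' where g': "v' \<in> H1 W" "has_trace W v' g'" "AE x in surface_measure. x \<in> \<Gamma> \<longrightarrow> g' x = 0"
    by (auto simp: H1D_def vanishes_on_def)
  have "AE x in surface_measure. x \<in> \<Gamma> \<longrightarrow> g x + g' x = 0" using g(3) g'(3) by eventually_elim auto
  then show "v + v' \<in> H1D W \<Gamma>"
    using has_trace_add[OF W g(2) g'(2)] subspace_add[OF subspace_H1[OF W(1)] g(1) g'(1)]
    by (auto simp: H1D_def vanishes_on_def)
qed

lemma test_function_H1D:
  assumes W: "open W" "bounded W" and \<Gamma>: "\<Gamma> \<subseteq> frontier W" and t: "test_function W \<phi>"
  shows "\<phi> \<in> H1D W \<Gamma>"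
proof -
  obtain K where K: "smooth \<phi>" "compact K" "K \<subseteq> W" "\<And>x. x \<notin> K \<Longrightarrow> \<phi> x = 0"
    "\<And>x. x \<notin> K \<Longrightarrow> grad \<phi> x = 0" using test_functionE[OF t] by blast
  have "\<phi> x = 0" if "x \<in> \<Gamma>" for x
  proof -
    have "x \<notin> W" using that \<Gamma> W(1) by (auto simp: frontier_def interior_open)
    then show ?thesis using K by blast
  qed
  then have z: "AE x in surface_measure. x \<in> \<Gamma> \<longrightarrow> \<phi> x = 0" by (intro AE_I2) simp
  show ?thesis unfolding H1D_def vanishes_on_def mem_Collect_eq
    by (intro conjI exI[of _ \<phi>] smooth_H1[OF W K(1)] has_trace_smooth[OF W K(1)] z)
qed

lemma sq_int_eq_l2norm:
  fixes f :: "'a::euclidean_space \<Rightarrow> 'b::euclidean_space"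
  assumes "f \<in> borel_measurable borel" "f \<in> L2 W" "open W"
  shows "sq_int f W = ennreal ((l2norm W f)\<^sup>2)"
proof -
  note [measurable] = assms(1)
  have [measurable]: "W \<in> sets borel" using assms(3) by simp
  have "sq_int f W = (\<integral>\<^sup>+x. ennreal ((norm (f x))\<^sup>2) * indicator W x \<partial>lebesgue)"
    unfolding sq_int_def by (rule nn_integral_completion[symmetric])
  also have "\<dots> = (\<integral>\<^sup>+x. ennreal ((norm (f x))\<^sup>2) \<partial>lebesgue_on W)"
    by (rule nn_integral_restrict_space[symmetric]) (simp add: sets_lebesgue_open assms)
  also have "\<dots> = ennreal (\<integral>x. (norm (f x))\<^sup>2 \<partial>lebesgue_on W)"
    by (rule nn_integral_eq_integral[OF L2_D(2)[OF assms(2)]]) simp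
  also have "\<dots> = ennreal ((l2norm W f)\<^sup>2)"
    by (simp add: l2norm_def integral_nonneg_AE)
  finally show ?thesis .
qed

text \<open>The inequality for smooth functions passes to the limit in the definition of the trace: the norms
  and the boundary integrals converge along the approximating sequence.\<close>

theorem poincare_H1D:
  fixes W \<Gamma> :: "'a::euclidean_space set"
  assumes W: "regular_domain W" and \<Gamma>: "dirichlet_part W \<Gamma>"
  obtains C where "C \<ge> 0" "\<And>v. v \<in> H1D W \<Gamma> \<Longrightarrow> l2norm W v \<le> C * l2norm W (wgrad W v)"
proof -
  have W': "open W" "bounded W" using W by (auto simp: regular_domain_def)
  have \<Gamma>': "\<Gamma> \<in> sets borel" "\<Gamma> \<subseteq> frontier W" using \<Gamma> by (auto simp: dirichlet_part_def)
  note [measurable_cong] = sets_surface_measure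
  obtain C where C: "C \<ge> 0" "\<And>f. smooth f \<Longrightarrow>
     sq_int f W \<le> ennreal C * (sq_int (grad f) W + (\<integral>\<^sup>+x\<in>\<Gamma>. ennreal ((f x)\<^sup>2) \<partial>surface_measure))"
    using poincare_smooth[OF W \<Gamma>] by blast
  have "l2norm W v \<le> sqrt C * l2norm W (wgrad W v)" if v: "v \<in> H1D W \<Gamma>" for v
  proof -
    obtain g where g: "v \<in> H1 W" "has_trace W v g" "AE x in surface_measure. x \<in> \<Gamma> \<longrightarrow> g x = 0"
      using v by (auto simp: H1D_def vanishes_on_def)
    obtain \<phi> where \<phi>: "\<And>n. smooth (\<phi> n)" "(\<lambda>n. h1norm W (\<phi> n - v)) \<longlonglongrightarrow> 0"
      "(\<lambda>n. \<integral>\<^sup>+x\<in>frontier W. ennreal ((\<phi> n x - g x)\<^sup>2) \<partial>surface_measure) \<longlonglongrightarrow> 0"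
      using g(2) by (auto simp: has_trace_def)
    define S where "S n = (\<integral>\<^sup>+x\<in>\<Gamma>. ennreal ((\<phi> n x)\<^sup>2) \<partial>surface_measure)" for n
    have S: "S \<longlonglongrightarrow> 0"
    proof (rule tendsto_sandwich[OF _ _ tendsto_const \<phi>(3)])
      have "S n \<le> (\<integral>\<^sup>+x\<in>frontier W. ennreal ((\<phi> n x - g x)\<^sup>2) \<partial>surface_measure)" for n
        unfolding S_def using g(3)
        by (intro nn_integral_mono_AE, elim eventually_mono) (use \<Gamma>'(2) in \<open>auto simp: indicator_def\<close>)
      then show "\<forall>\<^sub>F n in sequentially. S n \<le> (\<integral>\<^sup>+x\<in>frontier W. ennreal ((\<phi> n x - g x)\<^sup>2) \<partial>surface_measure)" by simp
    qed simp
    have H: "\<phi> n \<in> H1 W" "\<phi> n - v \<in> H1 W" for n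
      using subspace_diff[OF subspace_H1[OF W'(1)]] smooth_H1[OF W'] \<phi>(1) g(1) by blast+
    have inL2: "u \<in> L2 W" if "u \<in> H1 W" for u :: "'a \<Rightarrow> real" using that by (simp add: H1_def)
    have d1: "\<bar>l2norm W (\<phi> n) - l2norm W v\<bar> \<le> h1norm W (\<phi> n - v)" for n
    proof -
      have "l2norm W (\<phi> n) \<le> l2norm W (\<phi> n - v) + l2norm W v"
        using l2norm_add_le[OF inL2[OF H(2)] inL2[OF g(1)], of n] by (simp add: fun_ops)
      moreover have "l2norm W v \<le> l2norm W (\<phi> n) + l2norm W (\<phi> n - v)"
        using l2norm_add_le[OF inL2[OF H(1)] L2_scaleR[OF inL2[OF H(2)], of "-1"], of n n]
        by (simp only: l2norm_scaleR) (simp add: fun_ops)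
      moreover have "l2norm W (\<phi> n - v) \<le> h1norm W (\<phi> n - v)"
        unfolding h1norm_def by (rule real_le_rsqrt) simp
      ultimately show ?thesis by linarith
    qed
    have d2: "\<bar>l2norm W (grad (\<phi> n)) - l2norm W (wgrad W v)\<bar> \<le> h1norm W (\<phi> n - v)" for n
    proof -
      let ?d = "wgrad W (\<phi> n - v)"
      have L: "?d \<in> L2 W" "wgrad W v \<in> L2 W" "grad (\<phi> n) \<in> L2 W"
        using wgrad_L2[OF H(2)] wgrad_L2[OF g(1)] has_weak_grad_smooth[OF W' \<phi>(1)] by (auto simp: has_weak_grad_def)
      have ae: "AE x in lebesgue_on W. grad (\<phi> n) x = ?d x + wgrad W v x"
        using wgrad_add_AE[OF W'(1) H(2)[of n] g(1)] wgrad_smooth_AE[OF W' \<phi>(1)[of n]]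
        by eventually_elim simp
      have "l2norm W (grad (\<phi> n)) = l2norm W (\<lambda>x. ?d x + wgrad W v x)"
        by (rule l2norm_cong_AE[OF L(3) L2_add[OF L(1,2)] ae])
      then have "l2norm W (grad (\<phi> n)) \<le> l2norm W ?d + l2norm W (wgrad W v)"
        using l2norm_add_le[OF L(1,2)] by simp
      moreover have "l2norm W (wgrad W v) = l2norm W (\<lambda>x. grad (\<phi> n) x + (-1) *\<^sub>R ?d x)"
        by (rule l2norm_cong_AE[OF L(2) L2_add[OF L(3) L2_scaleR[OF L(1)]]]) (use ae in \<open>auto elim!: eventually_mono\<close>)
      then have "l2norm W (wgrad W v) \<le> l2norm W (grad (\<phi> n)) + l2norm W ?d"
        using l2norm_add_le[OF L(3) L2_scaleR[OF L(1), of "-1"]] unfolding l2norm_scaleR by simp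
      moreover have "l2norm W ?d \<le> h1norm W (\<phi> n - v)"
        unfolding h1norm_def by (rule real_le_rsqrt) simp
      ultimately show ?thesis by linarith
    qed
    have lim1: "(\<lambda>n. l2norm W (\<phi> n)) \<longlonglongrightarrow> l2norm W v"
      by (rule LIM_zero_cancel, rule Lim_null_comparison[OF _ \<phi>(2)]) (use d1 in simp)
    have lim2: "(\<lambda>n. l2norm W (grad (\<phi> n))) \<longlonglongrightarrow> l2norm W (wgrad W v)"
      by (rule LIM_zero_cancel, rule Lim_null_comparison[OF _ \<phi>(2)]) (use d2 in simp)
    have le: "ennreal ((l2norm W (\<phi> n))\<^sup>2) \<le> ennreal C * (ennreal ((l2norm W (grad (\<phi> n)))\<^sup>2) + S n)" for n
    proof -
      have "sq_int (\<phi> n) W = ennreal ((l2norm W (\<phi> n))\<^sup>2)"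
        by (rule sq_int_eq_l2norm[OF _ inL2[OF H(1)] W'(1)]) (intro borel_measurable_continuous_onI smooth_continuous \<phi>)
      moreover have "sq_int (grad (\<phi> n)) W = ennreal ((l2norm W (grad (\<phi> n)))\<^sup>2)"
        using has_weak_grad_smooth[OF W' \<phi>(1)]
        by (intro sq_int_eq_l2norm W' borel_measurable_continuous_onI smooth_grad_continuous \<phi>) (simp add: has_weak_grad_def)
      ultimately show ?thesis using C(2)[OF \<phi>(1)[of n]] by (simp add: S_def)
    qed
    have "(\<lambda>n. ennreal ((l2norm W (grad (\<phi> n)))\<^sup>2) + S n) \<longlonglongrightarrow> ennreal ((l2norm W (wgrad W v))\<^sup>2) + 0"
      by (intro tendsto_add tendsto_ennrealI tendsto_power lim2 S)
    then have lim_r: "(\<lambda>n. ennreal C * (ennreal ((l2norm W (grad (\<phi> n)))\<^sup>2) + S n))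
        \<longlonglongrightarrow> ennreal C * (ennreal ((l2norm W (wgrad W v))\<^sup>2) + 0)"
      by (intro ennreal_tendsto_cmult) auto
    have lim_l: "(\<lambda>n. ennreal ((l2norm W (\<phi> n))\<^sup>2)) \<longlonglongrightarrow> ennreal ((l2norm W v)\<^sup>2)"
      by (intro tendsto_ennrealI tendsto_power lim1)
    have "ennreal ((l2norm W v)\<^sup>2) \<le> ennreal C * (ennreal ((l2norm W (wgrad W v))\<^sup>2) + 0)"
      by (rule LIMSEQ_le[OF lim_l lim_r]) (use le in auto)
    then have "(l2norm W v)\<^sup>2 \<le> C * (l2norm W (wgrad W v))\<^sup>2"
      using C(1) by (simp add: ennreal_mult[symmetric])
    then have "sqrt ((l2norm W v)\<^sup>2) \<le> sqrt (C * (l2norm W (wgrad W v))\<^sup>2)" by (rule real_sqrt_le_mono)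
    then show ?thesis by (simp add: real_sqrt_mult l2norm_nonneg)
  qed
  then show thesis using C(1) by (intro that[of "sqrt C"]) auto
qed

section \<open>Bilinear forms bounded uniformly in the mesh size\<close>

text \<open>A family of maps into \<open>L\<^sup>2\<close>, indexed by the mesh size, that are linear almost everywhere and
  bounded by \<open>N\<close> with one constant for all indices. Every term of the stabilized Lagrangian is an inner
  product of two such maps, so that symmetry, bilinearity and uniform continuity of the forms follow
  from closure properties.\<close>

definition L2op :: "'a::euclidean_space set \<Rightarrow> 'i set \<Rightarrow> 'w::real_vector set \<Rightarrow> ('i \<Rightarrow> 'w \<Rightarrow> real)
    \<Rightarrow> ('i \<Rightarrow> 'w \<Rightarrow> 'a \<Rightarrow> 'b::euclidean_space) \<Rightarrow> bool" where
  "L2op \<Omega> H W N \<phi> \<longleftrightarrow>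
     (\<forall>h\<in>H. \<forall>w\<in>W. \<phi> h w \<in> L2 \<Omega> \<and>
        (\<forall>w'\<in>W. AE x in lebesgue_on \<Omega>. \<phi> h (w + w') x = \<phi> h w x + \<phi> h w' x) \<and>
        (\<forall>c. AE x in lebesgue_on \<Omega>. \<phi> h (c *\<^sub>R w) x = c *\<^sub>R \<phi> h w x)) \<and>
     (\<exists>C\<ge>0. \<forall>h\<in>H. \<forall>w\<in>W. l2norm \<Omega> (\<phi> h w) \<le> C * N h w)"

lemma L2opD:
  assumes "L2op \<Omega> H W N \<phi>" "h \<in> H" "w \<in> W"
  shows "\<phi> h w \<in> L2 \<Omega>" "w' \<in> W \<Longrightarrow> AE x in lebesgue_on \<Omega>. \<phi> h (w + w') x = \<phi> h w x + \<phi> h w' x"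
    "AE x in lebesgue_on \<Omega>. \<phi> h (c *\<^sub>R w) x = c *\<^sub>R \<phi> h w x"
  using assms unfolding L2op_def by blast+

lemma L2op_bound:
  assumes "L2op \<Omega> H W N \<phi>"
  obtains C where "C \<ge> 0" "\<And>h w. h \<in> H \<Longrightarrow> w \<in> W \<Longrightarrow> l2norm \<Omega> (\<phi> h w) \<le> C * N h w"
  using assms unfolding L2op_def by blast

lemma L2op_add:
  assumes "L2op \<Omega> H W N \<phi>" "L2op \<Omega> H W N \<psi>"
  shows "L2op \<Omega> H W N (\<lambda>h w x. \<phi> h w x + \<psi> h w x)"
  unfolding L2op_def
proof (intro conjI ballI allI)
  fix h w assume h: "h \<in> H" and w: "w \<in> W"
  note a = L2opD[OF assms(1) h w] and b = L2opD[OF assms(2) h w]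
  show "(\<lambda>x. \<phi> h w x + \<psi> h w x) \<in> L2 \<Omega>" by (rule L2_add[OF a(1) b(1)])
  fix c show "AE x in lebesgue_on \<Omega>. \<phi> h (c *\<^sub>R w) x + \<psi> h (c *\<^sub>R w) x = c *\<^sub>R (\<phi> h w x + \<psi> h w x)"
    using a(3)[of c] b(3)[of c] by eventually_elim (simp add: scaleR_add_right)
next
  fix h w w' assume h: "h \<in> H" and w: "w \<in> W" and w': "w' \<in> W"
  show "AE x in lebesgue_on \<Omega>. \<phi> h (w + w') x + \<psi> h (w + w') x = \<phi> h w x + \<psi> h w x + (\<phi> h w' x + \<psi> h w' x)"
    using L2opD(2)[OF assms(1) h w w'] L2opD(2)[OF assms(2) h w w'] by eventually_elim simp
next
  obtain C where C: "C \<ge> 0" "\<And>h w. h \<in> H \<Longrightarrow> w \<in> W \<Longrightarrow> l2norm \<Omega> (\<phi> h w) \<le> C * N h w" using L2op_bound[OF assms(1)] by blast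
  obtain D where D: "D \<ge> 0" "\<And>h w. h \<in> H \<Longrightarrow> w \<in> W \<Longrightarrow> l2norm \<Omega> (\<psi> h w) \<le> D * N h w" using L2op_bound[OF assms(2)] by blast
  have "l2norm \<Omega> (\<lambda>x. \<phi> h w x + \<psi> h w x) \<le> (C + D) * N h w" if "h \<in> H" "w \<in> W" for h w
    using l2norm_add_le[OF L2opD(1)[OF assms(1) that] L2opD(1)[OF assms(2) that]] C(2)[OF that] D(2)[OF that]
    by (simp add: distrib_right)
  then show "\<exists>C\<ge>0. \<forall>h\<in>H. \<forall>w\<in>W. l2norm \<Omega> (\<lambda>x. \<phi> h w x + \<psi> h w x) \<le> C * N h w"
    using C(1) D(1) by (intro exI[of _ "C + D"]) auto
qed

lemma L2op_scaleR:
  assumes "L2op \<Omega> H W N \<phi>" "\<And>h. h \<in> H \<Longrightarrow> \<bar>k h\<bar> \<le> M" "\<And>h w. h \<in> H \<Longrightarrow> w \<in> W \<Longrightarrow> 0 \<le> N h w"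
  shows "L2op \<Omega> H W N (\<lambda>h w x. k h *\<^sub>R \<phi> h w x)"
  unfolding L2op_def
proof (intro conjI ballI allI)
  fix h w assume h: "h \<in> H" and w: "w \<in> W"
  note a = L2opD[OF assms(1) h w]
  show "(\<lambda>x. k h *\<^sub>R \<phi> h w x) \<in> L2 \<Omega>" by (rule L2_scaleR[OF a(1)])
  fix c show "AE x in lebesgue_on \<Omega>. k h *\<^sub>R \<phi> h (c *\<^sub>R w) x = c *\<^sub>R k h *\<^sub>R \<phi> h w x"
    using a(3)[of c] by eventually_elim simp
next
  fix h w w' assume h: "h \<in> H" and w: "w \<in> W" and w': "w' \<in> W"
  show "AE x in lebesgue_on \<Omega>. k h *\<^sub>R \<phi> h (w + w') x = k h *\<^sub>R \<phi> h w x + k h *\<^sub>R \<phi> h w' x"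
    using L2opD(2)[OF assms(1) h w w'] by eventually_elim (simp add: scaleR_add_right)
next
  obtain C where C: "C \<ge> 0" "\<And>h w. h \<in> H \<Longrightarrow> w \<in> W \<Longrightarrow> l2norm \<Omega> (\<phi> h w) \<le> C * N h w" using L2op_bound[OF assms(1)] by blast
  have "l2norm \<Omega> (\<lambda>x. k h *\<^sub>R \<phi> h w x) \<le> (\<bar>M\<bar> * C) * N h w" if "h \<in> H" "w \<in> W" for h w
  proof -
    have "\<bar>k h\<bar> * l2norm \<Omega> (\<phi> h w) \<le> \<bar>M\<bar> * (C * N h w)"
      using assms(2)[OF that(1)] C(2)[OF that] by (intro mult_mono) (auto simp: l2norm_nonneg)
    then show ?thesis by (simp add: l2norm_scaleR mult.assoc)
  qed
  then show "\<exists>C\<ge>0. \<forall>h\<in>H. \<forall>w\<in>W. l2norm \<Omega> (\<lambda>x. k h *\<^sub>R \<phi> h w x) \<le> C * N h w"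
    using C(1) by (intro exI[of _ "\<bar>M\<bar> * C"]) auto
qed

lemma L2op_diff:
  assumes "L2op \<Omega> H W N \<phi>" "L2op \<Omega> H W N \<psi>" "\<And>h w. h \<in> H \<Longrightarrow> w \<in> W \<Longrightarrow> 0 \<le> N h w"
  shows "L2op \<Omega> H W N (\<lambda>h w x. \<phi> h w x - \<psi> h w x)"
  using L2op_add[OF assms(1) L2op_scaleR[OF assms(2), of "\<lambda>h. - 1" 1, OF _ assms(3)]] by simp

lemma L2op_mult:
  fixes \<phi> :: "'i \<Rightarrow> 'w::real_vector \<Rightarrow> 'a::euclidean_space \<Rightarrow> real"
  assumes "L2op \<Omega> H W N \<phi>" "\<zeta> \<in> Linf \<Omega>"
  shows "L2op \<Omega> H W N (\<lambda>h w x. \<zeta> x * \<phi> h w x)"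
  unfolding L2op_def
proof (intro conjI ballI allI)
  fix h w assume h: "h \<in> H" and w: "w \<in> W"
  note a = L2opD[OF assms(1) h w]
  show "(\<lambda>x. \<zeta> x * \<phi> h w x) \<in> L2 \<Omega>" by (rule L2_Linf_mult[OF a(1) assms(2)])
  fix c show "AE x in lebesgue_on \<Omega>. \<zeta> x * \<phi> h (c *\<^sub>R w) x = c *\<^sub>R (\<zeta> x * \<phi> h w x)"
    using a(3)[of c] by eventually_elim simp
next
  fix h w w' assume h: "h \<in> H" and w: "w \<in> W" and w': "w' \<in> W"
  show "AE x in lebesgue_on \<Omega>. \<zeta> x * \<phi> h (w + w') x = \<zeta> x * \<phi> h w x + \<zeta> x * \<phi> h w' x"
    using L2opD(2)[OF assms(1) h w w'] by eventually_elim (simp add: distrib_left)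
next
  obtain C where C: "C \<ge> 0" "\<And>h w. h \<in> H \<Longrightarrow> w \<in> W \<Longrightarrow> l2norm \<Omega> (\<phi> h w) \<le> C * N h w" using L2op_bound[OF assms(1)] by blast
  obtain Z where Z: "Z \<ge> 0" "\<And>f. f \<in> L2 \<Omega> \<Longrightarrow> l2norm \<Omega> (\<lambda>x. \<zeta> x * f x) \<le> Z * l2norm \<Omega> f"
    using l2norm_Linf_mult_le[OF assms(2)] by blast
  have "l2norm \<Omega> (\<lambda>x. \<zeta> x * \<phi> h w x) \<le> (Z * C) * N h w" if "h \<in> H" "w \<in> W" for h w
    using Z(2)[OF L2opD(1)[OF assms(1) that]] mult_left_mono[OF C(2)[OF that] Z(1)] by simp
  then show "\<exists>C\<ge>0. \<forall>h\<in>H. \<forall>w\<in>W. l2norm \<Omega> (\<lambda>x. \<zeta> x * \<phi> h w x) \<le> C * N h w"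
    using C(1) Z(1) by (intro exI[of _ "Z * C"]) auto
qed

text \<open>The constant \<open>K\<close> is common to all indices: it is one of the two numbers that enter the constant of
  the error estimate, and uniformity in the mesh size is decided here.\<close>

definition bilform :: "'i set \<Rightarrow> 'w::real_vector set \<Rightarrow> ('i \<Rightarrow> 'w \<Rightarrow> real) \<Rightarrow> ('i \<Rightarrow> 'w \<Rightarrow> 'w \<Rightarrow> real) \<Rightarrow> bool" where
  "bilform H W N B \<longleftrightarrow> (\<forall>h\<in>H. sym_bilinear W (B h)) \<and>
     (\<exists>K\<ge>0. \<forall>h\<in>H. \<forall>w\<in>W. \<forall>w'\<in>W. \<bar>B h w w'\<bar> \<le> K * (N h w * N h w'))"

lemma bilform_bound:
  assumes "bilform H W N B"
  obtains K where "K \<ge> 0" "\<And>h w w'. h \<in> H \<Longrightarrow> w \<in> W \<Longrightarrow> w' \<in> W \<Longrightarrow> \<bar>B h w w'\<bar> \<le> K * (N h w * N h w')"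
  using assms unfolding bilform_def by blast

lemma bilform_add:
  assumes "bilform H W N B" "bilform H W N B'"
  shows "bilform H W N (\<lambda>h w w'. B h w w' + B' h w w')"
  unfolding bilform_def
proof (intro conjI ballI)
  fix h assume "h \<in> H"
  then have "sym_bilinear W (B h)" "sym_bilinear W (B' h)" using assms by (auto simp: bilform_def)
  then show "sym_bilinear W (\<lambda>w w'. B h w w' + B' h w w')"
    unfolding sym_bilinear_def by (auto simp: distrib_left)
next
  obtain K where K: "K \<ge> 0" "\<And>h w w'. h \<in> H \<Longrightarrow> w \<in> W \<Longrightarrow> w' \<in> W \<Longrightarrow> \<bar>B h w w'\<bar> \<le> K * (N h w * N h w')"
    using bilform_bound[OF assms(1)] by blast
  obtain L where L: "L \<ge> 0" "\<And>h w w'. h \<in> H \<Longrightarrow> w \<in> W \<Longrightarrow> w' \<in> W \<Longrightarrow> \<bar>B' h w w'\<bar> \<le> L * (N h w * N h w')"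
    using bilform_bound[OF assms(2)] by blast
  have "\<bar>B h w w' + B' h w w'\<bar> \<le> (K + L) * (N h w * N h w')" if "h \<in> H" "w \<in> W" "w' \<in> W" for h w w'
    using K(2)[OF that] L(2)[OF that] abs_triangle_ineq[of "B h w w'" "B' h w w'"] unfolding distrib_right by linarith
  then show "\<exists>K\<ge>0. \<forall>h\<in>H. \<forall>w\<in>W. \<forall>w'\<in>W. \<bar>B h w w' + B' h w w'\<bar> \<le> K * (N h w * N h w')"
    using K(1) L(1) by (intro exI[of _ "K + L"]) auto
qed

lemma bilform_scale:
  assumes "bilform H W N B" shows "bilform H W N (\<lambda>h w w'. k * B h w w')"
  unfolding bilform_def
proof (intro conjI ballI)
  fix h assume "h \<in> H"
  then have "sym_bilinear W (B h)" using assms by (auto simp: bilform_def)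
  then show "sym_bilinear W (\<lambda>w w'. k * B h w w')"
    unfolding sym_bilinear_def by (auto simp: distrib_left)
next
  obtain K where K: "K \<ge> 0" "\<And>h w w'. h \<in> H \<Longrightarrow> w \<in> W \<Longrightarrow> w' \<in> W \<Longrightarrow> \<bar>B h w w'\<bar> \<le> K * (N h w * N h w')"
    using bilform_bound[OF assms(1)] by blast
  have "\<bar>k * B h w w'\<bar> \<le> (\<bar>k\<bar> * K) * (N h w * N h w')" if "h \<in> H" "w \<in> W" "w' \<in> W" for h w w'
    using mult_left_mono[OF K(2)[OF that], of "\<bar>k\<bar>"] by (simp add: abs_mult mult.assoc)
  then show "\<exists>K\<ge>0. \<forall>h\<in>H. \<forall>w\<in>W. \<forall>w'\<in>W. \<bar>k * B h w w'\<bar> \<le> K * (N h w * N h w')"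
    using K(1) by (intro exI[of _ "\<bar>k\<bar> * K"]) auto
qed

lemma bilform_diff:
  assumes "bilform H W N B" "bilform H W N B'"
  shows "bilform H W N (\<lambda>h w w'. B h w w' - B' h w w')"
  using bilform_add[OF assms(1) bilform_scale[OF assms(2), of "-1"]] by simp

text \<open>A symmetrised product of two different maps, as the saddle point terms require.\<close>

lemma bilform_cross:
  assumes W: "subspace W" and a: "L2op \<Omega> H W N \<phi>" "L2op \<Omega> H W N \<psi>"
    and N: "\<And>h w. h \<in> H \<Longrightarrow> w \<in> W \<Longrightarrow> 0 \<le> N h w"
  shows "bilform H W N (\<lambda>h w w'. l2ip \<Omega> (\<phi> h w) (\<psi> h w') + l2ip \<Omega> (\<phi> h w') (\<psi> h w))"
  unfolding bilform_def
proof (intro conjI ballI)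
  fix h assume h: "h \<in> H"
  note p = L2opD[OF a(1) h] and q = L2opD[OF a(2) h]
  note L = sym_bilinearD[OF sym_bilinear_l2ip[of \<Omega>]]
  have add: "l2ip \<Omega> (\<phi> h (u + v)) f = l2ip \<Omega> (\<phi> h u) f + l2ip \<Omega> (\<phi> h v) f"
    if "u \<in> W" "v \<in> W" "f \<in> L2 \<Omega>" for u v f
  proof -
    have "l2ip \<Omega> (\<phi> h (u + v)) f = l2ip \<Omega> (\<phi> h u + \<phi> h v) f"
      using p(1,2) that subspace_add[OF W]
      by (intro l2ip_cong_AE) (auto simp: fun_ops(1) intro: L2_add)
    then show ?thesis using L(2)[OF p(1)[OF that(1)] p(1)[OF that(2)] that(3)] by simp
  qed
  have add': "l2ip \<Omega> f (\<psi> h (u + v)) = l2ip \<Omega> f (\<psi> h u) + l2ip \<Omega> f (\<psi> h v)"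
    if "u \<in> W" "v \<in> W" "f \<in> L2 \<Omega>" for u v f
  proof -
    have "l2ip \<Omega> f (\<psi> h (u + v)) = l2ip \<Omega> f (\<psi> h u + \<psi> h v)"
      using q(1,2) that subspace_add[OF W]
      by (intro l2ip_cong_AE) (auto simp: fun_ops(1) intro: L2_add)
    then show ?thesis using L(3)[OF q(1)[OF that(1)] q(1)[OF that(2)] that(3)] by simp
  qed
  have sc: "l2ip \<Omega> (\<phi> h (c *\<^sub>R u)) f = c * l2ip \<Omega> (\<phi> h u) f" if "u \<in> W" "f \<in> L2 \<Omega>" for u c f
  proof -
    have "l2ip \<Omega> (\<phi> h (c *\<^sub>R u)) f = l2ip \<Omega> (c *\<^sub>R \<phi> h u) f"
      using p(1,3) that subspace_scale[OF W]
      by (intro l2ip_cong_AE) (auto simp: fun_ops(2) intro: L2_scaleR)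
    then show ?thesis using L(4)[OF p(1)[OF that(1)] that(2)] by simp
  qed
  have sc': "l2ip \<Omega> f (\<psi> h (c *\<^sub>R u)) = c * l2ip \<Omega> f (\<psi> h u)" if "u \<in> W" "f \<in> L2 \<Omega>" for u c f
  proof -
    have "l2ip \<Omega> f (\<psi> h (c *\<^sub>R u)) = l2ip \<Omega> f (c *\<^sub>R \<psi> h u)"
      using q(1,3) that subspace_scale[OF W]
      by (intro l2ip_cong_AE) (auto simp: fun_ops(2) intro: L2_scaleR)
    then show ?thesis using L(5)[OF that(2) q(1)[OF that(1)]] by simp
  qed
  show "sym_bilinear W (\<lambda>w w'. l2ip \<Omega> (\<phi> h w) (\<psi> h w') + l2ip \<Omega> (\<phi> h w') (\<psi> h w))"
    unfolding sym_bilinear_def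
    by (intro conjI W ballI allI) (simp_all add: add add' sc sc' p q distrib_left)
next
  obtain C where C: "C \<ge> 0" "\<And>h w. h \<in> H \<Longrightarrow> w \<in> W \<Longrightarrow> l2norm \<Omega> (\<phi> h w) \<le> C * N h w" using L2op_bound[OF a(1)] by blast
  obtain D where D: "D \<ge> 0" "\<And>h w. h \<in> H \<Longrightarrow> w \<in> W \<Longrightarrow> l2norm \<Omega> (\<psi> h w) \<le> D * N h w" using L2op_bound[OF a(2)] by blast
  have b: "\<bar>l2ip \<Omega> (\<phi> h w) (\<psi> h w')\<bar> \<le> (C * D) * (N h w * N h w')" if "h \<in> H" "w \<in> W" "w' \<in> W" for h w w'
  proof -
    have "\<bar>l2ip \<Omega> (\<phi> h w) (\<psi> h w')\<bar> \<le> l2norm \<Omega> (\<phi> h w) * l2norm \<Omega> (\<psi> h w')"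
      using that by (intro l2ip_bound L2opD(1)[OF a(1)] L2opD(1)[OF a(2)])
    also have "\<dots> \<le> (C * N h w) * (D * N h w')"
      using that C D N by (intro mult_mono) (auto simp: l2norm_nonneg)
    finally show ?thesis by (simp add: mult_ac)
  qed
  have "\<bar>l2ip \<Omega> (\<phi> h w) (\<psi> h w') + l2ip \<Omega> (\<phi> h w') (\<psi> h w)\<bar> \<le> (2 * (C * D)) * (N h w * N h w')"
    if "h \<in> H" "w \<in> W" "w' \<in> W" for h w w'
    using b[OF that] b[OF that(1,3,2)] by (simp add: mult.commute[of "N h w'"] abs_le_iff)
  then show "\<exists>K\<ge>0. \<forall>h\<in>H. \<forall>w\<in>W. \<forall>w'\<in>W. \<bar>l2ip \<Omega> (\<phi> h w) (\<psi> h w') + l2ip \<Omega> (\<phi> h w') (\<psi> h w)\<bar> \<le> K * (N h w * N h w')"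
    using C(1) D(1) by (intro exI[of _ "2 * (C * D)"]) auto
qed

lemma bilform_square:
  fixes \<phi> :: "'i \<Rightarrow> 'w::real_vector \<Rightarrow> 'a::euclidean_space \<Rightarrow> 'b::euclidean_space"
  assumes W: "subspace W" and a: "L2op \<Omega> H W N \<phi>"
    and N: "\<And>h w. h \<in> H \<Longrightarrow> w \<in> W \<Longrightarrow> 0 \<le> N h w"
  shows "bilform H W N (\<lambda>h w w'. l2ip \<Omega> (\<phi> h w) (\<phi> h w'))"
proof -
  have "bilform H W N (\<lambda>h w w'. 1/2 * (l2ip \<Omega> (\<phi> h w) (\<phi> h w') + l2ip \<Omega> (\<phi> h w') (\<phi> h w)))"
    by (intro bilform_scale bilform_cross[OF W a a] N)
  moreover have "l2ip \<Omega> f g = l2ip \<Omega> g f" for f g :: "'a \<Rightarrow> 'b"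
    unfolding l2ip_def by (simp add: inner_commute)
  then have "(\<lambda>h w w'. 1/2 * (l2ip \<Omega> (\<phi> h w) (\<phi> h w') + l2ip \<Omega> (\<phi> h w') (\<phi> h w)))
      = (\<lambda>h w w'. l2ip \<Omega> (\<phi> h w) (\<phi> h w'))" by (auto simp: fun_eq_iff)
  ultimately show ?thesis by simp
qed

section \<open>The bilinear forms of the problem\<close>

lemma l2ip_commute: "l2ip W f g = l2ip W g f"
  unfolding l2ip_def by (simp add: inner_commute)

lemma l2ip_add_left: "f \<in> L2 W \<Longrightarrow> g \<in> L2 W \<Longrightarrow> k \<in> L2 W \<Longrightarrow> l2ip W (\<lambda>x. f x + g x) k = l2ip W f k + l2ip W g k"
  using sym_bilinearD(2)[OF sym_bilinear_l2ip, of f W g k] by (simp add: fun_ops)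
lemma l2ip_add_right: "f \<in> L2 W \<Longrightarrow> g \<in> L2 W \<Longrightarrow> k \<in> L2 W \<Longrightarrow> l2ip W k (\<lambda>x. f x + g x) = l2ip W k f + l2ip W k g"
  using l2ip_add_left[of f W g k] by (simp only: l2ip_commute[of W k])
lemma l2ip_diff_left: "f \<in> L2 W \<Longrightarrow> g \<in> L2 W \<Longrightarrow> k \<in> L2 W \<Longrightarrow> l2ip W (\<lambda>x. f x - g x) k = l2ip W f k - l2ip W g k"
  using sym_bilinear_diff(1)[OF sym_bilinear_l2ip, of f W g k] by (simp add: fun_ops)
lemma l2ip_diff_right: "f \<in> L2 W \<Longrightarrow> g \<in> L2 W \<Longrightarrow> k \<in> L2 W \<Longrightarrow> l2ip W k (\<lambda>x. f x - g x) = l2ip W k f - l2ip W k g"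
  using l2ip_diff_left[of f W g k] by (simp only: l2ip_commute[of W k])
lemma l2ip_scaleR_left: "l2ip W (\<lambda>x. c *\<^sub>R f x) k = c * l2ip W f k"
  unfolding l2ip_def by simp
lemma l2ip_scaleR_right: "l2ip W k (\<lambda>x. c *\<^sub>R f x) = c * l2ip W k f"
  unfolding l2ip_def by simp
lemma l2ip_uminus_left: "l2ip W (\<lambda>x. - f x) k = - l2ip W f k"
  unfolding l2ip_def by simp
lemma l2ip_uminus_right: "l2ip W k (\<lambda>x. - f x) = - l2ip W k f"
  unfolding l2ip_def by simp
lemma l2ip_zero: "l2ip W (\<lambda>x. 0) k = 0" "l2ip W k (\<lambda>x. 0) = 0" "l2ip W 0 k = 0" "l2ip W k 0 = 0"
  unfolding l2ip_def by simp_all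

lemma L2_diff: "f \<in> L2 W \<Longrightarrow> g \<in> L2 W \<Longrightarrow> (\<lambda>x. f x - g x) \<in> L2 W"
  using L2_add[of f W "\<lambda>x. - 1 *\<^sub>R g x"] L2_scaleR[of g W "- 1"] by simp
lemma L2_uminus: "f \<in> L2 W \<Longrightarrow> (\<lambda>x. - f x) \<in> L2 W"
  using L2_scaleR[of f W "-1"] by simp
lemma L2_zero': "0 \<in> L2 W"
  using L2_zero[of W] by (simp add: fun_ops)

lemma wgrad_zero_AE: assumes "open W" shows "AE x in lebesgue_on W. wgrad W 0 x = 0"
  using wgrad_scaleR_AE[OF assms subspace_0[OF subspace_H1[OF assms]], of 0] by simp

lemma l2ip_wgrad_zero:
  assumes "open W" "k \<in> L2 W" shows "l2ip W (wgrad W 0) k = 0" "l2ip W k (wgrad W 0) = 0"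
proof -
  have "l2ip W (wgrad W 0) k = l2ip W 0 k"
    using assms wgrad_zero_AE[OF assms(1)] wgrad_L2[OF subspace_0[OF subspace_H1[OF assms(1)]]]
    by (intro l2ip_cong_AE) (auto simp: L2_zero')
  then show "l2ip W (wgrad W 0) k = 0" by (simp add: l2ip_zero)
  then show "l2ip W k (wgrad W 0) = 0" by (simp add: l2ip_commute)
qed

lemma wdiv_zero_AE: assumes "open W" shows "AE x in lebesgue_on W. wdiv W 0 x = 0"
  using wdiv_scaleR_AE[OF assms subspace_0[OF subspace_Hdiv[OF assms]], of 0] by simp

lemmas l2ip_simps = l2ip_add_left l2ip_add_right l2ip_diff_left l2ip_diff_right l2ip_scaleR_left l2ip_scaleR_right
  l2ip_uminus_left l2ip_uminus_right l2ip_zero L2_diff L2_add L2_scaleR L2_uminus L2_zero L2_zero'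

text \<open>The inequality of Young in the form that absorbs a cross term into two squares.\<close>

lemma l2ip_young:
  assumes "f \<in> L2 W" "g \<in> L2 W" "t > 0"
  shows "l2ip W f g \<le> t * l2ip W f f + l2ip W g g / (4 * t)" "- l2ip W f g \<le> t * l2ip W f f + l2ip W g g / (4 * t)"
proof -
  let ?a = "l2norm W f" and ?b = "l2norm W g"
  have "?a * ?b \<le> t * ?a\<^sup>2 + ?b\<^sup>2 / (4 * t)"
  proof -
    have "0 \<le> (2 * t * ?a - ?b)\<^sup>2 / (4 * t)" using assms(3) by simp
    also have "\<dots> = t * ?a\<^sup>2 + ?b\<^sup>2 / (4 * t) - ?a * ?b"
      using assms(3) by (simp add: power2_eq_square field_simps)
    finally show ?thesis by simp
  qed
  then show "l2ip W f g \<le> t * l2ip W f f + l2ip W g g / (4 * t)" "- l2ip W f g \<le> t * l2ip W f f + l2ip W g g / (4 * t)"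
    using l2ip_bound[OF assms(1,2)] unfolding l2ip_self by linarith+
qed

lemma l2ip_nonneg: "0 \<le> l2ip W f f" by (simp add: l2ip_self)

type_synonym 'a tup = "'a data \<times> 'a primal \<times> 'a dual"

text \<open>The components of a tuple of data, primal and dual unknowns. On these tuples the Lagrangian is a
  quadratic form without affine part.\<close>

definition w_q :: "'a tup \<Rightarrow> 'a \<Rightarrow> real" where "w_q w = fst (fst w)"
definition w_et :: "'a tup \<Rightarrow> 'a \<Rightarrow> 'a" where "w_et w = fst (snd (fst w))"
definition w_st :: "'a tup \<Rightarrow> 'a \<Rightarrow> 'a" where "w_st w = snd (snd (fst w))"
definition w_u :: "'a tup \<Rightarrow> 'a \<Rightarrow> real" where "w_u w = fst (fst (snd w))"
definition w_e :: "'a tup \<Rightarrow> 'a \<Rightarrow> 'a" where "w_e w = fst (snd (fst (snd w)))"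
definition w_s :: "'a tup \<Rightarrow> 'a \<Rightarrow> 'a" where "w_s w = snd (snd (fst (snd w)))"
definition w_l :: "'a tup \<Rightarrow> 'a \<Rightarrow> real" where "w_l w = fst (snd (snd w))"
definition w_m :: "'a tup \<Rightarrow> 'a \<Rightarrow> 'a" where "w_m w = snd (snd (snd w))"

lemmas w_defs = w_q_def w_et_def w_st_def w_u_def w_e_def w_s_def w_l_def w_m_def

text \<open>The polarisation of twice the Lagrangian, seen as a quadratic form in data and unknowns. The terms
  with \<open>\<alpha>\<close>, \<open>\<gamma>\<close> and \<open>\<eta>\<close> polarise the first three stabilizations.\<close>

definition bform :: "'a::euclidean_space set \<Rightarrow> ('a \<Rightarrow> real) \<Rightarrow> real \<Rightarrow> real \<Rightarrow> real \<Rightarrow> real \<Rightarrow> 'a tup \<Rightarrow> 'a tup \<Rightarrow> real" where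
  "bform \<Omega> \<zeta> \<kappa> \<alpha> \<gamma> \<eta> w w' =
     l2ip \<Omega> (\<lambda>x. w_e w x - w_et w x) (\<lambda>x. w_e w' x - w_et w' x)
     + \<kappa> * l2ip \<Omega> (\<lambda>x. w_s w x - w_st w x) (\<lambda>x. w_s w' x - w_st w' x)
     - (l2ip \<Omega> (w_s w) (wgrad \<Omega> (w_l w')) + l2ip \<Omega> (w_s w') (wgrad \<Omega> (w_l w)))
     + (l2ip \<Omega> (\<lambda>x. \<zeta> x * w_u w x - w_q w x) (w_l w') + l2ip \<Omega> (\<lambda>x. \<zeta> x * w_u w' x - w_q w' x) (w_l w))
     + (l2ip \<Omega> (\<lambda>x. w_e w x - wgrad \<Omega> (w_u w) x) (w_m w') + l2ip \<Omega> (\<lambda>x. w_e w' x - wgrad \<Omega> (w_u w') x) (w_m w))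
     + \<alpha> * l2ip \<Omega> (\<lambda>x. w_e w x - wgrad \<Omega> (w_u w) x) (\<lambda>x. w_e w' x - wgrad \<Omega> (w_u w') x)
     - \<gamma> * l2ip \<Omega> (\<lambda>x. w_e w x + w_m w x - w_et w x) (\<lambda>x. w_e w' x + w_m w' x - w_et w' x)
     - \<eta> / \<kappa> * l2ip \<Omega> (\<lambda>x. \<kappa> *\<^sub>R w_s w x - wgrad \<Omega> (w_l w) x - \<kappa> *\<^sub>R w_st w x)
                        (\<lambda>x. \<kappa> *\<^sub>R w_s w' x - wgrad \<Omega> (w_l w') x - \<kappa> *\<^sub>R w_st w' x)"

text \<open>The polarisation of the two divergence stabilizations, with the length scale \<open>h\<close> moved inside the
  norms because \<open>h\<close> times the divergence is what the mesh-dependent norm bounds.\<close>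

definition divform :: "'a::euclidean_space set \<Rightarrow> ('a \<Rightarrow> real) \<Rightarrow> real \<Rightarrow> real \<Rightarrow> real \<Rightarrow> real \<Rightarrow> 'a tup \<Rightarrow> 'a tup \<Rightarrow> real" where
  "divform \<Omega> \<zeta> \<kappa> \<theta> \<beta> h w w' =
     \<theta> * \<kappa> * l2ip \<Omega> (\<lambda>x. h *\<^sub>R wdiv \<Omega> (w_s w) x + h *\<^sub>R (\<zeta> x * w_u w x - w_q w x))
                     (\<lambda>x. h *\<^sub>R wdiv \<Omega> (w_s w') x + h *\<^sub>R (\<zeta> x * w_u w' x - w_q w' x))
     - \<beta> * l2ip \<Omega> (\<lambda>x. h *\<^sub>R wdiv \<Omega> (w_m w) x + h *\<^sub>R (\<zeta> x * w_l w x))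
                     (\<lambda>x. h *\<^sub>R wdiv \<Omega> (w_m w') x + h *\<^sub>R (\<zeta> x * w_l w' x))"

definition Z_space :: "'a::euclidean_space set \<Rightarrow> 'a set \<Rightarrow> ('a primal \<times> 'a dual) set" where
  "Z_space \<Omega> \<Gamma> = X_space \<Omega> \<Gamma> \<times> Y_space \<Omega> \<Gamma>"

text \<open>The energy space of the fully stabilized method. It contains the discrete spaces as well as the exact
  solution, whose vector fields \<open>s\<close> and \<open>\<mu>\<close> have square integrable divergence.\<close>

definition Zdiv_space :: "'a::euclidean_space set \<Rightarrow> 'a set \<Rightarrow> ('a primal \<times> 'a dual) set" where
  "Zdiv_space \<Omega> \<Gamma> = (H1D \<Omega> \<Gamma> \<times> L2 \<Omega> \<times> Hdiv \<Omega>) \<times> (H1D \<Omega> \<Gamma> \<times> Hdiv \<Omega>)"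

locale problem =
  fixes \<Omega> \<Gamma> :: "'a::euclidean_space set" and \<zeta> :: "'a \<Rightarrow> real" and \<kappa> :: real
  assumes dom: "regular_domain \<Omega>" and dir: "dirichlet_part \<Omega> \<Gamma>" and \<zeta>: "\<zeta> \<in> Linf \<Omega>" and \<kappa>: "\<kappa> > 0"
begin

lemma open_domain: "open \<Omega>" and bounded_domain: "bounded \<Omega>" using dom by (auto simp: regular_domain_def)

lemma H1D_sub: "u \<in> H1D \<Omega> \<Gamma> \<Longrightarrow> u \<in> H1 \<Omega>" "u \<in> H1D \<Omega> \<Gamma> \<Longrightarrow> u \<in> L2 \<Omega>" "u \<in> H1D \<Omega> \<Gamma> \<Longrightarrow> wgrad \<Omega> u \<in> L2 \<Omega>"
  using wgrad_L2[of u \<Omega>] by (auto simp: H1D_def, auto simp: H1_def)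

lemma subspaces: "subspace (data_space \<Omega>)" "subspace (X_space \<Omega> \<Gamma>)" "subspace (Y_space \<Omega> \<Gamma>)"
  "subspace (Z_space \<Omega> \<Gamma>)" "subspace (Zdiv_space \<Omega> \<Gamma>)"
  unfolding data_space_def X_space_def Y_space_def Z_space_def Zdiv_space_def
  by (intro subspace_Times subspace_L2 subspace_Hdiv subspace_H1D open_domain bounded_domain)+

lemma Zdiv_sub: "Zdiv_space \<Omega> \<Gamma> \<subseteq> Z_space \<Omega> \<Gamma>"
  by (auto simp: Zdiv_space_def Z_space_def X_space_def Y_space_def Hdiv_def)

lemma l2norm_le_data_norm:
  "l2norm \<Omega> q \<le> data_norm \<Omega> (q, et, st)" "l2norm \<Omega> et \<le> data_norm \<Omega> (q, et, st)" "l2norm \<Omega> st \<le> data_norm \<Omega> (q, et, st)"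
  by (auto intro!: real_le_rsqrt)

text \<open>The weights \<open>1 / sqrt \<kappa>\<close> and \<open>sqrt \<kappa>\<close> undo the scaling of the norm by \<open>\<kappa>\<close>.\<close>

lemma l2norm_le_norm_XY:
  "l2norm \<Omega> (wgrad \<Omega> u) \<le> norm_XY \<Omega> \<kappa> ((u, e, s), (l, m))"
  "l2norm \<Omega> e \<le> norm_XY \<Omega> \<kappa> ((u, e, s), (l, m))"
  "l2norm \<Omega> s \<le> (1 / sqrt \<kappa>) * norm_XY \<Omega> \<kappa> ((u, e, s), (l, m))"
  "l2norm \<Omega> (wgrad \<Omega> l) \<le> sqrt \<kappa> * norm_XY \<Omega> \<kappa> ((u, e, s), (l, m))"
  "l2norm \<Omega> m \<le> norm_XY \<Omega> \<kappa> ((u, e, s), (l, m))"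
proof -
  let ?N = "norm_XY \<Omega> \<kappa> ((u, e, s), (l, m))"
  have pos: "0 \<le> \<kappa> * (l2norm \<Omega> s)\<^sup>2" "0 \<le> 1 / \<kappa> * (l2norm \<Omega> (wgrad \<Omega> l))\<^sup>2" using \<kappa> by auto
  show "l2norm \<Omega> (wgrad \<Omega> u) \<le> ?N" "l2norm \<Omega> e \<le> ?N" "l2norm \<Omega> m \<le> ?N"
    using pos by (auto intro!: real_le_rsqrt simp del: zero_le_mult_iff)
  have "sqrt \<kappa> * l2norm \<Omega> s \<le> ?N"
    using pos \<kappa> by (auto intro!: real_le_rsqrt simp: power_mult_distrib)
  then show "l2norm \<Omega> s \<le> (1 / sqrt \<kappa>) * ?N" using \<kappa> by (simp add: field_simps)
  have "(1 / sqrt \<kappa>) * l2norm \<Omega> (wgrad \<Omega> l) \<le> ?N"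
    using pos \<kappa> by (auto intro!: real_le_rsqrt simp: power_mult_distrib power_divide)
  then show "l2norm \<Omega> (wgrad \<Omega> l) \<le> sqrt \<kappa> * ?N" using \<kappa> by (simp add: field_simps)
qed

lemma data_norm_nonneg: "0 \<le> data_norm \<Omega> d"
  by (cases d) auto
lemma norm_XY_nonneg: "0 \<le> norm_XY \<Omega> \<kappa> z"
proof -
  obtain u e s l m where z: "z = ((u, e, s), (l, m))" by (metis surj_pair)
  show ?thesis unfolding z using order_trans[OF l2norm_nonneg l2norm_le_norm_XY(2)] .
qed

end

text \<open>Any norm that dominates the energy norm makes the fields and their gradients uniformly bounded maps
  of the tuple; by the Friedrichs inequality, \<open>u\<close> and \<open>\<lambda>\<close> themselves are bounded too. The parameter \<open>Nz\<close>
  stands for the plain or the mesh-dependent norm.\<close>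

locale features = problem \<Omega> \<Gamma> \<zeta> \<kappa>
  for \<Omega> \<Gamma> :: "'a::euclidean_space set" and \<zeta> \<kappa> +
  fixes H :: "'i set" and Z :: "('a primal \<times> 'a dual) set" and Nz :: "'i \<Rightarrow> 'a primal \<times> 'a dual \<Rightarrow> real"
  assumes Z: "subspace Z" "Z \<subseteq> Z_space \<Omega> \<Gamma>"
    and Nz: "\<And>h z. h \<in> H \<Longrightarrow> z \<in> Z \<Longrightarrow> norm_XY \<Omega> \<kappa> z \<le> Nz h z"
begin

abbreviation "W \<equiv> data_space \<Omega> \<times> Z"
definition N :: "'i \<Rightarrow> 'a tup \<Rightarrow> real" where "N h w = data_norm \<Omega> (fst w) + Nz h (snd w)"

lemma subspace_W: "subspace W" by (intro subspace_Times subspaces Z)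

lemma W_memD:
  assumes "w \<in> W"
  shows "w_q w \<in> L2 \<Omega>" "w_et w \<in> L2 \<Omega>" "w_st w \<in> L2 \<Omega>" "w_u w \<in> H1D \<Omega> \<Gamma>" "w_e w \<in> L2 \<Omega>" "w_s w \<in> L2 \<Omega>"
    "w_l w \<in> H1D \<Omega> \<Gamma>" "w_m w \<in> L2 \<Omega>"
  using assms Z(2) by (auto simp: w_defs data_space_def Z_space_def X_space_def Y_space_def)

lemma Nz_nonneg: "h \<in> H \<Longrightarrow> z \<in> Z \<Longrightarrow> 0 \<le> Nz h z"
  using Nz norm_XY_nonneg order_trans by blast

lemma N_nonneg: "h \<in> H \<Longrightarrow> w \<in> W \<Longrightarrow> 0 \<le> N h w"
  using Nz_nonneg data_norm_nonneg by (auto simp: N_def)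

lemma N_bounds:
  assumes h: "h \<in> H" and w: "w \<in> W"
  shows "l2norm \<Omega> (w_q w) \<le> 1 * N h w" "l2norm \<Omega> (w_et w) \<le> 1 * N h w" "l2norm \<Omega> (w_st w) \<le> 1 * N h w"
    "l2norm \<Omega> (wgrad \<Omega> (w_u w)) \<le> 1 * N h w" "l2norm \<Omega> (w_e w) \<le> 1 * N h w" "l2norm \<Omega> (w_s w) \<le> (1 / sqrt \<kappa>) * N h w"
    "l2norm \<Omega> (wgrad \<Omega> (w_l w)) \<le> sqrt \<kappa> * N h w" "l2norm \<Omega> (w_m w) \<le> 1 * N h w"
proof -
  obtain q et st u e s l m where w_eq: "w = ((q, et, st), (u, e, s), (l, m))" by (metis surj_pair)
  have d: "data_norm \<Omega> (q, et, st) \<le> N h w" using Nz_nonneg[OF h] w by (auto simp: N_def w_eq)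
  have z: "norm_XY \<Omega> \<kappa> ((u, e, s), (l, m)) \<le> N h w"
    using Nz[OF h, of "((u, e, s), (l, m))"] w data_norm_nonneg[of "(q, et, st)"]
    unfolding N_def w_eq by (simp del: norm_XY.simps data_norm.simps)
  show "l2norm \<Omega> (w_q w) \<le> 1 * N h w" "l2norm \<Omega> (w_et w) \<le> 1 * N h w" "l2norm \<Omega> (w_st w) \<le> 1 * N h w"
    using l2norm_le_data_norm[where q=q and et=et and st=st] d by (auto simp: w_defs w_eq simp del: data_norm.simps)
  note b = l2norm_le_norm_XY[where u=u and e=e and s=s and l=l and m=m]
  show "l2norm \<Omega> (wgrad \<Omega> (w_u w)) \<le> 1 * N h w" "l2norm \<Omega> (w_e w) \<le> 1 * N h w" "l2norm \<Omega> (w_m w) \<le> 1 * N h w"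
    using b(1,2,5) z by (auto simp: w_defs w_eq simp del: norm_XY.simps)
  have k: "0 \<le> 1 / sqrt \<kappa>" "0 \<le> sqrt \<kappa>" using \<kappa> by auto
  show "l2norm \<Omega> (w_s w) \<le> (1 / sqrt \<kappa>) * N h w"
    using order_trans[OF b(3) mult_left_mono[OF z k(1)]] by (simp add: w_s_def w_eq)
  show "l2norm \<Omega> (wgrad \<Omega> (w_l w)) \<le> sqrt \<kappa> * N h w"
    using order_trans[OF b(4) mult_left_mono[OF z k(2)]] by (simp add: w_l_def w_eq)
qed

lemma L2opI:
  assumes "\<And>w. w \<in> W \<Longrightarrow> \<phi> w \<in> L2 \<Omega>" "\<And>w w'. w \<in> W \<Longrightarrow> w' \<in> W \<Longrightarrow> AE x in lebesgue_on \<Omega>. \<phi> (w + w') x = \<phi> w x + \<phi> w' x"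
    "\<And>w c. w \<in> W \<Longrightarrow> AE x in lebesgue_on \<Omega>. \<phi> (c *\<^sub>R w) x = c *\<^sub>R \<phi> w x"
    "\<And>h w. h \<in> H \<Longrightarrow> w \<in> W \<Longrightarrow> l2norm \<Omega> (\<phi> w) \<le> C * N h w" "0 \<le> C"
  shows "L2op \<Omega> H W N (\<lambda>h. \<phi>)"
  unfolding L2op_def using assms by blast

lemma features_L2op:
  shows op_q: "L2op \<Omega> H W N (\<lambda>h. w_q)" and op_et: "L2op \<Omega> H W N (\<lambda>h. w_et)" and op_st: "L2op \<Omega> H W N (\<lambda>h. w_st)"
    and op_e: "L2op \<Omega> H W N (\<lambda>h. w_e)" and op_s: "L2op \<Omega> H W N (\<lambda>h. w_s)" and op_m: "L2op \<Omega> H W N (\<lambda>h. w_m)"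
  by (rule L2opI[OF _ _ _ N_bounds(1)], simp_all add: W_memD, simp_all add: w_q_def fun_ops)
     (rule L2opI[OF _ _ _ N_bounds(2)], simp_all add: W_memD, simp_all add: w_et_def fun_ops,
      rule L2opI[OF _ _ _ N_bounds(3)], simp_all add: W_memD, simp_all add: w_st_def fun_ops,
      rule L2opI[OF _ _ _ N_bounds(5)], simp_all add: W_memD, simp_all add: w_e_def fun_ops,
      rule L2opI[OF _ _ _ N_bounds(6)], simp_all add: W_memD \<kappa> less_imp_le, simp_all add: w_s_def fun_ops,
      rule L2opI[OF _ _ _ N_bounds(8)], simp_all add: W_memD, simp_all add: w_m_def fun_ops)

lemma w_u_linear: "w_u (w + w') = w_u w + w_u w'" "w_u (c *\<^sub>R w) = c *\<^sub>R w_u w"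
  and w_l_linear: "w_l (w + w') = w_l w + w_l w'" "w_l (c *\<^sub>R w) = c *\<^sub>R w_l w"
  by (simp_all add: w_u_def w_l_def)

lemma op_gu: "L2op \<Omega> H W N (\<lambda>h w. wgrad \<Omega> (w_u w))"
  by (rule L2opI[OF _ _ _ N_bounds(4)])
     (simp_all add: w_u_linear wgrad_add_AE wgrad_scaleR_AE open_domain W_memD H1D_sub)

lemma op_gl: "L2op \<Omega> H W N (\<lambda>h w. wgrad \<Omega> (w_l w))"
  by (rule L2opI[OF _ _ _ N_bounds(7)])
     (simp_all add: w_l_linear wgrad_add_AE wgrad_scaleR_AE open_domain W_memD H1D_sub \<kappa> less_imp_le)

text \<open>The only place where the boundary condition is used for continuity of the forms: the norm sees just
  the gradients of \<open>u\<close> and \<open>\<lambda>\<close>, while the term with \<open>\<zeta>\<close> involves their values.\<close>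

lemma op_u: "L2op \<Omega> H W N (\<lambda>h. w_u)" and op_l: "L2op \<Omega> H W N (\<lambda>h. w_l)"
proof -
  obtain C where C: "C \<ge> 0" "\<And>v. v \<in> H1D \<Omega> \<Gamma> \<Longrightarrow> l2norm \<Omega> v \<le> C * l2norm \<Omega> (wgrad \<Omega> v)"
    using poincare_H1D[OF dom dir] by blast
  have u: "l2norm \<Omega> (w_u w) \<le> C * N h w" if "h \<in> H" "w \<in> W" for h w
    using order_trans[OF C(2)[OF W_memD(4)[OF that(2)]] mult_left_mono[OF N_bounds(4)[OF that] C(1)]] by simp
  have l: "l2norm \<Omega> (w_l w) \<le> (C * sqrt \<kappa>) * N h w" if "h \<in> H" "w \<in> W" for h w
    using order_trans[OF C(2)[OF W_memD(7)[OF that(2)]] mult_left_mono[OF N_bounds(7)[OF that] C(1)]] by (simp add: mult.assoc)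
  show "L2op \<Omega> H W N (\<lambda>h. w_u)"
    by (rule L2opI[OF _ _ _ u C(1)]) (simp_all add: W_memD H1D_sub w_u_linear, simp_all add: fun_ops)
  show "L2op \<Omega> H W N (\<lambda>h. w_l)"
    by (rule L2opI[OF _ _ _ l]) (simp_all add: W_memD H1D_sub w_l_linear C(1) \<kappa> less_imp_le, simp_all add: fun_ops)
qed

lemma bilform_bform: "bilform H W N (\<lambda>h. bform \<Omega> \<zeta> \<kappa> \<alpha> \<gamma> \<eta>)"
  unfolding bform_def
  by (intro bilform_diff bilform_add bilform_scale bilform_square bilform_cross subspace_W N_nonneg
      L2op_diff L2op_add L2op_mult op_q op_et op_st op_e op_s op_m op_gu op_gl op_u op_l \<zeta>
      L2op_scaleR[where M="\<bar>\<kappa>\<bar>"] order_refl)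

end

section \<open>Stability of the natural and of the minimally stabilized form\<close>

text \<open>Setting the data to zero leaves the form of the homogeneous problem.\<close>

lemma sym_bilinear_snd:
  assumes "sym_bilinear (D \<times> Z) B" "subspace D" "subspace Z"
  shows "sym_bilinear Z (\<lambda>z z'. B (0, z) (0, z'))"
proof -
  have 0: "0 \<in> D" using assms(2) by (rule subspace_0)
  note L = sym_bilinearD[OF assms(1)]
  show ?thesis
    unfolding sym_bilinear_def
  proof (intro conjI assms(3) ballI allI)
    fix x y z c assume x: "x \<in> Z" and y: "y \<in> Z"
    have m: "(0, x) \<in> D \<times> Z" "(0, y) \<in> D \<times> Z" using x y 0 by auto
    show "B (0, x) (0, y) = B (0, y) (0, x)" using L(1)[OF m] .
    show "B (0, c *\<^sub>R x) (0, y) = c * B (0, x) (0, y)" using L(4)[OF m, of c] by simp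
    assume "z \<in> Z"
    then show "B (0, x + y) (0, z) = B (0, x) (0, z) + B (0, y) (0, z)" using L(2)[OF m, of "(0, z)"] 0 by simp
  qed
qed

context problem
begin

lemma wgrad_zero_L2: "wgrad \<Omega> 0 \<in> L2 \<Omega>"
  by (rule wgrad_L2[OF subspace_0[OF subspace_H1[OF open_domain]]])

lemmas eval_simps = w_defs l2ip_simps l2ip_wgrad_zero[OF open_domain] wgrad_zero_L2 H1D_sub L2_Linf_mult[OF _ \<zeta>] l2ip_commute

text \<open>The values of the form on purely primal and purely dual tuples decide both the saddle structure and
  the stability estimates.\<close>

lemma bform_primal_diag:
  assumes "u \<in> H1D \<Omega> \<Gamma>" "e \<in> L2 \<Omega>" "s \<in> L2 \<Omega>"
  shows "bform \<Omega> \<zeta> \<kappa> \<alpha> \<gamma> \<eta> (0, (u, e, s), 0) (0, (u, e, s), 0) =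
    (1 + \<alpha> - \<gamma>) * l2ip \<Omega> e e + \<kappa> * (1 - \<eta>) * l2ip \<Omega> s s + \<alpha> * (l2ip \<Omega> (wgrad \<Omega> u) (wgrad \<Omega> u) - 2 * l2ip \<Omega> e (wgrad \<Omega> u))"
  unfolding bform_def using assms \<kappa> by (simp add: eval_simps field_simps)

lemma bform_dual_diag:
  assumes "l \<in> H1D \<Omega> \<Gamma>" "m \<in> L2 \<Omega>"
  shows "bform \<Omega> \<zeta> \<kappa> \<alpha> \<gamma> \<eta> (0, 0, (l, m)) (0, 0, (l, m)) =
    - \<gamma> * l2ip \<Omega> m m - \<eta> / \<kappa> * l2ip \<Omega> (wgrad \<Omega> l) (wgrad \<Omega> l)"
  unfolding bform_def using assms \<kappa> by (simp add: eval_simps)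

text \<open>Testing with a single field isolates one equation of the optimality system.\<close>

lemma bform_test_e:
  assumes "u \<in> H1D \<Omega> \<Gamma>" "e \<in> L2 \<Omega>" "s \<in> L2 \<Omega>" "l \<in> H1D \<Omega> \<Gamma>" "m \<in> L2 \<Omega>" "q \<in> L2 \<Omega>" "et \<in> L2 \<Omega>" "st \<in> L2 \<Omega>" "e' \<in> L2 \<Omega>"
  shows "bform \<Omega> \<zeta> \<kappa> \<alpha> 0 \<eta> ((q, et, st), (u, e, s), (l, m)) (0, (0, e', 0), 0) =
    l2ip \<Omega> e e' - l2ip \<Omega> et e' + l2ip \<Omega> m e' + \<alpha> * (l2ip \<Omega> e e' - l2ip \<Omega> (wgrad \<Omega> u) e')"
  unfolding bform_def using assms \<kappa> by (simp add: eval_simps)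

lemma bform_test_s:
  assumes "u \<in> H1D \<Omega> \<Gamma>" "e \<in> L2 \<Omega>" "s \<in> L2 \<Omega>" "l \<in> H1D \<Omega> \<Gamma>" "m \<in> L2 \<Omega>" "q \<in> L2 \<Omega>" "et \<in> L2 \<Omega>" "st \<in> L2 \<Omega>" "s' \<in> L2 \<Omega>"
  shows "bform \<Omega> \<zeta> \<kappa> \<alpha> \<gamma> 0 ((q, et, st), (u, e, s), (l, m)) (0, (0, 0, s'), 0) =
    \<kappa> * l2ip \<Omega> s s' - \<kappa> * l2ip \<Omega> st s' - l2ip \<Omega> (wgrad \<Omega> l) s'"
  unfolding bform_def using assms \<kappa> by (simp add: eval_simps right_diff_distrib)

lemma bform_test_m:
  assumes "u \<in> H1D \<Omega> \<Gamma>" "e \<in> L2 \<Omega>" "s \<in> L2 \<Omega>" "l \<in> H1D \<Omega> \<Gamma>" "m \<in> L2 \<Omega>" "q \<in> L2 \<Omega>" "et \<in> L2 \<Omega>" "st \<in> L2 \<Omega>" "m' \<in> L2 \<Omega>"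
  shows "bform \<Omega> \<zeta> \<kappa> \<alpha> 0 \<eta> ((q, et, st), (u, e, s), (l, m)) (0, 0, (0, m')) =
    l2ip \<Omega> e m' - l2ip \<Omega> (wgrad \<Omega> u) m'"
  unfolding bform_def using assms \<kappa> by (simp add: eval_simps)

lemma bform_test_u:
  assumes "u \<in> H1D \<Omega> \<Gamma>" "e \<in> L2 \<Omega>" "s \<in> L2 \<Omega>" "l \<in> H1D \<Omega> \<Gamma>" "m \<in> L2 \<Omega>" "q \<in> L2 \<Omega>" "et \<in> L2 \<Omega>" "st \<in> L2 \<Omega>" "u' \<in> H1D \<Omega> \<Gamma>"
  shows "bform \<Omega> \<zeta> \<kappa> 0 0 0 ((q, et, st), (u, e, s), (l, m)) (0, (u', 0, 0), 0) =
    l2ip \<Omega> (\<lambda>x. \<zeta> x * l x) u' - l2ip \<Omega> m (wgrad \<Omega> u')"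
proof -
  have "l2ip \<Omega> (\<lambda>x. \<zeta> x * u' x) l = l2ip \<Omega> (\<lambda>x. \<zeta> x * l x) u'"
    unfolding l2ip_def by (simp add: mult_ac)
  then show ?thesis
  unfolding bform_def using assms \<kappa> by (simp add: eval_simps)
qed

lemma bform_test_l:
  assumes "u \<in> H1D \<Omega> \<Gamma>" "e \<in> L2 \<Omega>" "s \<in> L2 \<Omega>" "l \<in> H1D \<Omega> \<Gamma>" "m \<in> L2 \<Omega>" "q \<in> L2 \<Omega>" "et \<in> L2 \<Omega>" "st \<in> L2 \<Omega>" "l' \<in> H1D \<Omega> \<Gamma>"
  shows "bform \<Omega> \<zeta> \<kappa> 0 0 0 ((q, et, st), (u, e, s), (l, m)) (0, 0, (l', 0)) =
    l2ip \<Omega> (\<lambda>x. \<zeta> x * u x - q x) l' - l2ip \<Omega> s (wgrad \<Omega> l')"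
  unfolding bform_def using assms \<kappa> by (simp add: eval_simps)

lemma features_XY: "features \<Omega> \<Gamma> \<zeta> \<kappa> (Hs :: real set) (Z_space \<Omega> \<Gamma>) (\<lambda>_. norm_XY \<Omega> \<kappa>)"
  by unfold_locales (auto simp: subspaces)

lemma sym_bilinear_bform: "sym_bilinear (data_space \<Omega> \<times> Z_space \<Omega> \<Gamma>) (bform \<Omega> \<zeta> \<kappa> \<alpha> \<gamma> \<eta>)"
  using features.bilform_bform[OF features_XY[of UNIV]] by (auto simp: bilform_def)

text \<open>The inner product of the energy norm. Having one makes the triangle inequality and the existence of
  best approximations instances of the general lemmas on symmetric forms.\<close>

definition nform :: "'a tup \<Rightarrow> 'a tup \<Rightarrow> real" where
  "nform w w' = l2ip \<Omega> (wgrad \<Omega> (w_u w)) (wgrad \<Omega> (w_u w')) + l2ip \<Omega> (w_e w) (w_e w') + \<kappa> * l2ip \<Omega> (w_s w) (w_s w')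
     + 1 / \<kappa> * l2ip \<Omega> (wgrad \<Omega> (w_l w)) (wgrad \<Omega> (w_l w')) + l2ip \<Omega> (w_m w) (w_m w')"

lemma sym_bilinear_nform: "sym_bilinear (data_space \<Omega> \<times> Z_space \<Omega> \<Gamma>) nform"
proof -
  interpret f: features \<Omega> \<Gamma> \<zeta> \<kappa> "UNIV :: real set" "Z_space \<Omega> \<Gamma>" "\<lambda>_. norm_XY \<Omega> \<kappa>" by (rule features_XY)
  have "bilform UNIV f.W f.N (\<lambda>h. nform)"
    unfolding nform_def
    by (intro bilform_add bilform_scale bilform_square f.subspace_W f.N_nonneg
        f.op_e f.op_s f.op_m f.op_gu f.op_gl UNIV_I)
  then show ?thesis by (auto simp: bilform_def)
qed

lemma norm_XY_nform: "norm_XY \<Omega> \<kappa> z = sqrt (nform (0, z) (0, z))"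
proof -
  obtain u e s l m where z: "z = ((u, e, s), (l, m))" by (metis surj_pair)
  show ?thesis unfolding z by (simp add: nform_def w_defs l2ip_self)
qed

lemma nform_nonneg: "0 \<le> nform w w"
  using \<kappa> by (simp add: nform_def l2ip_nonneg)

lemmas sym_bilinear_nform_Z = sym_bilinear_snd[OF sym_bilinear_nform subspaces(1,4)]

lemma norm_XY_triangle:
  "z \<in> Z_space \<Omega> \<Gamma> \<Longrightarrow> z' \<in> Z_space \<Omega> \<Gamma> \<Longrightarrow> norm_XY \<Omega> \<kappa> (z + z') \<le> norm_XY \<Omega> \<kappa> z + norm_XY \<Omega> \<kappa> z'"
  unfolding norm_XY_nform by (rule seminorm_triangle[OF sym_bilinear_nform_Z nform_nonneg])

lemma norm_XY_flip:
  assumes "(x, y) \<in> Z_space \<Omega> \<Gamma>" shows "norm_XY \<Omega> \<kappa> (x, - y) = norm_XY \<Omega> \<kappa> (x, y)"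
proof -
  obtain u e s l m where z: "x = (u, e, s)" "y = (l, m)" by (metis surj_pair)
  have H: "l \<in> H1D \<Omega> \<Gamma>" using assms by (auto simp: z Z_space_def Y_space_def)
  have "- l = (- 1) *\<^sub>R l" by simp
  then have "l2norm \<Omega> (wgrad \<Omega> (- l)) = l2norm \<Omega> (\<lambda>x. (- 1) *\<^sub>R wgrad \<Omega> l x)"
    using wgrad_scaleR_AE[OF open_domain H1D_sub(1)[OF H], of "-1"] H subspace_scale[OF subspace_H1[OF open_domain] H1D_sub(1)[OF H], of "-1"]
    by (intro l2norm_cong_AE) (auto intro!: L2_uminus H1D_sub(3) wgrad_L2[of "- l"])
  moreover have "l2norm \<Omega> (- m) = l2norm \<Omega> (\<lambda>x. (- 1) *\<^sub>R m x)" by (simp add: fun_Compl_def)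
  ultimately show ?thesis unfolding l2norm_scaleR by (simp add: z)
qed

text \<open>Flipping the sign of the dual part cancels the mixed terms, by symmetry, and turns the indefinite
  form into a sum of nonnegative diagonal terms; \<open>c1\<close> is a correction that supplies what the diagonal
  misses.\<close>

lemma test_expand:
  assumes B: "sym_bilinear (data_space \<Omega> \<times> Z) B" and Z: "subspace Z"
    and m: "(x, 0) \<in> Z" "(0, y) \<in> Z" "c1 \<in> Z"
  shows "B (0, x, y) (0, (x, - y) + c1) = B (0, x, 0) (0, x, 0) - B (0, 0, y) (0, 0, y) + B (0, x, y) (0, c1)"
proof -
  let ?W = "data_space \<Omega> \<times> Z"
  have 0: "0 \<in> data_space \<Omega>" using subspaces(1) by (rule subspace_0)
  have xy: "(x, y) \<in> Z" using subspace_add[OF Z m(1,2)] by simp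
  have xmy: "(x, - y) \<in> Z" using subspace_diff[OF Z m(1,2)] by simp
  have W: "(0, x, 0) \<in> ?W" "(0, 0, y) \<in> ?W" "(0, c1) \<in> ?W" "(0, x, y) \<in> ?W" "(0, x, - y) \<in> ?W"
    using 0 m xy xmy by auto
  have e1: "(0 :: 'a data, x, y) = (0, x, 0) + (0, 0, y)" and e2: "(0 :: 'a data, x, - y) = (0, x, 0) - (0, 0, y)"
    and e3: "(0 :: 'a data, (x, - y) + c1) = (0, x, - y) + (0, c1)" by simp_all
  have "B (0, x, y) (0, (x, - y) + c1) = B (0, x, y) (0, x, - y) + B (0, x, y) (0, c1)"
    unfolding e3 using sym_bilinearD(3)[OF B W(5,3,4)] .
  also have "B (0, x, y) (0, x, - y) = B (0, x, 0) (0, x, - y) + B (0, 0, y) (0, x, - y)"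
    unfolding e1 using sym_bilinearD(2)[OF B W(1,2,5)] .
  also have "\<dots> = B (0, x, 0) (0, x, 0) - B (0, 0, y) (0, 0, y)"
    unfolding e2 using sym_bilinear_diff(2)[OF B W(1,2,1)] sym_bilinear_diff(2)[OF B W(1,2,2)]
      sym_bilinearD(1)[OF B W(1,2)] by simp
  finally show ?thesis .
qed

lemma Z_mem: "((u, e, s), (l, m)) \<in> Z_space \<Omega> \<Gamma> \<longleftrightarrow> u \<in> H1D \<Omega> \<Gamma> \<and> e \<in> L2 \<Omega> \<and> s \<in> L2 \<Omega> \<and> l \<in> H1D \<Omega> \<Gamma> \<and> m \<in> L2 \<Omega>"
  by (auto simp: Z_space_def X_space_def Y_space_def)

lemma zero_mem: "0 \<in> H1D \<Omega> \<Gamma>" "0 \<in> L2 \<Omega>"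
  using subspace_0[OF subspace_H1D[OF open_domain bounded_domain]] L2_zero' by auto

lemma norm_XY_sq: "(norm_XY \<Omega> \<kappa> ((u, e, s), (l, m)))\<^sup>2 = l2ip \<Omega> (wgrad \<Omega> u) (wgrad \<Omega> u) + l2ip \<Omega> e e + \<kappa> * l2ip \<Omega> s s
     + 1 / \<kappa> * l2ip \<Omega> (wgrad \<Omega> l) (wgrad \<Omega> l) + l2ip \<Omega> m m"
  using \<kappa> by (simp add: l2ip_self)

lemma l2norm_0: "l2norm \<Omega> 0 = 0" "l2norm \<Omega> (\<lambda>x. 0) = 0" by (simp_all add: l2norm_eq l2ip_zero)

text \<open>The flipped unknown yields \<open>\<parallel>e\<parallel>\<^sup>2 + \<kappa> \<parallel>s\<parallel>\<^sup>2\<close> only. The three parts of \<open>c1\<close> are multiples of \<open>\<mu>\<close>,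
  \<open>\<nabla>\<lambda>\<close> and \<open>\<nabla>u\<close>, put in the slots whose equations contain these fields, and contribute half of the
  missing squares \<open>\<parallel>\<mu>\<parallel>\<^sup>2\<close>, \<open>\<parallel>\<nabla>\<lambda>\<parallel>\<^sup>2 / \<kappa>\<close> and \<open>\<parallel>\<nabla>u\<parallel>\<^sup>2\<close>. Young's inequality with weights \<open>1/4\<close> absorbs the
  cross terms. The representatives \<open>ru\<close> and \<open>rl\<close> of the gradients are free so that they can be taken
  from the discrete spaces. The term with \<open>\<zeta>\<close> is a mixed term and cancels, whatever its sign.\<close>

lemma stability_natural:
  assumes z: "((u, e, s), (l, m)) \<in> Z_space \<Omega> \<Gamma>" and r: "has_weak_grad \<Omega> u ru" "has_weak_grad \<Omega> l rl"
  defines "c1 \<equiv> ((0, (1/2) *\<^sub>R m, (- (1 / (2 * \<kappa>))) *\<^sub>R rl), (0, (- (1/2)) *\<^sub>R ru))"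
  shows "norm_XY \<Omega> \<kappa> (((u, e, s), - (l, m)) + c1) \<le> 2 * norm_XY \<Omega> \<kappa> ((u, e, s), (l, m))"
    and "1/4 * (norm_XY \<Omega> \<kappa> ((u, e, s), (l, m)))\<^sup>2 \<le> bform \<Omega> \<zeta> \<kappa> 0 0 0 (0, (u, e, s), (l, m)) (0, ((u, e, s), - (l, m)) + c1)"
proof -
  have mem: "u \<in> H1D \<Omega> \<Gamma>" "e \<in> L2 \<Omega>" "s \<in> L2 \<Omega>" "l \<in> H1D \<Omega> \<Gamma>" "m \<in> L2 \<Omega>" using z by (auto simp: Z_mem)
  note g = H1D_sub(3)[OF mem(1)] H1D_sub(3)[OF mem(4)]
  have rL: "ru \<in> L2 \<Omega>" "rl \<in> L2 \<Omega>" using r by (auto simp: has_weak_grad_def)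
  \<comment> \<open>any representative of the gradient has the same inner products\<close>
  have rip: "l2ip \<Omega> f ru = l2ip \<Omega> f (wgrad \<Omega> u)" "l2ip \<Omega> f rl = l2ip \<Omega> f (wgrad \<Omega> l)" if "f \<in> L2 \<Omega>" for f
    using wgrad_AE[OF open_domain r(1)] wgrad_AE[OF open_domain r(2)] rL g that by (auto intro!: l2ip_cong_AE elim: eventually_mono)
  have rr: "l2ip \<Omega> ru ru = l2ip \<Omega> (wgrad \<Omega> u) (wgrad \<Omega> u)" "l2ip \<Omega> rl rl = l2ip \<Omega> (wgrad \<Omega> l) (wgrad \<Omega> l)"
    using rip rL g l2ip_commute by metis+
  have c1Z: "c1 \<in> Z_space \<Omega> \<Gamma>"
    unfolding c1_def Z_mem by (intro conjI zero_mem subspace_scale[OF subspace_L2] mem rL)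
  let ?z = "((u, e, s), (l, m))"
  have flipZ: "((u, e, s), - (l, m)) \<in> Z_space \<Omega> \<Gamma>"
    using z by (simp add: Z_mem subspace_neg[OF subspace_L2] subspace_neg[OF subspace_H1D[OF open_domain bounded_domain]])
  have nn: "0 \<le> \<kappa> * l2ip \<Omega> s s" "0 \<le> 1 / \<kappa> * l2ip \<Omega> (wgrad \<Omega> l) (wgrad \<Omega> l)"
    using \<kappa> by (simp_all add: l2ip_nonneg)
  have c1n: "norm_XY \<Omega> \<kappa> c1 \<le> norm_XY \<Omega> \<kappa> ?z"
  proof (rule power2_le_imp_le[OF _ norm_XY_nonneg])
    have "(norm_XY \<Omega> \<kappa> c1)\<^sup>2 = 1/4 * (l2ip \<Omega> m m + 1 / \<kappa> * l2ip \<Omega> (wgrad \<Omega> l) (wgrad \<Omega> l) + l2ip \<Omega> (wgrad \<Omega> u) (wgrad \<Omega> u))"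
      unfolding c1_def norm_XY_sq using \<kappa> rr by (simp add: fun_ops(2) l2ip_simps l2ip_wgrad_zero open_domain wgrad_zero_L2 field_simps power2_eq_square)
    also have "\<dots> \<le> (norm_XY \<Omega> \<kappa> ?z)\<^sup>2"
    proof -
      have "1/4 * (M + L + U) \<le> U + E + S + L + M" if "0 \<le> U" "0 \<le> E" "0 \<le> S" "0 \<le> L" "0 \<le> M" for U E S L M :: real
        using that by (simp add: distrib_left)
      note aux = this
      show ?thesis unfolding norm_XY_sq by (intro aux l2ip_nonneg nn)
    qed
    finally show "(norm_XY \<Omega> \<kappa> c1)\<^sup>2 \<le> (norm_XY \<Omega> \<kappa> ?z)\<^sup>2" .
  qed
  show "norm_XY \<Omega> \<kappa> (((u, e, s), - (l, m)) + c1) \<le> 2 * norm_XY \<Omega> \<kappa> ?z"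
    using norm_XY_triangle[OF flipZ c1Z] c1n norm_XY_flip[OF z] by linarith
  have parts: "((u, e, s), 0) \<in> Z_space \<Omega> \<Gamma>" "(0, (l, m)) \<in> Z_space \<Omega> \<Gamma>"
     "((0, (1/2) *\<^sub>R m, 0), 0) \<in> Z_space \<Omega> \<Gamma>" "((0, 0, (- (1 / (2 * \<kappa>))) *\<^sub>R rl), 0) \<in> Z_space \<Omega> \<Gamma>"
     "(0, (0, (- (1/2)) *\<^sub>R ru)) \<in> Z_space \<Omega> \<Gamma>"
    using mem rL zero_mem
    by (auto simp: Z_space_def X_space_def Y_space_def zero_prod_def simp del: scaleR_minus_left intro!: subspace_scale[OF subspace_L2])
  let ?B = "bform \<Omega> \<zeta> \<kappa> 0 0 0" and ?w = "(0, (u, e, s), (l, m))"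
  have d0: "(0::'a data) \<in> data_space \<Omega>" using subspaces(1) by (rule subspace_0)
  have sum1: "(0 :: 'a data, c1) = ((0, (0, (1/2) *\<^sub>R m, 0), 0) + (0, (0, 0, (- (1 / (2 * \<kappa>))) *\<^sub>R rl), 0)) + (0, 0, (0, (- (1/2)) *\<^sub>R ru))"
    by (simp add: c1_def)
  have "?B ?w (0, c1) = ?B ?w (0, (0, (1/2) *\<^sub>R m, 0), 0) + ?B ?w (0, (0, 0, (- (1 / (2 * \<kappa>))) *\<^sub>R rl), 0) + ?B ?w (0, 0, (0, (- (1/2)) *\<^sub>R ru))"
  proof -
    let ?W = "data_space \<Omega> \<times> Z_space \<Omega> \<Gamma>"
    have W: "(0, (0, (1/2) *\<^sub>R m, 0), 0) \<in> ?W" "(0, (0, 0, (- (1 / (2 * \<kappa>))) *\<^sub>R rl), 0) \<in> ?W"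
      "(0, 0, (0, (- (1/2)) *\<^sub>R ru)) \<in> ?W" "?w \<in> ?W"
      using parts(3-5) z d0 by (simp_all only: mem_Times_iff fst_conv snd_conv simp_thms)
    have Wab: "(0, (0, (1/2) *\<^sub>R m, 0), 0) + (0, (0, 0, (- (1 / (2 * \<kappa>))) *\<^sub>R rl), 0) \<in> ?W"
      by (rule subspace_add[OF sym_bilinear_subspace[OF sym_bilinear_bform] W(1,2)])
    show ?thesis
      unfolding sum1 sym_bilinearD(3)[OF sym_bilinear_bform Wab W(3,4)] sym_bilinearD(3)[OF sym_bilinear_bform W(1,2,4)] ..
  qed
  also have "\<dots> = 1/2 * l2ip \<Omega> e m + 1/2 * l2ip \<Omega> m m - 1/2 * l2ip \<Omega> s (wgrad \<Omega> l) + 1 / \<kappa> * (1/2 * l2ip \<Omega> (wgrad \<Omega> l) (wgrad \<Omega> l))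
      - 1/2 * l2ip \<Omega> e (wgrad \<Omega> u) + 1/2 * l2ip \<Omega> (wgrad \<Omega> u) (wgrad \<Omega> u)"
  proof -
    have L: "(1/2) *\<^sub>R m \<in> L2 \<Omega>" "(- (1 / (2 * \<kappa>))) *\<^sub>R rl \<in> L2 \<Omega>" "(- (1/2)) *\<^sub>R ru \<in> L2 \<Omega>"
      using mem rL subspace_scale[OF subspace_L2] by blast+
    have w0: "?w = ((0, 0, 0), (u, e, s), (l, m))" by (simp add: zero_prod_def)
    show ?thesis
      unfolding w0 bform_test_e[OF mem zero_mem(2) zero_mem(2) zero_mem(2) L(1)]
        bform_test_s[OF mem zero_mem(2) zero_mem(2) zero_mem(2) L(2)]
        bform_test_m[OF mem zero_mem(2) zero_mem(2) zero_mem(2) L(3)]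
      using \<kappa> by (simp add: fun_ops(2) l2ip_simps rip mem g field_simps)
  qed
  finally have c1eq: "?B ?w (0, c1) = \<dots>" .
  have "?B ?w (0, ((u, e, s), - (l, m)) + c1) = l2ip \<Omega> e e + \<kappa> * l2ip \<Omega> s s + ?B ?w (0, c1)"
    using test_expand[OF sym_bilinear_bform subspaces(4) parts(1,2) c1Z]
      bform_primal_diag[OF mem(1-3), of 0 0 0] bform_dual_diag[OF mem(4,5), of 0 0 0] by simp
  moreover have "1/2 * l2ip \<Omega> s (wgrad \<Omega> l) \<le> 1/4 * (\<kappa> * l2ip \<Omega> s s) + 1/4 * (1 / \<kappa> * l2ip \<Omega> (wgrad \<Omega> l) (wgrad \<Omega> l))"
    using l2ip_young(1)[OF mem(3) g(2), of "\<kappa> / 2"] \<kappa> by (simp add: field_simps)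
  moreover have "- (1/2 * l2ip \<Omega> e m) \<le> 1/4 * l2ip \<Omega> e e + 1/4 * l2ip \<Omega> m m"
    using l2ip_young(2)[OF mem(2,5), of "1/2"] by simp
  moreover have "1/2 * l2ip \<Omega> e (wgrad \<Omega> u) \<le> 1/4 * l2ip \<Omega> e e + 1/4 * l2ip \<Omega> (wgrad \<Omega> u) (wgrad \<Omega> u)"
    using l2ip_young(1)[OF mem(2) g(1), of "1/2"] by simp
  moreover have "0 \<le> l2ip \<Omega> e e" "0 \<le> \<kappa> * l2ip \<Omega> s s" using \<kappa> by (simp_all add: l2ip_nonneg)
  ultimately show "1/4 * (norm_XY \<Omega> \<kappa> ?z)\<^sup>2 \<le> ?B ?w (0, ((u, e, s), - (l, m)) + c1)"
    unfolding norm_XY_sq c1eq by (simp add: distrib_left)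
qed

text \<open>In equal-order spaces the gradients of discrete functions are not discrete fields and cannot serve as
  test functions. The stabilizations provide the squares instead: \<open>\<alpha>\<close> gives \<open>\<parallel>\<nabla>u\<parallel>\<^sup>2\<close> and \<open>\<eta>\<close> gives
  \<open>\<parallel>\<nabla>\<lambda>\<parallel>\<^sup>2 / \<kappa>\<close>. Only \<open>\<parallel>\<mu>\<parallel>\<^sup>2\<close> has to come from a correction, with \<open>\<mu> / 2\<close> in the slot of \<open>e\<close>. What the
  cross terms leave of the coefficient \<open>1/8\<close> of \<open>\<parallel>\<nabla>u\<parallel>\<^sup>2\<close> is \<open>1/32\<close>.\<close>

lemma stability_minimal:
  assumes z: "((u, e, s), (l, m)) \<in> Z_space \<Omega> \<Gamma>"
  defines "c1 \<equiv> ((0, (1/2) *\<^sub>R m, 0), 0)"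
  shows "norm_XY \<Omega> \<kappa> (((u, e, s), - (l, m)) + c1) \<le> 2 * norm_XY \<Omega> \<kappa> ((u, e, s), (l, m))"
    and "1/32 * (norm_XY \<Omega> \<kappa> ((u, e, s), (l, m)))\<^sup>2
      \<le> bform \<Omega> \<zeta> \<kappa> (1/8) 0 (1/2) (0, (u, e, s), (l, m)) (0, ((u, e, s), - (l, m)) + c1)"
proof -
  have mem: "u \<in> H1D \<Omega> \<Gamma>" "e \<in> L2 \<Omega>" "s \<in> L2 \<Omega>" "l \<in> H1D \<Omega> \<Gamma>" "m \<in> L2 \<Omega>" using z by (auto simp: Z_mem)
  note g = H1D_sub(3)[OF mem(1)] H1D_sub(3)[OF mem(4)]
  have c1Z: "c1 \<in> Z_space \<Omega> \<Gamma>"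
    unfolding c1_def using mem zero_mem
    by (auto simp: Z_space_def X_space_def Y_space_def zero_prod_def intro!: subspace_scale[OF subspace_L2])
  let ?z = "((u, e, s), (l, m))"
  have flipZ: "((u, e, s), - (l, m)) \<in> Z_space \<Omega> \<Gamma>"
    using z by (simp add: Z_mem subspace_neg[OF subspace_L2] subspace_neg[OF subspace_H1D[OF open_domain bounded_domain]])
  have nn: "0 \<le> \<kappa> * l2ip \<Omega> s s" "0 \<le> 1 / \<kappa> * l2ip \<Omega> (wgrad \<Omega> l) (wgrad \<Omega> l)"
    using \<kappa> by (simp_all add: l2ip_nonneg)
  have c1n: "norm_XY \<Omega> \<kappa> c1 \<le> norm_XY \<Omega> \<kappa> ?z"
  proof (rule power2_le_imp_le[OF _ norm_XY_nonneg])
    have "(norm_XY \<Omega> \<kappa> c1)\<^sup>2 = 1/4 * l2ip \<Omega> m m"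
      unfolding c1_def zero_prod_def norm_XY_sq using \<kappa>
      by (simp add: fun_ops(2) l2ip_simps l2ip_wgrad_zero open_domain wgrad_zero_L2)
    also have "\<dots> \<le> (norm_XY \<Omega> \<kappa> ?z)\<^sup>2"
    proof -
      have "1/4 * M \<le> U + E + S + L + M" if "0 \<le> U" "0 \<le> E" "0 \<le> S" "0 \<le> L" "0 \<le> M" for U E S L M :: real
        using that by (simp add: distrib_left)
      note aux = this
      show ?thesis unfolding norm_XY_sq by (intro aux l2ip_nonneg nn)
    qed
    finally show "(norm_XY \<Omega> \<kappa> c1)\<^sup>2 \<le> (norm_XY \<Omega> \<kappa> ?z)\<^sup>2" .
  qed
  show "norm_XY \<Omega> \<kappa> (((u, e, s), - (l, m)) + c1) \<le> 2 * norm_XY \<Omega> \<kappa> ?z"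
    using norm_XY_triangle[OF flipZ c1Z] c1n norm_XY_flip[OF z] by linarith
  have parts: "((u, e, s), 0) \<in> Z_space \<Omega> \<Gamma>" "(0, (l, m)) \<in> Z_space \<Omega> \<Gamma>"
    using mem zero_mem by (auto simp: Z_space_def X_space_def Y_space_def zero_prod_def)
  let ?B = "bform \<Omega> \<zeta> \<kappa> (1/8) 0 (1/2)" and ?w = "(0, (u, e, s), (l, m))"
  have c1eq: "?B ?w (0, c1) = 9/16 * l2ip \<Omega> e m + 1/2 * l2ip \<Omega> m m - 1/16 * l2ip \<Omega> (wgrad \<Omega> u) m"
  proof -
    have L: "(1/2) *\<^sub>R m \<in> L2 \<Omega>" using mem subspace_scale[OF subspace_L2] by blast
    have w0: "?w = ((0, 0, 0), (u, e, s), (l, m))" by (simp add: zero_prod_def)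
    show ?thesis
      unfolding w0 c1_def bform_test_e[OF mem zero_mem(2) zero_mem(2) zero_mem(2) L]
      by (simp add: fun_ops(2) l2ip_simps mem g field_simps)
  qed
  have "?B ?w (0, ((u, e, s), - (l, m)) + c1) = 9/8 * l2ip \<Omega> e e + 1/2 * (\<kappa> * l2ip \<Omega> s s)
      + 1/8 * l2ip \<Omega> (wgrad \<Omega> u) (wgrad \<Omega> u) - 1/4 * l2ip \<Omega> e (wgrad \<Omega> u)
      + 1/2 * (1 / \<kappa> * l2ip \<Omega> (wgrad \<Omega> l) (wgrad \<Omega> l)) + ?B ?w (0, c1)"
    using test_expand[OF sym_bilinear_bform subspaces(4) parts(1,2) c1Z]
      bform_primal_diag[OF mem(1-3), of "1/8" 0 "1/2"] bform_dual_diag[OF mem(4,5), of "1/8" 0 "1/2"]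
    by (simp add: right_diff_distrib)
  moreover have "l2ip \<Omega> e (wgrad \<Omega> u) \<le> l2ip \<Omega> e e + 1/4 * l2ip \<Omega> (wgrad \<Omega> u) (wgrad \<Omega> u)"
    using l2ip_young(1)[OF mem(2) g(1), of 1] by simp
  moreover have "- l2ip \<Omega> e m \<le> l2ip \<Omega> e e + 1/4 * l2ip \<Omega> m m"
    using l2ip_young(2)[OF mem(2,5), of 1] by simp
  moreover have "l2ip \<Omega> (wgrad \<Omega> u) m \<le> 1/2 * l2ip \<Omega> (wgrad \<Omega> u) (wgrad \<Omega> u) + 1/2 * l2ip \<Omega> m m"
    using l2ip_young(1)[OF g(1) mem(5), of "1/2"] by simp
  moreover have "0 \<le> l2ip \<Omega> e e" "0 \<le> l2ip \<Omega> m m" "0 \<le> \<kappa> * l2ip \<Omega> s s" "0 \<le> 1 / \<kappa> * l2ip \<Omega> (wgrad \<Omega> l) (wgrad \<Omega> l)"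
    using \<kappa> by (simp_all add: l2ip_nonneg)
  ultimately show "1/32 * (norm_XY \<Omega> \<kappa> ?z)\<^sup>2 \<le> ?B ?w (0, ((u, e, s), - (l, m)) + c1)"
    unfolding norm_XY_sq c1eq by (simp add: distrib_left)
qed

end

section \<open>Residuals of the solution of the continuous problem\<close>

context problem
begin

lemma l2ip_AE_zero:
  assumes "f \<in> L2 \<Omega>" "g \<in> L2 \<Omega>" "AE x in lebesgue_on \<Omega>. f x = 0" shows "l2ip \<Omega> f g = 0"
  using l2ip_cong_AE[OF assms(1) L2_zero assms(2,2,3)] by (simp add: l2ip_zero)

lemma lagrangian_bform: "lagrangian \<Omega> \<zeta> \<kappa> d x y = 1/2 * bform \<Omega> \<zeta> \<kappa> 0 0 0 (d, x, y) (d, x, y)"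
proof -
  obtain q et st u e s l m where "d = (q, et, st)" "x = (u, e, s)" "y = (l, m)" by (metis surj_pair)
  then show ?thesis by (simp add: bform_def w_defs l2ip_self)
qed

text \<open>The Lagrangian is convex in the primal and affine in the dual unknowns.\<close>

lemma P2_solution_iff:
  assumes d: "d \<in> data_space \<Omega>"
  shows "P2_solution \<Omega> \<Gamma> \<zeta> \<kappa> d p \<longleftrightarrow>
    p \<in> Z_space \<Omega> \<Gamma> \<and> (\<forall>z'\<in>Z_space \<Omega> \<Gamma>. bform \<Omega> \<zeta> \<kappa> 0 0 0 (d, p) (0, z') = 0)"
proof -
  obtain x y where p: "p = (x, y)" by (cases p)
  have "saddle_point (X_space \<Omega> \<Gamma>) (Y_space \<Omega> \<Gamma>) (lagrangian \<Omega> \<zeta> \<kappa> d) (x, y) \<longleftrightarrow>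
     x \<in> X_space \<Omega> \<Gamma> \<and> y \<in> Y_space \<Omega> \<Gamma> \<and> (\<forall>x'\<in>X_space \<Omega> \<Gamma>. \<forall>y'\<in>Y_space \<Omega> \<Gamma>. bform \<Omega> \<zeta> \<kappa> 0 0 0 (d, x, y) (0, x', y') = 0)"
  proof (rule saddle_point_iff_stationary[OF sym_bilinear_bform[of 0 0 0, unfolded Z_space_def] subspaces(2,3,1) d lagrangian_bform])
    fix x assume "x \<in> X_space \<Omega> \<Gamma>"
    then obtain u e s where x: "x = (u, e, s)" "u \<in> H1D \<Omega> \<Gamma>" "e \<in> L2 \<Omega>" "s \<in> L2 \<Omega>" by (auto simp: X_space_def)
    show "0 \<le> bform \<Omega> \<zeta> \<kappa> 0 0 0 (0, x, 0) (0, x, 0)"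
      unfolding x(1) bform_primal_diag[OF x(2-4)] using \<kappa> by (simp add: l2ip_nonneg)
  next
    fix y assume "y \<in> Y_space \<Omega> \<Gamma>"
    then obtain l m where y: "y = (l, m)" "l \<in> H1D \<Omega> \<Gamma>" "m \<in> L2 \<Omega>" by (auto simp: Y_space_def)
    show "bform \<Omega> \<zeta> \<kappa> 0 0 0 (0, 0, y) (0, 0, y) \<le> 0"
      unfolding y(1) bform_dual_diag[OF y(2,3)] by simp
  qed
  then show ?thesis unfolding P2_solution_def p by (auto simp: Z_space_def)
qed

lemma test_ip_wgrad:
  assumes t: "test_function \<Omega> \<phi>" and f: "f \<in> L2 \<Omega>"
  shows "l2ip \<Omega> f (wgrad \<Omega> \<phi>) = (\<integral>x. f x \<bullet> grad \<phi> x \<partial>lebesgue_on \<Omega>)"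
proof -
  have sm: "smooth \<phi>" using t by (simp add: test_function_def)
  have "l2ip \<Omega> f (wgrad \<Omega> \<phi>) = l2ip \<Omega> f (grad \<phi>)"
    using f wgrad_smooth_AE[OF open_domain bounded_domain sm] test_function_L2(2)[OF t sets_lebesgue_open[OF open_domain]] wgrad_L2[OF smooth_H1[OF open_domain bounded_domain sm]]
    by (intro l2ip_cong_AE) auto
  then show ?thesis by (simp add: l2ip_def)
qed

text \<open>Each algebraic residual is square integrable and is an admissible test function for its own equation,
  so its norm vanishes. The two differential equations are tested with smooth functions of compact
  support, which satisfy the boundary condition; this is where the weak divergences of the solution
  come from.\<close>

lemma P2_solution_residuals:
  assumes d: "(q, et, st) \<in> data_space \<Omega>" and p: "P2_solution \<Omega> \<Gamma> \<zeta> \<kappa> (q, et, st) ((u, e, s), (l, m))"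
  shows "AE x in lebesgue_on \<Omega>. e x - wgrad \<Omega> u x = 0"
    and "AE x in lebesgue_on \<Omega>. e x + m x - et x = 0"
    and "AE x in lebesgue_on \<Omega>. \<kappa> *\<^sub>R s x - wgrad \<Omega> l x - \<kappa> *\<^sub>R st x = 0"
    and "has_weak_div \<Omega> s (\<lambda>x. q x - \<zeta> x * u x)"
    and "has_weak_div \<Omega> m (\<lambda>x. - (\<zeta> x * l x))"
proof -
  have dm: "q \<in> L2 \<Omega>" "et \<in> L2 \<Omega>" "st \<in> L2 \<Omega>" using d by (auto simp: data_space_def)
  have st: "((u, e, s), (l, m)) \<in> Z_space \<Omega> \<Gamma>"
    "\<And>z'. z' \<in> Z_space \<Omega> \<Gamma> \<Longrightarrow> bform \<Omega> \<zeta> \<kappa> 0 0 0 ((q, et, st), (u, e, s), (l, m)) (0, z') = 0"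
    using p unfolding P2_solution_iff[OF d] by auto
  have mem: "u \<in> H1D \<Omega> \<Gamma>" "e \<in> L2 \<Omega>" "s \<in> L2 \<Omega>" "l \<in> H1D \<Omega> \<Gamma>" "m \<in> L2 \<Omega>" using st(1) by (auto simp: Z_mem)
  note g = H1D_sub(3)[OF mem(1)] H1D_sub(3)[OF mem(4)]
  have Zt: "((0, e', 0), 0) \<in> Z_space \<Omega> \<Gamma>" "((0, 0, e'), 0) \<in> Z_space \<Omega> \<Gamma>" "(0, (0, e')) \<in> Z_space \<Omega> \<Gamma>" if "e' \<in> L2 \<Omega>" for e'
    using that zero_mem by (auto simp: Z_space_def X_space_def Y_space_def zero_prod_def)
  have Zu: "((u', 0, 0), 0) \<in> Z_space \<Omega> \<Gamma>" "(0, (u', 0)) \<in> Z_space \<Omega> \<Gamma>" if "u' \<in> H1D \<Omega> \<Gamma>" for u'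
    using that zero_mem by (auto simp: Z_space_def X_space_def Y_space_def zero_prod_def)
  show "AE x in lebesgue_on \<Omega>. e x - wgrad \<Omega> u x = 0"
  proof (rule l2norm_zero_AE)
    let ?f = "\<lambda>x. e x - wgrad \<Omega> u x"
    show L: "?f \<in> L2 \<Omega>" by (intro L2_diff mem g)
    show "l2norm \<Omega> ?f = 0"
      using st(2)[OF Zt(3)[OF L]] unfolding bform_test_m[OF mem dm L]
      unfolding l2norm_eq by (simp only: l2ip_diff_left[OF mem(2) g(1) L]) simp
  qed
  show "AE x in lebesgue_on \<Omega>. e x + m x - et x = 0"
  proof (rule l2norm_zero_AE)
    let ?f = "\<lambda>x. e x + m x - et x"
    show L: "?f \<in> L2 \<Omega>" by (intro L2_diff L2_add mem dm)
    show "l2norm \<Omega> ?f = 0"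
      using st(2)[OF Zt(1)[OF L]] unfolding bform_test_e[OF mem dm L]
      unfolding l2norm_eq by (simp only: l2ip_diff_left[OF L2_add[OF mem(2,5)] dm(2) L] l2ip_add_left[OF mem(2,5) L]) simp
  qed
  show "AE x in lebesgue_on \<Omega>. \<kappa> *\<^sub>R s x - wgrad \<Omega> l x - \<kappa> *\<^sub>R st x = 0"
  proof (rule l2norm_zero_AE)
    let ?f = "\<lambda>x. \<kappa> *\<^sub>R s x - wgrad \<Omega> l x - \<kappa> *\<^sub>R st x"
    show L: "?f \<in> L2 \<Omega>" by (intro L2_diff L2_scaleR mem dm g)
    have "l2ip \<Omega> ?f ?f = \<kappa> * l2ip \<Omega> s ?f - l2ip \<Omega> (wgrad \<Omega> l) ?f - \<kappa> * l2ip \<Omega> st ?f"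
      by (simp only: l2ip_diff_left[OF L2_diff[OF L2_scaleR[OF mem(3)] g(2)] L2_scaleR[OF dm(3)] L]
          l2ip_diff_left[OF L2_scaleR[OF mem(3)] g(2) L] l2ip_scaleR_left)
    then show "l2norm \<Omega> ?f = 0"
      using st(2)[OF Zt(2)[OF L]] unfolding bform_test_s[OF mem dm L] l2norm_eq by simp
  qed
  have \<zeta>u: "(\<lambda>x. \<zeta> x * u x) \<in> L2 \<Omega>" "(\<lambda>x. \<zeta> x * l x) \<in> L2 \<Omega>" by (intro L2_Linf_mult \<zeta> H1D_sub(2) mem)+
  have \<Gamma>f: "\<Gamma> \<subseteq> frontier \<Omega>" using dir by (simp add: dirichlet_part_def)
  show "has_weak_div \<Omega> s (\<lambda>x. q x - \<zeta> x * u x)"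
    unfolding has_weak_div_alt
  proof (intro conjI allI impI)
    show "(\<lambda>x. q x - \<zeta> x * u x) \<in> L2 \<Omega>" by (intro L2_diff dm \<zeta>u)
    fix \<phi> assume t: "test_function \<Omega> \<phi>"
    have h: "\<phi> \<in> H1D \<Omega> \<Gamma>" by (rule test_function_H1D[OF open_domain bounded_domain \<Gamma>f t])
    have "l2ip \<Omega> (\<lambda>x. \<zeta> x * u x - q x) \<phi> = l2ip \<Omega> s (wgrad \<Omega> \<phi>)"
      using st(2)[OF Zu(2)[OF h]] unfolding bform_test_l[OF mem dm h] by simp
    also have "\<dots> = (\<integral>x. s x \<bullet> grad \<phi> x \<partial>lebesgue_on \<Omega>)" by (rule test_ip_wgrad[OF t mem(3)])
    also have "l2ip \<Omega> (\<lambda>x. \<zeta> x * u x - q x) \<phi> = - (\<integral>x. (q x - \<zeta> x * u x) * \<phi> x \<partial>lebesgue_on \<Omega>)"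
      unfolding l2ip_def by (simp add: algebra_simps flip: Bochner_Integration.integral_minus)
    finally show "(\<integral>x. s x \<bullet> grad \<phi> x \<partial>lebesgue_on \<Omega>) = - (\<integral>x. (q x - \<zeta> x * u x) * \<phi> x \<partial>lebesgue_on \<Omega>)" by simp
  qed
  show "has_weak_div \<Omega> m (\<lambda>x. - (\<zeta> x * l x))"
    unfolding has_weak_div_alt
  proof (intro conjI allI impI)
    show "(\<lambda>x. - (\<zeta> x * l x)) \<in> L2 \<Omega>" by (intro L2_uminus \<zeta>u)
    fix \<phi> assume t: "test_function \<Omega> \<phi>"
    have h: "\<phi> \<in> H1D \<Omega> \<Gamma>" by (rule test_function_H1D[OF open_domain bounded_domain \<Gamma>f t])
    have "l2ip \<Omega> (\<lambda>x. \<zeta> x * l x) \<phi> = l2ip \<Omega> m (wgrad \<Omega> \<phi>)"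
      using st(2)[OF Zu(1)[OF h]] unfolding bform_test_u[OF mem dm h] by simp
    also have "\<dots> = (\<integral>x. m x \<bullet> grad \<phi> x \<partial>lebesgue_on \<Omega>)" by (rule test_ip_wgrad[OF t mem(5)])
    finally show "(\<integral>x. m x \<bullet> grad \<phi> x \<partial>lebesgue_on \<Omega>) = - (\<integral>x. - (\<zeta> x * l x) * \<phi> x \<partial>lebesgue_on \<Omega>)"
      by (simp add: l2ip_def)
  qed
qed

lemma W_L2:
  assumes "w \<in> data_space \<Omega> \<times> Z_space \<Omega> \<Gamma>"
  shows "w_q w \<in> L2 \<Omega>" "w_et w \<in> L2 \<Omega>" "w_st w \<in> L2 \<Omega>" "w_u w \<in> L2 \<Omega>" "w_e w \<in> L2 \<Omega>" "w_s w \<in> L2 \<Omega>"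
    "w_l w \<in> L2 \<Omega>" "w_m w \<in> L2 \<Omega>" "wgrad \<Omega> (w_u w) \<in> L2 \<Omega>" "wgrad \<Omega> (w_l w) \<in> L2 \<Omega>"
  using assms by (auto simp: w_defs data_space_def Z_space_def X_space_def Y_space_def H1D_sub)

text \<open>Every stabilization term is an inner product with a residual that vanishes at the exact solution,
  hence the exact solution satisfies the stabilized equations for all values of the coefficients.\<close>

lemma P2_solution_consistent:
  assumes d: "d \<in> data_space \<Omega>" and p: "P2_solution \<Omega> \<Gamma> \<zeta> \<kappa> d p"
  shows "p \<in> Zdiv_space \<Omega> \<Gamma>"
    and "z' \<in> Z_space \<Omega> \<Gamma> \<Longrightarrow> bform \<Omega> \<zeta> \<kappa> \<alpha> \<gamma> \<eta> (d, p) (0, z') = 0"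
    and "z' \<in> Zdiv_space \<Omega> \<Gamma> \<Longrightarrow> divform \<Omega> \<zeta> \<kappa> \<theta> \<beta> h (d, p) (0, z') = 0"
proof -
  obtain q et st u e s l m where e: "d = (q, et, st)" "p = ((u, e, s), (l, m))" by (metis surj_pair)
  note r = P2_solution_residuals[OF d[unfolded e] p[unfolded e]]
  have pZ: "p \<in> Z_space \<Omega> \<Gamma>" "\<And>z'. z' \<in> Z_space \<Omega> \<Gamma> \<Longrightarrow> bform \<Omega> \<zeta> \<kappa> 0 0 0 (d, p) (0, z') = 0"
    using p unfolding P2_solution_iff[OF d] by auto
  have dm: "q \<in> L2 \<Omega>" "et \<in> L2 \<Omega>" "st \<in> L2 \<Omega>" using d by (auto simp: data_space_def e)
  have mem: "u \<in> H1D \<Omega> \<Gamma>" "e \<in> L2 \<Omega>" "s \<in> L2 \<Omega>" "l \<in> H1D \<Omega> \<Gamma>" "m \<in> L2 \<Omega>" using pZ(1) by (auto simp: Z_mem e)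
  note g = H1D_sub(3)[OF mem(1)] H1D_sub(3)[OF mem(4)]
  show pd: "p \<in> Zdiv_space \<Omega> \<Gamma>" using mem r(4,5) by (auto simp: e Zdiv_space_def Hdiv_def)
  have sm: "s \<in> Hdiv \<Omega>" "m \<in> Hdiv \<Omega>" using pd by (auto simp: e Zdiv_space_def)
  have 0: "0 \<in> data_space \<Omega>" using subspaces(1) by (rule subspace_0)
  {
    assume z': "z' \<in> Z_space \<Omega> \<Gamma>"
    note L = W_L2[of "(0, z')", OF SigmaI[OF 0 z']]
    have "l2ip \<Omega> (\<lambda>x. e x - wgrad \<Omega> u x) (\<lambda>x. w_e (0, z') x - wgrad \<Omega> (w_u (0, z')) x) = 0"
      "l2ip \<Omega> (\<lambda>x. e x + m x - et x) (\<lambda>x. w_e (0, z') x + w_m (0, z') x - w_et (0, z') x) = 0"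
      "l2ip \<Omega> (\<lambda>x. \<kappa> *\<^sub>R s x - wgrad \<Omega> l x - \<kappa> *\<^sub>R st x)
          (\<lambda>x. \<kappa> *\<^sub>R w_s (0, z') x - wgrad \<Omega> (w_l (0, z')) x - \<kappa> *\<^sub>R w_st (0, z') x) = 0"
      by (intro l2ip_AE_zero r L2_diff L2_add L2_scaleR mem dm g L)+
    then show "bform \<Omega> \<zeta> \<kappa> \<alpha> \<gamma> \<eta> (d, p) (0, z') = 0"
      using pZ(2)[OF z'] unfolding bform_def
      by (simp add: e w_e_def[of "((q, et, st), _)"] w_u_def[of "((q, et, st), _)"] w_m_def[of "((q, et, st), _)"]
         w_et_def[of "((q, et, st), _)"] w_s_def[of "((q, et, st), _)"] w_l_def[of "((q, et, st), _)"]
         w_st_def[of "((q, et, st), _)"])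
  }
  {
    assume z'd: "z' \<in> Zdiv_space \<Omega> \<Gamma>"
    then have z': "z' \<in> Z_space \<Omega> \<Gamma>" using Zdiv_sub by blast
    note L = W_L2[of "(0, z')", OF SigmaI[OF 0 z']]
    have Ld: "wdiv \<Omega> (w_s (0, z')) \<in> L2 \<Omega>" "wdiv \<Omega> (w_m (0, z')) \<in> L2 \<Omega>"
      using z'd by (auto simp: Zdiv_space_def w_s_def w_m_def intro: wdiv_L2)
    have \<zeta>u: "(\<lambda>x. \<zeta> x * u x) \<in> L2 \<Omega>" "(\<lambda>x. \<zeta> x * l x) \<in> L2 \<Omega>" by (intro L2_Linf_mult \<zeta> H1D_sub(2) mem)+
    have \<zeta>z: "(\<lambda>x. \<zeta> x * w_u (0, z') x) \<in> L2 \<Omega>" "(\<lambda>x. \<zeta> x * w_l (0, z') x) \<in> L2 \<Omega>" by (intro L2_Linf_mult \<zeta> L)+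
    have "l2ip \<Omega> (\<lambda>x. h *\<^sub>R wdiv \<Omega> s x + h *\<^sub>R (\<zeta> x * u x - q x))
        (\<lambda>x. h *\<^sub>R wdiv \<Omega> (w_s (0, z')) x + h *\<^sub>R (\<zeta> x * w_u (0, z') x - w_q (0, z') x)) = 0"
    proof (intro l2ip_AE_zero L2_diff L2_add L2_scaleR mem dm L Ld \<zeta>u \<zeta>z wdiv_L2 sm)
      show "AE x in lebesgue_on \<Omega>. h *\<^sub>R wdiv \<Omega> s x + h *\<^sub>R (\<zeta> x * u x - q x) = 0"
        using wdiv_AE[OF open_domain r(4)] by eventually_elim (simp add: right_diff_distrib)
    qed
    moreover have "l2ip \<Omega> (\<lambda>x. h *\<^sub>R wdiv \<Omega> m x + h *\<^sub>R (\<zeta> x * l x))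
        (\<lambda>x. h *\<^sub>R wdiv \<Omega> (w_m (0, z')) x + h *\<^sub>R (\<zeta> x * w_l (0, z') x)) = 0"
    proof (intro l2ip_AE_zero L2_diff L2_add L2_scaleR mem dm L Ld \<zeta>u \<zeta>z wdiv_L2 sm)
      show "AE x in lebesgue_on \<Omega>. h *\<^sub>R wdiv \<Omega> m x + h *\<^sub>R (\<zeta> x * l x) = 0"
        using wdiv_AE[OF open_domain r(5)] by eventually_elim simp
    qed
    ultimately show "divform \<Omega> \<zeta> \<kappa> \<theta> \<beta> h (d, p) (0, z') = 0"
      unfolding divform_def
      by (simp add: e w_u_def[of "((q, et, st), _)"] w_m_def[of "((q, et, st), _)"]
         w_s_def[of "((q, et, st), _)"] w_l_def[of "((q, et, st), _)"] w_q_def[of "((q, et, st), _)"])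
  }
qed

end

section \<open>The abstract Galerkin theorem\<close>

context problem
begin

text \<open>The energy norm sees only gradients of \<open>u\<close> and \<open>\<lambda>\<close>; the Friedrichs inequality makes it definite
  up to null sets.\<close>

lemma norm_XY_zero_imp_ae_eq:
  assumes p: "p \<in> Z_space \<Omega> \<Gamma>" "p' \<in> Z_space \<Omega> \<Gamma>" and z: "norm_XY \<Omega> \<kappa> (p - p') = 0"
  shows "ae_eq \<Omega> p p'"
proof -
  obtain u e s l m where p1: "p = ((u, e, s), (l, m))" by (metis surj_pair)
  obtain u' e' s' l' m' where p2: "p' = ((u', e', s'), (l', m'))" by (metis surj_pair)
  have mem: "u \<in> H1D \<Omega> \<Gamma>" "e \<in> L2 \<Omega>" "s \<in> L2 \<Omega>" "l \<in> H1D \<Omega> \<Gamma>" "m \<in> L2 \<Omega>"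
    "u' \<in> H1D \<Omega> \<Gamma>" "e' \<in> L2 \<Omega>" "s' \<in> L2 \<Omega>" "l' \<in> H1D \<Omega> \<Gamma>" "m' \<in> L2 \<Omega>" using p by (auto simp: p1 p2 Z_mem)
  have z': "norm_XY \<Omega> \<kappa> ((u - u', e - e', s - s'), (l - l', m - m')) = 0" using z by (simp add: p1 p2)
  note b = l2norm_le_norm_XY[where u="u - u'" and e="e - e'" and s="s - s'" and l="l - l'" and m="m - m'", unfolded z']
  have n: "l2norm \<Omega> (wgrad \<Omega> (u - u')) = 0" "l2norm \<Omega> (e - e') = 0" "l2norm \<Omega> (s - s') = 0"
    "l2norm \<Omega> (wgrad \<Omega> (l - l')) = 0" "l2norm \<Omega> (m - m') = 0"
    by (intro order_antisym l2norm_nonneg; use b in simp)+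
  obtain C where C: "C \<ge> 0" "\<And>v. v \<in> H1D \<Omega> \<Gamma> \<Longrightarrow> l2norm \<Omega> v \<le> C * l2norm \<Omega> (wgrad \<Omega> v)"
    using poincare_H1D[OF dom dir] by blast
  have h: "u - u' \<in> H1D \<Omega> \<Gamma>" "l - l' \<in> H1D \<Omega> \<Gamma>" using mem subspace_diff[OF subspace_H1D[OF open_domain bounded_domain]] by blast+
  have n': "l2norm \<Omega> (u - u') = 0" "l2norm \<Omega> (l - l') = 0"
    by (intro order_antisym l2norm_nonneg; use C(2)[OF h(1)] C(2)[OF h(2)] n in simp)+
  have "AE x in lebesgue_on \<Omega>. (u - u') x = 0" "AE x in lebesgue_on \<Omega>. (l - l') x = 0"
    by (intro l2norm_zero_AE H1D_sub h n')+
  moreover have "AE x in lebesgue_on \<Omega>. (e - e') x = 0" "AE x in lebesgue_on \<Omega>. (s - s') x = 0" "AE x in lebesgue_on \<Omega>. (m - m') x = 0"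
    by (intro l2norm_zero_AE subspace_diff[OF subspace_L2] mem n)+
  ultimately show ?thesis unfolding p1 p2 ae_eq.simps by eventually_elim simp
qed

lemma data_norm_zero: "data_norm \<Omega> 0 = 0"
  by (simp add: zero_prod_def l2norm_0)

text \<open>The common argument for the three methods. Saddle points are the solutions of a linear system with a
  symmetric form. The test functions \<open>z'\<close> of the stability hypothesis give an inf-sup bound with constant
  \<open>c / C'\<close>: it makes the kernel of the system trivial, so that solutions exist in finite dimension, and it
  bounds the difference of two solutions by the difference of the data. For quasi-optimality, the
  exact solution satisfies the discrete equations (\<open>cons\<close>), so the error is orthogonal to the
  discrete space with respect to the form. The difference between the discrete solution and the best
  approximation is therefore bounded by \<open>C' / c * K\<close> times the best approximation error, as in the lemma of Cea.\<close>

theorem galerkin_conclusion: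
  fixes Hs :: "real set" and Z :: "('a primal \<times> 'a dual) set" and Nz :: "real \<Rightarrow> 'a primal \<times> 'a dual \<Rightarrow> real"
  assumes Z: "subspace Z" "Z \<subseteq> Z_space \<Omega> \<Gamma>"
    and M: "\<And>h. h \<in> Hs \<Longrightarrow> sym_bilinear Z (M h)" "\<And>h z. h \<in> Hs \<Longrightarrow> 0 \<le> M h z z" "\<And>h z. Nz h z = sqrt (M h z z)"
    and Nz: "\<And>h z. h \<in> Hs \<Longrightarrow> z \<in> Z \<Longrightarrow> norm_XY \<Omega> \<kappa> z \<le> Nz h z"
    and B: "bilform Hs (data_space \<Omega> \<times> Z) (\<lambda>h w. data_norm \<Omega> (fst w) + Nz h (snd w)) B"
    and sub: "\<And>h. h \<in> Hs \<Longrightarrow> subspace (Xh h)" "\<And>h. h \<in> Hs \<Longrightarrow> subspace (Yh h)"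
      "\<And>h. h \<in> Hs \<Longrightarrow> Xh h \<times> Yh h \<subseteq> Z" "\<And>h. h \<in> Hs \<Longrightarrow> \<exists>S. finite S \<and> Xh h \<times> Yh h \<subseteq> span S"
    and func: "\<And>h d x y. h \<in> Hs \<Longrightarrow> d \<in> data_space \<Omega> \<Longrightarrow> x \<in> Xh h \<Longrightarrow> y \<in> Yh h \<Longrightarrow>
      stab_lagrangian \<Omega> \<zeta> \<kappa> (T h) (P h) d x y = 1/2 * B h (d, x, y) (d, x, y)"
    and pos: "\<And>h x. h \<in> Hs \<Longrightarrow> x \<in> Xh h \<Longrightarrow> 0 \<le> B h (0, x, 0) (0, x, 0)"
    and neg: "\<And>h y. h \<in> Hs \<Longrightarrow> y \<in> Yh h \<Longrightarrow> B h (0, 0, y) (0, 0, y) \<le> 0"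
    and c: "c > 0" and C': "C' \<ge> 0"
    and stab: "\<And>h z. h \<in> Hs \<Longrightarrow> z \<in> Xh h \<times> Yh h \<Longrightarrow>
      \<exists>z'\<in>Xh h \<times> Yh h. Nz h z' \<le> C' * Nz h z \<and> c * (Nz h z)\<^sup>2 \<le> B h (0, z) (0, z')"
    and cons: "\<And>h d p z'. h \<in> Hs \<Longrightarrow> d \<in> data_space \<Omega> \<Longrightarrow> P2_solution \<Omega> \<Gamma> \<zeta> \<kappa> d p \<Longrightarrow> z' \<in> Z \<Longrightarrow> p \<in> Z \<and> B h (d, p) (0, z') = 0"
  shows "(\<forall>h\<in>Hs. well_posed \<Omega> \<zeta> \<kappa> (T h) (P h) (Xh h) (Yh h)) \<and> quasi_optimal \<Omega> \<Gamma> \<zeta> \<kappa> Hs T P Xh Yh Nz"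
proof -
  let ?D = "data_space \<Omega>"
  note D = subspaces(1)
  have D0: "0 \<in> ?D" using D by (rule subspace_0)
  have Z0: "0 \<in> Z" using Z(1) by (rule subspace_0)
  have Bsym: "sym_bilinear (?D \<times> Z) (B h)" if "h \<in> Hs" for h using B that by (simp add: bilform_def)
  obtain K where K: "K \<ge> 0" "\<And>h w w'. h \<in> Hs \<Longrightarrow> w \<in> ?D \<times> Z \<Longrightarrow> w' \<in> ?D \<times> Z \<Longrightarrow>
      \<bar>B h w w'\<bar> \<le> K * ((data_norm \<Omega> (fst w) + Nz h (snd w)) * (data_norm \<Omega> (fst w') + Nz h (snd w')))"
    using bilform_bound[OF B] by blast
  have Nz0: "Nz h 0 = 0" if "h \<in> Hs" for h
    using sym_bilinear_zero(1)[OF M(1)[OF that] Z0] by (simp add: M(3))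
  have Nz_nonneg: "0 \<le> Nz h z" if "h \<in> Hs" for h z using M(2)[OF that] by (simp add: M(3))
  have Zh: "subspace (Xh h \<times> Yh h)" if "h \<in> Hs" for h using sub(1,2)[OF that] by (rule subspace_Times)
  have split_d: "B h (d, z) (0, z') = B h (d, 0) (0, z') + B h (0, z) (0, z')"
    if "h \<in> Hs" "d \<in> ?D" "z \<in> Z" "z' \<in> Z" for h d z z'
    using sym_bilinearD(2)[OF Bsym[OF that(1)], of "(d, 0)" "(0, z)" "(0, z')"] that D0 Z0 by simp
  have bound_d: "\<bar>B h (d, 0) (0, z')\<bar> \<le> K * data_norm \<Omega> d * Nz h z'"
    if "h \<in> Hs" "d \<in> ?D" "z' \<in> Z" for h d z'
    using K(2)[OF that(1), of "(d, 0)" "(0, z')"] that D0 Z0 by (simp add: Nz0 data_norm_zero mult.assoc del: data_norm.simps)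
  have bound_z: "\<bar>B h (0, z) (0, z')\<bar> \<le> K * Nz h z * Nz h z'"
    if "h \<in> Hs" "z \<in> Z" "z' \<in> Z" for h z z'
    using K(2)[OF that(1), of "(0, z)" "(0, z')"] that D0 Z0 by (simp add: data_norm_zero mult.assoc del: data_norm.simps)
  \<comment> \<open>a bound for the residual functional \<open>z' \<mapsto> B z z'\<close> is a bound for \<open>z\<close>\<close>
  have inf_sup: "Nz h z \<le> (C' / c) * a"
    if h: "h \<in> Hs" and z: "z \<in> Xh h \<times> Yh h" and a: "\<And>z'. z' \<in> Xh h \<times> Yh h \<Longrightarrow> B h (0, z) (0, z') \<le> a * Nz h z'" and a0: "0 \<le> a" for h z a
  proof -
    obtain z' where z': "z' \<in> Xh h \<times> Yh h" "Nz h z' \<le> C' * Nz h z" "c * (Nz h z)\<^sup>2 \<le> B h (0, z) (0, z')"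
      using stab[OF h z] by blast
    have "c * (Nz h z)\<^sup>2 \<le> a * (C' * Nz h z)"
      using z'(3) a[OF z'(1)] mult_left_mono[OF z'(2) a0] by linarith
    then have "(c * Nz h z) * Nz h z \<le> (a * C') * Nz h z" by (simp add: power2_eq_square mult_ac)
    then have "c * Nz h z \<le> a * C'"
      using Nz_nonneg[OF h, of z] C' a0 by (cases "Nz h z = 0") auto
    then show ?thesis using c by (simp add: field_simps)
  qed
  have sol_iff: "P2h_solution \<Omega> \<zeta> \<kappa> (T h) (P h) (Xh h) (Yh h) d p \<longleftrightarrow>
      p \<in> Xh h \<times> Yh h \<and> (\<forall>z'\<in>Xh h \<times> Yh h. B h (d, p) (0, z') = 0)" if h: "h \<in> Hs" and d: "d \<in> ?D" for h d p
  proof -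
    obtain x y where p: "p = (x, y)" by (cases p)
    have "sym_bilinear (?D \<times> Xh h \<times> Yh h) (B h)"
      using sub(3)[OF h] by (intro sym_bilinear_subset[OF Bsym[OF h]] subspace_Times D sub h) blast
    from saddle_point_iff_stationary[OF this sub(1)[OF h] sub(2)[OF h] D d func[OF h d] pos[OF h] neg[OF h], of x y]
    show ?thesis unfolding P2h_solution_def p by auto
  qed
  \<comment> \<open>the difference of two solutions solves the problem for the difference of the data\<close>
  have diff_est: "Nz h (p' - p) \<le> (C' / c * K) * data_norm \<Omega> (d' - d)"
    if h: "h \<in> Hs" and d: "d \<in> ?D" "d' \<in> ?D"
      and p: "P2h_solution \<Omega> \<zeta> \<kappa> (T h) (P h) (Xh h) (Yh h) d p" "P2h_solution \<Omega> \<zeta> \<kappa> (T h) (P h) (Xh h) (Yh h) d' p'" for h d d' p p'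
  proof -
    have ps: "p \<in> Xh h \<times> Yh h" "p' \<in> Xh h \<times> Yh h" "p' - p \<in> Xh h \<times> Yh h"
      using p unfolding sol_iff[OF h d(1)] sol_iff[OF h d(2)] using subspace_diff[OF Zh[OF h]] by blast+
    have dd: "d' - d \<in> ?D" using d D subspace_diff by blast
    have "B h (0, p' - p) (0, z') \<le> (K * data_norm \<Omega> (d' - d)) * Nz h z'" if z': "z' \<in> Xh h \<times> Yh h" for z'
    proof -
      note inZ = ps[THEN subsetD[OF sub(3)[OF h]]] subsetD[OF sub(3)[OF h] z']
      have "B h (d' - d, p' - p) (0, z') = B h (d', p') (0, z') - B h (d, p) (0, z')"
        using sym_bilinear_diff(1)[OF Bsym[OF h], of "(d', p')" "(d, p)" "(0, z')"] inZ d D0 by simp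
      also have "\<dots> = 0"
      proof -
        have "B h (d', p') (0, z') = 0" "B h (d, p) (0, z') = 0"
          using p z' unfolding sol_iff[OF h d(1)] sol_iff[OF h d(2)] by blast+
        then show ?thesis by simp
      qed
      finally show ?thesis
        using split_d[OF h dd inZ(3,4)] bound_d[OF h dd inZ(4)] by linarith
    qed
    from inf_sup[OF h ps(3) this] K(1) data_norm_nonneg[of "d' - d"] show ?thesis by (simp add: mult.assoc del: data_norm.simps)
  qed
  have wp: "well_posed \<Omega> \<zeta> \<kappa> (T h) (P h) (Xh h) (Yh h)" if h: "h \<in> Hs" for h
    unfolding well_posed_def
  proof (intro ballI conjI allI impI)
    fix d assume d: "d \<in> ?D"
    obtain S where S: "finite S" "Xh h \<times> Yh h \<subseteq> span S" using sub(4)[OF h] by blast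
    have A: "sym_bilinear (Xh h \<times> Yh h) (\<lambda>z z'. B h (0, z) (0, z'))"
      by (rule sym_bilinear_subset[OF sym_bilinear_snd[OF Bsym[OF h] D Z(1)] sub(3)[OF h] Zh[OF h]])
    have "\<exists>p\<in>Xh h \<times> Yh h. \<forall>z'\<in>Xh h \<times> Yh h. B h (0, p) (0, z') = - B h (d, 0) (0, z')"
    proof (rule symmetric_form_solvable[OF A S])
      fix x y :: "'a primal \<times> 'a dual" and k assume x: "x \<in> Xh h \<times> Yh h"
      then have xZ: "x \<in> Z" using sub(3)[OF h] by blast
      show "- B h (d, 0) (0, k *\<^sub>R x) = k * - B h (d, 0) (0, x)"
        using sym_bilinearD(5)[OF Bsym[OF h], of "(d, 0)" "(0, x)" k] xZ d D0 Z0 by simp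
      assume y: "y \<in> Xh h \<times> Yh h"
      then have yZ: "y \<in> Z" using sub(3)[OF h] by blast
      show "- B h (d, 0) (0, x + y) = - B h (d, 0) (0, x) + - B h (d, 0) (0, y)"
        using sym_bilinearD(3)[OF Bsym[OF h], of "(0, x)" "(0, y)" "(d, 0)"] xZ yZ d D0 Z0 by simp
    next
      fix z assume z: "z \<in> Xh h \<times> Yh h" and ker: "\<forall>v\<in>Xh h \<times> Yh h. B h (0, v) (0, z) = 0"
      have zZ: "z \<in> Z" using z sub(3)[OF h] by blast
      have "Nz h z \<le> (C' / c) * 0"
      proof (rule inf_sup[OF h z])
        fix z' assume z': "z' \<in> Xh h \<times> Yh h"
        then have "B h (0, z) (0, z') = B h (0, z') (0, z)" using sym_bilinearD(1)[OF A z z'] by simp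
        then show "B h (0, z) (0, z') \<le> 0 * Nz h z'" using ker z' by simp
      qed simp
      then have "Nz h z = 0" using Nz_nonneg[OF h, of z] by simp
      then show "- B h (d, 0) (0, z) = 0" using bound_d[OF h d zZ] by simp
    qed
    then obtain p where p: "p \<in> Xh h \<times> Yh h" "\<And>z'. z' \<in> Xh h \<times> Yh h \<Longrightarrow> B h (0, p) (0, z') = - B h (d, 0) (0, z')" by blast
    have "B h (d, p) (0, z') = 0" if "z' \<in> Xh h \<times> Yh h" for z'
      using split_d[OF h d subsetD[OF sub(3)[OF h] p(1)] subsetD[OF sub(3)[OF h] that]] p(2)[OF that] by simp
    then show "\<exists>p. P2h_solution \<Omega> \<zeta> \<kappa> (T h) (P h) (Xh h) (Yh h) d p"
      using p(1) unfolding sol_iff[OF h d] by blast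
  next
    fix d p p' assume d: "d \<in> ?D" and p: "P2h_solution \<Omega> \<zeta> \<kappa> (T h) (P h) (Xh h) (Yh h) d p" "P2h_solution \<Omega> \<zeta> \<kappa> (T h) (P h) (Xh h) (Yh h) d p'"
    have inZ: "p \<in> Z" "p' \<in> Z" using p sub(3)[OF h] unfolding sol_iff[OF h d] by blast+
    have "Nz h (p - p') \<le> 0" using diff_est[OF h d d p(2,1)] by (simp add: data_norm_zero del: data_norm.simps)
    then have "norm_XY \<Omega> \<kappa> (p - p') = 0"
      using Nz[OF h subspace_diff[OF Z(1) inZ]] norm_XY_nonneg[of "p - p'"] by linarith
    then show "ae_eq \<Omega> p p'" using inZ Z(2) by (intro norm_XY_zero_imp_ae_eq) auto
  next
    fix d p and \<epsilon> :: real assume d: "d \<in> ?D" and p: "P2h_solution \<Omega> \<zeta> \<kappa> (T h) (P h) (Xh h) (Yh h) d p" and \<epsilon>: "\<epsilon> > 0"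
    define L where "L = C' / c * K"
    have L: "L \<ge> 0" using C' c K(1) by (simp add: L_def)
    show "\<exists>\<delta>>0. \<forall>d'\<in>?D. \<forall>p'. P2h_solution \<Omega> \<zeta> \<kappa> (T h) (P h) (Xh h) (Yh h) d' p' \<longrightarrow>
        data_norm \<Omega> (d' - d) < \<delta> \<longrightarrow> norm_XY \<Omega> \<kappa> (p' - p) < \<epsilon>"
    \<comment> \<open>one is added because \<open>L\<close> may be zero\<close>
    proof (intro exI[of _ "\<epsilon> / (L + 1)"] conjI ballI allI impI)
      show "0 < \<epsilon> / (L + 1)" using \<epsilon> L by simp
      fix d' p' assume d': "d' \<in> ?D" and p': "P2h_solution \<Omega> \<zeta> \<kappa> (T h) (P h) (Xh h) (Yh h) d' p'"
        and lt: "data_norm \<Omega> (d' - d) < \<epsilon> / (L + 1)"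
      have inZ: "p' - p \<in> Z"
        using p p' sub(3)[OF h] subspace_diff[OF Z(1)] unfolding sol_iff[OF h d] sol_iff[OF h d'] by blast
      have "norm_XY \<Omega> \<kappa> (p' - p) \<le> L * data_norm \<Omega> (d' - d)"
        using Nz[OF h inZ] diff_est[OF h d d' p p'] unfolding L_def by linarith
      also have "\<dots> \<le> (L + 1) * data_norm \<Omega> (d' - d)"
        using data_norm_nonneg by (intro mult_right_mono) auto
      also have "\<dots> < \<epsilon>" using lt L by (simp add: pos_less_divide_eq mult.commute del: data_norm.simps)
      finally show "norm_XY \<Omega> \<kappa> (p' - p) < \<epsilon>" .
    qed
  qed
  have "quasi_optimal \<Omega> \<Gamma> \<zeta> \<kappa> Hs T P Xh Yh Nz"
    unfolding quasi_optimal_def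
  proof (intro exI[of _ "1 + C' / c * K"] conjI ballI allI impI)
    show "0 < 1 + C' / c * K" using C' c K(1) by (simp add: add_pos_nonneg)
    fix h d p ph assume h: "h \<in> Hs" and d: "d \<in> ?D" and p: "P2_solution \<Omega> \<Gamma> \<zeta> \<kappa> d p"
      and ph: "P2h_solution \<Omega> \<zeta> \<kappa> (T h) (P h) (Xh h) (Yh h) d ph"
    have pZ: "p \<in> Z" and pB: "\<And>z'. z' \<in> Z \<Longrightarrow> B h (d, p) (0, z') = 0" using cons[OF h d p] Z0 by blast+
    have phV: "ph \<in> Xh h \<times> Yh h" and phB: "\<And>z'. z' \<in> Xh h \<times> Yh h \<Longrightarrow> B h (d, ph) (0, z') = 0"
      using ph unfolding sol_iff[OF h d] by blast+
    obtain S where S: "finite S" "Xh h \<times> Yh h \<subseteq> span S" using sub(4)[OF h] by blast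
    obtain b where b: "b \<in> Xh h \<times> Yh h" "\<And>v. v \<in> Xh h \<times> Yh h \<Longrightarrow> Nz h (p - b) \<le> Nz h (p - v)"
      using best_approximation_exists[OF M(1)[OF h] M(2)[OF h] Zh[OF h] sub(3)[OF h] S pZ] unfolding M(3) by blast
    have "is_arg_min (\<lambda>z. Nz h (p - z)) (\<lambda>z. z \<in> Xh h \<times> Yh h) b"
      unfolding is_arg_min_linorder using b by blast
    moreover have "Nz h (p - ph) \<le> (1 + C' / c * K) * Nz h (p - b)"
    proof -
      have inZ: "b \<in> Z" "ph \<in> Z" "p - b \<in> Z" "b - ph \<in> Z"
        using b(1) phV pZ sub(3)[OF h] subspace_diff[OF Z(1)] by blast+
      have bV: "b - ph \<in> Xh h \<times> Yh h" using subspace_diff[OF Zh[OF h] b(1) phV] .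
      have "Nz h (b - ph) \<le> (C' / c) * (K * Nz h (p - b))"
      proof (rule inf_sup[OF h bV])
        fix z' assume z': "z' \<in> Xh h \<times> Yh h"
        then have z'Z: "z' \<in> Z" using sub(3)[OF h] by blast
        have "B h (0, p - ph) (0, z') = B h (d, p) (0, z') - B h (d, ph) (0, z')"
          using sym_bilinear_diff(1)[OF Bsym[OF h], of "(d, p)" "(d, ph)" "(0, z')"] inZ pZ z'Z d D0 by simp
        \<comment> \<open>orthogonality of the error\<close>
        then have o: "B h (0, p - ph) (0, z') = 0" using pB[OF z'Z] phB[OF z'] by simp
        have "B h (0, p - ph) (0, z') = B h (0, p - b) (0, z') + B h (0, b - ph) (0, z')"
          using sym_bilinearD(2)[OF Bsym[OF h], of "(0, p - b)" "(0, b - ph)" "(0, z')"] inZ z'Z D0 by simp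
        then show "B h (0, b - ph) (0, z') \<le> K * Nz h (p - b) * Nz h z'"
          using o bound_z[OF h inZ(3) z'Z] by linarith
      qed (use K(1) Nz_nonneg[OF h] in simp)
      moreover have "Nz h (p - ph) \<le> Nz h (p - b) + Nz h (b - ph)"
        using seminorm_triangle[OF M(1)[OF h] M(2)[OF h] inZ(3,4)] unfolding M(3) by simp
      ultimately show ?thesis by (simp add: distrib_right mult.assoc)
    qed
    ultimately show "\<exists>b. is_arg_min (\<lambda>z. Nz h (p - z)) (\<lambda>z. z \<in> Xh h \<times> Yh h) b \<and>
         Nz h (p - ph) \<le> (1 + C' / c * K) * Nz h (p - b)" by blast
  qed
  then show ?thesis using wp by blast
qed

end

section \<open>Meshes, broken norms and finite-dimensional spaces of fields\<close>

lemma L2_subset: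
  assumes "f \<in> L2 W" "U \<subseteq> W" "U \<in> sets lebesgue" "W \<in> sets lebesgue" shows "f \<in> L2 U"
proof -
  have "f \<in> borel_measurable (lebesgue_on U)"
    using measurable_restrict_mono[OF L2_D(1)[OF assms(1)] assms(2)] .
  moreover have "integrable (lebesgue_on U) (\<lambda>x. (norm (f x))\<^sup>2)"
  proof -
    have "integrable lebesgue (\<lambda>x. indicator W x *\<^sub>R (norm (f x))\<^sup>2)"
      using L2_D(2)[OF assms(1)] assms(4) by (simp add: integrable_restrict_space)
    then have "integrable lebesgue (\<lambda>x. indicator U x *\<^sub>R (indicator W x *\<^sub>R (norm (f x))\<^sup>2))"
      by (rule integrable_mult_indicator[OF assms(3)])
    moreover have "(\<lambda>x. indicator U x *\<^sub>R (indicator W x *\<^sub>R (norm (f x))\<^sup>2)) = (\<lambda>x. indicator U x *\<^sub>R (norm (f x))\<^sup>2)"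
      using assms(2) by (auto simp: indicator_def fun_eq_iff)
    ultimately show ?thesis using assms(3) by (simp add: integrable_restrict_space)
  qed
  ultimately show ?thesis by (simp add: L2_def)
qed

text \<open>Test functions of the smaller set are test functions of the larger one.\<close>

lemma has_weak_div_subset:
  assumes "has_weak_div W s g" "U \<subseteq> W" "open U" "open W" shows "has_weak_div U s g"
  unfolding has_weak_div_alt
proof (intro conjI allI impI)
  have m: "U \<in> sets lebesgue" "W \<in> sets lebesgue" using assms by (auto intro: sets_lebesgue_open)
  show "g \<in> L2 U" using assms m by (intro L2_subset[of g W U]) (auto simp: has_weak_div_def)
  fix \<phi> assume t: "test_function U \<phi>"
  then have tW: "test_function W \<phi>" using assms(2) unfolding test_function_def by blast
  obtain K where K: "smooth \<phi>" "compact K" "K \<subseteq> U" "\<And>x. x \<notin> K \<Longrightarrow> \<phi> x = 0" "\<And>x. x \<notin> K \<Longrightarrow> grad \<phi> x = 0"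
    using test_functionE[OF t] by blast
  have z: "\<phi> x = 0" "grad \<phi> x = 0" if "x \<notin> U" for x using K(3-5) that by auto
  have z': "\<phi> x = 0" "grad \<phi> x = 0" if "x \<notin> W" for x using z assms(2) that by auto
  have "(\<integral>x. s x \<bullet> grad \<phi> x \<partial>lebesgue_on U) = (\<integral>x. s x \<bullet> grad \<phi> x \<partial>lebesgue_on W)"
    using z z' by (simp add: integral_lebesgue_on_supp[OF m(1)] integral_lebesgue_on_supp[OF m(2)])
  moreover have "(\<integral>x. g x * \<phi> x \<partial>lebesgue_on U) = (\<integral>x. g x * \<phi> x \<partial>lebesgue_on W)"
    using z z' by (simp add: integral_lebesgue_on_supp[OF m(1)] integral_lebesgue_on_supp[OF m(2)])
  ultimately show "(\<integral>x. s x \<bullet> grad \<phi> x \<partial>lebesgue_on U) = - (\<integral>x. g x * \<phi> x \<partial>lebesgue_on U)"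
    using assms(1) tW by (simp add: has_weak_div_alt)
qed

text \<open>A Lipschitz domain has no slits: below each boundary point there are exterior points arbitrarily
  close to it.\<close>

lemma interior_closure_lipschitz:
  assumes W: "open W" "lipschitz_boundary W" shows "interior (closure W) \<subseteq> W"
proof
  fix x assume x: "x \<in> interior (closure W)"
  show "x \<in> W"
  proof (rule ccontr)
    assume "x \<notin> W"
    then have xf: "x \<in> frontier W" using x interior_subset W(1) by (auto simp: frontier_def interior_open)
    obtain r n L g where ch: "r > 0" "norm n = 1" "L-lipschitz_on {z. z \<bullet> n = 0} g"
      "\<And>z. z \<in> frontier W \<Longrightarrow> z \<in> ball x r \<Longrightarrow> z \<bullet> n = g (z - (z \<bullet> n) *\<^sub>R n)"
      "\<And>z t. z \<in> frontier W \<Longrightarrow> z \<in> ball x r \<Longrightarrow> 0 < t \<Longrightarrow> t < r \<Longrightarrow> z + t *\<^sub>R n \<in> W"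
      "\<And>z t. z \<in> frontier W \<Longrightarrow> z \<in> ball x r \<Longrightarrow> 0 < t \<Longrightarrow> t < r \<Longrightarrow> z - t *\<^sub>R n \<notin> closure W"
      by (rule boundary_chart[OF W xf], rule that; assumption)
    obtain e where e: "e > 0" "ball x e \<subseteq> closure W" using x by (auto simp: mem_interior)
    define t where "t = min e r / 2"
    have t: "0 < t" "t < r" "t < e" using e(1) ch(1) by (auto simp: t_def)
    have "x - t *\<^sub>R n \<in> ball x e" using t ch(2) by (simp add: dist_norm)
    then have "x - t *\<^sub>R n \<in> closure W" using e(2) by blast
    then show False using ch(6)[OF xf _ t(1,2)] ch(1) by simp
  qed
qed

text \<open>The interiors of the elements tile the domain up to a null set. Two elements whose interiors meet
  coincide, because a proper face misses the interior, and the boundaries of convex sets are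
  negligible.\<close>

lemma conformal_mesh_interiors:
  assumes W: "open W" "lipschitz_boundary W" and T: "conformal_mesh W T"
  shows "K \<in> T \<Longrightarrow> interior K \<subseteq> W"
    and "K \<in> T \<Longrightarrow> K' \<in> T \<Longrightarrow> K \<noteq> K' \<Longrightarrow> interior K \<inter> interior K' = {}"
    and "negligible (W - (\<Union>K\<in>T. interior K))"
proof -
  have T': "finite T" "\<And>K. K \<in> T \<Longrightarrow> polytope K" "\<Union>T = closure W"
    "\<And>K K'. K \<in> T \<Longrightarrow> K' \<in> T \<Longrightarrow> (K \<inter> K') face_of K \<and> (K \<inter> K') face_of K'"
    using T by (auto simp: conformal_mesh_def)
  show "interior K \<subseteq> W" if "K \<in> T"
  proof -
    have "interior K \<subseteq> interior (closure W)" using that T'(3) by (intro interior_mono) auto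
    then show ?thesis using interior_closure_lipschitz[OF W] by blast
  qed
  show "interior K \<inter> interior K' = {}" if K: "K \<in> T" "K' \<in> T" "K \<noteq> K'"
  proof (rule ccontr)
    assume ne: "interior K \<inter> interior K' \<noteq> {}"
    have "K \<inter> K' = K"
    proof (rule ccontr)
      assume "K \<inter> K' \<noteq> K"
      then have "(K \<inter> K') \<inter> interior K = {}" using T'(4)[OF K(1,2)] face_of_disjoint_interior by blast
      then show False using ne interior_subset by blast
    qed
    moreover have "K \<inter> K' = K'"
    proof (rule ccontr)
      assume "K \<inter> K' \<noteq> K'"
      then have "(K \<inter> K') \<inter> interior K' = {}" using T'(4)[OF K(1,2)] face_of_disjoint_interior by blast
      then show False using ne interior_subset by blast
    qed
    ultimately show False using K(3) by simp
  qed
  have "negligible (\<Union>K\<in>T. frontier K)"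
    using T'(1,2) by (intro negligible_Union) (auto simp: polytope_imp_convex negligible_convex_frontier)
  moreover have "W - (\<Union>K\<in>T. interior K) \<subseteq> (\<Union>K\<in>T. frontier K)"
  proof
    fix x assume x: "x \<in> W - (\<Union>K\<in>T. interior K)"
    then obtain K where "K \<in> T" "x \<in> K" using T'(3) closure_subset by blast
    then show "x \<in> (\<Union>K\<in>T. frontier K)" using x closure_subset by (auto simp: frontier_def)
  qed
  ultimately show "negligible (W - (\<Union>K\<in>T. interior K))" by (rule negligible_subset)
qed

lemma broken_norm_eq:
  fixes f :: "'a::euclidean_space \<Rightarrow> real"
  assumes W: "open W" "lipschitz_boundary W" and T: "conformal_mesh W T" and f: "f \<in> L2 W"
    and fK: "\<And>K. K \<in> T \<Longrightarrow> fK K \<in> borel_measurable (lebesgue_on (interior K))"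
      "\<And>K. K \<in> T \<Longrightarrow> AE x in lebesgue_on (interior K). fK K x = f x"
  shows "(\<Sum>K\<in>T. (l2norm (interior K) (fK K))\<^sup>2) = (l2norm W f)\<^sup>2"
proof -
  note I = conformal_mesh_interiors[OF W T]
  have fin: "finite T" using T by (simp add: conformal_mesh_def)
  have Wl: "W \<in> sets lebesgue" by (rule sets_lebesgue_open[OF W(1)])
  have Kl: "interior K \<in> sets lebesgue" for K by (simp add: sets_lebesgue_open)
  let ?F = "\<lambda>x. (norm (f x))\<^sup>2"
  have intK: "integrable lebesgue (\<lambda>x. indicator (interior K) x *\<^sub>R ?F x)" if "K \<in> T" for K
    using L2_D(2)[OF L2_subset[OF f I(1)[OF that] Kl Wl]] Kl by (simp add: integrable_restrict_space)
  have "(\<Sum>K\<in>T. (l2norm (interior K) (fK K))\<^sup>2) = (\<Sum>K\<in>T. \<integral>x. indicator (interior K) x *\<^sub>R ?F x \<partial>lebesgue)"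
  proof (rule sum.cong[OF refl])
    fix K assume K: "K \<in> T"
    have "(l2norm (interior K) (fK K))\<^sup>2 = (\<integral>x. (norm (fK K x))\<^sup>2 \<partial>lebesgue_on (interior K))"
      by (simp add: l2norm_def integral_nonneg_AE)
    also have "\<dots> = (\<integral>x. ?F x \<partial>lebesgue_on (interior K))"
      using fK[OF K] L2_D(1)[OF L2_subset[OF f I(1)[OF K] Kl Wl]] by (intro integral_cong_AE) auto
    also have "\<dots> = (\<integral>x. indicator (interior K) x *\<^sub>R ?F x \<partial>lebesgue)"
      using Kl by (intro integral_restrict_space) simp
    finally show "(l2norm (interior K) (fK K))\<^sup>2 = (\<integral>x. indicator (interior K) x *\<^sub>R ?F x \<partial>lebesgue)" .
  qed
  also have "\<dots> = (\<integral>x. (\<Sum>K\<in>T. indicator (interior K) x *\<^sub>R ?F x) \<partial>lebesgue)"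
    using intK by (intro Bochner_Integration.integral_sum[symmetric]) auto
  also have "\<dots> = (\<integral>x. indicator W x *\<^sub>R ?F x \<partial>lebesgue)"
  proof (rule integral_cong_AE)
    show "(\<lambda>x. \<Sum>K\<in>T. indicator (interior K) x *\<^sub>R ?F x) \<in> borel_measurable lebesgue"
      using intK by (intro borel_measurable_sum) auto
    show "(\<lambda>x. indicator W x *\<^sub>R ?F x) \<in> borel_measurable lebesgue"
      using L2_D(2)[OF f] Wl by (auto simp: integrable_restrict_space dest: borel_measurable_integrable)
    have "AE x in lebesgue. x \<notin> W - (\<Union>K\<in>T. interior K)"
      using I(3) by (intro AE_not_in) (simp add: negligible_iff_null_sets)
    then show "AE x in lebesgue. (\<Sum>K\<in>T. indicator (interior K) x *\<^sub>R ?F x) = indicator W x *\<^sub>R ?F x"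
    proof eventually_elim
      case (elim x)
      show ?case
      proof (cases "x \<in> W")
        case True
        then obtain K where K: "K \<in> T" "x \<in> interior K" using elim by blast
        have "(\<Sum>K'\<in>T. indicator (interior K') x *\<^sub>R ?F x) = (\<Sum>K'\<in>{K}. indicator (interior K') x *\<^sub>R ?F x)"
          using fin K I(2)[OF K(1)] by (intro sum.mono_neutral_right) (auto simp: indicator_def)
        then show ?thesis using K True by simp
      next
        case False
        then have "x \<notin> interior K" if "K \<in> T" for K using I(1)[OF that] by blast
        then show ?thesis using False by simp
      qed
    qed
  qed
  also have "\<dots> = (\<integral>x. ?F x \<partial>lebesgue_on W)"
    using Wl by (intro integral_restrict_space[symmetric]) simp
  also have "\<dots> = (l2norm W f)\<^sup>2" by (simp add: l2norm_def integral_nonneg_AE)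
  finally show ?thesis .
qed

lemma sum_fun_apply: "(\<Sum>i\<in>I. F i) x = (\<Sum>i\<in>I. F i x)" for F :: "'i \<Rightarrow> 'a \<Rightarrow> 'b::real_vector"
  by (induction I rule: infinite_finite_induct) auto

text \<open>The divergence is the sum of the diagonal derivatives of the components.\<close>

lemma vector_fields_Hdiv:
  assumes W: "open W" and V: "V \<subseteq> H1 W" and s: "s \<in> vector_fields V" shows "s \<in> Hdiv W"
proof -
  have sb: "(\<lambda>x. s x \<bullet> b) \<in> H1 W" if "b \<in> Basis" for b using s V that by (auto simp: vector_fields_def)
  have sbL: "(\<lambda>x. s x \<bullet> b) \<in> L2 W" if "b \<in> Basis" for b using sb[OF that] by (simp add: H1_def)
  have Wl: "W \<in> sets lebesgue" by (rule sets_lebesgue_open[OF W])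
  have sL: "s \<in> L2 W"
  proof (rule L2_bounded_by)
    show "s \<in> borel_measurable (lebesgue_on W)"
      using sbL by (subst borel_measurable_euclidean_space) (auto dest: L2_D(1))
    show "integrable (lebesgue_on W) (\<lambda>x. \<Sum>b\<in>Basis. (norm (s x \<bullet> b))\<^sup>2)"
      by (intro Bochner_Integration.integrable_sum L2_D(2) sbL)
    show "AE x in lebesgue_on W. (norm (s x))\<^sup>2 \<le> (\<Sum>b\<in>Basis. (norm (s x \<bullet> b))\<^sup>2)"
    proof (rule AE_I2)
      fix x
      have "(norm (s x))\<^sup>2 = (\<Sum>b\<in>Basis. (s x \<bullet> b) * (s x \<bullet> b))"
        by (simp add: power2_norm_eq_inner euclidean_inner[of "s x" "s x"])
      then show "(norm (s x))\<^sup>2 \<le> (\<Sum>b\<in>Basis. (norm (s x \<bullet> b))\<^sup>2)" by (simp add: power2_eq_square)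
    qed
  qed
  let ?G = "\<lambda>b. wgrad W (\<lambda>x. s x \<bullet> b)"
  have GL: "(\<lambda>x. ?G b x \<bullet> b) \<in> L2 W" if "b \<in> Basis" for b
    using wgrad_L2[OF sb[OF that]] that by (intro L2_Basis) auto
  have "has_weak_div W s (\<lambda>x. \<Sum>b\<in>Basis. ?G b x \<bullet> b)"
    unfolding has_weak_div_alt
  proof (intro conjI allI impI)
    have "(\<lambda>x. \<Sum>b\<in>Basis. ?G b x \<bullet> b) = (\<Sum>b\<in>Basis. (\<lambda>x. ?G b x \<bullet> b))"
      by (simp add: fun_eq_iff sum_fun_apply)
    then show "(\<lambda>x. \<Sum>b\<in>Basis. ?G b x \<bullet> b) \<in> L2 W"
      using subspace_sum[OF subspace_L2, of Basis "\<lambda>b x. ?G b x \<bullet> b" W] GL by simp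
    fix \<phi> assume t: "test_function W \<phi>"
    note tL = test_function_L2[OF t Wl]
    have "(\<integral>x. s x \<bullet> grad \<phi> x \<partial>lebesgue_on W) = (\<integral>x. (\<Sum>b\<in>Basis. (s x \<bullet> b) * (grad \<phi> x \<bullet> b)) \<partial>lebesgue_on W)"
      by (intro Bochner_Integration.integral_cong refl euclidean_inner)
    also have "\<dots> = (\<Sum>b\<in>Basis. \<integral>x. (s x \<bullet> b) * (grad \<phi> x \<bullet> b) \<partial>lebesgue_on W)"
      by (intro Bochner_Integration.integral_sum L2_mult_integrable sbL L2_Basis tL) auto
    also have "\<dots> = (\<Sum>b\<in>Basis. - (\<integral>x. (?G b x \<bullet> b) * \<phi> x \<partial>lebesgue_on W))"
      using has_weak_grad_wgrad[OF sb] t by (intro sum.cong) (auto simp: has_weak_grad_alt)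
    also have "\<dots> = - (\<integral>x. (\<Sum>b\<in>Basis. (?G b x \<bullet> b) * \<phi> x) \<partial>lebesgue_on W)"
      unfolding sum_negf by (subst Bochner_Integration.integral_sum) (auto intro!: L2_mult_integrable GL tL)
    finally show "(\<integral>x. s x \<bullet> grad \<phi> x \<partial>lebesgue_on W) = - (\<integral>x. (\<Sum>b\<in>Basis. ?G b x \<bullet> b) * \<phi> x \<partial>lebesgue_on W)"
      by (simp add: sum_distrib_right)
  qed
  then show ?thesis using sL by (auto simp: Hdiv_def)
qed

lemma fun_sum_scaleR: "(\<lambda>x. \<Sum>b\<in>B. c b *\<^sub>R b x) = (\<Sum>b\<in>B. c b *\<^sub>R b)" for B :: "('a \<Rightarrow> 'b::real_vector) set"
  by (simp add: fun_eq_iff sum_fun_apply scaleR_fun_def)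

text \<open>Identifies the coefficient description of a discrete space with a span, which carries the linear
  algebra.\<close>

lemma finite_dim_space_span: assumes "finite_dim_space V" obtains S where "finite S" "V = span S"
proof -
  obtain B where B: "finite B" "V = {f. \<exists>c. f = (\<lambda>x. \<Sum>b\<in>B. c b *\<^sub>R b x)}"
    using assms by (auto simp: finite_dim_space_def)
  then have "V = span B" unfolding span_finite[OF B(1)] fun_sum_scaleR by auto
  then show thesis using B(1) that by blast
qed

lemma vector_fields_finite_dim:
  fixes V :: "('a::euclidean_space \<Rightarrow> real) set"
  assumes "finite_dim_space V"
  shows "subspace (vector_fields V)" "\<exists>S. finite S \<and> vector_fields V \<subseteq> span S"
proof -
  obtain S where S: "finite S" "V = span S" using finite_dim_space_span[OF assms] by blast
  have V: "subspace V" unfolding S(2) by (rule subspace_span)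
  have c0: "(\<lambda>x. 0) \<in> V" and cp: "\<And>f g. f \<in> V \<Longrightarrow> g \<in> V \<Longrightarrow> (\<lambda>x. f x + g x) \<in> V"
    and cs: "\<And>c f. f \<in> V \<Longrightarrow> (\<lambda>x. c * f x) \<in> V"
    using V unfolding subspace_def fun_ops real_scaleR_def by blast+
  show "subspace (vector_fields V)"
    unfolding subspace_def vector_fields_def by (auto simp: fun_ops inner_add_left c0 cp cs)
  \<comment> \<open>the field with component \<open>v\<close> in the direction \<open>b\<close>\<close>
  define \<tau> where "\<tau> b v = (\<lambda>x. v x *\<^sub>R b)" for b :: 'a and v :: "'a \<Rightarrow> real"
  define S' where "S' = (\<Union>b\<in>Basis. \<tau> b ` S)"
  have lin: "linear (\<tau> b)" for b
    by (rule linearI) (auto simp: \<tau>_def fun_ops scaleR_add_left)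
  have "vector_fields V \<subseteq> span S'"
  proof
    fix w assume w: "w \<in> vector_fields V"
    have "\<tau> b (\<lambda>x. w x \<bullet> b) \<in> span S'" if b: "b \<in> Basis" for b
    proof -
      have "(\<lambda>x. w x \<bullet> b) \<in> span S" using w b S(2) by (auto simp: vector_fields_def)
      then have "\<tau> b (\<lambda>x. w x \<bullet> b) \<in> span (\<tau> b ` S)" using linear_span_image[OF lin] by blast
      then show ?thesis using b span_mono[of "\<tau> b ` S" S'] unfolding S'_def by blast
    qed
    then have "(\<Sum>b\<in>Basis. \<tau> b (\<lambda>x. w x \<bullet> b)) \<in> span S'" by (rule span_sum)
    moreover have "(\<Sum>b\<in>Basis. \<tau> b (\<lambda>x. w x \<bullet> b)) = (\<lambda>x. \<Sum>b\<in>Basis. (w x \<bullet> b) *\<^sub>R b)"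
      by (simp add: fun_eq_iff sum_fun_apply \<tau>_def)
    ultimately show "w \<in> span S'" by (simp add: euclidean_representation)
  qed
  moreover have "finite S'" using S(1) by (simp add: S'_def)
  ultimately show "\<exists>S. finite S \<and> vector_fields V \<subseteq> span S" by blast
qed

lemma finite_span_Times:
  assumes "\<exists>S. finite S \<and> A \<subseteq> span S" "\<exists>S. finite S \<and> B \<subseteq> span S"
  shows "\<exists>S. finite S \<and> A \<times> B \<subseteq> span S"
proof -
  obtain S T where S: "finite S" "A \<subseteq> span S" and T: "finite T" "B \<subseteq> span T" using assms by blast
  let ?U = "(\<lambda>a. (a, 0)) ` S \<union> (\<lambda>b. (0, b)) ` T"
  have l1: "linear (\<lambda>a. (a, 0))" and l2: "linear (\<lambda>b. (0, b))" by (auto intro!: linearI)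
  have "A \<times> B \<subseteq> span ?U"
  proof
    fix z assume "z \<in> A \<times> B"
    then have "fst z \<in> span S" "snd z \<in> span T" using S T by auto
    then have "(fst z, 0) \<in> span ((\<lambda>a. (a, 0)) ` S)" "(0, snd z) \<in> span ((\<lambda>b. (0, b)) ` T)"
      unfolding linear_span_image[OF l1] linear_span_image[OF l2] by auto
    then have "(fst z, 0) \<in> span ?U" "(0, snd z) \<in> span ?U" using span_mono[of _ ?U] by blast+
    from span_add[OF this] show "z \<in> span ?U" by simp
  qed
  then show ?thesis using S(1) T(1) by (intro exI[of _ ?U]) auto
qed

section \<open>Stability of the fully stabilized form\<close>

context problem
begin

text \<open>The inner product of the mesh-dependent norm.\<close>

definition nform_full :: "real \<Rightarrow> 'a tup \<Rightarrow> 'a tup \<Rightarrow> real" where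
  "nform_full h w w' = nform w w' + \<kappa> * l2ip \<Omega> (\<lambda>x. h *\<^sub>R wdiv \<Omega> (w_s w) x) (\<lambda>x. h *\<^sub>R wdiv \<Omega> (w_s w') x)
     + l2ip \<Omega> (\<lambda>x. h *\<^sub>R wdiv \<Omega> (w_m w) x) (\<lambda>x. h *\<^sub>R wdiv \<Omega> (w_m w') x)"

lemma nform_full_nonneg: "0 \<le> nform_full h w w"
  using nform_nonneg \<kappa> by (simp add: nform_full_def l2ip_nonneg)

lemma norm_full_nform: "norm_full \<Omega> \<kappa> h z = sqrt (nform_full h (0, z) (0, z))"
proof -
  obtain u e s l m where z: "z = ((u, e, s), (l, m))" by (metis surj_pair)
  have "nform (0, z) (0, z) = (norm_XY \<Omega> \<kappa> z)\<^sup>2" using norm_XY_nform[of z] nform_nonneg[of "(0, z)"] by simp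
  then show ?thesis unfolding z norm_full.simps nform_full_def l2ip_self l2norm_scaleR
    by (simp del: norm_XY.simps add: w_s_def w_m_def power_mult_distrib)
qed

lemma norm_XY_le_norm_full: "norm_XY \<Omega> \<kappa> z \<le> norm_full \<Omega> \<kappa> h z"
  unfolding norm_full_nform norm_XY_nform using \<kappa> by (simp add: nform_full_def l2ip_nonneg)

lemma features_full: "features \<Omega> \<Gamma> \<zeta> \<kappa> (Hs :: real set) (Zdiv_space \<Omega> \<Gamma>) (norm_full \<Omega> \<kappa>)"
  using Zdiv_sub norm_XY_le_norm_full by unfold_locales (auto simp: subspaces simp del: norm_full.simps norm_XY.simps)

lemma div_le_norm_full:
  assumes h: "0 \<le> h"
  shows "h * l2norm \<Omega> (wdiv \<Omega> s) \<le> (1 / sqrt \<kappa>) * norm_full \<Omega> \<kappa> h ((u, e, s), (l, m))"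
    and "h * l2norm \<Omega> (wdiv \<Omega> m) \<le> 1 * norm_full \<Omega> \<kappa> h ((u, e, s), (l, m))"
proof -
  let ?N = "norm_full \<Omega> \<kappa> h ((u, e, s), (l, m))"
  have p: "0 \<le> (norm_XY \<Omega> \<kappa> ((u, e, s), (l, m)))\<^sup>2" "0 \<le> \<kappa> * h\<^sup>2 * (l2norm \<Omega> (wdiv \<Omega> s))\<^sup>2" "0 \<le> h\<^sup>2 * (l2norm \<Omega> (wdiv \<Omega> m))\<^sup>2"
    using \<kappa> by simp_all
  have "sqrt \<kappa> * (h * l2norm \<Omega> (wdiv \<Omega> s)) \<le> ?N"
    unfolding norm_full.simps using p \<kappa> by (intro real_le_rsqrt) (simp add: power_mult_distrib del: norm_XY.simps)
  then show "h * l2norm \<Omega> (wdiv \<Omega> s) \<le> (1 / sqrt \<kappa>) * ?N" using \<kappa> by (simp add: field_simps del: norm_full.simps)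
  show "h * l2norm \<Omega> (wdiv \<Omega> m) \<le> 1 * ?N"
    unfolding norm_full.simps mult_1 using p by (intro real_le_rsqrt) (simp add: power_mult_distrib del: norm_XY.simps)
qed

text \<open>The divergences enter the form only with the factor \<open>h\<close>, and in this combination the norm bounds
  them; the upper bound \<open>D\<close> for the mesh sizes controls the factor \<open>h\<close> in front of the lower order terms.\<close>

lemma bilform_full:
  assumes D: "\<And>h. h \<in> Hs \<Longrightarrow> 0 \<le> h \<and> h \<le> D"
  shows "bilform Hs (data_space \<Omega> \<times> Zdiv_space \<Omega> \<Gamma>) (\<lambda>h w. data_norm \<Omega> (fst w) + norm_full \<Omega> \<kappa> h (snd w))
      (\<lambda>h w w'. bform \<Omega> \<zeta> \<kappa> \<alpha> \<gamma> \<eta> w w' + divform \<Omega> \<zeta> \<kappa> \<theta> \<beta> h w w')"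
    and "h \<in> Hs \<Longrightarrow> sym_bilinear (Zdiv_space \<Omega> \<Gamma>) (\<lambda>z z'. nform_full h (0, z) (0, z'))"
proof -
  interpret f: features \<Omega> \<Gamma> \<zeta> \<kappa> Hs "Zdiv_space \<Omega> \<Gamma>" "norm_full \<Omega> \<kappa>" by (rule features_full)
  have N_eq: "f.N = (\<lambda>h w. data_norm \<Omega> (fst w) + norm_full \<Omega> \<kappa> h (snd w))" by (intro ext) (rule f.N_def)
  have Hd: "w_s w \<in> Hdiv \<Omega>" "w_m w \<in> Hdiv \<Omega>" if "w \<in> f.W" for w
    using that by (auto simp: w_defs Zdiv_space_def)
  have lin: "w_s (w + w') = w_s w + w_s w'" "w_m (w + w') = w_m w + w_m w'" "w_s (c *\<^sub>R w) = c *\<^sub>R w_s w" "w_m (c *\<^sub>R w) = c *\<^sub>R w_m w" for w w' c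
    by (simp_all add: w_defs)
  have N_ge: "norm_full \<Omega> \<kappa> h z \<le> f.N h (d, z)" for h d z
    using data_norm_nonneg[of d] by (simp add: f.N_def del: norm_full.simps data_norm.simps)
  have op_ds: "L2op \<Omega> Hs f.W f.N (\<lambda>h w x. h *\<^sub>R wdiv \<Omega> (w_s w) x)"
    unfolding L2op_def
  proof (intro conjI ballI allI exI[of _ "1 / sqrt \<kappa>"])
    fix h w assume h: "h \<in> Hs" and w: "w \<in> f.W"
    show "(\<lambda>x. h *\<^sub>R wdiv \<Omega> (w_s w) x) \<in> L2 \<Omega>" by (intro L2_scaleR wdiv_L2 Hd w)
    fix c show "AE x in lebesgue_on \<Omega>. h *\<^sub>R wdiv \<Omega> (w_s (c *\<^sub>R w)) x = c *\<^sub>R h *\<^sub>R wdiv \<Omega> (w_s w) x"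
      unfolding lin using wdiv_scaleR_AE[OF open_domain Hd(1)[OF w], of c] by eventually_elim simp
  next
    fix h w w' assume "h \<in> Hs" "w \<in> f.W" "w' \<in> f.W"
    then show "AE x in lebesgue_on \<Omega>. h *\<^sub>R wdiv \<Omega> (w_s (w + w')) x = h *\<^sub>R wdiv \<Omega> (w_s w) x + h *\<^sub>R wdiv \<Omega> (w_s w') x"
      unfolding lin using wdiv_add_AE[OF open_domain Hd(1) Hd(1), of w w'] by (auto elim!: eventually_mono simp: distrib_left)
  next
    fix h w assume h: "h \<in> Hs" and "w \<in> f.W"
    obtain d u e s l m where w: "w = (d, (u, e, s), (l, m))" by (metis surj_pair)
    have "\<bar>h\<bar> * l2norm \<Omega> (wdiv \<Omega> s) \<le> (1 / sqrt \<kappa>) * norm_full \<Omega> \<kappa> h ((u, e, s), (l, m))"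
      using div_le_norm_full(1)[of h s u e l m] D[OF h] by simp
    also have "\<dots> \<le> (1 / sqrt \<kappa>) * f.N h w" unfolding w using \<kappa> by (intro mult_left_mono N_ge) simp
    finally show "l2norm \<Omega> (\<lambda>x. h *\<^sub>R wdiv \<Omega> (w_s w) x) \<le> (1 / sqrt \<kappa>) * f.N h w"
      by (simp only: l2norm_scaleR) (simp add: w w_s_def)
  qed (use \<kappa> in simp)
  have op_dm: "L2op \<Omega> Hs f.W f.N (\<lambda>h w x. h *\<^sub>R wdiv \<Omega> (w_m w) x)"
    unfolding L2op_def
  proof (intro conjI ballI allI exI[of _ "1"])
    fix h w assume h: "h \<in> Hs" and w: "w \<in> f.W"
    show "(\<lambda>x. h *\<^sub>R wdiv \<Omega> (w_m w) x) \<in> L2 \<Omega>" by (intro L2_scaleR wdiv_L2 Hd w)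
    fix c show "AE x in lebesgue_on \<Omega>. h *\<^sub>R wdiv \<Omega> (w_m (c *\<^sub>R w)) x = c *\<^sub>R h *\<^sub>R wdiv \<Omega> (w_m w) x"
      unfolding lin using wdiv_scaleR_AE[OF open_domain Hd(2)[OF w], of c] by eventually_elim simp
  next
    fix h w w' assume "h \<in> Hs" "w \<in> f.W" "w' \<in> f.W"
    then show "AE x in lebesgue_on \<Omega>. h *\<^sub>R wdiv \<Omega> (w_m (w + w')) x = h *\<^sub>R wdiv \<Omega> (w_m w) x + h *\<^sub>R wdiv \<Omega> (w_m w') x"
      unfolding lin using wdiv_add_AE[OF open_domain Hd(2) Hd(2), of w w'] by (auto elim!: eventually_mono simp: distrib_left)
  next
    fix h w assume h: "h \<in> Hs" and "w \<in> f.W"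
    obtain d u e s l m where w: "w = (d, (u, e, s), (l, m))" by (metis surj_pair)
    have "\<bar>h\<bar> * l2norm \<Omega> (wdiv \<Omega> m) \<le> 1 * norm_full \<Omega> \<kappa> h ((u, e, s), (l, m))"
      using div_le_norm_full(2)[of h m u e s l] D[OF h] by simp
    also have "\<dots> \<le> 1 * f.N h w" unfolding w by (intro mult_left_mono N_ge) simp
    finally show "l2norm \<Omega> (\<lambda>x. h *\<^sub>R wdiv \<Omega> (w_m w) x) \<le> 1 * f.N h w"
      by (simp only: l2norm_scaleR) (simp add: w w_m_def)
  qed simp
  have hD: "\<bar>h\<bar> \<le> D" if "h \<in> Hs" for h using D[OF that] by simp
  have "bilform Hs f.W f.N (\<lambda>h w w'. divform \<Omega> \<zeta> \<kappa> \<theta> \<beta> h w w')"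
    unfolding divform_def
    by (intro bilform_diff bilform_scale bilform_square f.subspace_W f.N_nonneg L2op_add op_ds op_dm
        L2op_scaleR[where k="\<lambda>h. h" and M=D] L2op_diff L2op_mult f.op_u f.op_l f.op_q \<zeta> hD)
  then have "bilform Hs f.W f.N (\<lambda>h w w'. bform \<Omega> \<zeta> \<kappa> \<alpha> \<gamma> \<eta> w w' + divform \<Omega> \<zeta> \<kappa> \<theta> \<beta> h w w')"
    by (intro bilform_add f.bilform_bform)
  then show "bilform Hs (data_space \<Omega> \<times> Zdiv_space \<Omega> \<Gamma>) (\<lambda>h w. data_norm \<Omega> (fst w) + norm_full \<Omega> \<kappa> h (snd w))
      (\<lambda>h w w'. bform \<Omega> \<zeta> \<kappa> \<alpha> \<gamma> \<eta> w w' + divform \<Omega> \<zeta> \<kappa> \<theta> \<beta> h w w')" unfolding N_eq .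
  have "bilform Hs f.W f.N (\<lambda>h. nform_full h)"
    unfolding nform_full_def nform_def
    by (intro bilform_add bilform_scale bilform_square f.subspace_W f.N_nonneg
        f.op_e f.op_s f.op_m f.op_gu f.op_gl op_ds op_dm)
  then show "sym_bilinear (Zdiv_space \<Omega> \<Gamma>) (\<lambda>z z'. nform_full h (0, z) (0, z'))" if "h \<in> Hs"
    using that by (intro sym_bilinear_snd[OF _ subspaces(1,5)]) (auto simp: bilform_def)
qed

lemma Zdiv_mem: "((u, e, s), (l, m)) \<in> Zdiv_space \<Omega> \<Gamma> \<longleftrightarrow> u \<in> H1D \<Omega> \<Gamma> \<and> e \<in> L2 \<Omega> \<and> s \<in> Hdiv \<Omega> \<and> l \<in> H1D \<Omega> \<Gamma> \<and> m \<in> Hdiv \<Omega>"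
  by (auto simp: Zdiv_space_def)

lemma norm_full_flip:
  assumes "(x, y) \<in> Zdiv_space \<Omega> \<Gamma>" shows "norm_full \<Omega> \<kappa> h (x, - y) = norm_full \<Omega> \<kappa> h (x, y)"
proof -
  obtain u e s l m where z: "x = (u, e, s)" "y = (l, m)" by (metis surj_pair)
  have H: "m \<in> Hdiv \<Omega>" using assms by (auto simp: z Zdiv_space_def)
  have "- m = (- 1) *\<^sub>R m" by simp
  then have "l2norm \<Omega> (wdiv \<Omega> (- m)) = l2norm \<Omega> (\<lambda>x. (- 1) *\<^sub>R wdiv \<Omega> m x)"
    using wdiv_scaleR_AE[OF open_domain H, of "-1"] H subspace_scale[OF subspace_Hdiv[OF open_domain] H, of "-1"]
    by (intro l2norm_cong_AE) (auto intro!: L2_uminus wdiv_L2)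
  moreover have "norm_XY \<Omega> \<kappa> ((u, e, s), (- l, - m)) = norm_XY \<Omega> \<kappa> ((u, e, s), (l, m))"
    using norm_XY_flip[of "(u, e, s)" "(l, m)"] assms Zdiv_sub by (auto simp: z simp del: norm_XY.simps)
  ultimately show ?thesis unfolding l2norm_scaleR by (simp add: z del: norm_XY.simps)
qed

lemma divform_primal_diag:
  assumes "u \<in> H1D \<Omega> \<Gamma>" "s \<in> Hdiv \<Omega>"
  shows "divform \<Omega> \<zeta> \<kappa> \<theta> \<beta> h (0, (u, e, s), 0) (0, (u, e, s), 0) =
    \<theta> * (\<kappa> * (l2norm \<Omega> (\<lambda>x. h *\<^sub>R wdiv \<Omega> s x + h *\<^sub>R (\<zeta> x * u x)))\<^sup>2)"
proof -
  have wl: "wdiv \<Omega> 0 \<in> L2 \<Omega>" by (rule wdiv_L2[OF subspace_0[OF subspace_Hdiv[OF open_domain]]])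
  have "l2ip \<Omega> (\<lambda>x. h * wdiv \<Omega> 0 x) (\<lambda>x. h * wdiv \<Omega> 0 x) = 0"
    using wdiv_zero_AE[OF open_domain] L2_scaleR[OF wl, of h] by (intro l2ip_AE_zero) (auto elim: eventually_mono)
  then show ?thesis by (simp add: divform_def w_defs l2ip_self)
qed

lemma divform_dual_diag:
  assumes "l \<in> H1D \<Omega> \<Gamma>" "m \<in> Hdiv \<Omega>"
  shows "divform \<Omega> \<zeta> \<kappa> \<theta> \<beta> h (0, 0, (l, m)) (0, 0, (l, m)) =
    - \<beta> * (l2norm \<Omega> (\<lambda>x. h *\<^sub>R wdiv \<Omega> m x + h *\<^sub>R (\<zeta> x * l x)))\<^sup>2"
proof -
  have wl: "wdiv \<Omega> 0 \<in> L2 \<Omega>" by (rule wdiv_L2[OF subspace_0[OF subspace_Hdiv[OF open_domain]]])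
  have "l2ip \<Omega> (\<lambda>x. h * wdiv \<Omega> 0 x) (\<lambda>x. h * wdiv \<Omega> 0 x) = 0"
    using wdiv_zero_AE[OF open_domain] L2_scaleR[OF wl, of h] by (intro l2ip_AE_zero) (auto elim: eventually_mono)
  then show ?thesis by (simp add: divform_def w_defs l2ip_self)
qed

text \<open>The stabilization controls the residual \<open>\<nabla>\<cdot>s + \<zeta> u\<close>, not the divergence alone. The difference is of lower
  order and is bounded by the gradient of \<open>u\<close> through the Friedrichs inequality.\<close>

lemma scaled_div_bound:
  assumes u: "u \<in> H1D \<Omega> \<Gamma>" and s: "s \<in> Hdiv \<Omega>" and h: "0 \<le> h" "h \<le> D"
    and R: "l2norm \<Omega> (\<lambda>x. \<zeta> x * u x) \<le> R * l2norm \<Omega> (wgrad \<Omega> u)" "0 \<le> R"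
  shows "h\<^sup>2 * (l2norm \<Omega> (wdiv \<Omega> s))\<^sup>2 \<le> 2 * (l2norm \<Omega> (\<lambda>x. h *\<^sub>R wdiv \<Omega> s x + h *\<^sub>R (\<zeta> x * u x)))\<^sup>2
     + 2 * (D * R)\<^sup>2 * (l2norm \<Omega> (wgrad \<Omega> u))\<^sup>2"
proof -
  let ?f = "\<lambda>x. h *\<^sub>R wdiv \<Omega> s x + h *\<^sub>R (\<zeta> x * u x)" and ?g = "\<lambda>x. (- h) *\<^sub>R (\<zeta> x * u x)"
  have \<zeta>u: "(\<lambda>x. \<zeta> x * u x) \<in> L2 \<Omega>" by (intro L2_Linf_mult \<zeta> H1D_sub(2) u)
  have L: "?f \<in> L2 \<Omega>" "?g \<in> L2 \<Omega>" by (intro L2_add L2_scaleR wdiv_L2 s \<zeta>u)+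
  have "h * l2norm \<Omega> (wdiv \<Omega> s) = l2norm \<Omega> (\<lambda>x. h *\<^sub>R wdiv \<Omega> s x)" unfolding l2norm_scaleR using h by simp
  also have "(\<lambda>x. h *\<^sub>R wdiv \<Omega> s x) = (\<lambda>x. ?f x + ?g x)" by simp
  also have "l2norm \<Omega> \<dots> \<le> l2norm \<Omega> ?f + l2norm \<Omega> ?g" by (rule l2norm_add_le[OF L])
  also have "l2norm \<Omega> ?g \<le> D * (R * l2norm \<Omega> (wgrad \<Omega> u))"
    unfolding l2norm_scaleR using h R by (intro mult_mono) (auto simp: l2norm_nonneg)
  finally have le: "h * l2norm \<Omega> (wdiv \<Omega> s) \<le> l2norm \<Omega> ?f + D * R * l2norm \<Omega> (wgrad \<Omega> u)" by (simp add: mult.assoc)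
  have "h\<^sup>2 * (l2norm \<Omega> (wdiv \<Omega> s))\<^sup>2 = (h * l2norm \<Omega> (wdiv \<Omega> s))\<^sup>2" by (simp add: power_mult_distrib)
  also have "\<dots> \<le> (l2norm \<Omega> ?f + D * R * l2norm \<Omega> (wgrad \<Omega> u))\<^sup>2"
    using le h by (intro power_mono) (auto simp: l2norm_nonneg)
  also have "\<dots> \<le> 2 * (l2norm \<Omega> ?f)\<^sup>2 + 2 * (D * R * l2norm \<Omega> (wgrad \<Omega> u))\<^sup>2"
    using zero_le_power2[of "l2norm \<Omega> ?f - D * R * l2norm \<Omega> (wgrad \<Omega> u)"]
    unfolding power2_sum power2_diff by linarith
  finally show ?thesis by (simp add: power_mult_distrib mult.assoc)
qed

text \<open>All squares of the norm appear on the diagonal, so that flipping the sign of the dual part suffices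
  and no correction is added: \<open>\<gamma>\<close> gives \<open>\<parallel>\<mu>\<parallel>\<^sup>2\<close>, and \<open>\<theta>\<close>, \<open>\<beta>\<close> give the residuals of the two divergence
  equations.\<close>

lemma stability_full:
  assumes "0 \<le> D"
  obtains c where "c > 0" "\<And>h u e s l m. 0 \<le> h \<Longrightarrow> h \<le> D \<Longrightarrow> ((u, e, s), (l, m)) \<in> Zdiv_space \<Omega> \<Gamma> \<Longrightarrow>
    c * (norm_full \<Omega> \<kappa> h ((u, e, s), (l, m)))\<^sup>2 \<le>
      bform \<Omega> \<zeta> \<kappa> (1/8) (1/8) (1/2) (0, (u, e, s), (l, m)) (0, ((u, e, s), - (l, m)))
      + divform \<Omega> \<zeta> \<kappa> (1/2) (1/2) h (0, (u, e, s), (l, m)) (0, ((u, e, s), - (l, m)))"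
proof -
  obtain C where C: "C \<ge> 0" "\<And>v. v \<in> H1D \<Omega> \<Gamma> \<Longrightarrow> l2norm \<Omega> v \<le> C * l2norm \<Omega> (wgrad \<Omega> v)"
    using poincare_H1D[OF dom dir] by blast
  obtain Zc where Zc: "Zc \<ge> 0" "\<And>f. f \<in> L2 \<Omega> \<Longrightarrow> l2norm \<Omega> (\<lambda>x. \<zeta> x * f x) \<le> Zc * l2norm \<Omega> f"
    using l2norm_Linf_mult_le[OF \<zeta>] by blast
  define R where "R = Zc * C"
  have R: "0 \<le> R" "\<And>v. v \<in> H1D \<Omega> \<Gamma> \<Longrightarrow> l2norm \<Omega> (\<lambda>x. \<zeta> x * v x) \<le> R * l2norm \<Omega> (wgrad \<Omega> v)"
  proof -
    show "0 \<le> R" using C Zc by (simp add: R_def)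
    fix v assume v: "v \<in> H1D \<Omega> \<Gamma>"
    show "l2norm \<Omega> (\<lambda>x. \<zeta> x * v x) \<le> R * l2norm \<Omega> (wgrad \<Omega> v)"
      using order_trans[OF Zc(2)[OF H1D_sub(2)[OF v]] mult_left_mono[OF C(2)[OF v] Zc(1)]] by (simp add: R_def mult.assoc)
  qed
  define Q where "Q = \<kappa> * (D * R)\<^sup>2"
  have Q: "Q \<ge> 0" using \<kappa> by (simp add: Q_def)
  \<comment> \<open>after absorption of the cross term the form still contains \<open>1/16\<close> of \<open>\<parallel>\<nabla>u\<parallel>\<^sup>2\<close>; it has to cover this
    square in the norm and, through \<open>Q\<close>, the lower order part of the divergences\<close>
  define c where "c = 1 / (32 * (1 + Q))"
  have c: "c > 0" "c \<le> 1/32" "c * (1 + 2 * Q) \<le> 1/16"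
    using Q by (auto simp: c_def field_simps)
  show thesis
  proof (rule that[OF c(1)])
    fix h u e s l m assume h: "0 \<le> h" "h \<le> D" and z: "((u, e, s), (l, m)) \<in> Zdiv_space \<Omega> \<Gamma>"
    have mem: "u \<in> H1D \<Omega> \<Gamma>" "e \<in> L2 \<Omega>" "s \<in> L2 \<Omega>" "l \<in> H1D \<Omega> \<Gamma>" "m \<in> L2 \<Omega>" "s \<in> Hdiv \<Omega>" "m \<in> Hdiv \<Omega>"
      using z by (auto simp: Zdiv_mem Hdiv_def)
    note g = H1D_sub(3)[OF mem(1)] H1D_sub(3)[OF mem(4)]
    have parts: "((u, e, s), 0) \<in> Zdiv_space \<Omega> \<Gamma>" "(0, (l, m)) \<in> Zdiv_space \<Omega> \<Gamma>"
      using mem zero_mem subspace_0[OF subspace_Hdiv[OF open_domain]] by (auto simp: Zdiv_space_def zero_prod_def)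
    let ?B = "\<lambda>w w'. bform \<Omega> \<zeta> \<kappa> (1/8) (1/8) (1/2) w w' + divform \<Omega> \<zeta> \<kappa> (1/2) (1/2) h w w'"
    let ?w = "(0, (u, e, s), (l, m))"
    have B: "sym_bilinear (data_space \<Omega> \<times> Zdiv_space \<Omega> \<Gamma>) ?B"
      using bilform_full(1)[of "{0..D}" D] h by (auto simp: bilform_def)
    define A where "A = \<kappa> * (l2norm \<Omega> (\<lambda>x. h *\<^sub>R wdiv \<Omega> s x + h *\<^sub>R (\<zeta> x * u x)))\<^sup>2"
    define A' where "A' = (l2norm \<Omega> (\<lambda>x. h *\<^sub>R wdiv \<Omega> m x + h *\<^sub>R (\<zeta> x * l x)))\<^sup>2"
    define a where "a = l2ip \<Omega> (wgrad \<Omega> u) (wgrad \<Omega> u)"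
    define E where "E = l2ip \<Omega> e e"
    define S where "S = \<kappa> * l2ip \<Omega> s s"
    define L where "L = 1 / \<kappa> * l2ip \<Omega> (wgrad \<Omega> l) (wgrad \<Omega> l)"
    define m2 where "m2 = l2ip \<Omega> m m"
    define ds where "ds = \<kappa> * h\<^sup>2 * (l2norm \<Omega> (wdiv \<Omega> s))\<^sup>2"
    define dm where "dm = h\<^sup>2 * (l2norm \<Omega> (wdiv \<Omega> m))\<^sup>2"
    have nn: "0 \<le> A" "0 \<le> A'" "0 \<le> a" "0 \<le> E" "0 \<le> S" "0 \<le> L" "0 \<le> m2" "0 \<le> ds" "0 \<le> dm"
      using \<kappa> by (simp_all add: A_def A'_def a_def E_def S_def L_def m2_def ds_def dm_def l2ip_nonneg)
    have Bval: "?B ?w (0, ((u, e, s), - (l, m))) = E + 1/2 * S + 1/8 * a - 1/4 * l2ip \<Omega> e (wgrad \<Omega> u) + 1/8 * m2 + 1/2 * L + 1/2 * A + 1/2 * A'"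
    proof -
      have "?B ?w (0, ((u, e, s), - (l, m)) + 0) = ?B (0, (u, e, s), 0) (0, (u, e, s), 0) - ?B (0, 0, (l, m)) (0, 0, (l, m)) + ?B ?w (0, 0)"
        by (rule test_expand[OF B subspaces(5) parts subspace_0[OF subspaces(5)]])
      moreover have "?B ?w (0, 0) = 0"
        using sym_bilinear_zero(2)[OF B, of ?w] z subspace_0[OF subspaces(1)] by (simp add: zero_prod_def)
      ultimately show ?thesis
        unfolding bform_primal_diag[OF mem(1-3)] bform_dual_diag[OF mem(4,5)] divform_primal_diag[OF mem(1,6)] divform_dual_diag[OF mem(4,7)]
        by (simp add: A_def A'_def a_def E_def S_def L_def m2_def right_diff_distrib)
    qed
    have cross: "l2ip \<Omega> e (wgrad \<Omega> u) \<le> E + 1/4 * a"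
      using l2ip_young(1)[OF mem(2) g(1), of 1] by (simp add: E_def a_def)
    have ds: "ds \<le> 2 * A + 2 * Q * a"
      using mult_left_mono[OF scaled_div_bound[OF mem(1,6) h R(2)[OF mem(1)] R(1)] less_imp_le[OF \<kappa>]]
      by (simp add: ds_def A_def Q_def a_def l2ip_self algebra_simps)
    have dm: "dm \<le> 2 * A' + 2 * Q * L"
      using scaled_div_bound[OF mem(4,7) h R(2)[OF mem(4)] R(1)] \<kappa>
      by (simp add: dm_def A'_def Q_def L_def l2ip_self)
    have N2: "(norm_full \<Omega> \<kappa> h ((u, e, s), (l, m)))\<^sup>2 = a + E + S + L + m2 + ds + dm"
    proof -
      have "(norm_full \<Omega> \<kappa> h ((u, e, s), (l, m)))\<^sup>2 = (norm_XY \<Omega> \<kappa> ((u, e, s), (l, m)))\<^sup>2 + ds + dm"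
        unfolding norm_full.simps ds_def dm_def using \<kappa> by (intro real_sqrt_pow2) simp
      then show ?thesis unfolding norm_XY_sq a_def E_def S_def L_def m2_def by simp
    qed
    have "c * (norm_full \<Omega> \<kappa> h ((u, e, s), (l, m)))\<^sup>2 \<le> c * (a + E + S + L + m2 + (2 * A + 2 * Q * a) + (2 * A' + 2 * Q * L))"
      unfolding N2 using ds dm c(1) by (intro mult_left_mono) auto
    also have "\<dots> = (c * (1 + 2 * Q)) * a + (c * (1 + 2 * Q)) * L + c * E + c * S + c * m2 + (2 * c) * A + (2 * c) * A'"
      by (simp add: algebra_simps)
    also have "\<dots> \<le> 1/16 * a + 1/16 * L + 1/32 * E + 1/32 * S + 1/32 * m2 + 1/16 * A + 1/16 * A'"
      using c nn by (intro add_mono mult_right_mono) auto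
    also have "\<dots> \<le> ?B ?w (0, ((u, e, s), - (l, m)))" unfolding Bval using cross nn by simp
    finally show "c * (norm_full \<Omega> \<kappa> h ((u, e, s), (l, m)))\<^sup>2 \<le> ?B ?w (0, ((u, e, s), - (l, m)))" .
  qed
qed

end

section \<open>Stabilized Lagrangians and the natural method\<close>

context problem
begin

text \<open>For fields with a global weak divergence, the elementwise divergence is its restriction to the
  element, so the broken norm is a global one.\<close>

lemma broken_div_norm:
  assumes T: "conformal_mesh \<Omega> T" and s: "s \<in> Hdiv \<Omega>" and f: "f \<in> L2 \<Omega>"
  shows "(\<Sum>K\<in>T. (l2norm (interior K) (\<lambda>x. wdiv (interior K) s x + f x))\<^sup>2) = (l2norm \<Omega> (\<lambda>x. wdiv \<Omega> s x + f x))\<^sup>2"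
proof -
  have lip: "lipschitz_boundary \<Omega>" using dom by (simp add: regular_domain_def)
  note I = conformal_mesh_interiors[OF open_domain lip T]
  have hd: "has_weak_div (interior K) s (wdiv \<Omega> s)" if "K \<in> T" for K
    by (rule has_weak_div_subset[OF has_weak_div_wdiv[OF s] I(1)[OF that] open_interior open_domain])
  show ?thesis
  proof (rule broken_norm_eq[OF open_domain lip T L2_add[OF wdiv_L2[OF s] f]])
    fix K assume K: "K \<in> T"
    have fm: "f \<in> borel_measurable (lebesgue_on (interior K))"
      using measurable_restrict_mono[OF L2_D(1)[OF f] I(1)[OF K]] .
    have wd: "wdiv (interior K) s \<in> L2 (interior K)"
      using hd[OF K] unfolding wdiv_def by (metis has_weak_div_def someI_ex)
    show "(\<lambda>x. wdiv (interior K) s x + f x) \<in> borel_measurable (lebesgue_on (interior K))"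
      by (intro borel_measurable_add L2_D(1) wd fm)
    show "AE x in lebesgue_on (interior K). wdiv (interior K) s x + f x = wdiv \<Omega> s x + f x"
      using wdiv_AE[OF open_interior hd[OF K]] by eventually_elim simp
  qed
qed

lemma stab_lagrangian_natural: "stab_lagrangian \<Omega> \<zeta> \<kappa> T stab_natural d x y = 1/2 * bform \<Omega> \<zeta> \<kappa> 0 0 0 (d, x, y) (d, x, y)"
proof -
  obtain q et st u e s l m where "d = (q, et, st)" "x = (u, e, s)" "y = (l, m)" by (metis surj_pair)
  then show ?thesis by (simp add: stab_natural_def bform_def w_defs l2ip_self)
qed

lemma stab_lagrangian_minimal:
  "stab_lagrangian \<Omega> \<zeta> \<kappa> T stab_minimal d x y = 1/2 * bform \<Omega> \<zeta> \<kappa> (1/8) 0 (1/2) (d, x, y) (d, x, y)"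
proof -
  obtain q et st u e s l m where "d = (q, et, st)" "x = (u, e, s)" "y = (l, m)" by (metis surj_pair)
  then show ?thesis by (simp add: stab_minimal_def bform_def w_defs l2ip_self)
qed

text \<open>Only on fields with a global divergence: there the broken terms become inner products on the whole
  domain.\<close>

lemma stab_lagrangian_full:
  assumes T: "conformal_mesh \<Omega> T" and d: "d \<in> data_space \<Omega>" and z: "(x, y) \<in> Zdiv_space \<Omega> \<Gamma>"
  shows "stab_lagrangian \<Omega> \<zeta> \<kappa> T (stab_full h) d x y = 1/2 * (bform \<Omega> \<zeta> \<kappa> (1/8) (1/8) (1/2) (d, x, y) (d, x, y)
     + divform \<Omega> \<zeta> \<kappa> (1/2) (1/2) h (d, x, y) (d, x, y))"
proof -
  obtain q et st u e s l m where eq: "d = (q, et, st)" "x = (u, e, s)" "y = (l, m)" by (metis surj_pair)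
  have mem: "u \<in> H1D \<Omega> \<Gamma>" "s \<in> Hdiv \<Omega>" "l \<in> H1D \<Omega> \<Gamma>" "m \<in> Hdiv \<Omega>" "q \<in> L2 \<Omega>"
    using z d by (auto simp: eq Zdiv_mem data_space_def)
  have \<zeta>u: "(\<lambda>x. \<zeta> x * u x) \<in> L2 \<Omega>" "(\<lambda>x. \<zeta> x * l x) \<in> L2 \<Omega>" by (intro L2_Linf_mult \<zeta> H1D_sub(2) mem)+
  have sums: "(\<Sum>K\<in>T. (l2norm (interior K) (\<lambda>x. wdiv (interior K) s x + \<zeta> x * u x - q x))\<^sup>2)
      = (l2norm \<Omega> (\<lambda>x. wdiv \<Omega> s x + (\<zeta> x * u x - q x)))\<^sup>2"
    "(\<Sum>K\<in>T. (l2norm (interior K) (\<lambda>x. wdiv (interior K) m x + \<zeta> x * l x))\<^sup>2)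
      = (l2norm \<Omega> (\<lambda>x. wdiv \<Omega> m x + \<zeta> x * l x))\<^sup>2"
    using broken_div_norm[OF T mem(2) L2_diff[OF \<zeta>u(1) mem(5)]] broken_div_norm[OF T mem(4) \<zeta>u(2)]
    by (simp_all add: add_diff_eq)
  have dv: "divform \<Omega> \<zeta> \<kappa> (1/2) (1/2) h (d, x, y) (d, x, y) =
     1/2 * \<kappa> * (h\<^sup>2 * (l2norm \<Omega> (\<lambda>x. wdiv \<Omega> s x + (\<zeta> x * u x - q x)))\<^sup>2)
     - 1/2 * (h\<^sup>2 * (l2norm \<Omega> (\<lambda>x. wdiv \<Omega> m x + \<zeta> x * l x))\<^sup>2)"
    unfolding divform_def scaleR_add_right[symmetric] l2ip_self l2norm_scaleR
    by (simp add: eq w_defs power_mult_distrib)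
  have bf: "lagrangian \<Omega> \<zeta> \<kappa> (q, et, st) (u, e, s) (l, m)
     + 1/8 / 2 * (l2norm \<Omega> (\<lambda>x. e x - wgrad \<Omega> u x))\<^sup>2
     - 1/8 / 2 * (l2norm \<Omega> (\<lambda>x. e x + m x - et x))\<^sup>2
     - 1/2 / (2 * \<kappa>) * (l2norm \<Omega> (\<lambda>x. \<kappa> *\<^sub>R s x - wgrad \<Omega> l x - \<kappa> *\<^sub>R st x))\<^sup>2
     = 1/2 * bform \<Omega> \<zeta> \<kappa> (1/8) (1/8) (1/2) (d, x, y) (d, x, y)"
    by (simp add: eq bform_def w_defs l2ip_self)
  show ?thesis
    unfolding eq(1) eq(2) eq(3) stab_lagrangian.simps sums stab_full_def
    using bf dv unfolding eq by (simp del: lagrangian.simps add: field_simps)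
qed

text \<open>The stabilizations with a negative sign must not destroy convexity in the primal unknowns. On the dual
  unknowns all terms are nonpositive.\<close>

lemma bform_signs:
  assumes "(x, y) \<in> Z_space \<Omega> \<Gamma>" and "0 \<le> \<alpha>" "\<alpha> \<le> 1/8" "\<gamma> \<le> \<alpha>" "0 \<le> \<gamma>" "0 \<le> \<eta>" "\<eta> \<le> 1"
  shows "0 \<le> bform \<Omega> \<zeta> \<kappa> \<alpha> \<gamma> \<eta> (0, x, 0) (0, x, 0)" "bform \<Omega> \<zeta> \<kappa> \<alpha> \<gamma> \<eta> (0, 0, y) (0, 0, y) \<le> 0"
proof -
  obtain u e s l m where eq: "x = (u, e, s)" "y = (l, m)" by (metis surj_pair)
  have mem: "u \<in> H1D \<Omega> \<Gamma>" "e \<in> L2 \<Omega>" "s \<in> L2 \<Omega>" "l \<in> H1D \<Omega> \<Gamma>" "m \<in> L2 \<Omega>" using assms(1) by (auto simp: Z_mem eq)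
  note g = H1D_sub(3)[OF mem(1)]
  let ?E = "l2ip \<Omega> e e" and ?a = "l2ip \<Omega> (wgrad \<Omega> u) (wgrad \<Omega> u)" and ?x = "l2ip \<Omega> e (wgrad \<Omega> u)"
  \<comment> \<open>the weight 4 suits \<open>\<alpha> \<le> 1/8\<close>: it costs at most \<open>4 \<alpha> \<le> 1/2\<close> of the coefficient of \<open>\<parallel>e\<parallel>\<^sup>2\<close>\<close>
  have "2 * ?x \<le> 4 * ?E + ?a" using l2ip_young(1)[OF mem(2) g, of 2] l2ip_nonneg[of \<Omega> "wgrad \<Omega> u"] by simp
  then have "\<alpha> * (2 * ?x) \<le> \<alpha> * (4 * ?E + ?a)" using assms(2) by (rule mult_left_mono)
  moreover have "(4 * \<alpha>) * ?E \<le> (1 + \<alpha> - \<gamma>) * ?E" using assms by (intro mult_right_mono l2ip_nonneg) simp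
  moreover have "0 \<le> \<kappa> * (1 - \<eta>) * l2ip \<Omega> s s" using \<kappa> assms by (simp add: l2ip_nonneg)
  ultimately show "0 \<le> bform \<Omega> \<zeta> \<kappa> \<alpha> \<gamma> \<eta> (0, x, 0) (0, x, 0)"
    unfolding eq bform_primal_diag[OF mem(1-3)] by (simp add: algebra_simps)
  have "0 \<le> \<gamma> * l2ip \<Omega> m m" "0 \<le> \<eta> / \<kappa> * l2ip \<Omega> (wgrad \<Omega> l) (wgrad \<Omega> l)"
    using \<kappa> assms by (simp_all add: l2ip_nonneg)
  then show "bform \<Omega> \<zeta> \<kappa> \<alpha> \<gamma> \<eta> (0, 0, y) (0, 0, y) \<le> 0"
    unfolding eq bform_dual_diag[OF mem(4,5)] by simp
qed

lemma bilform_XY: "bilform (Hs :: real set) (data_space \<Omega> \<times> Z_space \<Omega> \<Gamma>) (\<lambda>h w. data_norm \<Omega> (fst w) + norm_XY \<Omega> \<kappa> (snd w)) (\<lambda>h. bform \<Omega> \<zeta> \<kappa> \<alpha> \<gamma> \<eta>)"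
proof -
  interpret f: features \<Omega> \<Gamma> \<zeta> \<kappa> Hs "Z_space \<Omega> \<Gamma>" "\<lambda>_. norm_XY \<Omega> \<kappa>" by (rule features_XY)
  have N_eq: "f.N = (\<lambda>h w. data_norm \<Omega> (fst w) + norm_XY \<Omega> \<kappa> (snd w))" by (intro ext) (rule f.N_def)
  show ?thesis using f.bilform_bform unfolding N_eq .
qed

theorem natural_method:
  fixes Hs :: "real set"
  assumes nat: "\<And>h. h \<in> Hs \<Longrightarrow> natural_spaces \<Omega> \<Gamma> (T h) (Uh h) (Lh h) (Eh h) (Sh h) (Mh h)"
  shows "(\<forall>h\<in>Hs. well_posed \<Omega> \<zeta> \<kappa> (T h) stab_natural (Uh h \<times> Eh h \<times> Sh h) (Lh h \<times> Mh h)) \<and>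
        quasi_optimal \<Omega> \<Gamma> \<zeta> \<kappa> Hs T (\<lambda>h. stab_natural) (\<lambda>h. Uh h \<times> Eh h \<times> Sh h) (\<lambda>h. Lh h \<times> Mh h) (\<lambda>h. norm_XY \<Omega> \<kappa>)"
proof (rule galerkin_conclusion[where Z="Z_space \<Omega> \<Gamma>" and M="\<lambda>h z z'. nform (0, z) (0, z')" and B="\<lambda>h. bform \<Omega> \<zeta> \<kappa> 0 0 0" and c="1/4" and C'=2])
  fix h assume h: "h \<in> Hs"
  note n = nat[OF h, unfolded natural_spaces_def fe_space_def]
  have sp: "subspace (Uh h)" "subspace (Lh h)" "subspace (Eh h)" "subspace (Sh h)" "subspace (Mh h)"
    using n finite_dim_space_span by (metis subspace_span)+
  have fs: "\<exists>S. finite S \<and> Uh h \<subseteq> span S" "\<exists>S. finite S \<and> Lh h \<subseteq> span S" "\<exists>S. finite S \<and> Eh h \<subseteq> span S"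
    "\<exists>S. finite S \<and> Sh h \<subseteq> span S" "\<exists>S. finite S \<and> Mh h \<subseteq> span S"
    using n finite_dim_space_span by (metis order_refl)+
  show "subspace (Uh h \<times> Eh h \<times> Sh h)" "subspace (Lh h \<times> Mh h)" by (intro subspace_Times sp)+
  show sub: "(Uh h \<times> Eh h \<times> Sh h) \<times> Lh h \<times> Mh h \<subseteq> Z_space \<Omega> \<Gamma>"
    using n by (auto simp: Z_space_def X_space_def Y_space_def)
  show "\<exists>S. finite S \<and> (Uh h \<times> Eh h \<times> Sh h) \<times> Lh h \<times> Mh h \<subseteq> span S" by (intro finite_span_Times fs)
  show "sym_bilinear (Z_space \<Omega> \<Gamma>) (\<lambda>z z'. nform (0, z) (0, z'))" by (rule sym_bilinear_nform_Z)
  have z0: "0 \<in> Uh h \<times> Eh h \<times> Sh h" "0 \<in> Lh h \<times> Mh h" by (intro subspace_0 subspace_Times sp)+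
  show "0 \<le> bform \<Omega> \<zeta> \<kappa> 0 0 0 (0, x, 0) (0, x, 0)" if "x \<in> Uh h \<times> Eh h \<times> Sh h" for x
    by (rule bform_signs(1)[OF subsetD[OF sub SigmaI[OF that z0(2)]]]) auto
  show "bform \<Omega> \<zeta> \<kappa> 0 0 0 (0, 0, y) (0, 0, y) \<le> 0" if "y \<in> Lh h \<times> Mh h" for y
    by (rule bform_signs(2)[OF subsetD[OF sub SigmaI[OF z0(1) that]]]) auto
  fix z assume zV: "z \<in> (Uh h \<times> Eh h \<times> Sh h) \<times> Lh h \<times> Mh h"
  obtain u e s l m where z: "z = ((u, e, s), (l, m))" by (metis surj_pair)
  have mem: "u \<in> Uh h" "e \<in> Eh h" "s \<in> Sh h" "l \<in> Lh h" "m \<in> Mh h" "Eh h = Mh h" using zV n by (auto simp: z)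
  have gr: "\<forall>u\<in>Uh h. \<exists>m\<in>Mh h. has_weak_grad \<Omega> u m" "\<forall>l\<in>Lh h. \<exists>s\<in>Sh h. has_weak_grad \<Omega> l s"
    using n by simp_all
  obtain ru rl where r: "ru \<in> Mh h" "has_weak_grad \<Omega> u ru" "rl \<in> Sh h" "has_weak_grad \<Omega> l rl"
    using gr(1)[rule_format, OF mem(1)] gr(2)[rule_format, OF mem(4)] by blast
  \<comment> \<open>discrete because the spaces contain the gradients and because \<open>Eh\<close> and \<open>Mh\<close> coincide\<close>
  define c1 where "c1 = ((0 :: 'a \<Rightarrow> real, (1/2) *\<^sub>R m, (- (1 / (2 * \<kappa>))) *\<^sub>R rl), (0 :: 'a \<Rightarrow> real, (- (1/2)) *\<^sub>R ru))"
  have zZ: "((u, e, s), (l, m)) \<in> Z_space \<Omega> \<Gamma>" using sub zV unfolding z by blast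
  note st = stability_natural[OF zZ r(2,4), folded c1_def]
  show "\<exists>z'\<in>(Uh h \<times> Eh h \<times> Sh h) \<times> Lh h \<times> Mh h. norm_XY \<Omega> \<kappa> z' \<le> 2 * norm_XY \<Omega> \<kappa> z \<and>
      1/4 * (norm_XY \<Omega> \<kappa> z)\<^sup>2 \<le> bform \<Omega> \<zeta> \<kappa> 0 0 0 (0, z) (0, z')"
  proof (intro bexI[of _ "((u, e, s), - (l, m)) + c1"] conjI)
    have "((u, e, s), - (l, m)) \<in> (Uh h \<times> Eh h \<times> Sh h) \<times> Lh h \<times> Mh h"
      using mem by (simp add: subspace_neg sp)
    moreover have "c1 \<in> (Uh h \<times> Eh h \<times> Sh h) \<times> Lh h \<times> Mh h"
      unfolding c1_def using mem r by (intro SigmaI subspace_0 subspace_scale sp) auto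
    ultimately show "((u, e, s), - (l, m)) + c1 \<in> (Uh h \<times> Eh h \<times> Sh h) \<times> Lh h \<times> Mh h"
      by (intro subspace_add subspace_Times sp)
  qed (use st in \<open>simp_all only: z\<close>)
qed (auto simp: subspaces nform_nonneg norm_XY_nform bilform_XY[simplified norm_XY_nform] stab_lagrangian_natural
      intro: P2_solution_consistent(2) subsetD[OF Zdiv_sub] P2_solution_consistent(1) simp del: norm_XY.simps)

end

section \<open>Equal-order methods and the conclusion\<close>

context problem
begin

lemma equal_order_spaces:
  assumes V: "h1_conforming \<Omega> T V"
  shows "subspace (dirichlet_subspace \<Omega> \<Gamma> V)" "subspace (vector_fields V)"
    and "subspace (equal_order_X \<Omega> \<Gamma> V)" "subspace (equal_order_Y \<Omega> \<Gamma> V)"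
    and "equal_order_X \<Omega> \<Gamma> V \<times> equal_order_Y \<Omega> \<Gamma> V \<subseteq> Zdiv_space \<Omega> \<Gamma>"
    and "\<exists>S. finite S \<and> equal_order_X \<Omega> \<Gamma> V \<times> equal_order_Y \<Omega> \<Gamma> V \<subseteq> span S"
proof -
  have fd: "finite_dim_space V" and VH: "V \<subseteq> H1 \<Omega>" using V by (auto simp: h1_conforming_def fe_space_def)
  obtain S where S: "finite S" "V = span S" using finite_dim_space_span[OF fd] by blast
  have dsub: "dirichlet_subspace \<Omega> \<Gamma> V = V \<inter> H1D \<Omega> \<Gamma>" using VH by (auto simp: dirichlet_subspace_def H1D_def)
  show sd: "subspace (dirichlet_subspace \<Omega> \<Gamma> V)"
    unfolding dsub by (intro subspace_inter subspace_H1D open_domain bounded_domain) (simp add: S(2))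
  have fin_d: "\<exists>S. finite S \<and> dirichlet_subspace \<Omega> \<Gamma> V \<subseteq> span S" using S dsub by blast
  show sv: "subspace (vector_fields V)" by (rule vector_fields_finite_dim(1)[OF fd])
  note fin_v = vector_fields_finite_dim(2)[OF fd]
  show "subspace (equal_order_X \<Omega> \<Gamma> V)" "subspace (equal_order_Y \<Omega> \<Gamma> V)"
    unfolding equal_order_X_def equal_order_Y_def by (intro subspace_Times sd sv)+
  show "equal_order_X \<Omega> \<Gamma> V \<times> equal_order_Y \<Omega> \<Gamma> V \<subseteq> Zdiv_space \<Omega> \<Gamma>"
    using vector_fields_Hdiv[OF open_domain VH] dsub
    by (auto simp: equal_order_X_def equal_order_Y_def Zdiv_space_def Hdiv_def)
  show "\<exists>S. finite S \<and> equal_order_X \<Omega> \<Gamma> V \<times> equal_order_Y \<Omega> \<Gamma> V \<subseteq> span S"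
    unfolding equal_order_X_def equal_order_Y_def by (intro finite_span_Times fin_d fin_v)
qed

theorem minimal_method:
  fixes Hs :: "real set"
  assumes V: "\<And>h. h \<in> Hs \<Longrightarrow> h1_conforming \<Omega> (T h) (Vh h)"
  shows "(\<forall>h\<in>Hs. well_posed \<Omega> \<zeta> \<kappa> (T h) stab_minimal (equal_order_X \<Omega> \<Gamma> (Vh h)) (equal_order_Y \<Omega> \<Gamma> (Vh h))) \<and>
        quasi_optimal \<Omega> \<Gamma> \<zeta> \<kappa> Hs T (\<lambda>h. stab_minimal) (\<lambda>h. equal_order_X \<Omega> \<Gamma> (Vh h)) (\<lambda>h. equal_order_Y \<Omega> \<Gamma> (Vh h)) (\<lambda>h. norm_XY \<Omega> \<kappa>)"
proof (rule galerkin_conclusion[where Z="Z_space \<Omega> \<Gamma>" and M="\<lambda>h z z'. nform (0, z) (0, z')" and B="\<lambda>h. bform \<Omega> \<zeta> \<kappa> (1/8) 0 (1/2)" and c="1/32" and C'=2])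
  fix h assume h: "h \<in> Hs"
  note eo = equal_order_spaces[OF V[OF h]]
  let ?X = "equal_order_X \<Omega> \<Gamma> (Vh h)" and ?Y = "equal_order_Y \<Omega> \<Gamma> (Vh h)"
  show "subspace ?X" "subspace ?Y" by (rule eo)+
  show sub: "?X \<times> ?Y \<subseteq> Z_space \<Omega> \<Gamma>" using eo(5) Zdiv_sub by blast
  show "\<exists>S. finite S \<and> ?X \<times> ?Y \<subseteq> span S" by (rule eo)
  show "sym_bilinear (Z_space \<Omega> \<Gamma>) (\<lambda>z z'. nform (0, z) (0, z'))" by (rule sym_bilinear_nform_Z)
  have z0: "0 \<in> ?X" "0 \<in> ?Y" by (intro subspace_0 eo)+
  show "0 \<le> bform \<Omega> \<zeta> \<kappa> (1/8) 0 (1/2) (0, x, 0) (0, x, 0)" if "x \<in> ?X" for x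
    by (rule bform_signs(1)[OF subsetD[OF sub SigmaI[OF that z0(2)]]]) auto
  show "bform \<Omega> \<zeta> \<kappa> (1/8) 0 (1/2) (0, 0, y) (0, 0, y) \<le> 0" if "y \<in> ?Y" for y
    by (rule bform_signs(2)[OF subsetD[OF sub SigmaI[OF z0(1) that]]]) auto
  fix z assume zV: "z \<in> ?X \<times> ?Y"
  obtain u e s l m where z: "z = ((u, e, s), (l, m))" by (metis surj_pair)
  have mem: "(u, e, s) \<in> ?X" "(l, m) \<in> ?Y" "m \<in> vector_fields (Vh h)" using zV by (auto simp: z equal_order_Y_def)
  \<comment> \<open>discrete because \<open>e\<close> and \<open>\<mu>\<close> are sought in the same space\<close>
  define c1 where "c1 = ((0 :: 'a \<Rightarrow> real, (1/2) *\<^sub>R m, 0 :: 'a \<Rightarrow> 'a), 0 :: 'a dual)"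
  have zZ: "((u, e, s), (l, m)) \<in> Z_space \<Omega> \<Gamma>" using sub zV unfolding z by blast
  note st = stability_minimal[OF zZ, folded c1_def]
  show "\<exists>z'\<in>?X \<times> ?Y. norm_XY \<Omega> \<kappa> z' \<le> 2 * norm_XY \<Omega> \<kappa> z \<and>
      1/32 * (norm_XY \<Omega> \<kappa> z)\<^sup>2 \<le> bform \<Omega> \<zeta> \<kappa> (1/8) 0 (1/2) (0, z) (0, z')"
  proof (intro bexI[of _ "((u, e, s), - (l, m)) + c1"] conjI)
    have "((u, e, s), - (l, m)) \<in> ?X \<times> ?Y"
      by (intro SigmaI mem subspace_neg eo)
    moreover have "c1 \<in> ?X \<times> ?Y"
      unfolding c1_def equal_order_X_def using mem(3) by (intro SigmaI z0 subspace_0 subspace_scale eo) auto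
    ultimately show "((u, e, s), - (l, m)) + c1 \<in> ?X \<times> ?Y"
      by (intro subspace_add subspace_Times eo)
  qed (use st in \<open>simp_all only: z\<close>)
qed (auto simp: subspaces nform_nonneg norm_XY_nform bilform_XY[simplified norm_XY_nform] stab_lagrangian_minimal
      intro: P2_solution_consistent(2) subsetD[OF Zdiv_sub] P2_solution_consistent(1) simp del: norm_XY.simps)

theorem full_method:
  fixes Hs :: "real set"
  assumes V: "\<And>h. h \<in> Hs \<Longrightarrow> h1_conforming \<Omega> (T h) (Vh h)" and mesh: "\<And>h. h \<in> Hs \<Longrightarrow> conformal_mesh \<Omega> (T h)"
    and D: "\<And>h. h \<in> Hs \<Longrightarrow> 0 \<le> h \<and> h \<le> D" "0 \<le> D"
  shows "(\<forall>h\<in>Hs. well_posed \<Omega> \<zeta> \<kappa> (T h) (stab_full h) (equal_order_X \<Omega> \<Gamma> (Vh h)) (equal_order_Y \<Omega> \<Gamma> (Vh h))) \<and>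
        quasi_optimal \<Omega> \<Gamma> \<zeta> \<kappa> Hs T stab_full (\<lambda>h. equal_order_X \<Omega> \<Gamma> (Vh h)) (\<lambda>h. equal_order_Y \<Omega> \<Gamma> (Vh h)) (norm_full \<Omega> \<kappa>)"
proof -
  let ?B = "\<lambda>h w w'. bform \<Omega> \<zeta> \<kappa> (1/8) (1/8) (1/2) w w' + divform \<Omega> \<zeta> \<kappa> (1/2) (1/2) h w w'"
  obtain c where c: "c > 0" "\<And>h u e s l m. 0 \<le> h \<Longrightarrow> h \<le> D \<Longrightarrow> ((u, e, s), (l, m)) \<in> Zdiv_space \<Omega> \<Gamma> \<Longrightarrow>
    c * (norm_full \<Omega> \<kappa> h ((u, e, s), (l, m)))\<^sup>2 \<le> ?B h (0, (u, e, s), (l, m)) (0, ((u, e, s), - (l, m)))"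
    using stability_full[OF D(2)] by blast
  show ?thesis
  proof (rule galerkin_conclusion[where Z="Zdiv_space \<Omega> \<Gamma>" and M="\<lambda>h z z'. nform_full h (0, z) (0, z')" and B="?B" and c=c and C'=1])
    show "subspace (Zdiv_space \<Omega> \<Gamma>)" "Zdiv_space \<Omega> \<Gamma> \<subseteq> Z_space \<Omega> \<Gamma>" by (rule subspaces Zdiv_sub)+
    show "bilform Hs (data_space \<Omega> \<times> Zdiv_space \<Omega> \<Gamma>) (\<lambda>h w. data_norm \<Omega> (fst w) + norm_full \<Omega> \<kappa> h (snd w)) ?B"
      by (rule bilform_full(1)[OF D(1)])
    show "c > 0" "(0::real) \<le> 1" using c by auto
    fix h z show "norm_full \<Omega> \<kappa> h z = sqrt (nform_full h (0, z) (0, z))" by (rule norm_full_nform)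
    assume h: "h \<in> Hs"
    show "0 \<le> nform_full h (0, z) (0, z)" by (rule nform_full_nonneg)
    show "norm_XY \<Omega> \<kappa> z \<le> norm_full \<Omega> \<kappa> h z" by (rule norm_XY_le_norm_full)
  next
    fix h assume h: "h \<in> Hs"
    show "sym_bilinear (Zdiv_space \<Omega> \<Gamma>) (\<lambda>z z'. nform_full h (0, z) (0, z'))" by (rule bilform_full(2)[OF D(1) h])
    note eo = equal_order_spaces[OF V[OF h]]
    let ?X = "equal_order_X \<Omega> \<Gamma> (Vh h)" and ?Y = "equal_order_Y \<Omega> \<Gamma> (Vh h)"
    show "subspace ?X" "subspace ?Y" "?X \<times> ?Y \<subseteq> Zdiv_space \<Omega> \<Gamma>" "\<exists>S. finite S \<and> ?X \<times> ?Y \<subseteq> span S" by (rule eo)+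
    have z0: "0 \<in> ?X" "0 \<in> ?Y" by (intro subspace_0 eo)+
    show "stab_lagrangian \<Omega> \<zeta> \<kappa> (T h) (stab_full h) d x y = 1/2 * ?B h (d, x, y) (d, x, y)"
      if "d \<in> data_space \<Omega>" "x \<in> ?X" "y \<in> ?Y" for d x y
      using eo(5) that by (intro stab_lagrangian_full mesh h) auto
    show "0 \<le> ?B h (0, x, 0) (0, x, 0)" if x: "x \<in> ?X" for x
    proof -
      have xZ: "(x, 0) \<in> Zdiv_space \<Omega> \<Gamma>" by (rule subsetD[OF eo(5) SigmaI[OF x z0(2)]])
      obtain u e s where xe: "x = (u, e, s)" by (metis surj_pair)
      have mem: "u \<in> H1D \<Omega> \<Gamma>" "s \<in> Hdiv \<Omega>" using xZ by (auto simp: xe Zdiv_space_def)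
      have "0 \<le> bform \<Omega> \<zeta> \<kappa> (1/8) (1/8) (1/2) (0, x, 0) (0, x, 0)"
        by (rule bform_signs(1)[OF subsetD[OF Zdiv_sub xZ]]) auto
      moreover have "0 \<le> divform \<Omega> \<zeta> \<kappa> (1/2) (1/2) h (0, x, 0) (0, x, 0)"
        unfolding xe divform_primal_diag[OF mem] using \<kappa> by simp
      ultimately show ?thesis by simp
    qed
    show "?B h (0, 0, y) (0, 0, y) \<le> 0" if y: "y \<in> ?Y" for y
    proof -
      have yZ: "(0, y) \<in> Zdiv_space \<Omega> \<Gamma>" by (rule subsetD[OF eo(5) SigmaI[OF z0(1) y]])
      obtain l m where ye: "y = (l, m)" by (metis surj_pair)
      have mem: "l \<in> H1D \<Omega> \<Gamma>" "m \<in> Hdiv \<Omega>" using yZ by (auto simp: ye Zdiv_space_def)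
      have "bform \<Omega> \<zeta> \<kappa> (1/8) (1/8) (1/2) (0, 0, y) (0, 0, y) \<le> 0"
        by (rule bform_signs(2)[OF subsetD[OF Zdiv_sub yZ]]) auto
      moreover have "divform \<Omega> \<zeta> \<kappa> (1/2) (1/2) h (0, 0, y) (0, 0, y) \<le> 0"
        unfolding ye divform_dual_diag[OF mem] by simp
      ultimately show ?thesis by simp
    qed
    show "\<exists>z'\<in>?X \<times> ?Y. norm_full \<Omega> \<kappa> h z' \<le> 1 * norm_full \<Omega> \<kappa> h z \<and> c * (norm_full \<Omega> \<kappa> h z)\<^sup>2 \<le> ?B h (0, z) (0, z')"
      if zV: "z \<in> ?X \<times> ?Y" for z
    proof -
      obtain u e s l m where z: "z = ((u, e, s), (l, m))" by (metis surj_pair)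
      have mem: "(u, e, s) \<in> ?X" "(l, m) \<in> ?Y" using zV by (auto simp: z)
      have zZ: "((u, e, s), (l, m)) \<in> Zdiv_space \<Omega> \<Gamma>" using eo(5) zV unfolding z by blast
      show ?thesis
      proof (intro bexI[of _ "((u, e, s), - (l, m))"] conjI)
        show "((u, e, s), - (l, m)) \<in> ?X \<times> ?Y" by (intro SigmaI mem subspace_neg eo)
        show "norm_full \<Omega> \<kappa> h ((u, e, s), - (l, m)) \<le> 1 * norm_full \<Omega> \<kappa> h z"
          unfolding z norm_full_flip[OF zZ] by simp
        show "c * (norm_full \<Omega> \<kappa> h z)\<^sup>2 \<le> ?B h (0, z) (0, ((u, e, s), - (l, m)))"
          unfolding z using D(1)[OF h] zZ by (intro c(2)) auto
      qed
    qed
    show "p \<in> Zdiv_space \<Omega> \<Gamma> \<and> ?B h (d, p) (0, z') = 0"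
      if d: "d \<in> data_space \<Omega>" and p: "P2_solution \<Omega> \<Gamma> \<zeta> \<kappa> d p" and z': "z' \<in> Zdiv_space \<Omega> \<Gamma>" for d p z'
      using P2_solution_consistent(1)[OF d p] P2_solution_consistent(2)[OF d p subsetD[OF Zdiv_sub z']]
        P2_solution_consistent(3)[OF d p z'] by simp
  qed
qed

end

text \<open>The bounds make constants that depend on an upper bound for \<open>h\<close> uniform over the family.\<close>

lemma mesh_size_bounds:
  assumes W: "bounded W" and T: "conformal_mesh W T"
  shows "0 \<le> mesh_size T" "mesh_size T \<le> diameter (closure W)"
proof -
  have T': "finite T" "T \<noteq> {}" "\<And>K. K \<in> T \<Longrightarrow> K \<subseteq> closure W" "bounded (closure W)"
    using T W by (auto simp: conformal_mesh_def)
  have "Max (diameter ` T) \<in> diameter ` T" using T'(1,2) by (intro Max_in) auto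
  then obtain K where K: "K \<in> T" "mesh_size T = diameter K" unfolding mesh_size_def by blast
  show "0 \<le> mesh_size T" unfolding K(2)
    using T'(3)[OF K(1)] T'(4) by (intro diameter_ge_0) (rule bounded_subset)
  show "mesh_size T \<le> diameter (closure W)" unfolding K(2) by (rule diameter_subset[OF T'(3)[OF K(1)] T'(4)])
qed

theorem theorem2p2:
  fixes \<Omega> \<Gamma>D :: "'a::euclidean_space set"
    and \<zeta> :: "'a \<Rightarrow> real" and \<kappa> :: real
    and H :: "real set" and T :: "real \<Rightarrow> 'a set set"
  assumes "regular_domain \<Omega>"
    and "dirichlet_part \<Omega> \<Gamma>D"
    and "\<zeta> \<in> Linf \<Omega>"
    and "\<kappa> > 0"
    and "mesh_family \<Omega> H T"
  shows
    "(\<forall>Uh Lh Eh Sh Mh.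
        (\<forall>h\<in>H. natural_spaces \<Omega> \<Gamma>D (T h) (Uh h) (Lh h) (Eh h) (Sh h) (Mh h)) \<longrightarrow>
        (\<forall>h\<in>H. well_posed \<Omega> \<zeta> \<kappa> (T h) stab_natural (Uh h \<times> Eh h \<times> Sh h) (Lh h \<times> Mh h)) \<and>
        quasi_optimal \<Omega> \<Gamma>D \<zeta> \<kappa> H T (\<lambda>h. stab_natural)
          (\<lambda>h. Uh h \<times> Eh h \<times> Sh h) (\<lambda>h. Lh h \<times> Mh h) (\<lambda>h. norm_XY \<Omega> \<kappa>))
     \<and>
     (\<forall>Vh. (\<forall>h\<in>H. h1_conforming \<Omega> (T h) (Vh h)) \<longrightarrow>
        ((\<forall>h\<in>H. well_posed \<Omega> \<zeta> \<kappa> (T h) stab_minimal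
                   (equal_order_X \<Omega> \<Gamma>D (Vh h)) (equal_order_Y \<Omega> \<Gamma>D (Vh h))) \<and>
         quasi_optimal \<Omega> \<Gamma>D \<zeta> \<kappa> H T (\<lambda>h. stab_minimal)
           (\<lambda>h. equal_order_X \<Omega> \<Gamma>D (Vh h)) (\<lambda>h. equal_order_Y \<Omega> \<Gamma>D (Vh h))
           (\<lambda>h. norm_XY \<Omega> \<kappa>)) \<and>
        ((\<forall>h\<in>H. well_posed \<Omega> \<zeta> \<kappa> (T h) (stab_full h)
                   (equal_order_X \<Omega> \<Gamma>D (Vh h)) (equal_order_Y \<Omega> \<Gamma>D (Vh h))) \<and>
         quasi_optimal \<Omega> \<Gamma>D \<zeta> \<kappa> H T stab_full
           (\<lambda>h. equal_order_X \<Omega> \<Gamma>D (Vh h)) (\<lambda>h. equal_order_Y \<Omega> \<Gamma>D (Vh h))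
           (norm_full \<Omega> \<kappa>)))"
proof -
  interpret problem \<Omega> \<Gamma>D \<zeta> \<kappa> by unfold_locales (fact assms)+
  have mesh: "conformal_mesh \<Omega> (T h)" "mesh_size (T h) = h" if "h \<in> H" for h
    using assms(5) that by (auto simp: mesh_family_def)
  have size: "0 \<le> h \<and> h \<le> diameter (closure \<Omega>)" if "h \<in> H" for h
    using mesh_size_bounds[OF bounded_domain mesh(1)[OF that]] mesh(2)[OF that] by simp
  have diam: "0 \<le> diameter (closure \<Omega>)" by (rule diameter_ge_0[OF bounded_closure[OF bounded_domain]])
  show ?thesis
    by (intro conjI allI impI natural_method[THEN conjunct1] natural_method[THEN conjunct2]
        minimal_method[THEN conjunct1] minimal_method[THEN conjunct2]
        full_method[OF _ mesh(1) size diam, THEN conjunct1] full_method[OF _ mesh(1) size diam, THEN conjunct2]) blast+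
qed

end
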